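(* Let $\Omega\subset\mathbb{R}^3$ be a smooth bounded domain and $\nu>0$. Let $u_0\in H^1_d(\Omega)$ and $\rho_0\in L^\infty(\Omega)$ with $0\le\rho_0(x)\le M<\infty$ a.e. in $\Omega$. Let $(\rho,u)$, with $u\in L^\infty(0,T;H^1_d(\Omega))\cap L^2(0,T;H^2(\Omega))$ and $\rho\in L^\infty((0,T)\times\Omega)$, be a local weak solution, constructed by Kim's approximation procedure (described in the context), of the incompressible inhomogeneous Navier–Stokes system $$\partial_t(\rho u)+\nabla\cdot(\rho u\otimes u)+\nabla p-\nu\Delta u=0,\qquad \partial_t\rho+\nabla\cdot(\rho u)=0,\qquad \nabla\cdot u=0\quad\text{in }(0,T)\times\Omega,$$ $$u=0\ \text{ on }\partial\Omega\text{ for a.e. }t>0,\qquad u(0,x)=u_0(x),\quad \rho(0,x)=\rho_0(x),$$ where the time $T$ depends only on the norm of the initial velocity and the size of the domain. Then $(\rho,u)$ satisfies the energy inequality $$\tfrac12\|\sqrt\rho\,u\|_{L^2(\Omega)}^2(t)+\nu\|\nabla u\|_{L^2(0,t;L^2(\Omega))}^2\le\tfrac12\|\sqrt{\rho_0}\,u_0\|_{L^2(\Omega)}^2\qquad\text{for a.e. }t\in[0,T].$$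
   Context: $H^s_d(\Omega)$ is the completion, in the $H^s$ norm, of the real divergence-free vector fields in $C_c^\infty(\Omega)^3$. Kim's construction (J. U. Kim, SIAM J. Math. Anal. 18 (1987)): the weak solution $(\rho,u)$ is obtained as a limit, as $N\to\infty$ along a subsequence, of semi-Galerkin approximations $(\rho^N,u^N)$. Here $u^N(t,x)=\sum_{k=1}^N c^N_k(t)a_k(x)$, where the $a_k$ are smooth divergence-free basis vector fields vanishing on $\partial\Omega$; $\rho^N$ solves $\partial_t\rho^N+u^N\cdot\nabla\rho^N=0$ with $\rho^N(0)=\rho^N_0$; and $$\int_\Omega\rho^N(\partial_tu^N+u^N\cdot\nabla u^N)\cdot a_j\,dx+\nu\int_\Omega\nabla u^N:\nabla a_j\,dx=0,\qquad 1\le j\le N,\qquad u^N(0)=u^N_0 .$$ The approximations satisfy, with $C$ independent of $N$, $$\|\sqrt{\rho^N}\partial_tu^N\|_{L^2(0,T;L^2)},\ \|u^N\|_{L^\infty(0,T;H^1)},\ \|u^N\|_{L^2(0,T;H^2)},\ \|\partial_t\rho^N\|_{L^\infty(0,T;H^{-1})}\le C,\qquad \tfrac1N\le\rho^N\le M+\tfrac1N\ \text{a.e.},$$ $\rho^N_0\to\rho_0$ and $u^N_0\to u_0$ in $L^2(\Omega)$; and, along the subsequence, $\rho^N\to\rho$ and $\rho^Nu^N\to\rho u$ strongly in $L^2(0,T;H^{-1}(\Omega))$, while $u^N\to u$ weakly in $L^2(0,T;H^1_d(\Omega))$ and weakly-* in $L^\infty(0,T;H^1_d(\Omega))$. *)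

theory Defs
  imports "HOL-Analysis.Analysis"
begin

text \<open>
  Conventions.  Functions on a domain are total functions, of which only the values on the domain
  matter; elements of Lebesgue and Sobolev spaces are represented by arbitrary representatives of
  their classes.  A field on space-time is a function of the pair \<open>(t, x)\<close>, and \<open>curry u t\<close> is its
  time slice.  Norms take values in \<^typ>\<open>ennreal\<close> and are \<open>\<infinity>\<close> outside the space.
\<close>

section \<open>Smooth functions, test functions, smooth domains\<close>

definition partial :: "'a::euclidean_space \<Rightarrow> ('a \<Rightarrow> 'b::euclidean_space) \<Rightarrow> 'a \<Rightarrow> 'b" where
  "partial b f x = frechet_derivative f (at x) b"

definition partials :: "'a::euclidean_space list \<Rightarrow> ('a \<Rightarrow> 'b::euclidean_space) \<Rightarrow> 'a \<Rightarrow> 'b" where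
  "partials bs f = foldr partial bs f"

text \<open>Intended for open sets only: there, differentiability of all iterated partial derivatives
  is the same as being infinitely often continuously differentiable.\<close>

definition smooth_on :: "'a::euclidean_space set \<Rightarrow> ('a \<Rightarrow> 'b::euclidean_space) \<Rightarrow> bool" where
  "smooth_on S f \<longleftrightarrow> (\<forall>bs. set bs \<subseteq> Basis \<longrightarrow> (\<forall>x\<in>S. partials bs f differentiable (at x)))"

definition divergence :: "('a::euclidean_space \<Rightarrow> 'a) \<Rightarrow> 'a \<Rightarrow> real" where
  "divergence f x = (\<Sum>b\<in>Basis. partial b f x \<bullet> b)"

definition test_functions :: "'a::euclidean_space set \<Rightarrow> ('a \<Rightarrow> 'b::euclidean_space) set" where
  "test_functions S =
    {\<phi>. smooth_on UNIV \<phi> \<and> compact (closure {x. \<phi> x \<noteq> 0}) \<and> closure {x. \<phi> x \<noteq> 0} \<subseteq> S}"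

text \<open>The boundary is locally the zero set of a smooth function with non-vanishing gradient, and
  the domain lies on one side of it.\<close>

definition smooth_bounded_domain :: "'a::euclidean_space set \<Rightarrow> bool" where
  "smooth_bounded_domain \<Omega> \<longleftrightarrow>
     open \<Omega> \<and> connected \<Omega> \<and> \<Omega> \<noteq> {} \<and> bounded \<Omega> \<and>
     (\<forall>x\<in>frontier \<Omega>. \<exists>U (g :: 'a \<Rightarrow> real).
        open U \<and> x \<in> U \<and> smooth_on U g \<and>
        (\<forall>y\<in>U. \<exists>b\<in>Basis. partial b g y \<noteq> 0) \<and>
        \<Omega> \<inter> U = {y\<in>U. g y < 0})"


section \<open>Lebesgue and Sobolev spaces\<close>

definition ennsqrt :: "ennreal \<Rightarrow> ennreal" where
  "ennsqrt x = (if x = \<infinity> then \<infinity> else ennreal (sqrt (enn2real x)))"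

definition L2_norm :: "'a::euclidean_space set \<Rightarrow> ('a \<Rightarrow> 'b::euclidean_space) \<Rightarrow> ennreal" where
  "L2_norm \<Omega> f = ennsqrt (\<integral>\<^sup>+x. (ennreal (norm (f x)))\<^sup>2 \<partial>lebesgue_on \<Omega>)"

definition L2 :: "'a::euclidean_space set \<Rightarrow> ('a \<Rightarrow> 'b::euclidean_space) set" where
  "L2 \<Omega> = {f \<in> borel_measurable (lebesgue_on \<Omega>). L2_norm \<Omega> f < \<infinity>}"

definition Linfty :: "'a::euclidean_space set \<Rightarrow> ('a \<Rightarrow> 'b::euclidean_space) set" where
  "Linfty S = {f \<in> borel_measurable (lebesgue_on S). \<exists>C. AE x in lebesgue_on S. norm (f x) \<le> C}"

definition has_weak_partials ::
  "'a::euclidean_space set \<Rightarrow> 'a list \<Rightarrow> ('a \<Rightarrow> 'b::euclidean_space) \<Rightarrow> ('a \<Rightarrow> 'b) \<Rightarrow> bool" where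
  "has_weak_partials \<Omega> bs f g \<longleftrightarrow>
     (\<forall>K. compact K \<and> K \<subseteq> \<Omega> \<longrightarrow> integrable (lebesgue_on K) f \<and> integrable (lebesgue_on K) g) \<and>
     (\<forall>\<phi> :: 'a \<Rightarrow> real. \<phi> \<in> test_functions \<Omega> \<longrightarrow>
        (LINT x|lebesgue_on \<Omega>. partials bs \<phi> x *\<^sub>R f x) =
        (- 1) ^ length bs *\<^sub>R (LINT x|lebesgue_on \<Omega>. \<phi> x *\<^sub>R g x))"

text \<open>Unique up to null sets if it exists; arbitrary otherwise.\<close>

definition weak_partials ::
  "'a::euclidean_space set \<Rightarrow> 'a list \<Rightarrow> ('a \<Rightarrow> 'b::euclidean_space) \<Rightarrow> 'a \<Rightarrow> 'b" where
  "weak_partials \<Omega> bs f = (SOME g. has_weak_partials \<Omega> bs f g)"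

definition Sobolev :: "'a::euclidean_space set \<Rightarrow> nat \<Rightarrow> ('a \<Rightarrow> 'b::euclidean_space) set" where
  "Sobolev \<Omega> s =
    {f \<in> L2 \<Omega>. \<forall>bs. set bs \<subseteq> Basis \<and> length bs \<le> s \<longrightarrow> (\<exists>g\<in>L2 \<Omega>. has_weak_partials \<Omega> bs f g)}"

text \<open>The sum of the squared \<open>L\<^sup>2\<close> norms of the derivative tensors of order at most \<open>s\<close>: mixed
  derivatives are counted once for each ordering.\<close>

definition H_norm :: "'a::euclidean_space set \<Rightarrow> nat \<Rightarrow> ('a \<Rightarrow> 'b::euclidean_space) \<Rightarrow> ennreal" where
  "H_norm \<Omega> s f =
    (if f \<in> Sobolev \<Omega> s
     then ennsqrt (\<Sum>bs | set bs \<subseteq> Basis \<and> length bs \<le> s. (L2_norm \<Omega> (weak_partials \<Omega> bs f))\<^sup>2)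
     else \<infinity>)"

definition gradient_norm :: "'a::euclidean_space set \<Rightarrow> ('a \<Rightarrow> 'b::euclidean_space) \<Rightarrow> ennreal" where
  "gradient_norm \<Omega> f =
    (if f \<in> Sobolev \<Omega> 1
     then ennsqrt (\<Sum>b\<in>Basis. (L2_norm \<Omega> (weak_partials \<Omega> [b] f))\<^sup>2)
     else \<infinity>)"

definition H10 :: "'a::euclidean_space set \<Rightarrow> ('a \<Rightarrow> 'b::euclidean_space) set" where
  "H10 \<Omega> = {f \<in> Sobolev \<Omega> 1. \<exists>\<phi> :: nat \<Rightarrow> 'a \<Rightarrow> 'b. (\<forall>n. \<phi> n \<in> test_functions \<Omega>) \<and>
              (\<lambda>n. H_norm \<Omega> 1 (\<lambda>x. \<phi> n x - f x)) \<longlonglongrightarrow> 0}"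

text \<open>The completion of the divergence-free test fields in the \<open>H\<^sup>s\<close> norm, realised as a closure
  inside the Banach space \<open>H\<^sup>s\<close>.\<close>

definition Hd :: "'a::euclidean_space set \<Rightarrow> nat \<Rightarrow> ('a \<Rightarrow> 'a) set" where
  "Hd \<Omega> s = {f \<in> Sobolev \<Omega> s. \<exists>\<phi> :: nat \<Rightarrow> 'a \<Rightarrow> 'a.
              (\<forall>n. \<phi> n \<in> test_functions \<Omega> \<and> (\<forall>x. divergence (\<phi> n) x = 0)) \<and>
              (\<lambda>n. H_norm \<Omega> s (\<lambda>x. \<phi> n x - f x)) \<longlonglongrightarrow> 0}"


section \<open>Dual spaces\<close>

text \<open>Bounded linear functionals on a linear space \<open>V\<close> of functions with (semi)norm \<open>nrm\<close>;
  boundedness makes them respect equality of classes.\<close>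

definition dual ::
  "('i \<Rightarrow> 'b::euclidean_space) set \<Rightarrow> (('i \<Rightarrow> 'b) \<Rightarrow> ennreal) \<Rightarrow> (('i \<Rightarrow> 'b) \<Rightarrow> real) set" where
  "dual V nrm = {F.
     (\<forall>f\<in>V. \<forall>g\<in>V. F (\<lambda>x. f x + g x) = F f + F g) \<and>
     (\<forall>c. \<forall>f\<in>V. F (\<lambda>x. c *\<^sub>R f x) = c * F f) \<and>
     (\<exists>C. \<forall>f\<in>V. ennreal \<bar>F f\<bar> \<le> ennreal C * nrm f)}"

definition dual_norm ::
  "('i \<Rightarrow> 'b::euclidean_space) set \<Rightarrow> (('i \<Rightarrow> 'b) \<Rightarrow> ennreal) \<Rightarrow> (('i \<Rightarrow> 'b) \<Rightarrow> real) \<Rightarrow> ennreal" where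
  "dual_norm V nrm F = (SUP f\<in>{f\<in>V. nrm f \<le> 1}. ennreal \<bar>F f\<bar>)"

abbreviation Hm1 :: "'a::euclidean_space set \<Rightarrow> (('a \<Rightarrow> 'b::euclidean_space) \<Rightarrow> real) set" where
  "Hm1 \<Omega> \<equiv> dual (H10 \<Omega>) (H_norm \<Omega> 1)"

abbreviation Hm1_norm :: "'a::euclidean_space set \<Rightarrow> (('a \<Rightarrow> 'b::euclidean_space) \<Rightarrow> real) \<Rightarrow> ennreal" where
  "Hm1_norm \<Omega> \<equiv> dual_norm (H10 \<Omega>) (H_norm \<Omega> 1)"

text \<open>The embedding of \<open>L\<^sup>2\<close> into \<open>H\<^sup>-\<^sup>1\<close>.\<close>

definition L2_pairing ::
  "'a::euclidean_space set \<Rightarrow> ('a \<Rightarrow> 'b::euclidean_space) \<Rightarrow> ('a \<Rightarrow> 'b) \<Rightarrow> real" where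
  "L2_pairing \<Omega> f \<psi> = (LINT x|lebesgue_on \<Omega>. f x \<bullet> \<psi> x)"


section \<open>Spaces of time-dependent functions\<close>

definition L2t_norm :: "real \<Rightarrow> ('x \<Rightarrow> ennreal) \<Rightarrow> (real \<Rightarrow> 'x) \<Rightarrow> ennreal" where
  "L2t_norm T nrm h = ennsqrt (\<integral>\<^sup>+t. (nrm (h t))\<^sup>2 \<partial>lebesgue_on {0<..<T})"

definition Linftyt_norm :: "real \<Rightarrow> ('x \<Rightarrow> ennreal) \<Rightarrow> (real \<Rightarrow> 'x) \<Rightarrow> ennreal" where
  "Linftyt_norm T nrm h = Inf {C. AE t in lebesgue_on {0<..<T}. nrm (h t) \<le> C}"

text \<open>\<open>L\<^sup>2(0,T;X)\<close> and \<open>L\<^sup>\<infinity>(0,T;X)\<close> for a closed subspace \<open>X\<close> of some \<open>H\<^sup>s\<close>.  As these are separable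
  Hilbert spaces continuously embedded in \<open>L\<^sup>2\<close>, strong measurability into \<open>X\<close> amounts to joint
  measurability of a representative together with \<open>u(t) \<in> X\<close> for almost every \<open>t\<close>.\<close>

definition L2t ::
  "real \<Rightarrow> 'a::euclidean_space set \<Rightarrow> ('a \<Rightarrow> 'b::euclidean_space) set \<Rightarrow> (('a \<Rightarrow> 'b) \<Rightarrow> ennreal)
    \<Rightarrow> (real \<times> 'a \<Rightarrow> 'b) set" where
  "L2t T \<Omega> X nrm = {u \<in> borel_measurable (lebesgue_on ({0<..<T} \<times> \<Omega>)).
     (AE t in lebesgue_on {0<..<T}. curry u t \<in> X) \<and> L2t_norm T nrm (curry u) < \<infinity>}"

definition Linftyt ::
  "real \<Rightarrow> 'a::euclidean_space set \<Rightarrow> ('a \<Rightarrow> 'b::euclidean_space) set \<Rightarrow> (('a \<Rightarrow> 'b) \<Rightarrow> ennreal)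
    \<Rightarrow> (real \<times> 'a \<Rightarrow> 'b) set" where
  "Linftyt T \<Omega> X nrm = {u \<in> borel_measurable (lebesgue_on ({0<..<T} \<times> \<Omega>)).
     (AE t in lebesgue_on {0<..<T}. curry u t \<in> X) \<and> Linftyt_norm T nrm (curry u) < \<infinity>}"

definition weakly_converges_L2t ::
  "real \<Rightarrow> 'a::euclidean_space set \<Rightarrow> ('a \<Rightarrow> 'b::euclidean_space) set \<Rightarrow> (('a \<Rightarrow> 'b) \<Rightarrow> ennreal)
    \<Rightarrow> (nat \<Rightarrow> real \<times> 'a \<Rightarrow> 'b) \<Rightarrow> (real \<times> 'a \<Rightarrow> 'b) \<Rightarrow> bool" where
  "weakly_converges_L2t T \<Omega> X nrm v u \<longleftrightarrow>
     (\<forall>n. v n \<in> L2t T \<Omega> X nrm) \<and> u \<in> L2t T \<Omega> X nrm \<and>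
     (\<forall>F \<in> dual (L2t T \<Omega> X nrm) (\<lambda>w. L2t_norm T nrm (curry w)). (\<lambda>n. F (v n)) \<longlonglongrightarrow> F u)"

text \<open>For \<open>X\<close> as above, \<open>L\<^sup>\<infinity>(0,T;X)\<close> is the dual of \<open>L\<^sup>1(0,T;X')\<close>.  As \<open>X'\<close> is separable and \<open>X\<close>
  reflexive, strong measurability of \<open>g\<close> into \<open>X'\<close> is measurability of all \<open>t \<mapsto> \<langle>g(t), w\<rangle>\<close>.\<close>

definition weak_star_converges_Linftyt ::
  "real \<Rightarrow> 'a::euclidean_space set \<Rightarrow> ('a \<Rightarrow> 'b::euclidean_space) set \<Rightarrow> (('a \<Rightarrow> 'b) \<Rightarrow> ennreal)
    \<Rightarrow> (nat \<Rightarrow> real \<times> 'a \<Rightarrow> 'b) \<Rightarrow> (real \<times> 'a \<Rightarrow> 'b) \<Rightarrow> bool" where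
  "weak_star_converges_Linftyt T \<Omega> X nrm v u \<longleftrightarrow>
     (\<forall>n. v n \<in> Linftyt T \<Omega> X nrm) \<and> u \<in> Linftyt T \<Omega> X nrm \<and>
     (\<forall>g :: real \<Rightarrow> ('a \<Rightarrow> 'b) \<Rightarrow> real.
        (AE t in lebesgue_on {0<..<T}. g t \<in> dual X nrm) \<and>
        (\<forall>w\<in>X. (\<lambda>t. g t w) \<in> borel_measurable (lebesgue_on {0<..<T})) \<and>
        (\<integral>\<^sup>+t. dual_norm X nrm (g t) \<partial>lebesgue_on {0<..<T}) < \<infinity>
        \<longrightarrow> (\<lambda>n. LINT t|lebesgue_on {0<..<T}. g t (curry (v n) t))
              \<longlonglongrightarrow> (LINT t|lebesgue_on {0<..<T}. g t (curry u t)))"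

text \<open>\<open>\<sigma> \<in> L\<^sup>\<infinity>(0,T;H\<^sup>-\<^sup>1)\<close> is the distributional time derivative of \<open>f\<close>.\<close>

definition has_time_derivative_Hm1 ::
  "real \<Rightarrow> 'a::euclidean_space set \<Rightarrow> (real \<times> 'a \<Rightarrow> 'b::euclidean_space)
    \<Rightarrow> (real \<Rightarrow> ('a \<Rightarrow> 'b) \<Rightarrow> real) \<Rightarrow> bool" where
  "has_time_derivative_Hm1 T \<Omega> f \<sigma> \<longleftrightarrow>
     (AE t in lebesgue_on {0<..<T}. \<sigma> t \<in> Hm1 \<Omega>) \<and>
     (\<forall>\<psi>\<in>H10 \<Omega>. (\<lambda>t. \<sigma> t \<psi>) \<in> borel_measurable (lebesgue_on {0<..<T})) \<and>
     Linftyt_norm T (Hm1_norm \<Omega>) \<sigma> < \<infinity> \<and>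
     (\<forall>\<theta> \<in> test_functions {0<..<T}. \<forall>\<psi>\<in>H10 \<Omega>.
        (LINT t|lebesgue_on {0<..<T}. \<theta> t * \<sigma> t \<psi>) =
        - (LINT t|lebesgue_on {0<..<T}. deriv \<theta> t * L2_pairing \<Omega> (curry f t) \<psi>))"


section \<open>The inhomogeneous Navier--Stokes system\<close>

text \<open>Distributional form, including the initial value, of
  \<open>\<partial>\<^sub>t\<rho> + \<nabla>\<cdot>(\<rho>u) = 0\<close>, \<open>\<rho>(0) = \<rho>\<^sub>0\<close>; for divergence-free \<open>u\<close> this is also that of
  \<open>\<partial>\<^sub>t\<rho> + u\<cdot>\<nabla>\<rho> = 0\<close>.  The test functions may be nonzero at \<open>t = 0\<close>.\<close>

definition continuity_equation ::
  "'a::euclidean_space set \<Rightarrow> real \<Rightarrow> ('a \<Rightarrow> real) \<Rightarrow> (real \<times> 'a \<Rightarrow> 'a) \<Rightarrow> (real \<times> 'a \<Rightarrow> real) \<Rightarrow> bool"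
  where
  "continuity_equation \<Omega> T \<rho>0 u \<rho> \<longleftrightarrow>
     (\<forall>\<phi> :: real \<times> 'a \<Rightarrow> real. \<phi> \<in> test_functions ({..<T} \<times> \<Omega>) \<longrightarrow>
        (LINT t|lebesgue_on {0<..<T}. LINT x|lebesgue_on \<Omega>.
           \<rho> (t, x) * (partial (1, 0) \<phi> (t, x)
                       + frechet_derivative (curry \<phi> t) (at x) (u (t, x))))
        + (LINT x|lebesgue_on \<Omega>. \<rho>0 x * \<phi> (0, x)) = 0)"

text \<open>The pressure is eliminated by testing with divergence-free fields.\<close>

definition momentum_equation ::
  "real \<Rightarrow> 'a::euclidean_space set \<Rightarrow> real \<Rightarrow> ('a \<Rightarrow> real) \<Rightarrow> ('a \<Rightarrow> 'a)
    \<Rightarrow> (real \<times> 'a \<Rightarrow> real) \<Rightarrow> (real \<times> 'a \<Rightarrow> 'a) \<Rightarrow> bool" where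
  "momentum_equation \<nu> \<Omega> T \<rho>0 u0 \<rho> u \<longleftrightarrow>
     (\<forall>\<phi> :: real \<times> 'a \<Rightarrow> 'a.
        \<phi> \<in> test_functions ({..<T} \<times> \<Omega>) \<and> (\<forall>t x. divergence (curry \<phi> t) x = 0) \<longrightarrow>
        (LINT t|lebesgue_on {0<..<T}. LINT x|lebesgue_on \<Omega>.
           \<rho> (t, x) * (u (t, x) \<bullet> partial (1, 0) \<phi> (t, x))
           + \<rho> (t, x) * (u (t, x) \<bullet> frechet_derivative (curry \<phi> t) (at x) (u (t, x)))
           - \<nu> * (\<Sum>b\<in>Basis. weak_partials \<Omega> [b] (curry u t) x \<bullet> partial b (curry \<phi> t) x))
        + (LINT x|lebesgue_on \<Omega>. \<rho>0 x * (u0 x \<bullet> \<phi> (0, x))) = 0)"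

text \<open>Incompressibility and the boundary condition are contained in \<open>u(t) \<in> H\<^sup>1\<^sub>d\<close>.\<close>

definition weak_solution ::
  "real \<Rightarrow> 'a::euclidean_space set \<Rightarrow> real \<Rightarrow> ('a \<Rightarrow> real) \<Rightarrow> ('a \<Rightarrow> 'a)
    \<Rightarrow> (real \<times> 'a \<Rightarrow> real) \<Rightarrow> (real \<times> 'a \<Rightarrow> 'a) \<Rightarrow> bool" where
  "weak_solution \<nu> \<Omega> T \<rho>0 u0 \<rho> u \<longleftrightarrow>
     \<rho> \<in> Linfty ({0<..<T} \<times> \<Omega>) \<and>
     u \<in> Linftyt T \<Omega> (Hd \<Omega> 1) (H_norm \<Omega> 1) \<and>
     u \<in> L2t T \<Omega> (Sobolev \<Omega> 2) (H_norm \<Omega> 2) \<and>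
     momentum_equation \<nu> \<Omega> T \<rho>0 u0 \<rho> u \<and>
     continuity_equation \<Omega> T \<rho>0 u \<rho>"


section \<open>Kim's semi-Galerkin approximation\<close>

text \<open>A basis in the sense of the Galerkin method: linearly independent with dense span in
  \<open>H\<^sup>1\<^sub>d\<close>.  Indices start at 1.\<close>

definition Galerkin_basis :: "'a::euclidean_space set \<Rightarrow> (nat \<Rightarrow> 'a \<Rightarrow> 'a) \<Rightarrow> bool" where
  "Galerkin_basis \<Omega> a \<longleftrightarrow>
     (\<forall>k\<ge>1. smooth_on \<Omega> (a k) \<and> continuous_on (closure \<Omega>) (a k) \<and>
        (\<forall>x\<in>\<Omega>. divergence (a k) x = 0) \<and> (\<forall>x\<in>frontier \<Omega>. a k x = 0) \<and> a k \<in> Hd \<Omega> 1) \<and>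
     (\<forall>n (\<gamma> :: nat \<Rightarrow> real). (\<forall>x\<in>\<Omega>. (\<Sum>k=1..n. \<gamma> k *\<^sub>R a k x) = 0) \<longrightarrow> (\<forall>k\<in>{1..n}. \<gamma> k = 0)) \<and>
     (\<forall>v\<in>Hd \<Omega> 1. \<forall>\<epsilon>>0. \<exists>n (\<gamma> :: nat \<Rightarrow> real).
        H_norm \<Omega> 1 (\<lambda>x. v x - (\<Sum>k=1..n. \<gamma> k *\<^sub>R a k x)) < \<epsilon>)"

definition Galerkin_field ::
  "(nat \<Rightarrow> 'a::euclidean_space \<Rightarrow> 'a) \<Rightarrow> nat \<Rightarrow> (nat \<Rightarrow> real \<Rightarrow> real) \<Rightarrow> real \<times> 'a \<Rightarrow> 'a" where
  "Galerkin_field a N c = (\<lambda>(t, x). \<Sum>k=1..N. c k t *\<^sub>R a k x)"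

text \<open>\<open>c'\<close> are the derivatives of the coefficients \<open>c\<close>, so that \<open>Galerkin_field a N c'\<close> is the time
  derivative of the velocity.\<close>

definition semi_Galerkin_solution ::
  "real \<Rightarrow> 'a::euclidean_space set \<Rightarrow> real \<Rightarrow> (nat \<Rightarrow> 'a \<Rightarrow> 'a) \<Rightarrow> nat \<Rightarrow> ('a \<Rightarrow> real) \<Rightarrow> ('a \<Rightarrow> 'a)
    \<Rightarrow> (real \<times> 'a \<Rightarrow> real) \<Rightarrow> (nat \<Rightarrow> real \<Rightarrow> real) \<Rightarrow> (nat \<Rightarrow> real \<Rightarrow> real) \<Rightarrow> bool" where
  "semi_Galerkin_solution \<nu> \<Omega> T a N \<rho>0 u0 \<rho> c c' \<longleftrightarrow>
     (\<forall>k\<in>{1..N}. continuous_on {0..T} (c' k) \<and>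
        (\<forall>t\<in>{0..T}. (c k has_real_derivative c' k t) (at t within {0..T}))) \<and>
     \<rho> \<in> Linfty ({0<..<T} \<times> \<Omega>) \<and>
     continuity_equation \<Omega> T \<rho>0 (Galerkin_field a N c) \<rho> \<and>
     (AE x in lebesgue_on \<Omega>. Galerkin_field a N c (0, x) = u0 x) \<and>
     (AE t in lebesgue_on {0<..<T}. \<forall>j\<in>{1..N}.
        let u = curry (Galerkin_field a N c) t; u' = curry (Galerkin_field a N c') t in
        (LINT x|lebesgue_on \<Omega>.
           \<rho> (t, x) * ((u' x + frechet_derivative u (at x) (u x)) \<bullet> a j x))
        + \<nu> * (LINT x|lebesgue_on \<Omega>. (\<Sum>b\<in>Basis. partial b u x \<bullet> partial b (a j) x)) = 0)"

definition Kim_limit ::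
  "real \<Rightarrow> 'a::euclidean_space set \<Rightarrow> real \<Rightarrow> real \<Rightarrow> ('a \<Rightarrow> real) \<Rightarrow> ('a \<Rightarrow> 'a)
    \<Rightarrow> (real \<times> 'a \<Rightarrow> real) \<Rightarrow> (real \<times> 'a \<Rightarrow> 'a) \<Rightarrow> bool" where
  "Kim_limit \<nu> \<Omega> T M \<rho>0 u0 \<rho> u \<longleftrightarrow>
     (\<exists>(a :: nat \<Rightarrow> 'a \<Rightarrow> 'a) (\<rho>0N :: nat \<Rightarrow> 'a \<Rightarrow> real) (u0N :: nat \<Rightarrow> 'a \<Rightarrow> 'a)
       (\<rho>N :: nat \<Rightarrow> real \<times> 'a \<Rightarrow> real) (uN :: nat \<Rightarrow> real \<times> 'a \<Rightarrow> 'a)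
       (c :: nat \<Rightarrow> nat \<Rightarrow> real \<Rightarrow> real) (c' :: nat \<Rightarrow> nat \<Rightarrow> real \<Rightarrow> real)
       (\<sigma> :: nat \<Rightarrow> real \<Rightarrow> ('a \<Rightarrow> real) \<Rightarrow> real) (C :: real) (r :: nat \<Rightarrow> nat).
       Galerkin_basis \<Omega> a \<and>
       uN = (\<lambda>N. Galerkin_field a N (c N)) \<and>
       (\<forall>N\<ge>1.
          \<rho>0N N \<in> L2 \<Omega> \<and> u0N N \<in> L2 \<Omega> \<and>
          semi_Galerkin_solution \<nu> \<Omega> T a N (\<rho>0N N) (u0N N) (\<rho>N N) (c N) (c' N) \<and>
          L2t_norm T (L2_norm \<Omega>)
            (\<lambda>t x. sqrt (\<rho>N N (t, x)) *\<^sub>R Galerkin_field a N (c' N) (t, x)) \<le> ennreal C \<and>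
          Linftyt_norm T (H_norm \<Omega> 1) (curry (uN N)) \<le> ennreal C \<and>
          L2t_norm T (H_norm \<Omega> 2) (curry (uN N)) \<le> ennreal C \<and>
          has_time_derivative_Hm1 T \<Omega> (\<rho>N N) (\<sigma> N) \<and>
          Linftyt_norm T (Hm1_norm \<Omega>) (\<sigma> N) \<le> ennreal C \<and>
          (AE z in lebesgue_on ({0<..<T} \<times> \<Omega>). 1 / real N \<le> \<rho>N N z \<and> \<rho>N N z \<le> M + 1 / real N)) \<and>
       (\<lambda>N. L2_norm \<Omega> (\<lambda>x. \<rho>0N N x - \<rho>0 x)) \<longlonglongrightarrow> 0 \<and>
       (\<lambda>N. L2_norm \<Omega> (\<lambda>x. u0N N x - u0 x)) \<longlonglongrightarrow> 0 \<and>
       strict_mono r \<and>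
       (\<lambda>n. L2t_norm T (\<lambda>f. Hm1_norm \<Omega> (L2_pairing \<Omega> f))
          (\<lambda>t x. \<rho>N (r n) (t, x) - \<rho> (t, x))) \<longlonglongrightarrow> 0 \<and>
       (\<lambda>n. L2t_norm T (\<lambda>f. Hm1_norm \<Omega> (L2_pairing \<Omega> f))
          (\<lambda>t x. \<rho>N (r n) (t, x) *\<^sub>R uN (r n) (t, x) - \<rho> (t, x) *\<^sub>R u (t, x))) \<longlonglongrightarrow> 0 \<and>
       weakly_converges_L2t T \<Omega> (Hd \<Omega> 1) (H_norm \<Omega> 1) (\<lambda>n. uN (r n)) u \<and>
       weak_star_converges_Linftyt T \<Omega> (Hd \<Omega> 1) (H_norm \<Omega> 1) (\<lambda>n. uN (r n)) u)"

end

theory Submission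
  imports Defs
begin

text \<open>
  The semi-Galerkin approximations satisfy the energy equality: the momentum equation tested with
  \<open>u\<^sup>N\<close> itself is combined with the transport equation tested with \<open>|u\<^sup>N|\<^sup>2\<close>, that is, with the products
  \<open>a\<^sub>j \<bullet> a\<^sub>k\<close>, which are \<open>W\<^sup>1\<^sup>,\<^sup>1\<close> limits of test functions because \<open>a\<^sub>k\<close> lies in \<open>H\<^sup>1\<^sub>d\<close>.  In the limit the
  initial energies converge, and the dissipation is weakly lower semicontinuous.  The kinetic energies
  \<open>\<langle>\<rho>\<^sup>Nu\<^sup>N, u\<^sup>N\<rangle>\<close> converge after integration over any Borel set of times, since \<open>\<rho>\<^sup>Nu\<^sup>N\<close> converges strongly in
  \<open>L\<^sup>2(0,T;H\<^sup>-\<^sup>1)\<close> while \<open>u\<^sup>N\<close> is bounded in \<open>H\<^sup>1\<^sub>0\<close> and converges weakly; so the inequality holds for almost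
  every time.
\<close>

section \<open>Smooth functions and test functions\<close>

text \<open>The density solves its equation only weakly, so the kinetic energy cannot be
  differentiated in time directly. Tested with one product a_j . a_k, however, the transport
  equation gives the integral of \<rho> a_j . a_k a Lipschitz representative, and multiplying it by
  the C^1 coefficients c_j c_k is an elementary product rule. The density bounds are given for
  positive times; the continuity of these integrals carries them to time 0. There they make the
  initial energies converge, although |u_0|^2 is merely integrable and the initial densities
  converge only in L^2. A second obstacle is measurability. Weak derivatives are representatives
  chosen separately for each time, so the Dirichlet form of u(t) has to be shown measurable in t
  before it can be integrated or used as a functional. The separability of H^1_d, witnessed by the
  Galerkin basis, provides this. Finally, the limit density has to be shown nonnegative:
  \<open>sqrt\<close> is odd, and a negative density would turn \<rho> |u|^2 into its absolute
  value.\<close>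

lemma partials_Nil [simp]: "partials [] f = f"
  by (simp add: partials_def)

lemma partials_Cons: "partials (b # bs) f = partial b (partials bs f)"
  by (simp add: partials_def)

lemma partials_snoc: "partials (bs @ [b]) f = partials bs (partial b f)"
  by (simp add: partials_def)

text \<open>Peels off the derivative that is applied first, the last entry of the list. Smoothness
  thereby becomes a greatest fixed point, which \<open>smooth_on_coinduct\<close> exploits.\<close>

lemma smooth_on_step:
  "smooth_on S f \<longleftrightarrow> (\<forall>x\<in>S. f differentiable at x) \<and> (\<forall>b\<in>Basis. smooth_on S (partial b f))"
proof
  assume L: "smooth_on S f"
  have "f differentiable at x" if "x \<in> S" for x
    using L that unfolding smooth_on_def by (metis empty_set empty_subsetI partials_Nil)
  moreover have "smooth_on S (partial b f)" if "b \<in> Basis" for b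
    unfolding smooth_on_def
  proof safe
    fix bs :: "'a list" and x assume "set bs \<subseteq> Basis" "x \<in> S"
    then show "partials bs (partial b f) differentiable at x"
      using L that unfolding smooth_on_def partials_snoc[symmetric] by auto
  qed
  ultimately show "(\<forall>x\<in>S. f differentiable at x) \<and> (\<forall>b\<in>Basis. smooth_on S (partial b f))" by auto
next
  assume R: "(\<forall>x\<in>S. f differentiable at x) \<and> (\<forall>b\<in>Basis. smooth_on S (partial b f))"
  show "smooth_on S f" unfolding smooth_on_def
  proof safe
    fix bs :: "'a list" and x assume "set bs \<subseteq> Basis" "x \<in> S"
    then show "partials bs f differentiable at x"
      using R by (cases bs rule: rev_cases) (auto simp: partials_snoc smooth_on_def)
  qed
qed

lemma smooth_on_differentiable: "smooth_on S f \<Longrightarrow> x \<in> S \<Longrightarrow> f differentiable at x"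
  using smooth_on_step by blast

lemma smooth_on_partial: "smooth_on S f \<Longrightarrow> b \<in> Basis \<Longrightarrow> smooth_on S (partial b f)"
  using smooth_on_step by blast

text \<open>Spares every formula for iterated derivatives: each closure property below computes one
  derivative and names a class large enough to contain it again.\<close>

lemma smooth_on_coinduct:
  assumes "P f"
    and step: "\<And>f. P f \<Longrightarrow> (\<forall>x. f differentiable at x) \<and> (\<forall>b\<in>Basis. P (partial b f))"
  shows "smooth_on UNIV f"
  unfolding smooth_on_def
proof safe
  fix bs :: "'a list" and x assume "set bs \<subseteq> Basis"
  then show "partials bs f differentiable at x"
    using \<open>P f\<close>
  proof (induction bs arbitrary: f rule: rev_induct)
    case Nil then show ?case using step by auto
  next
    case (snoc b bs) then show ?case using step by (auto simp: partials_snoc)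
  qed
qed

lemma smooth_on_continuous_on: "smooth_on S f \<Longrightarrow> continuous_on S f"
  by (meson continuous_at_imp_continuous_on differentiable_imp_continuous_within
      smooth_on_differentiable)

lemma smooth_differentiable: "smooth_on UNIV f \<Longrightarrow> f differentiable at x"
  by (rule smooth_on_differentiable) auto

section \<open>Calculus of partial derivatives\<close>

lemma has_derivative_frechet: "f differentiable at x \<Longrightarrow> (f has_derivative frechet_derivative f (at x)) (at x)"
  by (simp add: frechet_derivative_works)

lemma partial_eq: "(f has_derivative f') (at x) \<Longrightarrow> partial b f x = f' b"
  unfolding partial_def using frechet_derivative_at by metis

lemma frechet_eq_sum_partial:
  assumes "f differentiable at x"
  shows "frechet_derivative f (at x) v = (\<Sum>b\<in>Basis. (v \<bullet> b) *\<^sub>R partial b f x)"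
proof -
  have lin: "linear (frechet_derivative f (at x))"
    using assms by (rule linear_frechet_derivative)
  have "frechet_derivative f (at x) v = frechet_derivative f (at x) (\<Sum>b\<in>Basis. (v \<bullet> b) *\<^sub>R b)"
    by (simp add: euclidean_representation)
  then show ?thesis
    by (simp add: linear_sum[OF lin] linear_cmul[OF lin] partial_def)
qed

text \<open>No differentiability is involved: \<open>frechet_derivative\<close> is a choice among
  all derivatives at x, and functions that agree near x have the same ones.\<close>

lemma partial_cong_open:
  assumes "open S" "x \<in> S" "\<And>y. y \<in> S \<Longrightarrow> f y = g y"
  shows "partial b f x = partial b g x"
proof -
  have "((f has_derivative D) (at x)) = ((g has_derivative D) (at x))" for D
    using assms by (auto intro: has_derivative_transform_within_open[of f D x UNIV S g]
      has_derivative_transform_within_open[of g D x UNIV S f])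
  then show ?thesis unfolding partial_def frechet_derivative_def by simp
qed

lemma partial_const [simp]: "partial b (\<lambda>x. c) = (\<lambda>x. 0)"
  by (auto intro!: partial_eq[where f'="\<lambda>x. 0"])

lemma partial_add:
  "f differentiable at x \<Longrightarrow> g differentiable at x \<Longrightarrow>
    partial b (\<lambda>x. f x + g x) x = partial b f x + partial b g x"
  unfolding partial_def[of b f] partial_def[of b g]
  by (rule partial_eq) (intro has_derivative_add has_derivative_frechet)

lemma partial_sum:
  assumes "\<And>i. i \<in> I \<Longrightarrow> f i differentiable at x"
  shows "partial b (\<lambda>x. \<Sum>i\<in>I. f i x) x = (\<Sum>i\<in>I. partial b (f i) x)"
  unfolding partial_def[of b "f _"]
  by (rule partial_eq) (intro has_derivative_sum has_derivative_frechet assms)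

lemma partial_linear:
  "bounded_linear L \<Longrightarrow> f differentiable at x \<Longrightarrow> partial b (\<lambda>x. L (f x)) x = L (partial b f x)"
  unfolding partial_def[of b f]
  by (rule partial_eq[OF bounded_linear.has_derivative[OF _ has_derivative_frechet]])

lemma partial_bilinear:
  "bounded_bilinear p \<Longrightarrow> f differentiable at x \<Longrightarrow> g differentiable at x \<Longrightarrow>
   partial b (\<lambda>x. p (f x) (g x)) x = p (f x) (partial b g x) + p (partial b f x) (g x)"
  unfolding partial_def[of b f] partial_def[of b g]
  by (rule partial_eq[OF bounded_bilinear.FDERIV[OF _ has_derivative_frechet has_derivative_frechet]])

section \<open>Closure properties of smooth functions\<close>

lemma smooth_const [simp]: "smooth_on UNIV (\<lambda>x. c)"
  by (rule smooth_on_coinduct[where P="\<lambda>f. \<exists>c. f = (\<lambda>x. c)"]) auto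

lemma smooth_add:
  assumes "smooth_on UNIV f" "smooth_on UNIV g"
  shows "smooth_on UNIV (\<lambda>x. f x + g x)"
proof (rule smooth_on_coinduct[where P="\<lambda>h. \<exists>f g. h = (\<lambda>x. f x + g x) \<and> smooth_on UNIV f \<and> smooth_on UNIV g"])
  fix h :: "'a \<Rightarrow> 'b" assume "\<exists>f g. h = (\<lambda>x. f x + g x) \<and> smooth_on UNIV f \<and> smooth_on UNIV g"
  then obtain f g where h: "h = (\<lambda>x. f x + g x)" "smooth_on UNIV f" "smooth_on UNIV g" by blast
  have "partial b h = (\<lambda>x. partial b f x + partial b g x)" for b
    unfolding h(1) by (intro ext partial_add smooth_differentiable h)
  moreover have "h differentiable at x" for x
    unfolding h(1) by (intro differentiable_add smooth_differentiable h)
  ultimately show "(\<forall>x. h differentiable at x) \<and> (\<forall>b\<in>Basis. \<exists>f g. partial b h = (\<lambda>x. f x + g x) \<and> smooth_on UNIV f \<and> smooth_on UNIV g)"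
    using h smooth_on_partial by blast
qed (use assms in blast)

lemma smooth_linear:
  assumes "bounded_linear L" "smooth_on UNIV f"
  shows "smooth_on UNIV (\<lambda>x. L (f x))"
proof (rule smooth_on_coinduct[where P="\<lambda>h. \<exists>f. h = (\<lambda>x. L (f x)) \<and> smooth_on UNIV f"])
  fix h :: "'c \<Rightarrow> 'b" assume "\<exists>f. h = (\<lambda>x. L (f x)) \<and> smooth_on UNIV f"
  then obtain f where h: "h = (\<lambda>x. L (f x))" "smooth_on UNIV f" by blast
  have "partial b h = (\<lambda>x. L (partial b f x))" for b
    unfolding h(1) by (intro ext partial_linear assms(1) smooth_differentiable h)
  moreover have "h differentiable at x" for x
    using h(1) smooth_differentiable[OF h(2), of x] assms(1)
    by (metis bounded_linear.has_derivative differentiable_def)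
  ultimately show "(\<forall>x. h differentiable at x) \<and> (\<forall>b\<in>Basis. \<exists>f. partial b h = (\<lambda>x. L (f x)) \<and> smooth_on UNIV f)"
    using h smooth_on_partial by blast
qed (use assms in blast)

text \<open>The derivative of a product is a sum of two products, so the class for the coinduction
  has to be closed under sums as well.\<close>

inductive bilinear_class ::
  "('b::euclidean_space \<Rightarrow> 'c::euclidean_space \<Rightarrow> 'd::euclidean_space) \<Rightarrow> ('a::euclidean_space \<Rightarrow> 'd) \<Rightarrow> bool"
  for p where
  "smooth_on UNIV f \<Longrightarrow> smooth_on UNIV g \<Longrightarrow> bilinear_class p (\<lambda>x. p (f x) (g x))"
| "bilinear_class p f \<Longrightarrow> bilinear_class p g \<Longrightarrow> bilinear_class p (\<lambda>x. f x + g x)"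

lemma smooth_bilinear:
  assumes p: "bounded_bilinear p" and "smooth_on UNIV f" "smooth_on UNIV g"
  shows "smooth_on UNIV (\<lambda>x. p (f x) (g x))"
proof (rule smooth_on_coinduct[where P="bilinear_class p"])
  show "bilinear_class p (\<lambda>x. p (f x) (g x))"
    using assms by (intro bilinear_class.intros)
next
  fix h :: "'d \<Rightarrow> 'c" assume "bilinear_class p h"
  then show "(\<forall>x. h differentiable at x) \<and> (\<forall>b\<in>Basis. bilinear_class p (partial b h))"
  proof induction
    case (1 f g)
    have "partial b (\<lambda>x. p (f x) (g x)) = (\<lambda>x. p (f x) (partial b g x) + p (partial b f x) (g x))" for b
      by (intro ext partial_bilinear p smooth_differentiable 1)
    moreover have "(\<lambda>x. p (f x) (g x)) differentiable at x" for x
      unfolding differentiable_def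
      by (rule exI, rule bounded_bilinear.FDERIV[OF p];
          rule has_derivative_frechet[OF smooth_differentiable]; rule 1)
    moreover have "bilinear_class p (\<lambda>x. p (f x) (partial b g x) + p (partial b f x) (g x))" if "b \<in> Basis" for b
      using 1 that by (rule_tac bilinear_class.intros(2); intro bilinear_class.intros(1) smooth_on_partial)
    ultimately show ?case by simp
  next
    case (2 f g)
    have "partial b (\<lambda>x. f x + g x) = (\<lambda>x. partial b f x + partial b g x)" for b
      using 2 by (intro ext partial_add) auto
    then show ?case using 2 by (auto intro: bilinear_class.intros)
  qed
qed

lemmas smooth_mult = smooth_bilinear[OF bounded_bilinear_mult[where 'a=real]]
lemmas smooth_scaleR = smooth_bilinear[OF bounded_bilinear_scaleR]
lemmas smooth_inner = smooth_bilinear[OF bounded_bilinear_inner]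

lemma smooth_prod:
  fixes f :: "'i \<Rightarrow> 'a::euclidean_space \<Rightarrow> real"
  shows "(\<And>i. i \<in> I \<Longrightarrow> smooth_on UNIV (f i)) \<Longrightarrow> smooth_on UNIV (\<lambda>x. \<Prod>i\<in>I. f i x)"
  by (induction I rule: infinite_finite_induct) (auto intro: smooth_mult)

text \<open>By the chain rule a partial derivative of f(L x + d) is a combination of partial
  derivatives of f at L x + d with constant coefficients. Hence scalars and sums are built
  in.\<close>

inductive affine_class ::
  "('a::euclidean_space \<Rightarrow> 'b::euclidean_space) \<Rightarrow> 'b \<Rightarrow> ('a \<Rightarrow> 'c::euclidean_space) \<Rightarrow> bool" for L d where
  "smooth_on UNIV f \<Longrightarrow> affine_class L d (\<lambda>x. c *\<^sub>R f (L x + d))"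
| "affine_class L d f \<Longrightarrow> affine_class L d g \<Longrightarrow> affine_class L d (\<lambda>x. f x + g x)"

lemma has_derivative_affine:
  assumes L: "bounded_linear L" and f: "f differentiable at (L x + d)"
  shows "((\<lambda>x. f (L x + d)) has_derivative (\<lambda>v. frechet_derivative f (at (L x + d)) (L v))) (at x)"
proof -
  have "((\<lambda>x. L x + d) has_derivative L) (at x)"
    using bounded_linear.has_derivative[OF L has_derivative_ident] by (auto intro!: derivative_eq_intros)
  from diff_chain_at[OF this has_derivative_frechet[OF f]] show ?thesis by (simp add: o_def)
qed

lemma partial_affine:
  assumes "bounded_linear L" "f differentiable at (L x + d)"
  shows "partial b (\<lambda>x. f (L x + d)) x = frechet_derivative f (at (L x + d)) (L b)"
  by (rule partial_eq[OF has_derivative_affine[OF assms]])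

lemma affine_class_sum:
  "finite I \<Longrightarrow> (\<And>i. i \<in> I \<Longrightarrow> affine_class L d (f i)) \<Longrightarrow> affine_class L d (\<lambda>x. \<Sum>i\<in>I. f i x)"
proof (induction I rule: finite_induct)
  case empty
  show ?case using affine_class.intros(1)[OF smooth_const, of L d 0 0] by simp
qed (auto intro: affine_class.intros)

lemma smooth_affine:
  assumes L: "bounded_linear L" and "smooth_on UNIV f"
  shows "smooth_on UNIV (\<lambda>x. f (L x + d))"
proof (rule smooth_on_coinduct[where P="affine_class L d"])
  show "affine_class L d (\<lambda>x. f (L x + d))"
    using affine_class.intros(1)[OF assms(2), of L d 1] by simp
next
  fix h assume "affine_class L d h"
  then show "(\<forall>x. h differentiable at x) \<and> (\<forall>b\<in>Basis. affine_class L d (partial b h))"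
  proof induction
    case (1 f c)
    note df = smooth_differentiable[OF 1]
    have d: "(\<lambda>x. f (L x + d)) differentiable at x" for x
      using has_derivative_affine[OF L df] unfolding differentiable_def by blast
    have "partial b (\<lambda>x. c *\<^sub>R f (L x + d)) = (\<lambda>x. \<Sum>i\<in>Basis. (c * (L b \<bullet> i)) *\<^sub>R partial i f (L x + d))" for b
      using partial_linear[OF bounded_linear_scaleR_right d] partial_affine[OF L df]
      by (auto simp: frechet_eq_sum_partial[OF df] scaleR_sum_right)
    moreover have "(\<lambda>x. c *\<^sub>R f (L x + d)) differentiable at x" for x
      using d by (intro differentiable_scaleR) auto
    ultimately show ?case
      by (auto intro!: affine_class_sum affine_class.intros smooth_on_partial 1)
  next
    case (2 f g)
    have "partial b (\<lambda>x. f x + g x) = (\<lambda>x. partial b f x + partial b g x)" for b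
      using 2 by (intro ext partial_add) auto
    then show ?case using 2 by (auto intro: affine_class.intros)
  qed
qed

text \<open>The functions \<open>p(1/x) exp(-1/x)\<close>, extended by zero to \<open>x \<le> 0\<close>, are closed under differentiation.\<close>

definition flat :: "real poly \<Rightarrow> real \<Rightarrow> real" where
  "flat p x = (if x > 0 then poly p (1 / x) * exp (- (1 / x)) else 0)"

lemma poly_exp_at_top: "((\<lambda>x::real. poly p x * exp (- x)) \<longlongrightarrow> 0) at_top"
proof (induction p)
  case 0
  then show ?case by simp
next
  case (pCons a p)
  have "((\<lambda>x. \<Sum>i\<le>degree (pCons a p). coeff (pCons a p) i * (x ^ i / exp x)) \<longlongrightarrow> (\<Sum>i\<le>degree (pCons a p). coeff (pCons a p) i * 0)) at_top"
    by (intro tendsto_intros tendsto_power_div_exp_0)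
  then show ?case
    by (simp add: poly_altdef sum_distrib_right exp_minus divide_inverse mult.assoc)
qed

text \<open>With y = 1/x, the derivative in x is -y^2 times the derivative in y of p(y) exp(-y),
  that is, y^2 (p - p')(y) exp(-y); the polynomial \<open>[:0, 0, 1:]\<close> is y^2. At 0 the
  difference quotient from the right is y p(y) exp(-y), whence \<open>pCons 0 p\<close> in that
  case.\<close>

lemma flat_has_derivative:
  "(flat p has_real_derivative flat ([:0, 0, 1:] * (p - pderiv p)) x) (at x)"
proof -
  consider "x > 0" | "x < 0" | "x = 0" by linarith
  then show ?thesis
  proof cases
    case 1
    have "((\<lambda>x. poly p (1 / x) * exp (- (1 / x))) has_real_derivative
        flat ([:0, 0, 1:] * (p - pderiv p)) x) (at x)"
      using 1 by (auto intro!: derivative_eq_intros DERIV_chain'[where g="poly p"] poly_DERIV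
        simp: flat_def field_simps power2_eq_square)
    then show ?thesis
      by (rule has_field_derivative_transform_within_open[where S="{0<..}"]) (use 1 in \<open>auto simp: flat_def\<close>)
  next
    case 2
    have "((\<lambda>x. 0) has_real_derivative flat ([:0, 0, 1:] * (p - pderiv p)) x) (at x)"
      using 2 by (auto simp: flat_def)
    then show ?thesis
      by (rule has_field_derivative_transform_within_open[where S="{..<0}"]) (use 2 in \<open>auto simp: flat_def\<close>)
  next
    case 3
    have "((\<lambda>y::real. poly (pCons 0 p) y * exp (- y)) \<longlongrightarrow> 0) at_top" by (rule poly_exp_at_top)
    from filterlim_compose[OF this filterlim_inverse_at_top_right]
    have r: "((\<lambda>y. flat p y / y) \<longlongrightarrow> 0) (at_right 0)"
      by (rule Lim_transform_eventually)
        (auto simp: flat_def field_simps intro: eventually_at_rightI[of 0 1])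
    have l: "((\<lambda>y. flat p y / y) \<longlongrightarrow> 0) (at_left 0)"
      by (rule tendsto_eventually) (auto simp: flat_def eventually_at_left_field intro: exI[of _ "-1"])
    have "((\<lambda>y. flat p y / y) \<longlongrightarrow> 0) (at 0)"
      using l r by (simp add: filterlim_split_at)
    then show ?thesis
      using 3 by (simp add: DERIV_def flat_def)
  qed
qed

lemma smooth_flat: "smooth_on UNIV (flat p)"
proof (rule smooth_on_coinduct[where P="\<lambda>f. \<exists>p. f = flat p"])
  fix f assume "\<exists>p. f = flat p"
  then obtain p where f: "f = flat p" by blast
  have D: "(flat p has_derivative (\<lambda>v. v * flat ([:0, 0, 1:] * (p - pderiv p)) x)) (at x)" for x
    using flat_has_derivative[of p x] by (simp add: has_field_derivative_def mult.commute[of _ "flat _ _"])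
  then have "partial 1 f = flat ([:0, 0, 1:] * (p - pderiv p))"
    unfolding f by (auto simp: partial_eq[OF D])
  then show "(\<forall>x. f differentiable at x) \<and> (\<forall>b\<in>Basis. \<exists>p. partial b f = flat p)"
    using D f unfolding differentiable_def by (auto intro: exI)
qed auto

section \<open>Test functions and their closure properties\<close>

lemma test_functions_smooth: "\<phi> \<in> test_functions S \<Longrightarrow> smooth_on UNIV \<phi>"
  by (simp add: test_functions_def)

lemma test_functionsI:
  assumes "smooth_on UNIV \<phi>" "compact K" "K \<subseteq> S" "\<And>x. x \<notin> K \<Longrightarrow> \<phi> x = 0"
  shows "\<phi> \<in> test_functions S"
proof -
  have "closure {x. \<phi> x \<noteq> 0} \<subseteq> K"
    using assms by (intro closure_minimal) (auto simp: compact_imp_closed)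
  moreover from this have "compact (closure {x. \<phi> x \<noteq> 0})"
    using compact_Int_closed[OF assms(2) closed_closure, of "{x. \<phi> x \<noteq> 0}"]
    by (simp add: Int_absorb1)
  ultimately show ?thesis
    using assms(1,3) unfolding test_functions_def by blast
qed

lemma test_functionsE:
  assumes "\<phi> \<in> test_functions S"
  obtains K where "compact K" "K \<subseteq> S" "\<And>x. x \<notin> K \<Longrightarrow> \<phi> x = 0"
proof (rule that)
  show "compact (closure {x. \<phi> x \<noteq> 0})" "closure {x. \<phi> x \<noteq> 0} \<subseteq> S"
    using assms by (simp_all add: test_functions_def)
  show "\<phi> x = 0" if "x \<notin> closure {x. \<phi> x \<noteq> 0}" for x
    using that closure_subset[of "{x. \<phi> x \<noteq> 0}"] by blast
qed

lemma test_functions_mono: "S \<subseteq> T \<Longrightarrow> \<phi> \<in> test_functions S \<Longrightarrow> \<phi> \<in> test_functions T"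
  unfolding test_functions_def by auto

lemma test_functions_bilinear_left:
  assumes "bounded_bilinear p" "\<phi> \<in> test_functions S" "smooth_on UNIV \<psi>"
  shows "(\<lambda>x. p (\<phi> x) (\<psi> x)) \<in> test_functions S"
proof -
  interpret bounded_bilinear p by fact
  obtain K where K: "compact K" "K \<subseteq> S" "\<And>x. x \<notin> K \<Longrightarrow> \<phi> x = 0"
    using test_functionsE[OF assms(2)] by blast
  have "smooth_on UNIV (\<lambda>x. p (\<phi> x) (\<psi> x))"
    by (rule smooth_bilinear[OF assms(1) test_functions_smooth[OF assms(2)] assms(3)])
  then show ?thesis
    by (rule test_functionsI[OF _ K(1,2)]) (simp add: K(3) zero_left)
qed

lemmas test_functions_inner = test_functions_bilinear_left[OF bounded_bilinear_inner]
lemmas test_functions_mult = test_functions_bilinear_left[OF bounded_bilinear_mult[where 'a=real]]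

lemma test_functions_linear:
  assumes "bounded_linear L" "\<phi> \<in> test_functions S"
  shows "(\<lambda>x. L (\<phi> x)) \<in> test_functions S"
proof -
  obtain K where K: "compact K" "K \<subseteq> S" "\<And>x. x \<notin> K \<Longrightarrow> \<phi> x = 0"
    using test_functionsE[OF assms(2)] by blast
  have "smooth_on UNIV (\<lambda>x. L (\<phi> x))"
    by (rule smooth_linear[OF assms(1) test_functions_smooth[OF assms(2)]])
  then show ?thesis
    by (rule test_functionsI[OF _ K(1,2)]) (simp add: K(3) linear_simps[OF assms(1)])
qed

lemma test_functions_add:
  assumes "\<phi> \<in> test_functions S" "\<psi> \<in> test_functions S"
  shows "(\<lambda>x. \<phi> x + \<psi> x) \<in> test_functions S"
proof -
  obtain K where K: "compact K" "K \<subseteq> S" "\<And>x. x \<notin> K \<Longrightarrow> \<phi> x = 0"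
    using test_functionsE[OF assms(1)] by blast
  obtain L where L: "compact L" "L \<subseteq> S" "\<And>x. x \<notin> L \<Longrightarrow> \<psi> x = 0"
    using test_functionsE[OF assms(2)] by blast
  show ?thesis
    by (rule test_functionsI[OF smooth_add[OF assms[THEN test_functions_smooth]], of "K \<union> L"])
      (use K L in auto)
qed

lemma test_functions_zero: "(\<lambda>x. 0) \<in> test_functions S"
  by (rule test_functionsI[of _ "{}"]) auto

lemma test_functions_sum:
  "(\<And>i. i \<in> I \<Longrightarrow> \<phi> i \<in> test_functions S) \<Longrightarrow> (\<lambda>x. \<Sum>i\<in>I. \<phi> i x) \<in> test_functions S"
  by (induction I rule: infinite_finite_induct) (auto intro: test_functions_add test_functions_zero)

lemma test_functions_partial:
  assumes "\<phi> \<in> test_functions S" "b \<in> Basis"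
  shows "partial b \<phi> \<in> test_functions S"
proof -
  obtain K where K: "compact K" "K \<subseteq> S" "\<And>x. x \<notin> K \<Longrightarrow> \<phi> x = 0"
    using test_functionsE[OF assms(1)] by blast
  have "partial b \<phi> x = 0" if "x \<notin> K" for x
    using partial_cong_open[of "- K" x \<phi> "\<lambda>x. 0" b] K that
    by (auto simp: open_Compl[OF compact_imp_closed])
  then show ?thesis
    by (rule test_functionsI[OF smooth_on_partial[OF test_functions_smooth[OF assms(1)] assms(2)] K(1,2)])
qed

lemma test_functions_continuous: "\<phi> \<in> test_functions S \<Longrightarrow> continuous_on T \<phi>"
  using smooth_on_continuous_on test_functions_smooth continuous_on_subset by blast

lemma test_functions_differentiable: "\<phi> \<in> test_functions S \<Longrightarrow> \<phi> differentiable at x"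
  by (simp add: smooth_differentiable test_functions_smooth)

lemma test_functions_measurable: "\<phi> \<in> test_functions S \<Longrightarrow> \<phi> \<in> borel_measurable borel"
  using test_functions_continuous borel_measurable_continuous_onI by blast

lemma test_functions_bounded:
  assumes "\<phi> \<in> test_functions S"
  obtains B where "B > 0" "\<And>x. norm (\<phi> x) \<le> B"
proof -
  obtain K where K: "compact K" "K \<subseteq> S" "\<And>x. x \<notin> K \<Longrightarrow> \<phi> x = 0"
    using test_functionsE[OF assms(1)] by blast
  have "bounded (\<phi> ` K)"
    using K test_functions_continuous[OF assms] by (intro compact_imp_bounded compact_continuous_image) auto
  then obtain B where B: "\<And>x. x \<in> K \<Longrightarrow> norm (\<phi> x) \<le> B" unfolding bounded_iff by auto
  show ?thesis
  proof (rule that[of "\<bar>B\<bar> + 1"])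
    show "norm (\<phi> x) \<le> \<bar>B\<bar> + 1" for x
      using K(3)[of x] B[of x] by (cases "x \<in> K") auto
  qed simp
qed

section \<open>Smooth approximation of indicators of open sets\<close>

text \<open>The shift by -1 makes a factor vanish within distance 1/n of its face, so the support is
  compact inside the open box. The factor n pushes the values to 1, the limit of exp(-1/s) for large
  s.\<close>

definition box_bump :: "'a::euclidean_space \<Rightarrow> 'a \<Rightarrow> nat \<Rightarrow> 'a \<Rightarrow> real" where
  "box_bump a b n x = (\<Prod>i\<in>Basis. flat 1 (real n * (x \<bullet> i - a \<bullet> i) - 1) * flat 1 (real n * (b \<bullet> i - x \<bullet> i) - 1))"

lemma flat_1_bounds: "0 \<le> flat 1 x" "flat 1 x \<le> 1" "x \<le> 0 \<Longrightarrow> flat 1 x = 0"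
  by (auto simp: flat_def)

lemma box_bump_bounds: "0 \<le> box_bump a b n x" "box_bump a b n x \<le> 1"
  unfolding box_bump_def
  by (auto intro!: prod_nonneg prod_le_1 mult_nonneg_nonneg mult_le_one simp: flat_1_bounds)

lemma smooth_box_bump: "smooth_on UNIV (box_bump a b n)"
proof -
  have 1: "smooth_on UNIV (\<lambda>x. flat 1 (real n * (x \<bullet> i - a \<bullet> i) - 1))" for i
    using smooth_affine[OF bounded_linear_compose[OF bounded_linear_mult_right[of "real n"] bounded_linear_inner_left[of i]] smooth_flat[of 1],
        of "- real n * (a \<bullet> i) - 1"]
    by (simp add: algebra_simps)
  have 2: "smooth_on UNIV (\<lambda>x. flat 1 (real n * (b \<bullet> i - x \<bullet> i) - 1))" for i
    using smooth_affine[OF bounded_linear_compose[OF bounded_linear_mult_right[of "- real n"] bounded_linear_inner_left[of i]] smooth_flat[of 1],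
        of "real n * (b \<bullet> i) - 1"]
    by (simp add: algebra_simps)
  show ?thesis
    unfolding box_bump_def[abs_def] by (intro smooth_prod smooth_mult 1 2)
qed

text \<open>The index 0 is listed separately: \<open>1 / real 0\<close> is 0, so the shrunken box
  would be the whole closed box, whereas all arguments of \<open>flat 1\<close> are then -1.\<close>

lemma box_bump_zero:
  assumes "x \<notin> cbox (a + (1 / real n) *\<^sub>R One) (b - (1 / real n) *\<^sub>R One) \<or> n = 0"
  shows "box_bump a b n x = 0"
proof -
  have "\<exists>i\<in>Basis. real n * (x \<bullet> i - a \<bullet> i) - 1 \<le> 0 \<or> real n * (b \<bullet> i - x \<bullet> i) - 1 \<le> 0"
  proof (cases "n = 0")
    case True
    obtain i :: 'a where "i \<in> Basis" using nonempty_Basis by blast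
    then show ?thesis using True by (intro bexI[of _ i]) auto
  next
    case False
    with assms obtain i where i: "i \<in> Basis" "x \<bullet> i < a \<bullet> i + 1 / real n \<or> x \<bullet> i > b \<bullet> i - 1 / real n"
      by (auto simp: mem_box inner_add_left inner_diff_left not_le)
    then show ?thesis using False by (intro bexI[of _ i]) (auto simp: field_simps)
  qed
  then have "\<exists>i\<in>Basis. flat 1 (real n * (x \<bullet> i - a \<bullet> i) - 1) * flat 1 (real n * (b \<bullet> i - x \<bullet> i) - 1) = 0"
    using flat_1_bounds(3) by (metis mult_eq_0_iff)
  then show ?thesis unfolding box_bump_def by (intro prod_zero) auto
qed

lemma flat_1_tendsto:
  assumes "(c::real) > 0"
  shows "(\<lambda>n. flat 1 (real n * c - 1)) \<longlonglongrightarrow> 1"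
proof -
  have "filterlim (\<lambda>n. c * real n) at_top sequentially"
    by (rule filterlim_tendsto_pos_mult_at_top[OF tendsto_const assms filterlim_real_sequentially])
  then have "filterlim (\<lambda>n. - 1 + c * real n) at_top sequentially"
    by (rule filterlim_tendsto_add_at_top[OF tendsto_const])
  also have "(\<lambda>n. - 1 + c * real n) = (\<lambda>n. real n * c - 1)"
    by (rule ext) simp
  finally have t: "filterlim (\<lambda>n. real n * c - 1) at_top sequentially" .
  have "(\<lambda>n. exp (- (1 / (real n * c - 1)))) \<longlonglongrightarrow> exp (- 0)"
    by (intro tendsto_intros tendsto_divide_0[OF tendsto_const] filterlim_at_top_imp_at_infinity t)
  then have "(\<lambda>n. exp (- (1 / (real n * c - 1)))) \<longlonglongrightarrow> 1" by simp
  then show ?thesis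
  proof (rule Lim_transform_eventually)
    show "\<forall>\<^sub>F n in sequentially. exp (- (1 / (real n * c - 1))) = flat 1 (real n * c - 1)"
      using filterlim_at_top_dense[THEN iffD1, OF t, rule_format, of 0]
      by eventually_elim (simp add: flat_def)
  qed
qed

lemma box_bump_tendsto:
  assumes "x \<in> box a b"
  shows "(\<lambda>n. box_bump a b n x) \<longlonglongrightarrow> 1"
proof -
  have "(\<lambda>n. box_bump a b n x) \<longlonglongrightarrow> (\<Prod>i\<in>(Basis::'a set). 1 * 1)"
    unfolding box_bump_def
    by (intro tendsto_prod tendsto_mult flat_1_tendsto) (use assms in \<open>auto simp: mem_box\<close>)
  then show ?thesis by simp
qed

lemma cbox_shrink_subset:
  assumes "n > 0" shows "cbox (a + (1 / real n) *\<^sub>R One) (b - (1 / real n) *\<^sub>R One) \<subseteq> box a b"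
proof
  fix x assume x: "x \<in> cbox (a + (1 / real n) *\<^sub>R One) (b - (1 / real n) *\<^sub>R One)"
  have n: "0 < 1 / real n" using assms by simp
  have "a \<bullet> i < x \<bullet> i \<and> x \<bullet> i < b \<bullet> i" if "i \<in> Basis" for i
  proof -
    have "a \<bullet> i + 1 / real n \<le> x \<bullet> i" "x \<bullet> i \<le> b \<bullet> i - 1 / real n"
      using x that by (auto simp: mem_box inner_add_left inner_diff_left)
    then show ?thesis using n by linarith
  qed
  then show "x \<in> box a b" by (simp add: mem_box)
qed

lemma empty_box: "\<exists>a b. {} = box a (b::'a::euclidean_space)"
  by (rule exI[of _ 0], rule exI[of _ 0]) simp

lemma open_indicator_approx:
  fixes U :: "'a::euclidean_space set"
  assumes "open U"
  obtains \<phi> :: "nat \<Rightarrow> 'a \<Rightarrow> real"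
  where "\<And>n. \<phi> n \<in> test_functions U" "\<And>n x. 0 \<le> \<phi> n x \<and> \<phi> n x \<le> 1"
    "\<And>x. (\<lambda>n. \<phi> n x) \<longlonglongrightarrow> indicator U x"
proof -
  obtain D where D: "countable D" "D \<subseteq> Pow U" "\<And>X. X \<in> D \<Longrightarrow> \<exists>a b. X = box a b" "\<Union>D = U"
    by (rule open_countable_Union_open_box[OF assms]) blast
  \<comment> \<open>The empty box keeps the family nonempty when U is empty, so that
    \<open>from_nat_into\<close> enumerates it.\<close>
  define D' where "D' = insert {} D"
  have D': "countable D'" "D' \<noteq> {}" "\<And>X. X \<in> D' \<Longrightarrow> \<exists>a b. X = box a b" "\<Union>D' = U"
    unfolding D'_def using D empty_box by auto
  define A where "A = from_nat_into D'"
  have A: "range A = D'" unfolding A_def by (rule range_from_nat_into[OF D'(2,1)])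
  have "\<forall>i. \<exists>a b. A i = box a b"
    using D'(3) A by (metis rangeI)
  then obtain a where "\<forall>i. \<exists>b. A i = box (a i) b" by (rule choice[THEN exE])
  then obtain b where "\<forall>i. A i = box (a i) (b i)" by (rule choice[THEN exE])
  then have ab: "A i = box (a i) (b i)" for i by simp
  \<comment> \<open>A smooth union of the first n boxes: it vanishes where all the bumps vanish and
    is at least as large as each of them. Only finitely many boxes enter at stage n, which keeps the
    support compact.\<close>
  define \<phi> where "\<phi> n x = 1 - (\<Prod>i<n. 1 - box_bump (a i) (b i) n x)" for n x
  show thesis
  proof (rule that[of \<phi>])
    fix n
    define K where "K = (\<Union>i<n. cbox (a i + (1 / real n) *\<^sub>R One) (b i - (1 / real n) *\<^sub>R One))"
    have KU: "K \<subseteq> U"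
    proof
      fix x assume "x \<in> K"
      then obtain i where i: "i < n" "x \<in> cbox (a i + (1 / real n) *\<^sub>R One) (b i - (1 / real n) *\<^sub>R One)"
        by (auto simp: K_def)
      then have "x \<in> A i" unfolding ab using cbox_shrink_subset[of n "a i" "b i"] by auto
      then show "x \<in> U" using A D'(4) by blast
    qed
    have sm: "smooth_on UNIV (\<phi> n)"
    proof -
      have "smooth_on UNIV (\<lambda>x. 1 + (-1) * (\<Prod>i<n. 1 + (-1) * box_bump (a i) (b i) n x))"
        by (intro smooth_add smooth_mult smooth_const smooth_prod smooth_box_bump)
      then show ?thesis unfolding \<phi>_def[abs_def] by simp
    qed
    have "\<phi> n x = 0" if "x \<notin> K" for x
    proof -
      have "box_bump (a i) (b i) n x = 0" if "i < n" for i
        by (rule box_bump_zero) (use that \<open>x \<notin> K\<close> in \<open>auto simp: K_def\<close>)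
      then show ?thesis unfolding \<phi>_def by simp
    qed
    then show "\<phi> n \<in> test_functions U"
      using KU sm by (intro test_functionsI[of _ K]) (auto simp: K_def)
  next
    fix n x
    have "0 \<le> (\<Prod>i<n. 1 - box_bump (a i) (b i) n x)" "(\<Prod>i<n. 1 - box_bump (a i) (b i) n x) \<le> 1"
      by (auto intro!: prod_nonneg prod_le_1 simp: box_bump_bounds)
    then show "0 \<le> \<phi> n x \<and> \<phi> n x \<le> 1" unfolding \<phi>_def by auto
  next
    fix x
    show "(\<lambda>n. \<phi> n x) \<longlonglongrightarrow> indicator U x"
    proof (cases "x \<in> U")
      case True
      then obtain X where "X \<in> D'" "x \<in> X" using D'(4) by blast
      then obtain i where "x \<in> A i" using A by blast
      then have i: "x \<in> box (a i) (b i)" using ab by simp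
      have le: "1 - \<phi> n x \<le> 1 - box_bump (a i) (b i) n x" if "n > i" for n
      proof -
        have "(\<Prod>j<n. 1 - box_bump (a j) (b j) n x) = (1 - box_bump (a i) (b i) n x) * (\<Prod>j\<in>{..<n} - {i}. 1 - box_bump (a j) (b j) n x)"
          using that by (subst prod.remove[of _ i]) auto
        also have "\<dots> \<le> (1 - box_bump (a i) (b i) n x) * 1"
          by (intro mult_left_mono prod_le_1) (auto simp: box_bump_bounds)
        finally show ?thesis unfolding \<phi>_def by simp
      qed
      have ge: "0 \<le> 1 - \<phi> n x" for n
        unfolding \<phi>_def by (auto intro!: prod_nonneg simp: box_bump_bounds)
      have "(\<lambda>n. 1 - box_bump (a i) (b i) n x) \<longlonglongrightarrow> 1 - 1"
        by (intro tendsto_intros box_bump_tendsto i)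
      then have r: "(\<lambda>n. 1 - box_bump (a i) (b i) n x) \<longlonglongrightarrow> 0" by simp
      have "(\<lambda>n. 1 - \<phi> n x) \<longlonglongrightarrow> 0"
      proof (rule tendsto_sandwich[OF _ _ tendsto_const r])
        show "\<forall>\<^sub>F n in sequentially. 1 - \<phi> n x \<le> 1 - box_bump (a i) (b i) n x"
          using le by (rule eventually_mono[OF eventually_gt_at_top[of i]])
      qed (use ge in simp)
      from tendsto_diff[OF tendsto_const[of 1] this] show ?thesis using True by simp
    next
      case False
      have "box_bump (a i) (b i) n x = 0" for i n
      proof (rule box_bump_zero)
        have "x \<notin> box (a i) (b i)" using False A D'(4) by (simp add: ab[symmetric]) blast
        then show "x \<notin> cbox (a i + (1 / real n) *\<^sub>R One) (b i - (1 / real n) *\<^sub>R One) \<or> n = 0"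
          using cbox_shrink_subset[of n] by blast
      qed
      then show ?thesis using False by (simp add: \<phi>_def)
    qed
  qed
qed

section \<open>The fundamental lemma of the calculus of variations\<close>

lemma integrable_bounded_mult:
  fixes f :: "'a \<Rightarrow> real" and g :: "'a \<Rightarrow> 'b::{banach, second_countable_topology}"
  assumes "integrable M g" "f \<in> borel_measurable M" "AE x in M. \<bar>f x\<bar> \<le> B"
  shows "integrable M (\<lambda>x. f x *\<^sub>R g x)"
proof (rule Bochner_Integration.integrable_bound)
  show "integrable M (\<lambda>x. B *\<^sub>R g x)" using assms by simp
  show "AE x in M. norm (f x *\<^sub>R g x) \<le> norm (B *\<^sub>R g x)"
    using assms(3) by eventually_elim (auto intro!: mult_right_mono)
qed (use assms in measurable)

lemma test_functions_outside: "\<phi> \<in> test_functions S \<Longrightarrow> x \<notin> S \<Longrightarrow> \<phi> x = 0"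
  by (rule test_functionsE) blast+

lemma lebesgue_on_borel_measurable:
  "f \<in> borel_measurable borel \<Longrightarrow> f \<in> borel_measurable (lebesgue_on S)"
  by (intro measurable_restrict_space1 measurable_completion) simp

lemma lebesgue_on_continuous_measurable:
  fixes f :: "'a::euclidean_space \<Rightarrow> 'b::euclidean_space"
  assumes "continuous_on S f" "S \<in> sets borel"
  shows "f \<in> borel_measurable (lebesgue_on S)"
  using assms by (intro continuous_imp_measurable_on_sets_lebesgue) auto

text \<open>Open sets are limits of test functions, and measurable sets are limits of open sets.\<close>

lemma AE_nonneg_if_test_integrals_nonneg:
  fixes f :: "'a::euclidean_space \<Rightarrow> real"
  assumes U: "open U" and f: "integrable (lebesgue_on U) f"
    and pos: "\<And>\<phi>. \<phi> \<in> test_functions U \<Longrightarrow> (\<forall>x. 0 \<le> \<phi> x) \<Longrightarrow> 0 \<le> (LINT x|lebesgue_on U. \<phi> x * f x)"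
  shows "AE x in lebesgue_on U. 0 \<le> f x"
proof -
  let ?M = "lebesgue_on U"
  have ops: "0 \<le> (LINT x|?M. indicator V x * f x)" if V: "open V" "V \<subseteq> U" for V
  proof -
    obtain \<phi> where \<phi>: "\<And>n. \<phi> n \<in> test_functions V" "\<And>n x. 0 \<le> \<phi> n x \<and> \<phi> n x \<le> (1::real)"
      "\<And>x. (\<lambda>n. \<phi> n x) \<longlonglongrightarrow> indicator V x"
      using open_indicator_approx[OF V(1)] by metis
    have m: "\<phi> n \<in> borel_measurable ?M" for n
      using \<phi>(1) by (intro lebesgue_on_borel_measurable test_functions_measurable)
    have "(\<lambda>n. LINT x|?M. \<phi> n x * f x) \<longlonglongrightarrow> (LINT x|?M. indicator V x * f x)"
    proof (rule integral_dominated_convergence[where w="\<lambda>x. norm (f x)"])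
      show "(\<lambda>x. indicator V x * f x) \<in> borel_measurable ?M"
        using f V by (intro borel_measurable_times borel_measurable_indicator)
          (auto simp: sets_restrict_space intro: lebesgue_on_borel_measurable)
      show "AE x in ?M. norm (\<phi> n x * f x) \<le> norm (f x)" for n
        using \<phi>(2) by (auto simp: abs_mult intro!: mult_left_le_one_le)
    qed (use m f \<phi>(3) in \<open>auto intro!: tendsto_intros\<close>)
    then show ?thesis
      by (rule LIMSEQ_le_const) (use \<phi> V in \<open>auto intro!: pos test_functions_mono[OF V(2)]\<close>)
  qed
  define A where "A = {x\<in>U. f x < 0}"
  have Am: "A \<in> sets ?M"
    using borel_measurable_less[OF borel_measurable_integrable[OF f] borel_measurable_const[of 0]]
    by (simp add: A_def)
  then have Al: "A \<in> sets lebesgue"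
    using U by (auto simp: sets_restrict_space)
  have "\<exists>T. open T \<and> A \<subseteq> T \<and> T - A \<in> lmeasurable \<and> emeasure lebesgue (T - A) < ennreal (1 / real (Suc n))" for n
  proof -
    have "0 < 1 / real (Suc n)" by simp
    then obtain T where "open T" "A \<subseteq> T" "T - A \<in> lmeasurable" "emeasure lebesgue (T - A) < ennreal (1 / real (Suc n))"
      by (rule sets_lebesgue_outer_open[OF Al])
    then show ?thesis by blast
  qed
  then obtain T where T: "\<And>n. open (T n)" "\<And>n. A \<subseteq> T n" "\<And>n. T n - A \<in> lmeasurable"
    "\<And>n. emeasure lebesgue (T n - A) < ennreal (1 / real (Suc n))" by metis
  \<comment> \<open>The intersections make the open sets decrease to \<open>Wi\<close>, which
    differs from the bad set A by a null set. So the bound for open sets passes to A by dominated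
    convergence.\<close>
  define W where "W n = (\<Inter>k\<le>n. T k) \<inter> U" for n
  define Wi where "Wi = (\<Inter>n. T n) \<inter> U"
  have W: "open (W n)" "W n \<subseteq> U" for n
    unfolding W_def using T U by auto
  have Wim: "Wi \<in> sets lebesgue" unfolding Wi_def using T(1) U by (intro sets.Int sets.countable_INT) auto
  have lim: "(\<lambda>n. indicator (W n) x * f x) \<longlonglongrightarrow> indicator Wi x * f x" for x
  proof -
    have "\<forall>\<^sub>F n in sequentially. indicator (W n) x = (indicator Wi x :: real)"
    proof (cases "x \<in> Wi")
      case False
      then consider "x \<notin> U" | k where "x \<notin> T k" by (auto simp: Wi_def)
      then show ?thesis
      proof cases
        case 2
        show ?thesis by (rule eventually_mono[OF eventually_ge_at_top[of k]]) (use 2 False in \<open>auto simp: W_def indicator_def\<close>)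
      qed (use False in \<open>auto simp: W_def indicator_def\<close>)
    qed (auto simp: W_def Wi_def)
    then show ?thesis by (intro tendsto_mult tendsto_eventually tendsto_const)
  qed
  have "(\<lambda>n. LINT x|?M. indicator (W n) x * f x) \<longlonglongrightarrow> (LINT x|?M. indicator Wi x * f x)"
  proof (rule integral_dominated_convergence[where w="\<lambda>x. norm (f x)"])
    show "(\<lambda>x. indicator Wi x * f x) \<in> borel_measurable ?M"
      using f Wim by (intro borel_measurable_times borel_measurable_indicator) (auto simp: sets_restrict_space Wi_def)
    show "(\<lambda>x. indicator (W n) x * f x) \<in> borel_measurable ?M" for n
      using f W[of n] by (intro borel_measurable_times borel_measurable_indicator) (auto simp: sets_restrict_space)
    show "AE x in ?M. norm (indicator (W n) x * f x) \<le> norm (f x)" for n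
      by (auto simp: abs_mult indicator_def)
  qed (use f lim in auto)
  then have 1: "0 \<le> (LINT x|?M. indicator Wi x * f x)"
    by (rule LIMSEQ_le_const) (use ops W in auto)
  have null: "Wi - A \<in> null_sets lebesgue"
  proof -
    have "emeasure lebesgue (Wi - A) \<le> ennreal (1 / real (Suc n))" for n
    proof -
      have "emeasure lebesgue (Wi - A) \<le> emeasure lebesgue (T n - A)"
        using T(1) Al by (intro emeasure_mono) (auto simp: Wi_def)
      then show ?thesis using T(4)[of n] by (meson order.trans less_imp_le)
    qed
    moreover have "(\<lambda>n. ennreal (1 / real (Suc n))) \<longlonglongrightarrow> ennreal 0"
      by (intro tendsto_ennrealI LIMSEQ_inverse_real_of_nat[unfolded inverse_eq_divide])
    ultimately have "emeasure lebesgue (Wi - A) \<le> ennreal 0"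
      by (intro LIMSEQ_le_const) auto
    then show ?thesis using Wim Al by (intro null_setsI) auto
  qed
  have AW: "A \<subseteq> Wi" using T(2) by (auto simp: A_def Wi_def)
  have "AE x in lebesgue. x \<in> U \<longrightarrow> indicator Wi x * f x = indicator A x * f x"
    using AE_not_in[OF null] by eventually_elim (use AW in \<open>auto simp: indicator_def\<close>)
  then have ae: "AE x in ?M. indicator Wi x * f x = indicator A x * f x"
    using U by (subst AE_restrict_space_iff) auto
  have iA: "integrable ?M (\<lambda>x. indicator A x * f x)"
    using integrable_real_mult_indicator[OF Am f] by (simp add: mult.commute)
  have "(LINT x|?M. indicator Wi x * f x) = (LINT x|?M. indicator A x * f x)"
    using f Wim Am ae by (intro integral_cong_AE borel_measurable_times borel_measurable_indicator) (auto simp: sets_restrict_space Wi_def)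
  with 1 have 2: "0 \<le> (LINT x|?M. indicator A x * f x)" by simp
  \<comment> \<open>The integrand is nonpositive and its integral nonnegative, so it vanishes almost
    everywhere; f being negative on A, this leaves A null.\<close>
  have np: "indicator A x * f x \<le> 0" for x by (auto simp: indicator_def A_def)
  have "(LINT x|?M. - (indicator A x * f x)) = 0"
  proof (rule antisym)
    show "0 \<le> (LINT x|?M. - (indicator A x * f x))"
      by (rule integral_nonneg_AE) (use np in simp)
  qed (use 2 in simp)
  then have "AE x in ?M. - (indicator A x * f x) = 0"
    using iA np by (subst (asm) integral_nonneg_eq_0_iff_AE) auto
  then show ?thesis
    by (rule lebesgue_on_mono) (auto simp: A_def indicator_def split: if_splits)
qed

section \<open>Localisation to open sets with compact closure\<close>

lemma AE_lebesgue_on_countable_cover: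
  assumes "countable D" "\<And>X. X \<in> D \<Longrightarrow> X \<in> sets lebesgue" "\<Union>D = U"
    and "\<And>X. X \<in> D \<Longrightarrow> AE x in lebesgue_on X. P x"
  shows "AE x in lebesgue_on U. P x"
proof -
  have "AE x in lebesgue. \<forall>X\<in>D. x \<in> X \<longrightarrow> P x"
    using assms by (intro AE_ball_countable' ) (auto simp: AE_restrict_space_iff)
  moreover have "U \<in> sets lebesgue" using assms by (metis sets.countable_Union subsetI)
  ultimately show ?thesis
    using assms(3) by (subst AE_restrict_space_iff) (auto elim!: eventually_mono)
qed

definition locally_integrable :: "'a::euclidean_space set \<Rightarrow> ('a \<Rightarrow> 'b::euclidean_space) \<Rightarrow> bool" where
  "locally_integrable U f \<longleftrightarrow> (\<forall>K. compact K \<and> K \<subseteq> U \<longrightarrow> integrable (lebesgue_on K) f)"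

text \<open>Local integrability controls a function on compact subsets only, so the fundamental
  lemma is applied on pieces whose closure is compact in U. Countably many pieces keep the
  exceptional set null.\<close>

lemma open_countable_Union_boxes_compactly_inside:
  fixes U :: "'a::euclidean_space set"
  assumes "open U"
  obtains D where "countable D" "\<Union>D = U" "\<And>X. X \<in> D \<Longrightarrow> open X"
    "\<And>X. X \<in> D \<Longrightarrow> compact (closure X) \<and> closure X \<subseteq> U"
proof -
  obtain D where D: "countable D" "D \<subseteq> Pow U" "\<And>X. X \<in> D \<Longrightarrow> \<exists>a b. X = box a b" "\<Union>D = U"
    by (rule open_countable_Union_open_box[OF assms]) blast
  obtain a b where ab: "\<And>X. X \<in> D \<Longrightarrow> X = box (a X) (b X)" using D(3) by metis
  define B where "B X n = box (a X + (1 / real (Suc n)) *\<^sub>R One) (b X - (1 / real (Suc n)) *\<^sub>R One)" for X n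
  define D' where "D' = (\<Union>X\<in>D. range (B X))"
  have cl: "closure (B X n) \<subseteq> X" if "X \<in> D" for X n
  proof -
    have "closure (B X n) \<subseteq> cbox (a X + (1 / real (Suc n)) *\<^sub>R One) (b X - (1 / real (Suc n)) *\<^sub>R One)"
      unfolding B_def by (rule closure_minimal[OF box_subset_cbox closed_cbox])
    also have "\<dots> \<subseteq> box (a X) (b X)" by (rule cbox_shrink_subset) simp
    finally show ?thesis using ab[OF that] by simp
  qed
  have cov: "X \<subseteq> (\<Union>n. B X n)" if "X \<in> D" for X
  proof
    fix x assume "x \<in> X"
    then have x: "x \<in> box (a X) (b X)" using ab[OF that] by simp
    have "\<forall>\<^sub>F n in sequentially. 1 / real (Suc n) < x \<bullet> i - a X \<bullet> i \<and> 1 / real (Suc n) < b X \<bullet> i - x \<bullet> i" if "i \<in> Basis" for i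
      using x that
      by (intro eventually_conj order_tendstoD[OF LIMSEQ_inverse_real_of_nat[unfolded inverse_eq_divide]]) (auto simp: mem_box)
    then have "\<forall>\<^sub>F n in sequentially. \<forall>i\<in>Basis. 1 / real (Suc n) < x \<bullet> i - a X \<bullet> i \<and> 1 / real (Suc n) < b X \<bullet> i - x \<bullet> i"
      by (simp add: eventually_ball_finite)
    then obtain n where n: "\<forall>i\<in>Basis. 1 / real (Suc n) < x \<bullet> i - a X \<bullet> i \<and> 1 / real (Suc n) < b X \<bullet> i - x \<bullet> i"
      by (auto simp: eventually_sequentially)
    have "x \<in> B X n"
      unfolding B_def mem_box
    proof
      fix i :: 'a assume "i \<in> Basis"
      then show "(a X + (1 / real (Suc n)) *\<^sub>R One) \<bullet> i < x \<bullet> i \<and> x \<bullet> i < (b X - (1 / real (Suc n)) *\<^sub>R One) \<bullet> i"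
        using n[rule_format, of i] by (simp add: inner_add_left inner_diff_left del: of_nat_Suc)
    qed
    then show "x \<in> (\<Union>n. B X n)" by blast
  qed
  show thesis
  proof (rule that[of D'])
    show "countable D'" unfolding D'_def using D(1) by auto
    show "\<Union>D' = U"
    proof
      show "\<Union>D' \<subseteq> U" using cl D(2) closure_subset unfolding D'_def by blast
      show "U \<subseteq> \<Union>D'" using cov D(4) unfolding D'_def by blast
    qed
    show "open X" if "X \<in> D'" for X using that unfolding D'_def B_def by auto
    show "compact (closure X) \<and> closure X \<subseteq> U" if "X \<in> D'" for X
      using that cl D(2) unfolding D'_def B_def by (fastforce simp: compact_closure bounded_box)
  qed
qed

lemma LINT_lebesgue_on_superset:
  fixes f :: "'a::euclidean_space \<Rightarrow> 'b::euclidean_space"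
  assumes "S \<subseteq> T" "S \<in> sets lebesgue" "T \<in> sets lebesgue" "\<And>x. x \<in> T - S \<Longrightarrow> f x = 0"
  shows "(LINT x|lebesgue_on T. f x) = (LINT x|lebesgue_on S. f x)"
proof -
  have "(LINT x|lebesgue_on T. f x) = (LINT x|lebesgue_on T. (if x \<in> S then f x else 0))"
    by (rule Bochner_Integration.integral_cong) (use assms in auto)
  then show ?thesis by (simp add: Lebesgue_Measure.integral_restrict assms)
qed

lemma integrable_lebesgue_on_superset:
  fixes f :: "'a::euclidean_space \<Rightarrow> 'b::euclidean_space"
  assumes "integrable (lebesgue_on S) f" "S \<subseteq> T" "S \<in> sets lebesgue" "T \<in> sets lebesgue" "\<And>x. x \<in> T - S \<Longrightarrow> f x = 0"
  shows "integrable (lebesgue_on T) f"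
proof -
  have "(\<lambda>x. if x \<in> T then f x else 0) = (\<lambda>x. if x \<in> S then f x else 0)"
    using assms(2,5) by (intro ext) auto
  then show ?thesis
    using assms(1) Lebesgue_Measure.integrable_restrict_UNIV[OF assms(3), of f] Lebesgue_Measure.integrable_restrict_UNIV[OF assms(4), of f] by simp
qed

lemma integrable_lebesgue_on_subset:
  fixes f :: "'a::euclidean_space \<Rightarrow> 'b::euclidean_space"
  assumes "integrable (lebesgue_on T) f" "S \<subseteq> T" "S \<in> sets lebesgue" "T \<in> sets lebesgue"
  shows "integrable (lebesgue_on S) f"
proof -
  have S: "S \<in> sets (lebesgue_on T)" using assms by (auto simp: sets_restrict_space)
  have "integrable (lebesgue_on T) (\<lambda>x. indicator S x *\<^sub>R f x)"
    by (rule integrable_mult_indicator[OF S assms(1)])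
  then have "integrable lebesgue (\<lambda>x. if x \<in> T then indicator S x *\<^sub>R f x else 0)"
    by (simp only: Lebesgue_Measure.integrable_restrict_UNIV[OF assms(4)])
  also have "(\<lambda>x. if x \<in> T then indicator S x *\<^sub>R f x else 0) = (\<lambda>x. if x \<in> S then f x else 0)"
    using assms(2) by (intro ext) (auto simp: indicator_def)
  finally show ?thesis by (simp only: Lebesgue_Measure.integrable_restrict_UNIV[OF assms(3)])
qed

text \<open>On each piece f is integrable and every test function of the piece is one of U, so the
  sign lemma applies to both f and -f.\<close>

lemma AE_zero_if_test_integrals_zero:
  fixes f :: "'a::euclidean_space \<Rightarrow> real"
  assumes U: "open U" and f: "locally_integrable U f"
    and zero: "\<And>\<phi>. \<phi> \<in> test_functions U \<Longrightarrow> (LINT x|lebesgue_on U. \<phi> x * f x) = 0"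
  shows "AE x in lebesgue_on U. f x = 0"
proof -
  obtain D where D: "countable D" "\<Union>D = U" "\<And>X. X \<in> D \<Longrightarrow> open X"
    "\<And>X. X \<in> D \<Longrightarrow> compact (closure X) \<and> closure X \<subseteq> U"
    by (rule open_countable_Union_boxes_compactly_inside[OF U]) blast
  show ?thesis
  proof (rule AE_lebesgue_on_countable_cover[OF D(1) _ D(2)])
    fix X assume X: "X \<in> D"
    then show "X \<in> sets lebesgue" using D(3) by auto
    have XU: "X \<subseteq> U" using X D(2) by auto
    have int: "integrable (lebesgue_on X) f"
      using f D(4)[OF X] D(3)[OF X] closure_subset[of X] unfolding locally_integrable_def
      by (intro integrable_lebesgue_on_subset[of "closure X" f X]) auto
    have z: "(LINT x|lebesgue_on X. \<phi> x * f x) = 0" if \<phi>: "\<phi> \<in> test_functions X" for \<phi>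
    proof -
      have "\<phi> x = 0" if "x \<notin> X" for x using test_functions_outside[OF \<phi> that] .
      then have "(LINT x|lebesgue_on U. \<phi> x * f x) = (LINT x|lebesgue_on X. \<phi> x * f x)"
        using XU D(3)[OF X] U by (intro LINT_lebesgue_on_superset) auto
      then show ?thesis using zero[OF test_functions_mono[OF XU \<phi>]] by simp
    qed
    have "AE x in lebesgue_on X. 0 \<le> f x"
      by (rule AE_nonneg_if_test_integrals_nonneg) (use D(3)[OF X] int z in auto)
    moreover have "AE x in lebesgue_on X. 0 \<le> - f x"
      by (rule AE_nonneg_if_test_integrals_nonneg) (use D(3)[OF X] int z in auto)
    ultimately show "AE x in lebesgue_on X. f x = 0"
      by eventually_elim auto
  qed
qed

section \<open>Weak derivatives\<close>

text \<open>Lebesgue measure is complete. This is what makes arbitrary representatives harmless: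
  measurability is inherited from any function that is equal almost everywhere.\<close>

lemma lebesgue_on_AE_measurable:
  fixes f :: "'a::euclidean_space \<Rightarrow> 'b::euclidean_space"
  assumes "f \<in> borel_measurable (lebesgue_on S)" "AE x in lebesgue_on S. f x = g x" "S \<in> sets lebesgue"
  shows "g \<in> borel_measurable (lebesgue_on S)"
proof -
  have 1: "(\<lambda>x. if x \<in> S then f x else 0) \<in> borel_measurable lebesgue"
    using assms by (simp add: borel_measurable_if)
  have 2: "AE x in lebesgue. (if x \<in> S then f x else 0) = (if x \<in> S then g x else 0)"
    using assms(2,3) by (auto simp: AE_restrict_space_iff)
  show ?thesis
    using borel_measurable_AE[OF 1 2] by (rule borel_measurable_if_D)
qed

lemma integrable_test_times_locally_integrable:
  fixes g :: "'a::euclidean_space \<Rightarrow> 'b::euclidean_space"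
  assumes "open \<Omega>" "locally_integrable \<Omega> g" and \<phi>: "\<phi> \<in> test_functions \<Omega>"
  shows "integrable (lebesgue_on \<Omega>) (\<lambda>x. \<phi> x *\<^sub>R g x)"
proof -
  obtain K where K: "compact K" "K \<subseteq> \<Omega>" "\<And>x. x \<notin> K \<Longrightarrow> \<phi> x = 0"
    by (rule test_functionsE[OF \<phi>]) blast
  obtain B where B: "B > 0" "\<And>x. norm (\<phi> x) \<le> B" by (rule test_functions_bounded[OF \<phi>]) blast
  have "integrable (lebesgue_on K) (\<lambda>x. \<phi> x *\<^sub>R g x)"
    by (rule integrable_bounded_mult[where B=B])
      (use assms K B lebesgue_on_borel_measurable[OF test_functions_measurable[OF \<phi>]] in \<open>auto simp: locally_integrable_def\<close>)
  then show ?thesis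
    by (rule integrable_lebesgue_on_superset) (use K assms(1) in \<open>auto simp: compact_imp_closed\<close>)
qed

lemma has_weak_partials_locally_integrable:
  "has_weak_partials \<Omega> bs f g \<Longrightarrow> locally_integrable \<Omega> f \<and> locally_integrable \<Omega> g"
  unfolding has_weak_partials_def locally_integrable_def by blast

lemma has_weak_partialsD:
  "has_weak_partials \<Omega> bs f g \<Longrightarrow> \<phi> \<in> test_functions \<Omega> \<Longrightarrow>
     (LINT x|lebesgue_on \<Omega>. partials bs \<phi> x *\<^sub>R f x) = (- 1) ^ length bs *\<^sub>R (LINT x|lebesgue_on \<Omega>. \<phi> x *\<^sub>R g x)"
  unfolding has_weak_partials_def by blast

lemma has_weak_partialsI:
  assumes "locally_integrable \<Omega> f" "locally_integrable \<Omega> g"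
    "\<And>\<phi>. \<phi> \<in> test_functions \<Omega> \<Longrightarrow>
     (LINT x|lebesgue_on \<Omega>. partials bs \<phi> x *\<^sub>R f x) = (- 1) ^ length bs *\<^sub>R (LINT x|lebesgue_on \<Omega>. \<phi> x *\<^sub>R g x)"
  shows "has_weak_partials \<Omega> bs f g"
  using assms unfolding has_weak_partials_def locally_integrable_def by blast

lemma has_weak_partials_unique:
  fixes f g h :: "'a::euclidean_space \<Rightarrow> 'b::euclidean_space"
  assumes \<Omega>: "open \<Omega>" and g: "has_weak_partials \<Omega> bs f g" and h: "has_weak_partials \<Omega> bs f h"
  shows "AE x in lebesgue_on \<Omega>. g x = h x"
proof -
  note lg = has_weak_partials_locally_integrable[OF g, THEN conjunct2]
  note lh = has_weak_partials_locally_integrable[OF h, THEN conjunct2]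
  have "AE x in lebesgue_on \<Omega>. (g x - h x) \<bullet> e = 0" for e
  proof (rule AE_zero_if_test_integrals_zero[OF \<Omega>])
    show "locally_integrable \<Omega> (\<lambda>x. (g x - h x) \<bullet> e)"
      using lg lh unfolding locally_integrable_def by (auto intro!: integrable_inner_left)
    fix \<phi> :: "'a \<Rightarrow> real" assume \<phi>: "\<phi> \<in> test_functions \<Omega>"
    note ig = integrable_test_times_locally_integrable[OF \<Omega> lg \<phi>]
    note ih = integrable_test_times_locally_integrable[OF \<Omega> lh \<phi>]
    have eq: "(LINT x|lebesgue_on \<Omega>. \<phi> x *\<^sub>R g x) = (LINT x|lebesgue_on \<Omega>. \<phi> x *\<^sub>R h x)"
      using has_weak_partialsD[OF g \<phi>] has_weak_partialsD[OF h \<phi>] by simp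
    have "(LINT x|lebesgue_on \<Omega>. \<phi> x * ((g x - h x) \<bullet> e)) = (LINT x|lebesgue_on \<Omega>. (\<phi> x *\<^sub>R g x - \<phi> x *\<^sub>R h x) \<bullet> e)"
      by (simp add: inner_diff_left algebra_simps)
    also have "\<dots> = (LINT x|lebesgue_on \<Omega>. (\<phi> x *\<^sub>R g x - \<phi> x *\<^sub>R h x)) \<bullet> e"
      by (rule integral_inner_left) (use ig ih in auto)
    also have "\<dots> = 0" using ig ih eq by simp
    finally show "(LINT x|lebesgue_on \<Omega>. \<phi> x * ((g x - h x) \<bullet> e)) = 0" .
  qed
  then have "AE x in lebesgue_on \<Omega>. \<forall>e\<in>Basis. (g x - h x) \<bullet> e = 0"
    by (intro AE_finite_allI) auto
  then show ?thesis
    by eventually_elim (metis euclidean_eqI inner_diff_left eq_iff_diff_eq_0)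
qed

lemma weak_partials_works: "has_weak_partials \<Omega> bs f g \<Longrightarrow> has_weak_partials \<Omega> bs f (weak_partials \<Omega> bs f)"
  unfolding weak_partials_def by (rule someI[where P="has_weak_partials \<Omega> bs f"])

lemma weak_partials_AE_eq:
  "open \<Omega> \<Longrightarrow> has_weak_partials \<Omega> bs f g \<Longrightarrow> AE x in lebesgue_on \<Omega>. weak_partials \<Omega> bs f x = g x"
  using has_weak_partials_unique weak_partials_works by blast

lemma locally_integrable_add:
  "locally_integrable \<Omega> f \<Longrightarrow> locally_integrable \<Omega> g \<Longrightarrow> locally_integrable \<Omega> (\<lambda>x. f x + g x)"
  unfolding locally_integrable_def by auto

lemma locally_integrable_scaleR:
  "locally_integrable \<Omega> f \<Longrightarrow> locally_integrable \<Omega> (\<lambda>x. c *\<^sub>R f x)"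
  unfolding locally_integrable_def by auto

lemma partials_test_functions:
  "\<phi> \<in> test_functions S \<Longrightarrow> set bs \<subseteq> Basis \<Longrightarrow> partials bs \<phi> \<in> test_functions S"
  by (induction bs) (auto simp: partials_Cons intro: test_functions_partial)

lemma has_weak_partials_add:
  assumes "open \<Omega>" "set bs \<subseteq> Basis" "has_weak_partials \<Omega> bs f f'" "has_weak_partials \<Omega> bs g g'"
  shows "has_weak_partials \<Omega> bs (\<lambda>x. f x + g x) (\<lambda>x. f' x + g' x)"
proof -
  note l = assms(3,4)[THEN has_weak_partials_locally_integrable]
  note int = integrable_test_times_locally_integrable[OF assms(1)]
  show ?thesis
  proof (rule has_weak_partialsI)
    fix \<phi> :: "'a \<Rightarrow> real" assume \<phi>: "\<phi> \<in> test_functions \<Omega>"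
    note p = partials_test_functions[OF \<phi> assms(2)]
    show "(LINT x|lebesgue_on \<Omega>. partials bs \<phi> x *\<^sub>R (f x + g x)) = (- 1) ^ length bs *\<^sub>R (LINT x|lebesgue_on \<Omega>. \<phi> x *\<^sub>R (f' x + g' x))"
      using l(1)[THEN conjunct1, THEN int, OF p] l(2)[THEN conjunct1, THEN int, OF p]
        l(1)[THEN conjunct2, THEN int, OF \<phi>] l(2)[THEN conjunct2, THEN int, OF \<phi>]
        assms(3,4)[THEN has_weak_partialsD[OF _ \<phi>]]
      by (simp add: scaleR_add_right)
  qed (use l in \<open>auto intro: locally_integrable_add\<close>)
qed

lemma has_weak_partials_scaleR:
  assumes "has_weak_partials \<Omega> bs f f'"
  shows "has_weak_partials \<Omega> bs (\<lambda>x. c *\<^sub>R f x) (\<lambda>x. c *\<^sub>R f' x)"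
proof -
  note l = assms[THEN has_weak_partials_locally_integrable]
  show ?thesis
  proof (rule has_weak_partialsI)
    fix \<phi> :: "'a \<Rightarrow> real" assume \<phi>: "\<phi> \<in> test_functions \<Omega>"
    have "(LINT x|lebesgue_on \<Omega>. partials bs \<phi> x *\<^sub>R c *\<^sub>R f x) = c *\<^sub>R (LINT x|lebesgue_on \<Omega>. partials bs \<phi> x *\<^sub>R f x)"
      by (subst integral_scaleR_right[symmetric]) (simp add: mult.commute)
    moreover have "(LINT x|lebesgue_on \<Omega>. \<phi> x *\<^sub>R c *\<^sub>R f' x) = c *\<^sub>R (LINT x|lebesgue_on \<Omega>. \<phi> x *\<^sub>R f' x)"
      by (subst integral_scaleR_right[symmetric]) (simp add: mult.commute)
    ultimately show "(LINT x|lebesgue_on \<Omega>. partials bs \<phi> x *\<^sub>R c *\<^sub>R f x) = (- 1) ^ length bs *\<^sub>R (LINT x|lebesgue_on \<Omega>. \<phi> x *\<^sub>R c *\<^sub>R f' x)"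
      using has_weak_partialsD[OF assms \<phi>] by simp
  qed (use l in \<open>auto intro: locally_integrable_scaleR\<close>)
qed

lemma has_weak_partials_Nil: "locally_integrable \<Omega> f \<Longrightarrow> has_weak_partials \<Omega> [] f f"
  by (rule has_weak_partialsI) auto

text \<open>Translation invariance makes the integrals of the difference quotients vanish.\<close>

lemma integral_partial_compact_support:
  fixes F :: "'a::euclidean_space \<Rightarrow> 'b::euclidean_space"
  assumes b: "b \<in> Basis" and d: "\<And>x. F differentiable at x" and c: "continuous_on UNIV (partial b F)"
    and K: "compact K" "\<And>x. x \<notin> K \<Longrightarrow> F x = 0"
  shows "(LINT x|lborel. partial b F x) = 0"
proof -
  have nb: "norm b = 1" using b by simp
  have Fc: "continuous_on S F" for S
    using d by (simp add: continuous_at_imp_continuous_on differentiable_imp_continuous_within)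
  have pz: "partial b F x = 0" if "x \<notin> K" for x
    using partial_cong_open[of "- K" x F "\<lambda>x. 0" b] K that
    by (auto simp: open_Compl[OF compact_imp_closed])
  obtain B where B: "B \<ge> 0" "\<And>x. norm (partial b F x) \<le> B"
  proof -
    have "bounded (partial b F ` K)"
      using K c by (intro compact_imp_bounded compact_continuous_image) (auto intro: continuous_on_subset)
    then obtain B where B: "\<And>x. x \<in> K \<Longrightarrow> norm (partial b F x) \<le> B" unfolding bounded_iff by auto
    have "norm (partial b F x) \<le> \<bar>B\<bar>" for x
      using pz[of x] B[of x] by (cases "x \<in> K") auto
    then show thesis by (intro that[of "\<bar>B\<bar>"]) auto
  qed
  obtain R where R: "\<And>x. x \<in> K \<Longrightarrow> norm x \<le> R"
    using compact_imp_bounded[OF K(1)] unfolding bounded_iff by auto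
  have vd: "((\<lambda>t. F (x + t *\<^sub>R b)) has_derivative (\<lambda>s. s *\<^sub>R partial b F (x + t *\<^sub>R b))) (at t)" for x t
  proof -
    have 1: "((\<lambda>t. x + t *\<^sub>R b) has_derivative (\<lambda>s. s *\<^sub>R b)) (at t)"
      by (auto intro!: derivative_eq_intros)
    have "((\<lambda>t. F (x + t *\<^sub>R b)) has_derivative (\<lambda>s. frechet_derivative F (at (x + t *\<^sub>R b)) (s *\<^sub>R b))) (at t)"
      using diff_chain_at[OF 1 has_derivative_frechet[OF d]] by (simp add: o_def)
    then show ?thesis
      by (simp add: linear_cmul[OF linear_frechet_derivative[OF d]] partial_def)
  qed
  have lip: "norm (F (x + h *\<^sub>R b) - F x) \<le> B * \<bar>h\<bar>" for x h
  proof -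
    have on: "onorm (\<lambda>s::real. s *\<^sub>R partial b F (x + t *\<^sub>R b)) \<le> B" for t
      by (rule onorm_le) (use B(2) in \<open>simp add: mult.commute[of B] mult_left_mono\<close>)
    have "norm (F (x + h *\<^sub>R b) - F (x + 0 *\<^sub>R b)) \<le> B * norm (h - 0)"
      by (rule differentiable_bound[of UNIV "\<lambda>t. F (x + t *\<^sub>R b)" "\<lambda>t s. s *\<^sub>R partial b F (x + t *\<^sub>R b)"])
        (use vd on in auto)
    then show ?thesis by simp
  qed
  define h where "h n = 1 / real (Suc n)" for n
  have h: "h n > 0" "h n \<le> 1" for n unfolding h_def by (auto simp: field_simps)
  have h0: "h \<longlonglongrightarrow> 0" unfolding h_def by (rule LIMSEQ_inverse_real_of_nat[unfolded inverse_eq_divide])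
  define D where "D n x = (1 / h n) *\<^sub>R (F (h n *\<^sub>R b + x) - F x)" for n x
  have Fi: "integrable lborel F"
  proof -
    have "integrable lborel (\<lambda>x. indicator K x *\<^sub>R F x)"
      by (rule borel_integrable_compact[OF K(1) Fc])
    also have "(\<lambda>x. indicator K x *\<^sub>R F x) = F" using K(2) by (auto simp: indicator_def)
    finally show ?thesis .
  qed
  have Fm: "F \<in> borel_measurable borel" using Fi by auto
  have tr: "integrable lborel (\<lambda>x. F (v + x))" "(LINT x|lborel. F (v + x)) = (LINT x|lborel. F x)" for v
  proof -
    have "integrable (distr lborel borel ((+) v)) F" using Fi by (simp add: lborel_distr_plus)
    then show "integrable lborel (\<lambda>x. F (v + x))" by (subst (asm) integrable_distr_eq) (use Fm in auto)
    have "(LINT x|distr lborel borel ((+) v). F x) = (LINT x|lborel. F (v + x))"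
      by (rule integral_distr) (use Fm in auto)
    then show "(LINT x|lborel. F (v + x)) = (LINT x|lborel. F x)" by (simp add: lborel_distr_plus)
  qed
  have D0: "(LINT x|lborel. D n x) = 0" for n
    unfolding D_def using tr Fi by simp
  have "(\<lambda>n. LINT x|lborel. D n x) \<longlonglongrightarrow> (LINT x|lborel. partial b F x)"
  \<comment> \<open>All increments \<open>h n\<close> are at most 1, so the quotients vanish outside
    the ball of radius R + 1; inside it the mean value bound B dominates them.\<close>
  proof (rule integral_dominated_convergence[where w="\<lambda>x. B * indicator (cball 0 (R + 1)) x"])
    show "partial b F \<in> borel_measurable lborel" using c by (simp add: borel_measurable_continuous_onI)
    show "D n \<in> borel_measurable lborel" for n
      unfolding D_def[abs_def] using tr(1) Fi by (intro borel_measurable_integrable) auto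
    show "integrable lborel (\<lambda>x. B * indicator (cball (0::'a) (R + 1)) x)"
      by (intro integrable_mult_right integrable_real_indicator) (use emeasure_bounded_finite[OF bounded_cball, of "0::'a" "R + 1"] in auto)
    show "AE x in lborel. norm (D n x) \<le> B * indicator (cball 0 (R + 1)) x" for n
    proof (rule AE_I2)
      fix x :: 'a
      show "norm (D n x) \<le> B * indicator (cball 0 (R + 1)) x"
      proof (cases "x \<in> cball 0 (R + 1)")
        case True
        have "norm (D n x) = norm (F (x + h n *\<^sub>R b) - F x) / h n"
          unfolding D_def using h[of n] by (simp add: add.commute)
        also have "\<dots> \<le> B * \<bar>h n\<bar> / h n" using lip[of x "h n"] h[of n] by (intro divide_right_mono) auto
        also have "\<dots> = B" using h[of n] by simp
        finally show ?thesis using True by simp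
      next
        case False
        then have nx: "norm x > R + 1" by simp
        have "norm x \<le> norm (h n *\<^sub>R b + x) + norm (h n *\<^sub>R b)"
          by (metis add_diff_cancel_left' norm_triangle_ineq4 add.commute)
        then have "norm (h n *\<^sub>R b + x) > R" using nx nb h[of n] by simp
        then have "h n *\<^sub>R b + x \<notin> K" "x \<notin> K"
          using R[of "h n *\<^sub>R b + x"] R[of x] nx by (auto simp: not_le[symmetric])
        then have "F (h n *\<^sub>R b + x) = 0" "F x = 0" using K(2) by auto
        then show ?thesis using False by (simp add: D_def)
      qed
    qed
    show "AE x in lborel. (\<lambda>n. D n x) \<longlonglongrightarrow> partial b F x"
    proof (rule AE_I2)
      fix x
      have t: "((\<lambda>y. norm (F y - F x - frechet_derivative F (at x) (y - x)) / norm (y - x)) \<longlongrightarrow> 0) (at x)"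
        using has_derivative_frechet[OF d, of x] by (simp add: has_derivative_iff_norm)
      have "filterlim (\<lambda>n. h n *\<^sub>R b + x) (at x) sequentially"
        unfolding filterlim_at
      proof
        show "\<forall>\<^sub>F n in sequentially. h n *\<^sub>R b + x \<in> UNIV \<and> h n *\<^sub>R b + x \<noteq> x"
          using h nb by (auto intro!: always_eventually simp: less_imp_neq[symmetric])
        have "(\<lambda>n. h n *\<^sub>R b + x) \<longlonglongrightarrow> 0 *\<^sub>R b + x" by (intro tendsto_intros h0)
        then show "(\<lambda>n. h n *\<^sub>R b + x) \<longlonglongrightarrow> x" by simp
      qed
      from filterlim_compose[OF t this]
      have "(\<lambda>n. norm (F (h n *\<^sub>R b + x) - F x - h n *\<^sub>R partial b F x) / h n) \<longlonglongrightarrow> 0"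
        using h nb by (simp add: linear_cmul[OF linear_frechet_derivative[OF d]] partial_def less_imp_le)
      moreover have "norm (F (h n *\<^sub>R b + x) - F x - h n *\<^sub>R partial b F x) / h n = norm (D n x - partial b F x)" for n
      proof -
        have "D n x - partial b F x = (1 / h n) *\<^sub>R (F (h n *\<^sub>R b + x) - F x - h n *\<^sub>R partial b F x)"
          unfolding D_def using h[of n] by (simp add: scaleR_diff_right)
        then show ?thesis using h[of n] by simp
      qed
      ultimately have "(\<lambda>n. norm (D n x - partial b F x)) \<longlonglongrightarrow> 0" by simp
      then show "(\<lambda>n. D n x) \<longlonglongrightarrow> partial b F x"
        by (simp add: LIM_zero_iff tendsto_norm_zero_iff)
    qed
  qed
  then have "(\<lambda>n::nat. 0) \<longlonglongrightarrow> (LINT x|lborel. partial b F x)" by (simp only: D0)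
  from LIMSEQ_unique[OF this tendsto_const] show ?thesis .
qed

text \<open>Nothing is known of \<open>a\<close> near or beyond the boundary, but \<phi> a, extended
  by zero, is differentiable on the whole space with compact support and a continuous partial
  derivative. The integral of the latter vanishes, and the product rule splits it into the two sides
  of the definition.\<close>

lemma classical_partial_is_weak:
  fixes a :: "'a::euclidean_space \<Rightarrow> 'b::euclidean_space"
  assumes \<Omega>: "open \<Omega>" and b: "b \<in> Basis" and d: "\<And>x. x \<in> \<Omega> \<Longrightarrow> a differentiable at x"
    and c: "continuous_on \<Omega> (partial b a)"
  shows "has_weak_partials \<Omega> [b] a (partial b a)"
proof -
  have ac: "continuous_on \<Omega> a"
    using d by (simp add: continuous_at_imp_continuous_on differentiable_imp_continuous_within)
  have li: "locally_integrable \<Omega> f" if "continuous_on \<Omega> f" for f :: "'a \<Rightarrow> 'b"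
    unfolding locally_integrable_def
  proof safe
    fix K assume K: "compact K" "K \<subseteq> \<Omega>"
    have "integrable lborel (\<lambda>x. indicator K x *\<^sub>R f x)"
      using K that by (intro borel_integrable_compact continuous_on_subset[OF that])
    then have "integrable lebesgue (\<lambda>x. indicator K x *\<^sub>R f x)"
      using integrable_completion borel_measurable_integrable by blast
    then show "integrable (lebesgue_on K) f"
      using K by (subst integrable_restrict_space) (auto simp: compact_imp_closed)
  qed
  show ?thesis
  proof (rule has_weak_partialsI)
    show "locally_integrable \<Omega> a" "locally_integrable \<Omega> (partial b a)" using li ac c by auto
    fix \<phi> :: "'a \<Rightarrow> real" assume \<phi>: "\<phi> \<in> test_functions \<Omega>"
    obtain K where K: "compact K" "K \<subseteq> \<Omega>" "\<And>x. x \<notin> K \<Longrightarrow> \<phi> x = 0"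
      by (rule test_functionsE[OF \<phi>]) blast
    define F where "F x = (if x \<in> \<Omega> then \<phi> x *\<^sub>R a x else 0)" for x
    have oK: "open (- K)" using K by (simp add: open_Compl compact_imp_closed)
    have F0: "F x = 0" if "x \<notin> K" for x using that K by (simp add: F_def)
    have dpa: "(\<lambda>x. \<phi> x *\<^sub>R a x) differentiable at x" if "x \<in> \<Omega>" for x
      using d[OF that] test_functions_differentiable[OF \<phi>] by (intro differentiable_scaleR) auto
    have Fd: "F differentiable at x" for x
    proof (cases "x \<in> \<Omega>")
      case True
      obtain D where "((\<lambda>x. \<phi> x *\<^sub>R a x) has_derivative D) (at x)"
        using dpa[OF True] unfolding differentiable_def by blast
      then have "(F has_derivative D) (at x)"
        by (rule has_derivative_transform_within_open[OF _ \<Omega> True]) (simp add: F_def)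
      then show ?thesis unfolding differentiable_def by blast
    next
      case False
      have "((\<lambda>x. 0) has_derivative (\<lambda>x. 0)) (at x)" by simp
      then have "(F has_derivative (\<lambda>x. 0)) (at x)"
        by (rule has_derivative_transform_within_open[OF _ oK]) (use False K F0 in auto)
      then show ?thesis unfolding differentiable_def by blast
    qed
    have pF: "partial b F x = \<phi> x *\<^sub>R partial b a x + partial b \<phi> x *\<^sub>R a x" if "x \<in> \<Omega>" for x
    proof -
      have "partial b F x = partial b (\<lambda>x. \<phi> x *\<^sub>R a x) x"
        by (rule partial_cong_open[OF \<Omega> that]) (simp add: F_def)
      then show ?thesis
        using partial_bilinear[OF bounded_bilinear_scaleR test_functions_differentiable[OF \<phi>] d[OF that]] by simp
    qed
    have pF0: "partial b F x = 0" if "x \<notin> K" for x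
      using partial_cong_open[of "- K" x F "\<lambda>x. 0" b] F0 that oK by auto
    have pb: "partial b \<phi> \<in> test_functions \<Omega>" by (rule test_functions_partial[OF \<phi> b])
    have "continuous_on \<Omega> (partial b F)"
      using ac c test_functions_continuous[OF \<phi>, of \<Omega>] test_functions_continuous[OF pb, of \<Omega>]
      by (subst continuous_on_cong[OF refl pF]) (auto intro!: continuous_intros)
    moreover have "continuous_on (- K) (partial b F)"
      by (subst continuous_on_cong[OF refl pF0]) auto
    \<comment> \<open>Two open sets cover the space: in \<Omega> the product rule gives continuity,
      off the support the derivative is zero.\<close>
    ultimately have "continuous_on (\<Omega> \<union> - K) (partial b F)"
      using \<Omega> oK by (intro continuous_on_open_Un)
    moreover have "\<Omega> \<union> - K = UNIV" using K by auto
    ultimately have pc: "continuous_on UNIV (partial b F)" by simp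
    have pm: "partial b F \<in> borel_measurable borel" using pc by (rule borel_measurable_continuous_onI)
    have "0 = (LINT x|lborel. partial b F x)"
      using integral_partial_compact_support[OF b Fd pc K(1) F0] by simp
    also have "\<dots> = (LINT x|lebesgue. partial b F x)"
      using pm by (simp add: integral_completion)
    also have "\<dots> = (LINT x|lebesgue_on UNIV. partial b F x)" by (simp add: lebesgue_on_UNIV_eq)
    also have "\<dots> = (LINT x|lebesgue_on \<Omega>. partial b F x)"
      by (rule LINT_lebesgue_on_superset) (use \<Omega> pF0 K in auto)
    also have "\<dots> = (LINT x|lebesgue_on \<Omega>. \<phi> x *\<^sub>R partial b a x + partial b \<phi> x *\<^sub>R a x)"
      by (rule Bochner_Integration.integral_cong) (use pF in auto)
    also have "\<dots> = (LINT x|lebesgue_on \<Omega>. \<phi> x *\<^sub>R partial b a x) + (LINT x|lebesgue_on \<Omega>. partial b \<phi> x *\<^sub>R a x)"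
      using integrable_test_times_locally_integrable[OF \<Omega> li[OF c] \<phi>] integrable_test_times_locally_integrable[OF \<Omega> li[OF ac] pb]
      by simp
    finally show "(LINT x|lebesgue_on \<Omega>. partials [b] \<phi> x *\<^sub>R a x) = (- 1) ^ length [b] *\<^sub>R (LINT x|lebesgue_on \<Omega>. \<phi> x *\<^sub>R partial b a x)"
      by (simp add: partials_Cons add_eq_0_iff)
  qed
qed

section \<open>The spaces \<open>L\<^sup>2\<close> and \<open>H\<^sup>1\<close>\<close>

lemma ennsqrt_square [simp]: "(ennsqrt x)\<^sup>2 = x"
proof (cases x)
  case (real r)
  then show ?thesis by (simp add: ennsqrt_def ennreal_power)
next
  case top
  then show ?thesis by (simp add: ennsqrt_def power2_eq_square)
qed

lemma ennsqrt_ennreal: "0 \<le> r \<Longrightarrow> ennsqrt (ennreal r) = ennreal (sqrt r)"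
  by (simp add: ennsqrt_def)

lemma ennsqrt_less_top: "ennsqrt x < \<infinity> \<longleftrightarrow> x < \<infinity>"
  by (simp add: ennsqrt_def less_top)

lemma L2_norm_square: "(L2_norm \<Omega> f)\<^sup>2 = (\<integral>\<^sup>+x. ennreal ((norm (f x))\<^sup>2) \<partial>lebesgue_on \<Omega>)"
  unfolding L2_norm_def by (simp add: ennreal_power)

lemma L2_norm_finite: "L2_norm \<Omega> f < \<infinity> \<longleftrightarrow> (\<integral>\<^sup>+x. ennreal ((norm (f x))\<^sup>2) \<partial>lebesgue_on \<Omega>) < \<infinity>"
  unfolding L2_norm_def ennsqrt_less_top by (simp add: ennreal_power)

lemma L2_iff:
  "f \<in> L2 \<Omega> \<longleftrightarrow> f \<in> borel_measurable (lebesgue_on \<Omega>) \<and> integrable (lebesgue_on \<Omega>) (\<lambda>x. (norm (f x))\<^sup>2)"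
  unfolding L2_def mem_Collect_eq L2_norm_finite by (auto simp: integrable_iff_bounded)

lemma L2_measurable: "f \<in> L2 \<Omega> \<Longrightarrow> f \<in> borel_measurable (lebesgue_on \<Omega>)"
  by (simp add: L2_iff)

lemma L2_integrable: "f \<in> L2 \<Omega> \<Longrightarrow> integrable (lebesgue_on \<Omega>) (\<lambda>x. (norm (f x))\<^sup>2)"
  by (simp add: L2_iff)

lemma L2_norm_square_eq: "f \<in> L2 \<Omega> \<Longrightarrow> (L2_norm \<Omega> f)\<^sup>2 = ennreal (LINT x|lebesgue_on \<Omega>. (norm (f x))\<^sup>2)"
  unfolding L2_norm_square by (rule nn_integral_eq_integral) (auto simp: L2_integrable)

lemma two_inner_le: "2 * \<bar>a \<bullet> b\<bar> \<le> (norm a)\<^sup>2 + (norm b)\<^sup>2"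
proof -
  have "\<bar>a \<bullet> b\<bar> \<le> norm a * norm b" by (rule Cauchy_Schwarz_ineq2)
  moreover have "2 * (norm a * norm b) \<le> (norm a)\<^sup>2 + (norm b)\<^sup>2"
    using sum_squares_bound[of "norm a" "norm b"] by simp
  ultimately show ?thesis by linarith
qed

lemma L2_mult_integrable:
  assumes "f \<in> L2 \<Omega>" "g \<in> L2 \<Omega>"
  shows "integrable (lebesgue_on \<Omega>) (\<lambda>x. norm (f x) * norm (g x))"
proof (rule Bochner_Integration.integrable_bound)
  show "integrable (lebesgue_on \<Omega>) (\<lambda>x. (norm (f x))\<^sup>2 + (norm (g x))\<^sup>2)"
    using assms by (auto simp: L2_iff)
  show "AE x in lebesgue_on \<Omega>. norm (norm (f x) * norm (g x)) \<le> norm ((norm (f x))\<^sup>2 + (norm (g x))\<^sup>2)"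
  proof (rule AE_I2)
    fix x
    have "2 * (norm (f x) * norm (g x)) \<le> (norm (f x))\<^sup>2 + (norm (g x))\<^sup>2"
      using sum_squares_bound[of "norm (f x)" "norm (g x)"] by simp
    moreover have "0 \<le> norm (f x) * norm (g x)" by simp
    ultimately show "norm (norm (f x) * norm (g x)) \<le> norm ((norm (f x))\<^sup>2 + (norm (g x))\<^sup>2)"
      unfolding real_norm_def by linarith
  qed
qed (use assms in \<open>auto simp: L2_iff\<close>)

lemma L2_inner_integrable:
  assumes "f \<in> L2 \<Omega>" "g \<in> L2 \<Omega>"
  shows "integrable (lebesgue_on \<Omega>) (\<lambda>x. f x \<bullet> g x)"
  by (rule Bochner_Integration.integrable_bound[OF L2_mult_integrable[OF assms]])
    (use assms in \<open>auto simp: L2_iff Cauchy_Schwarz_ineq2\<close>)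

lemma norm_add_square_le:
  fixes a b :: "'a::real_inner"
  shows "(norm (a + b))\<^sup>2 \<le> 2 * (norm a)\<^sup>2 + 2 * (norm b)\<^sup>2"
proof -
  have "(norm (a + b))\<^sup>2 = (norm a)\<^sup>2 + (norm b)\<^sup>2 + 2 * (a \<bullet> b)"
    by (simp add: power2_norm_eq_inner inner_add_left inner_add_right inner_commute)
  then show ?thesis using two_inner_le[of a b] by linarith
qed

lemma L2_add:
  assumes "f \<in> L2 \<Omega>" "g \<in> L2 \<Omega>"
  shows "(\<lambda>x. f x + g x) \<in> L2 \<Omega>"
  unfolding L2_iff
proof
  show "integrable (lebesgue_on \<Omega>) (\<lambda>x. (norm (f x + g x))\<^sup>2)"
  proof (rule Bochner_Integration.integrable_bound)
    show "integrable (lebesgue_on \<Omega>) (\<lambda>x. 2 * (norm (f x))\<^sup>2 + 2 * (norm (g x))\<^sup>2)"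
      using assms by (auto simp: L2_iff)
    show "AE x in lebesgue_on \<Omega>. norm ((norm (f x + g x))\<^sup>2) \<le> norm (2 * (norm (f x))\<^sup>2 + 2 * (norm (g x))\<^sup>2)"
      using norm_add_square_le by (auto intro!: AE_I2)
  qed (use assms in \<open>auto simp: L2_iff\<close>)
qed (use assms in \<open>auto simp: L2_iff\<close>)

lemma L2_scaleR: "f \<in> L2 \<Omega> \<Longrightarrow> (\<lambda>x. c *\<^sub>R f x) \<in> L2 \<Omega>"
  unfolding L2_iff by (auto simp: power_mult_distrib)

lemma L2_diff:
  assumes "f \<in> L2 \<Omega>" "g \<in> L2 \<Omega>" shows "(\<lambda>x. f x - g x) \<in> L2 \<Omega>"
  using L2_add[OF assms(1) L2_scaleR[OF assms(2), of "-1"]] by simp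

lemma L2_AE_cong:
  assumes "f \<in> L2 \<Omega>" "AE x in lebesgue_on \<Omega>. f x = g x" "\<Omega> \<in> sets lebesgue"
  shows "g \<in> L2 \<Omega>"
proof -
  have g: "g \<in> borel_measurable (lebesgue_on \<Omega>)"
    using lebesgue_on_AE_measurable[OF _ assms(2,3)] assms(1) by (simp add: L2_iff)
  have "AE x in lebesgue_on \<Omega>. (norm (f x))\<^sup>2 = (norm (g x))\<^sup>2"
    using assms(2) by eventually_elim simp
  then have "integrable (lebesgue_on \<Omega>) (\<lambda>x. (norm (g x))\<^sup>2)"
    using assms(1) g by (subst integrable_cong_AE[symmetric, of "\<lambda>x. (norm (f x))\<^sup>2"]) (auto simp: L2_iff)
  then show ?thesis using g by (simp add: L2_iff)
qed

lemma L2_bounded: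
  assumes "f \<in> borel_measurable (lebesgue_on \<Omega>)" "AE x in lebesgue_on \<Omega>. norm (f x) \<le> B" "\<Omega> \<in> lmeasurable"
  shows "f \<in> L2 \<Omega>"
proof -
  interpret finite_measure "lebesgue_on \<Omega>" by (rule finite_measure_lebesgue_on[OF assms(3)])
  have "integrable (lebesgue_on \<Omega>) (\<lambda>x. (norm (f x))\<^sup>2)"
  proof (rule integrable_const_bound)
    show "AE x in lebesgue_on \<Omega>. norm ((norm (f x))\<^sup>2) \<le> B\<^sup>2"
      using assms(2) by eventually_elim (auto intro: power_mono)
  qed (use assms(1) in auto)
  then show ?thesis using assms(1) by (simp add: L2_iff)
qed

text \<open>The core of the Cauchy-Schwarz inequality for semidefinite forms, shared by the L^2
  pairing and the Dirichlet form. A form that is only semidefinite may have c = 0 for a nonzero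
  function, so that case is treated separately.\<close>

lemma quadratic_nonneg_discriminant:
  fixes a b c :: real
  assumes "\<And>t. 0 \<le> a + 2 * t * b + t\<^sup>2 * c"
  shows "\<bar>b\<bar> \<le> sqrt a * sqrt c"
proof -
  have a: "0 \<le> a" using assms[of 0] by simp
  have c: "0 \<le> c"
  proof (rule ccontr)
    assume "\<not> 0 \<le> c"
    then have c: "c < 0" by simp
    \<comment> \<open>Chosen so that t \<ge> 1 and t (-c) \<ge> a + 2 |b| + 1; then the quadratic
      term outweighs the other two.\<close>
    define t where "t = (a + 2 * \<bar>b\<bar> + 1) / - c + 1"
    have t1: "t \<ge> 1" unfolding t_def using a c by (simp add: divide_nonneg_neg)
    have "t * (- c) \<ge> a + 2 * \<bar>b\<bar> + 1" unfolding t_def using c by (simp add: field_simps)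
    then have "t * (t * (- c)) \<ge> t * (a + 2 * \<bar>b\<bar> + 1)" using t1 by (intro mult_left_mono) auto
    moreover have "t * a \<ge> 1 * a" using t1 a by (intro mult_right_mono) auto
    moreover have "t * b \<le> t * \<bar>b\<bar>" using t1 by (intro mult_left_mono) auto
    moreover have "t * (t * (- c)) = - (t\<^sup>2 * c)" "t * (a + 2 * \<bar>b\<bar> + 1) = t * a + 2 * (t * \<bar>b\<bar>) + t" "2 * t * b = 2 * (t * b)"
      by (simp_all add: algebra_simps power2_eq_square)
    ultimately have "a + 2 * t * b + t\<^sup>2 * c < 0"
      using t1 by linarith
    then show False using assms[of t] by simp
  qed
  have "b\<^sup>2 \<le> a * c"
  proof (cases "c = 0")
    case True
    have "b = 0"
    proof (rule ccontr)
      assume "b \<noteq> 0"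
      \<comment> \<open>At this argument the remaining affine function equals -1.\<close>
      then show False using assms[of "- (a + 1) / (2 * b)"] True by (simp add: field_simps)
    qed
    then show ?thesis using True by simp
  next
    case False
    then have "c > 0" using c by simp
    \<comment> \<open>The minimiser of the quadratic.\<close>
    then show ?thesis using assms[of "- b / c"] by (simp add: field_simps power2_eq_square)
  qed
  then have "sqrt (b\<^sup>2) \<le> sqrt (a * c)" by (rule real_sqrt_le_mono)
  then show ?thesis by (simp add: real_sqrt_mult)
qed

lemma L2_Cauchy_Schwarz:
  fixes f g :: "'a::euclidean_space \<Rightarrow> 'b::euclidean_space"
  assumes "f \<in> L2 \<Omega>" "g \<in> L2 \<Omega>"
  shows "\<bar>LINT x|lebesgue_on \<Omega>. f x \<bullet> g x\<bar> \<le>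
    sqrt (LINT x|lebesgue_on \<Omega>. (norm (f x))\<^sup>2) * sqrt (LINT x|lebesgue_on \<Omega>. (norm (g x))\<^sup>2)"
proof (rule quadratic_nonneg_discriminant)
  fix t
  have "0 \<le> (LINT x|lebesgue_on \<Omega>. (norm (f x + t *\<^sub>R g x))\<^sup>2)" by simp
  also have "\<dots> = (LINT x|lebesgue_on \<Omega>. (norm (f x))\<^sup>2 + 2 * t * (f x \<bullet> g x) + t\<^sup>2 * (norm (g x))\<^sup>2)"
    by (rule Bochner_Integration.integral_cong[OF refl])
      (simp add: power2_norm_eq_inner inner_add_left inner_add_right inner_commute power2_eq_square[of t] algebra_simps)
  also have "\<dots> = (LINT x|lebesgue_on \<Omega>. (norm (f x))\<^sup>2) + 2 * t * (LINT x|lebesgue_on \<Omega>. f x \<bullet> g x)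
     + t\<^sup>2 * (LINT x|lebesgue_on \<Omega>. (norm (g x))\<^sup>2)"
    using L2_integrable[OF assms(1)] L2_integrable[OF assms(2)] L2_inner_integrable[OF assms]
    by simp
  finally show "0 \<le> (LINT x|lebesgue_on \<Omega>. (norm (f x))\<^sup>2) + 2 * t * (LINT x|lebesgue_on \<Omega>. f x \<bullet> g x)
     + t\<^sup>2 * (LINT x|lebesgue_on \<Omega>. (norm (g x))\<^sup>2)" .
qed

lemma L2_Cauchy_Schwarz_norm:
  fixes f :: "'a::euclidean_space \<Rightarrow> 'b::euclidean_space" and g :: "'a \<Rightarrow> 'c::euclidean_space"
  assumes "f \<in> L2 \<Omega>" "g \<in> L2 \<Omega>"
  shows "(LINT x|lebesgue_on \<Omega>. norm (f x) * norm (g x)) \<le>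
    sqrt (LINT x|lebesgue_on \<Omega>. (norm (f x))\<^sup>2) * sqrt (LINT x|lebesgue_on \<Omega>. (norm (g x))\<^sup>2)"
proof -
  have "(\<lambda>x. norm (f x)) \<in> L2 \<Omega>" "(\<lambda>x. norm (g x)) \<in> L2 \<Omega>" using assms by (auto simp: L2_iff)
  from L2_Cauchy_Schwarz[OF this] show ?thesis by simp
qed

section \<open>The Dirichlet form and the H^1 norm\<close>

text \<open>The Dirichlet form. \<open>weak_partials\<close> picks representatives by choice, so
  bilinearity rests on equality almost everywhere and is established on the Sobolev space.\<close>

definition gradient_inner ::
  "'a::euclidean_space set \<Rightarrow> ('a \<Rightarrow> 'b::euclidean_space) \<Rightarrow> ('a \<Rightarrow> 'b) \<Rightarrow> real" where
  "gradient_inner \<Omega> f g =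
    (\<Sum>b\<in>Basis. LINT x|lebesgue_on \<Omega>. weak_partials \<Omega> [b] f x \<bullet> weak_partials \<Omega> [b] g x)"

definition H1_square :: "'a::euclidean_space set \<Rightarrow> ('a \<Rightarrow> 'b::euclidean_space) \<Rightarrow> real" where
  "H1_square \<Omega> f = (LINT x|lebesgue_on \<Omega>. (norm (f x))\<^sup>2) + gradient_inner \<Omega> f f"

lemma Sobolev_L2: "f \<in> Sobolev \<Omega> s \<Longrightarrow> f \<in> L2 \<Omega>"
  by (simp add: Sobolev_def)

lemma Sobolev_weak_partials:
  assumes "open \<Omega>" "f \<in> Sobolev \<Omega> s" "set bs \<subseteq> Basis" "length bs \<le> s"
  shows "has_weak_partials \<Omega> bs f (weak_partials \<Omega> bs f)" "weak_partials \<Omega> bs f \<in> L2 \<Omega>"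
proof -
  obtain g where g: "g \<in> L2 \<Omega>" "has_weak_partials \<Omega> bs f g"
    using assms unfolding Sobolev_def by blast
  show "has_weak_partials \<Omega> bs f (weak_partials \<Omega> bs f)" by (rule weak_partials_works[OF g(2)])
  have "AE x in lebesgue_on \<Omega>. g x = weak_partials \<Omega> bs f x"
    using weak_partials_AE_eq[OF assms(1) g(2)] by eventually_elim simp
  then show "weak_partials \<Omega> bs f \<in> L2 \<Omega>"
    by (rule L2_AE_cong[OF g(1)]) (use assms in auto)
qed

lemma Sobolev_weak_partial:
  assumes "open \<Omega>" "f \<in> Sobolev \<Omega> 1" "b \<in> Basis"
  shows "has_weak_partials \<Omega> [b] f (weak_partials \<Omega> [b] f)" "weak_partials \<Omega> [b] f \<in> L2 \<Omega>"
  using Sobolev_weak_partials[OF assms(1,2), of "[b]"] assms(3) by auto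

lemma Sobolev_add:
  assumes \<Omega>: "open \<Omega>" and f: "f \<in> Sobolev \<Omega> s" and g: "g \<in> Sobolev \<Omega> s"
  shows "(\<lambda>x. f x + g x) \<in> Sobolev \<Omega> s"
  unfolding Sobolev_def mem_Collect_eq
proof (intro conjI allI impI)
  show "(\<lambda>x. f x + g x) \<in> L2 \<Omega>" using f g by (intro L2_add Sobolev_L2)
  fix bs :: "'a list" assume bs: "set bs \<subseteq> Basis \<and> length bs \<le> s"
  show "\<exists>h\<in>L2 \<Omega>. has_weak_partials \<Omega> bs (\<lambda>x. f x + g x) h"
    using has_weak_partials_add[OF \<Omega> _ Sobolev_weak_partials(1)[OF \<Omega> f] Sobolev_weak_partials(1)[OF \<Omega> g]]
      L2_add[OF Sobolev_weak_partials(2)[OF \<Omega> f] Sobolev_weak_partials(2)[OF \<Omega> g]] bs by blast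
qed

lemma Sobolev_scaleR:
  assumes \<Omega>: "open \<Omega>" and f: "f \<in> Sobolev \<Omega> s"
  shows "(\<lambda>x. c *\<^sub>R f x) \<in> Sobolev \<Omega> s"
  unfolding Sobolev_def mem_Collect_eq
proof (intro conjI allI impI)
  show "(\<lambda>x. c *\<^sub>R f x) \<in> L2 \<Omega>" using f by (intro L2_scaleR Sobolev_L2)
  fix bs :: "'a list" assume bs: "set bs \<subseteq> Basis \<and> length bs \<le> s"
  show "\<exists>h\<in>L2 \<Omega>. has_weak_partials \<Omega> bs (\<lambda>x. c *\<^sub>R f x) h"
    using has_weak_partials_scaleR[OF Sobolev_weak_partials(1)[OF \<Omega> f]]
      L2_scaleR[OF Sobolev_weak_partials(2)[OF \<Omega> f]] bs by blast
qed

lemma Sobolev_diff: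
  assumes "open \<Omega>" "f \<in> Sobolev \<Omega> s" "g \<in> Sobolev \<Omega> s"
  shows "(\<lambda>x. f x - g x) \<in> Sobolev \<Omega> s"
  using Sobolev_add[OF assms(1,2) Sobolev_scaleR[OF assms(1,3), of "-1"]] by simp

lemma weak_partial_add:
  assumes "open \<Omega>" "f \<in> Sobolev \<Omega> 1" "g \<in> Sobolev \<Omega> 1" "b \<in> Basis"
  shows "AE x in lebesgue_on \<Omega>. weak_partials \<Omega> [b] (\<lambda>x. f x + g x) x = weak_partials \<Omega> [b] f x + weak_partials \<Omega> [b] g x"
  by (rule weak_partials_AE_eq[OF assms(1)], rule has_weak_partials_add) (use assms Sobolev_weak_partial(1) in auto)

lemma weak_partial_scaleR:
  assumes "open \<Omega>" "f \<in> Sobolev \<Omega> 1" "b \<in> Basis"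
  shows "AE x in lebesgue_on \<Omega>. weak_partials \<Omega> [b] (\<lambda>x. c *\<^sub>R f x) x = c *\<^sub>R weak_partials \<Omega> [b] f x"
  by (rule weak_partials_AE_eq[OF assms(1)], rule has_weak_partials_scaleR) (use assms Sobolev_weak_partial(1) in auto)

lemma gradient_inner_commute: "gradient_inner \<Omega> f g = gradient_inner \<Omega> g f"
  unfolding gradient_inner_def by (simp add: inner_commute)

lemma gradient_inner_nonneg: "0 \<le> gradient_inner \<Omega> f f"
  unfolding gradient_inner_def by (intro sum_nonneg) simp

lemma gradient_inner_add_left:
  assumes \<Omega>: "open \<Omega>" and f: "f \<in> Sobolev \<Omega> 1" and g: "g \<in> Sobolev \<Omega> 1" and h: "h \<in> Sobolev \<Omega> 1"
  shows "gradient_inner \<Omega> (\<lambda>x. f x + g x) h = gradient_inner \<Omega> f h + gradient_inner \<Omega> g h"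
proof -
  have "(LINT x|lebesgue_on \<Omega>. weak_partials \<Omega> [b] (\<lambda>x. f x + g x) x \<bullet> weak_partials \<Omega> [b] h x) =
      (LINT x|lebesgue_on \<Omega>. weak_partials \<Omega> [b] f x \<bullet> weak_partials \<Omega> [b] h x) + (LINT x|lebesgue_on \<Omega>. weak_partials \<Omega> [b] g x \<bullet> weak_partials \<Omega> [b] h x)"
    if b: "b \<in> Basis" for b
  proof -
    note wf = Sobolev_weak_partial(2)[OF \<Omega> f b] and wg = Sobolev_weak_partial(2)[OF \<Omega> g b] and wh = Sobolev_weak_partial(2)[OF \<Omega> h b]
      and wfg = Sobolev_weak_partial(2)[OF \<Omega> Sobolev_add[OF \<Omega> f g] b]
    have "(LINT x|lebesgue_on \<Omega>. weak_partials \<Omega> [b] (\<lambda>x. f x + g x) x \<bullet> weak_partials \<Omega> [b] h x) =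
      (LINT x|lebesgue_on \<Omega>. weak_partials \<Omega> [b] f x \<bullet> weak_partials \<Omega> [b] h x + weak_partials \<Omega> [b] g x \<bullet> weak_partials \<Omega> [b] h x)"
    proof (rule integral_cong_AE)
      show "AE x in lebesgue_on \<Omega>. weak_partials \<Omega> [b] (\<lambda>x. f x + g x) x \<bullet> weak_partials \<Omega> [b] h x =
        weak_partials \<Omega> [b] f x \<bullet> weak_partials \<Omega> [b] h x + weak_partials \<Omega> [b] g x \<bullet> weak_partials \<Omega> [b] h x"
        using weak_partial_add[OF \<Omega> f g b] by eventually_elim (simp add: inner_add_left)
    qed (use wf wg wh wfg in \<open>auto simp: L2_iff\<close>)
    then show ?thesis using L2_inner_integrable[OF wf wh] L2_inner_integrable[OF wg wh] by simp
  qed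
  then show ?thesis unfolding gradient_inner_def by (simp add: sum.distrib)
qed

lemma gradient_inner_scaleR_left:
  assumes \<Omega>: "open \<Omega>" and f: "f \<in> Sobolev \<Omega> 1" and h: "h \<in> Sobolev \<Omega> 1"
  shows "gradient_inner \<Omega> (\<lambda>x. c *\<^sub>R f x) h = c * gradient_inner \<Omega> f h"
proof -
  have "(LINT x|lebesgue_on \<Omega>. weak_partials \<Omega> [b] (\<lambda>x. c *\<^sub>R f x) x \<bullet> weak_partials \<Omega> [b] h x) =
      c * (LINT x|lebesgue_on \<Omega>. weak_partials \<Omega> [b] f x \<bullet> weak_partials \<Omega> [b] h x)"
    if b: "b \<in> Basis" for b
  proof -
    note wf = Sobolev_weak_partial(2)[OF \<Omega> f b] and wh = Sobolev_weak_partial(2)[OF \<Omega> h b]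
      and wcf = Sobolev_weak_partial(2)[OF \<Omega> Sobolev_scaleR[OF \<Omega> f, of c] b]
    have "(LINT x|lebesgue_on \<Omega>. weak_partials \<Omega> [b] (\<lambda>x. c *\<^sub>R f x) x \<bullet> weak_partials \<Omega> [b] h x) =
      (LINT x|lebesgue_on \<Omega>. c * (weak_partials \<Omega> [b] f x \<bullet> weak_partials \<Omega> [b] h x))"
    proof (rule integral_cong_AE)
      show "AE x in lebesgue_on \<Omega>. weak_partials \<Omega> [b] (\<lambda>x. c *\<^sub>R f x) x \<bullet> weak_partials \<Omega> [b] h x =
        c * (weak_partials \<Omega> [b] f x \<bullet> weak_partials \<Omega> [b] h x)"
        using weak_partial_scaleR[OF \<Omega> f b, of c] by eventually_elim simp
    qed (use wf wh wcf in \<open>auto simp: L2_iff\<close>)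
    then show ?thesis by simp
  qed
  then show ?thesis unfolding gradient_inner_def by (simp add: sum_distrib_left)
qed

lemma gradient_inner_add_right:
  assumes "open \<Omega>" "f \<in> Sobolev \<Omega> 1" "g \<in> Sobolev \<Omega> 1" "h \<in> Sobolev \<Omega> 1"
  shows "gradient_inner \<Omega> h (\<lambda>x. f x + g x) = gradient_inner \<Omega> h f + gradient_inner \<Omega> h g"
  using gradient_inner_add_left[OF assms] by (simp add: gradient_inner_commute)

lemma gradient_inner_scaleR_right:
  assumes "open \<Omega>" "f \<in> Sobolev \<Omega> 1" "h \<in> Sobolev \<Omega> 1"
  shows "gradient_inner \<Omega> h (\<lambda>x. c *\<^sub>R f x) = c * gradient_inner \<Omega> h f"
  using gradient_inner_scaleR_left[OF assms] by (simp add: gradient_inner_commute)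

lemma gradient_inner_quadratic:
  assumes \<Omega>: "open \<Omega>" and f: "f \<in> Sobolev \<Omega> 1" and g: "g \<in> Sobolev \<Omega> 1"
  shows "gradient_inner \<Omega> (\<lambda>x. f x + t *\<^sub>R g x) (\<lambda>x. f x + t *\<^sub>R g x) =
    gradient_inner \<Omega> f f + 2 * t * gradient_inner \<Omega> f g + t\<^sup>2 * gradient_inner \<Omega> g g"
proof -
  note tg = Sobolev_scaleR[OF \<Omega> g, of t]
  note ftg = Sobolev_add[OF \<Omega> f tg]
  show ?thesis
    by (simp add: gradient_inner_add_left[OF \<Omega> f tg ftg] gradient_inner_add_right[OF \<Omega> f tg f]
       gradient_inner_scaleR_left[OF \<Omega> g ftg] gradient_inner_scaleR_right[OF \<Omega> g f]
       gradient_inner_add_right[OF \<Omega> f tg g] gradient_inner_scaleR_right[OF \<Omega> g g]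
       gradient_inner_commute[of \<Omega> g f] power2_eq_square algebra_simps)
qed

lemma gradient_inner_Cauchy_Schwarz:
  assumes "open \<Omega>" "f \<in> Sobolev \<Omega> 1" "g \<in> Sobolev \<Omega> 1"
  shows "\<bar>gradient_inner \<Omega> f g\<bar> \<le> sqrt (gradient_inner \<Omega> f f) * sqrt (gradient_inner \<Omega> g g)"
proof (rule quadratic_nonneg_discriminant)
  fix t
  show "0 \<le> gradient_inner \<Omega> f f + 2 * t * gradient_inner \<Omega> f g + t\<^sup>2 * gradient_inner \<Omega> g g"
    unfolding gradient_inner_quadratic[OF assms, symmetric] by (rule gradient_inner_nonneg)
qed

lemma two_gradient_inner_le:
  assumes "open \<Omega>" "f \<in> Sobolev \<Omega> 1" "g \<in> Sobolev \<Omega> 1"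
  shows "2 * gradient_inner \<Omega> f g \<le> gradient_inner \<Omega> f f + gradient_inner \<Omega> g g"
  using gradient_inner_nonneg[of \<Omega> "\<lambda>x. f x + (-1) *\<^sub>R g x"] gradient_inner_quadratic[OF assms, of "-1"] by simp

lemma H1_square_nonneg: "0 \<le> H1_square \<Omega> f"
  unfolding H1_square_def by (intro add_nonneg_nonneg gradient_inner_nonneg) simp

lemma gradient_inner_le_H1_square: "gradient_inner \<Omega> f f \<le> H1_square \<Omega> f"
  unfolding H1_square_def by simp

lemma L2_square_le_H1_square: "(LINT x|lebesgue_on \<Omega>. (norm (f x))\<^sup>2) \<le> H1_square \<Omega> f"
  using gradient_inner_nonneg[of \<Omega> f] by (simp add: H1_square_def)

lemma gradient_norm_square:
  assumes "open \<Omega>" "f \<in> Sobolev \<Omega> 1"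
  shows "(gradient_norm \<Omega> f)\<^sup>2 = ennreal (gradient_inner \<Omega> f f)"
proof -
  have "(gradient_norm \<Omega> f)\<^sup>2 = (\<Sum>b\<in>Basis. (L2_norm \<Omega> (weak_partials \<Omega> [b] f))\<^sup>2)"
    using assms by (simp add: gradient_norm_def)
  also have "\<dots> = (\<Sum>b\<in>Basis. ennreal (LINT x|lebesgue_on \<Omega>. (norm (weak_partials \<Omega> [b] f x))\<^sup>2))"
    by (intro sum.cong refl L2_norm_square_eq Sobolev_weak_partial(2)[OF assms])
  finally show ?thesis by (simp add: gradient_inner_def power2_norm_eq_inner)
qed

text \<open>Turns the extended norm into a real number, so that the estimates below concern real
  integrals. The lists of length at most 1 are the empty one and the singletons; the chosen
  derivative of order 0 is f only almost everywhere, by uniqueness.\<close>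

lemma H_norm_1:
  assumes \<Omega>: "open \<Omega>" and f: "f \<in> Sobolev \<Omega> 1"
  shows "H_norm \<Omega> 1 f = ennreal (sqrt (H1_square \<Omega> f))"
proof -
  have lists: "{bs. set bs \<subseteq> Basis \<and> length bs \<le> 1} = insert [] ((\<lambda>b::'a. [b]) ` Basis)"
  proof -
    have "\<exists>b\<in>Basis. bs = [b]" if "set bs \<subseteq> Basis" "length bs \<le> 1" "bs \<noteq> []" for bs :: "'a list"
      using that by (cases bs) auto
    then show ?thesis by auto
  qed
  have inj: "inj_on (\<lambda>b::'a. [b]) Basis" by (auto simp: inj_on_def)
  have hwp: "has_weak_partials \<Omega> [] f (weak_partials \<Omega> [] f)"
    using Sobolev_weak_partials(1)[OF \<Omega> f, of "[]"] by simp
  have ae: "AE x in lebesgue_on \<Omega>. weak_partials \<Omega> [] f x = f x"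
    using has_weak_partials_unique[OF \<Omega> hwp has_weak_partials_Nil]
      has_weak_partials_locally_integrable[OF hwp] by blast
  have "(L2_norm \<Omega> (weak_partials \<Omega> [] f))\<^sup>2 = (L2_norm \<Omega> f)\<^sup>2"
    unfolding L2_norm_square by (rule nn_integral_cong_AE) (use ae in eventually_elim, simp)
  also have "\<dots> = ennreal (LINT x|lebesgue_on \<Omega>. (norm (f x))\<^sup>2)"
    by (rule L2_norm_square_eq[OF Sobolev_L2[OF f]])
  finally have 0: "(L2_norm \<Omega> (weak_partials \<Omega> [] f))\<^sup>2 = ennreal (LINT x|lebesgue_on \<Omega>. (norm (f x))\<^sup>2)" .
  have "(\<Sum>b\<in>Basis. (L2_norm \<Omega> (weak_partials \<Omega> [b] f))\<^sup>2) = ennreal (gradient_inner \<Omega> f f)"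
    using gradient_norm_square[OF assms] f by (simp add: gradient_norm_def)
  then have "(\<Sum>bs | set bs \<subseteq> Basis \<and> length bs \<le> 1. (L2_norm \<Omega> (weak_partials \<Omega> bs f))\<^sup>2) = ennreal (H1_square \<Omega> f)"
    unfolding lists H1_square_def
    by (subst sum.insert) (auto simp: sum.reindex[OF inj] o_def 0 ennreal_plus gradient_inner_nonneg)
  then show ?thesis
    using f unfolding H_norm_def by (simp add: ennsqrt_ennreal H1_square_nonneg)
qed

lemma H1_square_scaleR:
  assumes "open \<Omega>" "f \<in> Sobolev \<Omega> 1"
  shows "H1_square \<Omega> (\<lambda>x. c *\<^sub>R f x) = c\<^sup>2 * H1_square \<Omega> f"
  using gradient_inner_scaleR_left[OF assms Sobolev_scaleR[OF assms], of c c] gradient_inner_scaleR_right[OF assms assms(2), of c]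
  unfolding H1_square_def by (simp add: power_mult_distrib algebra_simps power2_eq_square)

lemma H1_square_add_le:
  assumes \<Omega>: "open \<Omega>" and f: "f \<in> Sobolev \<Omega> 1" and g: "g \<in> Sobolev \<Omega> 1"
  shows "H1_square \<Omega> (\<lambda>x. f x + g x) \<le> 2 * H1_square \<Omega> f + 2 * H1_square \<Omega> g"
proof -
  note L = L2_integrable[OF Sobolev_L2[OF f]] L2_integrable[OF Sobolev_L2[OF g]]
  have "(LINT x|lebesgue_on \<Omega>. (norm (f x + g x))\<^sup>2) \<le> (LINT x|lebesgue_on \<Omega>. 2 * (norm (f x))\<^sup>2 + 2 * (norm (g x))\<^sup>2)"
    using L norm_add_square_le L2_integrable[OF L2_add[OF Sobolev_L2[OF f] Sobolev_L2[OF g]]]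
    by (intro integral_mono) auto
  also have "\<dots> = 2 * (LINT x|lebesgue_on \<Omega>. (norm (f x))\<^sup>2) + 2 * (LINT x|lebesgue_on \<Omega>. (norm (g x))\<^sup>2)"
    using L by simp
  finally have 1: "(LINT x|lebesgue_on \<Omega>. (norm (f x + g x))\<^sup>2) \<le> \<dots>" .
  have 2: "gradient_inner \<Omega> (\<lambda>x. f x + g x) (\<lambda>x. f x + g x) \<le> 2 * gradient_inner \<Omega> f f + 2 * gradient_inner \<Omega> g g"
    using gradient_inner_quadratic[OF assms, of 1] two_gradient_inner_le[OF assms] by simp
  show ?thesis using 1 2 unfolding H1_square_def by simp
qed

lemma test_functions_Sobolev:
  fixes \<phi> :: "'a::euclidean_space \<Rightarrow> 'b::euclidean_space"
  assumes \<Omega>: "open \<Omega>" "\<Omega> \<in> lmeasurable" and \<phi>: "\<phi> \<in> test_functions \<Omega>"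
  shows "\<phi> \<in> Sobolev \<Omega> 1" "b \<in> Basis \<Longrightarrow> AE x in lebesgue_on \<Omega>. weak_partials \<Omega> [b] \<phi> x = partial b \<phi> x"
proof -
  have L: "\<psi> \<in> L2 \<Omega>" if \<psi>: "\<psi> \<in> test_functions \<Omega>" for \<psi> :: "'a \<Rightarrow> 'b"
  proof -
    obtain B where "\<And>x. norm (\<psi> x) \<le> B" by (rule test_functions_bounded[OF \<psi>]) blast
    then show ?thesis
      using lebesgue_on_borel_measurable[OF test_functions_measurable[OF \<psi>]] \<Omega>(2)
      by (intro L2_bounded[of _ _ B]) auto
  qed
  have w: "has_weak_partials \<Omega> [b] \<phi> (partial b \<phi>)" if "b \<in> Basis" for b
    by (rule classical_partial_is_weak[OF \<Omega>(1) that test_functions_differentiable[OF \<phi>]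
        test_functions_continuous[OF test_functions_partial[OF \<phi> that]]])
  obtain b0 :: 'a where b0: "b0 \<in> Basis" using nonempty_Basis by blast
  have N: "has_weak_partials \<Omega> [] \<phi> \<phi>"
    using has_weak_partials_locally_integrable[OF w[OF b0]] by (intro has_weak_partials_Nil) blast
  show "\<phi> \<in> Sobolev \<Omega> 1"
    unfolding Sobolev_def mem_Collect_eq
  proof (intro conjI allI impI)
    fix bs :: "'a list" assume bs: "set bs \<subseteq> Basis \<and> length bs \<le> 1"
    show "\<exists>g\<in>L2 \<Omega>. has_weak_partials \<Omega> bs \<phi> g"
    proof (cases bs)
      case Nil then show ?thesis using N L[OF \<phi>] by blast
    next
      case (Cons b cs)
      then have "bs = [b]" "b \<in> Basis" using bs by auto
      then show ?thesis using w L[OF test_functions_partial[OF \<phi>]] by blast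
    qed
  qed (rule L[OF \<phi>])
  show "b \<in> Basis \<Longrightarrow> AE x in lebesgue_on \<Omega>. weak_partials \<Omega> [b] \<phi> x = partial b \<phi> x"
    using weak_partials_AE_eq[OF \<Omega>(1) w] by blast
qed

lemma H_norm_tendsto_0_iff:
  assumes "open \<Omega>" "\<And>n. f n \<in> Sobolev \<Omega> 1"
  shows "(\<lambda>n. H_norm \<Omega> 1 (f n)) \<longlonglongrightarrow> 0 \<longleftrightarrow> (\<lambda>n. H1_square \<Omega> (f n)) \<longlonglongrightarrow> 0"
proof -
  have "(\<lambda>n. H_norm \<Omega> 1 (f n)) \<longlonglongrightarrow> 0 \<longleftrightarrow> (\<lambda>n. sqrt (H1_square \<Omega> (f n))) \<longlonglongrightarrow> 0"
    using tendsto_ennreal_iff[of "\<lambda>n. sqrt (H1_square \<Omega> (f n))" sequentially 0]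
    by (simp add: H_norm_1[OF assms] H1_square_nonneg del: One_nat_def)
  also have "\<dots> \<longleftrightarrow> (\<lambda>n. H1_square \<Omega> (f n)) \<longlonglongrightarrow> 0"
  proof
    assume "(\<lambda>n. sqrt (H1_square \<Omega> (f n))) \<longlonglongrightarrow> 0"
    from tendsto_power[OF this, of 2] show "(\<lambda>n. H1_square \<Omega> (f n)) \<longlonglongrightarrow> 0"
      by (simp add: H1_square_nonneg)
  next
    assume "(\<lambda>n. H1_square \<Omega> (f n)) \<longlonglongrightarrow> 0"
    from tendsto_real_sqrt[OF this] show "(\<lambda>n. sqrt (H1_square \<Omega> (f n))) \<longlonglongrightarrow> 0" by simp
  qed
  finally show ?thesis .
qed

section \<open>The spaces H^1_0 and H^1_d\<close>

lemma Hd_Sobolev: "f \<in> Hd \<Omega> s \<Longrightarrow> f \<in> Sobolev \<Omega> s"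
  by (simp add: Hd_def)

lemma Hd_H10: "f \<in> Hd \<Omega> 1 \<Longrightarrow> f \<in> H10 \<Omega>"
  unfolding Hd_def H10_def by blast

lemma H10_Sobolev: "f \<in> H10 \<Omega> \<Longrightarrow> f \<in> Sobolev \<Omega> 1"
  by (simp add: H10_def)

lemma H10_approx:
  assumes "open \<Omega>" "\<Omega> \<in> lmeasurable" "f \<in> H10 \<Omega>"
  obtains \<phi> where "\<And>n. \<phi> n \<in> test_functions \<Omega>" "(\<lambda>n. H1_square \<Omega> (\<lambda>x. \<phi> n x - f x)) \<longlonglongrightarrow> 0"
proof -
  obtain \<phi> where \<phi>: "\<And>n::nat. \<phi> n \<in> test_functions \<Omega>" "(\<lambda>n. H_norm \<Omega> 1 (\<lambda>x. \<phi> n x - f x)) \<longlonglongrightarrow> 0"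
    using assms(3) unfolding H10_def by blast
  have "(\<lambda>x. \<phi> n x - f x) \<in> Sobolev \<Omega> 1" for n
    using test_functions_Sobolev(1)[OF assms(1,2) \<phi>(1)] H10_Sobolev[OF assms(3)] by (intro Sobolev_diff assms)
  then have "(\<lambda>n. H1_square \<Omega> (\<lambda>x. \<phi> n x - f x)) \<longlonglongrightarrow> 0"
    using H_norm_tendsto_0_iff[OF assms(1), of "\<lambda>n x. \<phi> n x - f x"] \<phi>(2) by simp
  with \<phi>(1) show thesis by (rule that)
qed

lemma test_functions_H10:
  assumes "open \<Omega>" "\<Omega> \<in> lmeasurable" "\<phi> \<in> test_functions \<Omega>"
  shows "\<phi> \<in> H10 \<Omega>"
proof -
  note S = test_functions_Sobolev(1)[OF assms]
  have "H1_square \<Omega> (\<lambda>x. \<phi> x - \<phi> x) = 0"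
    using H1_square_scaleR[OF assms(1) S, of 0] by simp
  then have "H_norm \<Omega> 1 (\<lambda>x. \<phi> x - \<phi> x) = 0"
    using H_norm_1[OF assms(1) Sobolev_diff[OF assms(1) S S]] by simp
  then show ?thesis
    unfolding H10_def mem_Collect_eq using S assms(3) by (intro conjI exI[of _ "\<lambda>n. \<phi>"]) auto
qed

lemma Hd_linear:
  fixes f g :: "'a::euclidean_space \<Rightarrow> 'a"
  assumes \<Omega>: "open \<Omega>" "\<Omega> \<in> lmeasurable" and f: "f \<in> Hd \<Omega> 1" and g: "g \<in> Hd \<Omega> 1"
  shows "(\<lambda>x. f x + c *\<^sub>R g x) \<in> Hd \<Omega> 1"
proof -
  note Sf = Hd_Sobolev[OF f] and Sg = Hd_Sobolev[OF g]
  have ap: "\<exists>\<phi>. (\<forall>n::nat. \<phi> n \<in> test_functions \<Omega> \<and> (\<forall>x. divergence (\<phi> n) x = 0)) \<and> (\<lambda>n. H1_square \<Omega> (\<lambda>x. \<phi> n x - h x)) \<longlonglongrightarrow> 0"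
    if h: "h \<in> Hd \<Omega> 1" for h
  proof -
    from h have "\<exists>\<phi>. (\<forall>n::nat. \<phi> n \<in> test_functions \<Omega> \<and> (\<forall>x. divergence (\<phi> n) x = 0)) \<and> (\<lambda>n. H_norm \<Omega> 1 (\<lambda>x. \<phi> n x - h x)) \<longlonglongrightarrow> 0"
      unfolding Hd_def mem_Collect_eq by (rule conjunct2)
    then obtain \<phi> where \<phi>: "(\<forall>n::nat. \<phi> n \<in> test_functions \<Omega> \<and> (\<forall>x. divergence (\<phi> n) x = 0)) \<and> (\<lambda>n. H_norm \<Omega> 1 (\<lambda>x. \<phi> n x - h x)) \<longlonglongrightarrow> 0"
      by (rule exE)
    have t: "\<phi> n \<in> test_functions \<Omega>" for n using \<phi> by simp
    have "(\<lambda>x. \<phi> n x - h x) \<in> Sobolev \<Omega> 1" for n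
      by (rule Sobolev_diff[OF \<Omega>(1) test_functions_Sobolev(1)[OF \<Omega> t] Hd_Sobolev[OF h]])
    then have "(\<lambda>n. H1_square \<Omega> (\<lambda>x. \<phi> n x - h x)) \<longlonglongrightarrow> 0"
      using H_norm_tendsto_0_iff[OF \<Omega>(1), of "\<lambda>n x. \<phi> n x - h x"] \<phi> by simp
    then show ?thesis using \<phi> by (intro exI[of _ \<phi>]) simp
  qed
  from ap[OF f] obtain \<phi> where "(\<forall>n::nat. \<phi> n \<in> test_functions \<Omega> \<and> (\<forall>x. divergence (\<phi> n) x = 0)) \<and> (\<lambda>n. H1_square \<Omega> (\<lambda>x. \<phi> n x - f x)) \<longlonglongrightarrow> 0"
    by (rule exE)
  then have \<phi>: "\<phi> n \<in> test_functions \<Omega>" "divergence (\<phi> n) x = 0" "(\<lambda>n. H1_square \<Omega> (\<lambda>x. \<phi> n x - f x)) \<longlonglongrightarrow> 0" for n x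
    by auto
  from ap[OF g] obtain \<psi> where "(\<forall>n::nat. \<psi> n \<in> test_functions \<Omega> \<and> (\<forall>x. divergence (\<psi> n) x = 0)) \<and> (\<lambda>n. H1_square \<Omega> (\<lambda>x. \<psi> n x - g x)) \<longlonglongrightarrow> 0"
    by (rule exE)
  then have \<psi>: "\<psi> n \<in> test_functions \<Omega>" "divergence (\<psi> n) x = 0" "(\<lambda>n. H1_square \<Omega> (\<lambda>x. \<psi> n x - g x)) \<longlonglongrightarrow> 0" for n x
    by auto
  note S\<phi> = test_functions_Sobolev(1)[OF \<Omega> \<phi>(1)] and S\<psi> = test_functions_Sobolev(1)[OF \<Omega> \<psi>(1)]
  define \<eta> where "\<eta> n x = \<phi> n x + c *\<^sub>R \<psi> n x" for n x
  have \<eta>: "\<eta> n \<in> test_functions \<Omega>" for n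
    unfolding \<eta>_def[abs_def]
    by (rule test_functions_add[OF \<phi>(1) test_functions_linear[OF bounded_linear_scaleR_right \<psi>(1)]])
  have div: "divergence (\<eta> n) x = 0" for n x
  proof -
    have d1: "\<phi> n differentiable at x" "\<psi> n differentiable at x"
      using \<phi>(1) \<psi>(1) test_functions_differentiable by blast+
    then have d2: "(\<lambda>x. c *\<^sub>R \<psi> n x) differentiable at x" by (intro differentiable_scaleR) auto
    have "partial b (\<eta> n) x = partial b (\<phi> n) x + c *\<^sub>R partial b (\<psi> n) x" for b
      unfolding \<eta>_def[abs_def] using partial_add[OF d1(1) d2] partial_linear[OF bounded_linear_scaleR_right d1(2)] by simp
    then have "divergence (\<eta> n) x = divergence (\<phi> n) x + c * divergence (\<psi> n) x"
      unfolding divergence_def by (simp add: inner_add_left sum.distrib sum_distrib_left)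
    then show ?thesis using \<phi>(2) \<psi>(2) by simp
  qed
  have Sh: "(\<lambda>x. f x + c *\<^sub>R g x) \<in> Sobolev \<Omega> 1"
    by (intro Sobolev_add Sobolev_scaleR \<Omega> Sf Sg)
  have le: "H1_square \<Omega> (\<lambda>x. \<eta> n x - (f x + c *\<^sub>R g x)) \<le> 2 * H1_square \<Omega> (\<lambda>x. \<phi> n x - f x) + 2 * (c\<^sup>2 * H1_square \<Omega> (\<lambda>x. \<psi> n x - g x))" for n
  proof -
    have e: "(\<lambda>x. \<eta> n x - (f x + c *\<^sub>R g x)) = (\<lambda>x. (\<phi> n x - f x) + c *\<^sub>R (\<psi> n x - g x))"
      unfolding \<eta>_def by (simp add: algebra_simps)
    note S1 = Sobolev_diff[OF \<Omega>(1) S\<phi>[of n] Sf] and S2 = Sobolev_diff[OF \<Omega>(1) S\<psi>[of n] Sg]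
    show ?thesis
      unfolding e using H1_square_add_le[OF \<Omega>(1) S1 Sobolev_scaleR[OF \<Omega>(1) S2, of c]] H1_square_scaleR[OF \<Omega>(1) S2, of c] by simp
  qed
  have "(\<lambda>n. 2 * H1_square \<Omega> (\<lambda>x. \<phi> n x - f x) + 2 * (c\<^sup>2 * H1_square \<Omega> (\<lambda>x. \<psi> n x - g x))) \<longlonglongrightarrow> 2 * 0 + 2 * (c\<^sup>2 * 0)"
    by (intro tendsto_intros \<phi> \<psi>)
  then have lim: "(\<lambda>n. 2 * H1_square \<Omega> (\<lambda>x. \<phi> n x - f x) + 2 * (c\<^sup>2 * H1_square \<Omega> (\<lambda>x. \<psi> n x - g x))) \<longlonglongrightarrow> 0" by simp
  have "(\<lambda>n. H1_square \<Omega> (\<lambda>x. \<eta> n x - (f x + c *\<^sub>R g x))) \<longlonglongrightarrow> 0"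
    by (rule tendsto_sandwich[OF _ _ tendsto_const lim]) (simp_all add: H1_square_nonneg le)
  then have "(\<lambda>n. H_norm \<Omega> 1 (\<lambda>x. \<eta> n x - (f x + c *\<^sub>R g x))) \<longlonglongrightarrow> 0"
    using H_norm_tendsto_0_iff[OF \<Omega>(1) Sobolev_diff[OF \<Omega>(1) test_functions_Sobolev(1)[OF \<Omega> \<eta>] Sh]] by simp
  then show ?thesis
    unfolding Hd_def mem_Collect_eq using Sh \<eta> div by (intro conjI exI[of _ \<eta>]) auto
qed

section \<open>Fubini's theorem for Lebesgue measurable functions\<close>

lemma lebesgue_slices:
  fixes f :: "'a::euclidean_space \<times> 'b::euclidean_space \<Rightarrow> 'c"
  assumes "AE z in lborel. f z = g z"
  shows "AE t in lebesgue. AE x in lborel. f (t, x) = g (t, x)"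
proof -
  have "AE z in (lborel :: 'a measure) \<Otimes>\<^sub>M (lborel :: 'b measure). f z = g z"
    by (subst lborel_prod) (rule assms)
  then show ?thesis
    by (intro AE_completion lborel_pair.AE_pair)
qed

text \<open>Lebesgue measure on a product is the completion of the Borel product measure, so the
  product theorem is applied to a Borel representative G of the extension of f by zero. For almost
  every t the slices of f and G agree almost everywhere, which transfers integrability and
  integrals; completeness in t then makes the inner integral of f measurable.\<close>

lemma Fubini_lebesgue_on:
  fixes f :: "'a::euclidean_space \<times> 'b::euclidean_space \<Rightarrow> real"
  assumes I: "I \<in> sets borel" and \<Omega>: "\<Omega> \<in> sets borel" and f: "integrable (lebesgue_on (I \<times> \<Omega>)) f"
  shows "AE t in lebesgue_on I. integrable (lebesgue_on \<Omega>) (\<lambda>x. f (t, x))"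
    and "integrable (lebesgue_on I) (\<lambda>t. LINT x|lebesgue_on \<Omega>. f (t, x))"
    and "(LINT z|lebesgue_on (I \<times> \<Omega>). f z) = (LINT t|lebesgue_on I. LINT x|lebesgue_on \<Omega>. f (t, x))"
proof -
  have I\<Omega>: "I \<times> \<Omega> \<in> sets borel"
    using I \<Omega> by (metis borel_prod pair_measureI)
  define F where "F z = (if z \<in> I \<times> \<Omega> then f z else 0)" for z
  have Fi: "integrable lebesgue F"
    unfolding F_def[abs_def] using f I\<Omega> by (subst Lebesgue_Measure.integrable_restrict_UNIV) auto
  obtain G0 where G0: "G0 \<in> borel_measurable lborel" "AE z in lborel. F z = G0 z"
    using completion_ex_borel_measurable_real[OF borel_measurable_integrable[OF Fi]] by blast
  \<comment> \<open>The Borel representative need not vanish off I x \<Omega>; the indicator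
    restores this, and with it the slices at times outside I are exactly zero.\<close>
  define G where "G z = indicator (I \<times> \<Omega>) z * G0 z" for z
  have Gm: "G \<in> borel_measurable borel"
    unfolding G_def[abs_def] using G0 I\<Omega> by (intro borel_measurable_times borel_measurable_indicator) auto
  have FG: "AE z in lborel. F z = G z"
    using G0(2) by eventually_elim (auto simp: F_def G_def indicator_def split: if_splits)
  have FGl: "AE z in lebesgue. G z = F z"
    by (rule AE_completion) (use FG in eventually_elim, simp)
  have Gml: "G \<in> borel_measurable lebesgue" using Gm by (auto intro: measurable_completion)
  have Gi: "integrable lborel G"
  proof -
    have "integrable lebesgue G"
      using Fi Gml FGl integrable_cong_AE[of G lebesgue F] borel_measurable_integrable[OF Fi] by blast
    then show ?thesis using integrable_completion[of G lborel] Gm by simp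
  qed
  then have Gp: "integrable (lborel \<Otimes>\<^sub>M lborel) G" by (simp add: lborel_prod)
  have Gs: "(\<lambda>x. G (t, x)) \<in> borel_measurable borel" for t
  proof -
    have "(\<lambda>x. (t, x)) \<in> borel_measurable borel"
      by (intro borel_measurable_continuous_onI continuous_intros)
    from measurable_compose[OF this Gm] show ?thesis .
  qed
  note slices = lebesgue_slices[OF FG]
  have Gsi: "AE t in lebesgue. integrable lborel (\<lambda>x. G (t, x))"
    by (rule AE_completion[OF lborel_pair.AE_integrable_fst'[OF Gp]])
  have key: "AE t in lebesgue. t \<in> I \<longrightarrow> integrable (lebesgue_on \<Omega>) (\<lambda>x. f (t, x)) \<and> (LINT x|lebesgue_on \<Omega>. f (t, x)) = (LINT x|lborel. G (t, x))"
    using slices Gsi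
  proof eventually_elim
    case (elim t)
    show ?case
    proof
      assume t: "t \<in> I"
      have eq: "(\<lambda>x. if x \<in> \<Omega> then f (t, x) else 0) = (\<lambda>x. F (t, x))"
        using t by (auto simp: F_def)
      have ae: "AE x in lebesgue. G (t, x) = F (t, x)"
        by (rule AE_completion) (use elim(1) in eventually_elim, simp)
      have Fsm: "(\<lambda>x. F (t, x)) \<in> borel_measurable lebesgue"
        by (rule borel_measurable_AE[OF _ ae]) (use Gs in \<open>auto intro: measurable_completion\<close>)
      have Gl: "integrable lebesgue (\<lambda>x. G (t, x))" using elim(2) Gs by (subst integrable_completion) auto
      have "integrable lebesgue (\<lambda>x. F (t, x))"
        using Gl ae Fsm by (subst integrable_cong_AE[of _ _ "\<lambda>x. G (t, x)"]) (auto elim: eventually_mono)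
      then have 1: "integrable (lebesgue_on \<Omega>) (\<lambda>x. f (t, x))"
        using \<Omega> by (subst Lebesgue_Measure.integrable_restrict_UNIV[symmetric]) (auto simp: eq)
      have "(LINT x|lebesgue_on \<Omega>. f (t, x)) = (LINT x|lebesgue. (if x \<in> \<Omega> then f (t, x) else 0))"
        using \<Omega> by (subst Lebesgue_Measure.integral_restrict_UNIV) auto
      also have "\<dots> = (LINT x|lebesgue. F (t, x))" by (simp only: eq)
      also have "\<dots> = (LINT x|lebesgue. G (t, x))"
        using Gl ae Fsm by (intro integral_cong_AE) (auto elim: eventually_mono)
      also have "\<dots> = (LINT x|lborel. G (t, x))" by (rule integral_completion) (use Gs in auto)
      finally show "integrable (lebesgue_on \<Omega>) (\<lambda>x. f (t, x)) \<and> (LINT x|lebesgue_on \<Omega>. f (t, x)) = (LINT x|lborel. G (t, x))"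
        using 1 by blast
    qed
  qed
  have keyI: "AE t in lebesgue_on I. integrable (lebesgue_on \<Omega>) (\<lambda>x. f (t, x)) \<and> (LINT x|lebesgue_on \<Omega>. f (t, x)) = (LINT x|lborel. G (t, x))"
    by (subst AE_restrict_space_iff) (use I in simp, rule key)
  then show "AE t in lebesgue_on I. integrable (lebesgue_on \<Omega>) (\<lambda>x. f (t, x))" by eventually_elim blast
  define H where "H t = (LINT x|lborel. G (t, x))" for t
  have Hi: "integrable lborel H" unfolding H_def using lborel_pair.integrable_fst'[OF Gp] .
  have Hl: "integrable lebesgue H" using Hi by (subst integrable_completion) auto
  then have HI: "integrable (lebesgue_on I) H"
    using integrable_lebesgue_on_subset[of UNIV H I] I by (simp add: lebesgue_on_UNIV_eq)
  have aeH: "AE t in lebesgue_on I. H t = (LINT x|lebesgue_on \<Omega>. f (t, x))"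
    using keyI unfolding H_def by eventually_elim simp
  have Lm: "(\<lambda>t. LINT x|lebesgue_on \<Omega>. f (t, x)) \<in> borel_measurable (lebesgue_on I)"
    by (rule lebesgue_on_AE_measurable[OF _ aeH]) (use HI I in auto)
  show "integrable (lebesgue_on I) (\<lambda>t. LINT x|lebesgue_on \<Omega>. f (t, x))"
    using HI Lm aeH by (subst integrable_cong_AE[of _ _ H]) (auto elim: eventually_mono)
  have "(LINT t|lebesgue_on I. LINT x|lebesgue_on \<Omega>. f (t, x)) = (LINT t|lebesgue_on I. H t)"
    using HI Lm aeH by (intro integral_cong_AE) (auto elim: eventually_mono)
  also have "\<dots> = (LINT t|lebesgue_on UNIV. H t)"
  proof (rule LINT_lebesgue_on_superset[symmetric])
    fix t assume "t \<in> UNIV - I"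
    then have "G (t, x) = 0" for x by (simp add: G_def)
    then show "H t = 0" by (simp add: H_def)
  qed (use I in auto)
  also have "\<dots> = (LINT t|lborel. H t)"
    using Hi by (simp add: lebesgue_on_UNIV_eq integral_completion)
  also have "\<dots> = (LINT z|lborel. G z)"
    using lborel_pair.integral_fst'[OF Gp] by (simp add: H_def lborel_prod)
  also have "\<dots> = (LINT z|lebesgue. G z)" using Gm by (simp add: integral_completion)
  also have "\<dots> = (LINT z|lebesgue. F z)"
    using Gml Fi FGl by (intro integral_cong_AE) auto
  also have "\<dots> = (LINT z|lebesgue_on (I \<times> \<Omega>). f z)"
    unfolding F_def using I\<Omega> by (subst Lebesgue_Measure.integral_restrict_UNIV) auto
  finally show "(LINT z|lebesgue_on (I \<times> \<Omega>). f z) = (LINT t|lebesgue_on I. LINT x|lebesgue_on \<Omega>. f (t, x))" by simp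
qed

text \<open>The same transfer to a Borel representative. \<open>nn_integral\<close> is defined for
  every function and respects equality almost everywhere, so it tolerates slices that are not
  measurable.\<close>

lemma nn_integral_lebesgue_on_slices:
  fixes f :: "'a::euclidean_space \<times> 'b::euclidean_space \<Rightarrow> ennreal"
  assumes I: "I \<in> sets borel" and \<Omega>: "\<Omega> \<in> sets borel" and f: "f \<in> borel_measurable (lebesgue_on (I \<times> \<Omega>))"
  shows "(\<integral>\<^sup>+z. f z \<partial>lebesgue_on (I \<times> \<Omega>)) = (\<integral>\<^sup>+t. \<integral>\<^sup>+x. f (t, x) \<partial>lebesgue_on \<Omega> \<partial>lebesgue_on I)"
proof -
  have I\<Omega>: "I \<times> \<Omega> \<in> sets borel"
    using I \<Omega> by (metis borel_prod pair_measureI)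
  define F where "F z = f z * indicator (I \<times> \<Omega>) z" for z
  have Fm: "F \<in> borel_measurable lebesgue"
    unfolding F_def[abs_def] using f I\<Omega> by (subst (asm) borel_measurable_restrict_space_iff_ennreal) auto
  obtain G where G: "G \<in> borel_measurable lborel" "AE z in lborel. F z = G z"
    using completion_ex_borel_measurable[OF Fm] by blast
  have "(\<integral>\<^sup>+z. f z \<partial>lebesgue_on (I \<times> \<Omega>)) = (\<integral>\<^sup>+z. F z \<partial>lborel)"
    using I\<Omega> by (simp add: nn_integral_restrict_space F_def nn_integral_completion)
  also have "\<dots> = (\<integral>\<^sup>+z. G z \<partial>(lborel \<Otimes>\<^sub>M lborel))"
    unfolding lborel_prod by (rule nn_integral_cong_AE[OF G(2)])
  also have "\<dots> = (\<integral>\<^sup>+t. \<integral>\<^sup>+x. G (t, x) \<partial>lborel \<partial>lborel)"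
    using G(1) by (intro lborel.nn_integral_fst[symmetric]) (simp add: lborel_prod)
  also have "\<dots> = (\<integral>\<^sup>+t. \<integral>\<^sup>+x. G (t, x) \<partial>lborel \<partial>lebesgue)" by (simp add: nn_integral_completion)
  also have "\<dots> = (\<integral>\<^sup>+t. \<integral>\<^sup>+x. F (t, x) \<partial>lborel \<partial>lebesgue)"
  proof (rule nn_integral_cong_AE)
    show "AE t in lebesgue. (\<integral>\<^sup>+x. G (t, x) \<partial>lborel) = (\<integral>\<^sup>+x. F (t, x) \<partial>lborel)"
      using lebesgue_slices[OF G(2)] by eventually_elim (rule nn_integral_cong_AE, auto elim: eventually_mono)
  qed
  also have "\<dots> = (\<integral>\<^sup>+t. (\<integral>\<^sup>+x. f (t, x) \<partial>lebesgue_on \<Omega>) * indicator I t \<partial>lebesgue)"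
  proof (rule nn_integral_cong)
    fix t :: 'a
    show "(\<integral>\<^sup>+x. F (t, x) \<partial>lborel) = (\<integral>\<^sup>+x. f (t, x) \<partial>lebesgue_on \<Omega>) * indicator I t"
      using \<Omega> by (cases "t \<in> I") (simp_all add: F_def nn_integral_restrict_space nn_integral_completion indicator_times)
  qed
  also have "\<dots> = (\<integral>\<^sup>+t. \<integral>\<^sup>+x. f (t, x) \<partial>lebesgue_on \<Omega> \<partial>lebesgue_on I)"
    using I by (simp add: nn_integral_restrict_space)
  finally show ?thesis .
qed

lemma AE_lebesgue_on_slices:
  fixes P :: "'a::euclidean_space \<times> 'b::euclidean_space \<Rightarrow> bool"
  assumes I: "I \<in> sets borel" and \<Omega>: "\<Omega> \<in> sets borel" and P: "AE z in lebesgue_on (I \<times> \<Omega>). P z"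
  shows "AE t in lebesgue_on I. AE x in lebesgue_on \<Omega>. P (t, x)"
proof -
  have I\<Omega>: "I \<times> \<Omega> \<in> sets borel"
    using I \<Omega> by (metis borel_prod pair_measureI)
  have "AE z in lborel. z \<in> I \<times> \<Omega> \<longrightarrow> P z"
    using P I\<Omega> by (simp add: AE_restrict_space_iff AE_completion_iff)
  then have "AE z in lborel. (z \<in> I \<times> \<Omega> \<longrightarrow> P z) = True" by simp
  from lebesgue_slices[OF this] show ?thesis
    using I \<Omega> by (auto simp: AE_restrict_space_iff AE_completion_iff elim!: eventually_mono)
qed

section \<open>Weak solutions of scalar ordinary differential equations\<close>

text \<open>Difference quotients are at most L |t - s|, so the derivative is zero everywhere. This
  allows a product rule for Lipschitz functions without differentiating them almost
  everywhere.\<close>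

lemma constant_if_quadratic_increments:
  fixes H :: "real \<Rightarrow> real"
  assumes "\<And>s t. s \<in> {0..T} \<Longrightarrow> t \<in> {0..T} \<Longrightarrow> s \<le> t \<Longrightarrow> \<bar>H t - H s\<bar> \<le> L * (t - s)\<^sup>2"
    and t: "t \<in> {0..T}"
  shows "H t = H 0"
proof -
  have le: "\<bar>H t - H s\<bar> \<le> L * (t - s)\<^sup>2" if "s \<in> {0..T}" "t \<in> {0..T}" for s t
    using assms(1)[of s t] assms(1)[of t s] that by (cases "s \<le> t") (auto simp: abs_minus_commute power2_commute)
  have "(H has_field_derivative 0) (at x within {0..T})" if x: "x \<in> {0..T}" for x
    unfolding has_field_derivative_iff
  proof (rule Lim_null_comparison)
    show "\<forall>\<^sub>F y in at x within {0..T}. norm ((H y - H x) / (y - x)) \<le> L * \<bar>y - x\<bar>"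
      unfolding eventually_at_filter
    proof (rule always_eventually, intro allI impI)
      fix y assume y: "y \<noteq> x" "y \<in> {0..T}"
      obtain d where d: "d = \<bar>y - x\<bar>" "d > 0" using y by auto
      have "\<bar>H y - H x\<bar> / d \<le> L * d\<^sup>2 / d"
        using le[OF x y(2)] d by (intro divide_right_mono) (auto simp: power2_abs)
      also have "\<dots> = L * d" using d(2) by (simp add: power2_eq_square)
      finally show "norm ((H y - H x) / (y - x)) \<le> L * \<bar>y - x\<bar>" using d by (simp add: abs_divide)
    qed
    have "((\<lambda>y. L * \<bar>y - x\<bar>) \<longlongrightarrow> L * \<bar>x - x\<bar>) (at x within {0..T})" by (intro tendsto_intros)
    then show "((\<lambda>y. L * \<bar>y - x\<bar>) \<longlongrightarrow> 0) (at x within {0..T})" by simp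
  qed
  from has_field_derivative_zero_constant[of "{0..T}" H, OF _ this] obtain c where "\<forall>x\<in>{0..T}. H x = c" by auto
  then show ?thesis using t by auto
qed

lemma integrable_bounded_lebesgue_on:
  fixes f :: "'a::euclidean_space \<Rightarrow> 'b::euclidean_space"
  assumes "f \<in> borel_measurable (lebesgue_on S)" "AE x in lebesgue_on S. norm (f x) \<le> B" "S \<in> lmeasurable"
  shows "integrable (lebesgue_on S) f"
proof -
  interpret finite_measure "lebesgue_on S" by (rule finite_measure_lebesgue_on[OF assms(3)])
  show ?thesis by (rule integrable_const_bound[OF assms(2,1)])
qed

lemma integral_abs_le:
  fixes f :: "real \<Rightarrow> real"
  assumes "s \<le> t" "f integrable_on {s..t}" "\<And>r. r \<in> {s..t} \<Longrightarrow> \<bar>f r\<bar> \<le> B"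
  shows "\<bar>integral {s..t} f\<bar> \<le> B * (t - s)"
proof -
  have "0 \<le> \<bar>f s\<bar>" by simp
  also have "\<dots> \<le> B" using assms(1,3) by simp
  finally have B: "0 \<le> B" .
  have "norm (integral (cbox s t) f) \<le> B * measure lborel (cbox s t)"
    by (rule has_integral_bound[OF B]) (use assms in \<open>auto simp: integrable_integral\<close>)
  then show ?thesis using assms(1) by simp
qed

text \<open>The normal form of a solution of P' = F, P(0) = p0. The density F is bounded at every
  time rather than at almost every time, so the estimates below hold without exceptional
  sets.\<close>

locale bounded_density =
  fixes F :: "real \<Rightarrow> real" and K p0 :: real and P :: "real \<Rightarrow> real"
  assumes F: "F \<in> borel_measurable lebesgue" and FK: "\<And>s. \<bar>F s\<bar> \<le> K"
    and P: "\<And>t. P t = p0 + integral {0..t} F"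
begin

lemma int_mult:
  assumes "continuous_on {a..b} c"
  shows "integrable (lebesgue_on {a..b}) (\<lambda>s. c s * F s)"
proof -
  have "bounded (c ` {a..b})" using assms by (intro compact_imp_bounded compact_continuous_image) auto
  then obtain C where "\<forall>s\<in>{a..b}. \<bar>c s\<bar> \<le> C" unfolding bounded_iff by auto
  then have C: "\<bar>c s\<bar> \<le> C" if "s \<in> {a..b}" for s using that by blast
  have "c \<in> borel_measurable (lebesgue_on {a..b})"
    using assms by (intro lebesgue_on_continuous_measurable) auto
  moreover have "F \<in> borel_measurable (lebesgue_on {a..b})" using F by (rule measurable_restrict_space1)
  ultimately show ?thesis
  proof (intro integrable_bounded_lebesgue_on[where B="\<bar>C\<bar> * K"] borel_measurable_times AE_I2)
    fix s assume "s \<in> space (lebesgue_on {a..b})"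
    then have "\<bar>c s\<bar> \<le> \<bar>C\<bar>" using C[of s] by auto
    then show "norm (c s * F s) \<le> \<bar>C\<bar> * K"
      using FK[of s] by (auto simp: abs_mult intro!: mult_mono)
  qed auto
qed

lemma int_mult_on: "continuous_on {a..b} c \<Longrightarrow> (\<lambda>s. c s * F s) integrable_on {a..b}"
  by (rule integrable_on_lebesgue_on[OF int_mult]) auto

lemma int_on: "F integrable_on {a..b}"
  using int_mult_on[of a b "\<lambda>_. 1"] by simp

lemma int_abs_le: "s \<le> t \<Longrightarrow> \<bar>integral {s..t} F\<bar> \<le> K * (t - s)"
  using FK by (intro integral_abs_le int_on)

lemma P_diff: "0 \<le> s \<Longrightarrow> s \<le> t \<Longrightarrow> P t - P s = integral {s..t} F"
  using Henstock_Kurzweil_Integration.integral_combine[of 0 s t F] int_on[of 0 t] by (simp add: P)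

lemma P_Lipschitz: "0 \<le> s \<Longrightarrow> s \<le> t \<Longrightarrow> \<bar>P t - P s\<bar> \<le> K * (t - s)"
  using P_diff int_abs_le by simp

lemma P_continuous: "continuous_on {0..T} P"
proof -
  have "\<bar>P t - P s\<bar> \<le> K * \<bar>t - s\<bar>" if "s \<in> {0..T}" "t \<in> {0..T}" for s t
    using P_Lipschitz[of s t] P_Lipschitz[of t s] that by (cases "s \<le> t") auto
  moreover have "0 \<le> K" using FK[of 0] by simp
  ultimately have "lipschitz_on K {0..T} P"
    by (intro lipschitz_onI) (auto simp: dist_real_def)
  then show ?thesis by (rule lipschitz_on_continuous_on)
qed

text \<open>The difference of the two sides has increments of second order, hence is constant.\<close>

lemma product_rule:
  assumes c: "\<And>t. t \<in> {0..T} \<Longrightarrow> (c has_real_derivative c' t) (at t within {0..T})"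
    and c': "continuous_on {0..T} c'" and t: "t \<in> {0..T}"
  shows "c t * P t = c 0 * p0 + integral {0..t} (\<lambda>s. c' s * P s + c s * F s)"
proof -
  define q where "q s = c' s * P s + c s * F s" for s
  have K0: "0 \<le> K" using FK[of 0] by simp
  have cc: "continuous_on {0..T} c"
    using c by (meson DERIV_continuous continuous_on_eq_continuous_within)
  have "bounded (c' ` {0..T})" using c' by (intro compact_imp_bounded compact_continuous_image) auto
  then obtain C where "\<forall>s\<in>{0..T}. \<bar>c' s\<bar> \<le> C" unfolding bounded_iff by auto
  then have C: "\<bar>c' s\<bar> \<le> \<bar>C\<bar>" if "s \<in> {0..T}" for s using that by (meson abs_ge_self order_trans)
  have ftc: "(c' has_integral (c b - c a)) {a..b}" if "0 \<le> a" "a \<le> b" "b \<le> T" for a b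
  proof (rule fundamental_theorem_of_calculus[OF that(2)])
    fix x assume "x \<in> {a..b}"
    then have "(c has_real_derivative c' x) (at x within {a..b})"
      using that by (intro DERIV_subset[OF c]) auto
    then show "(c has_vector_derivative c' x) (at x within {a..b})"
      by (simp add: has_real_derivative_iff_has_vector_derivative)
  qed
  have cl: "\<bar>c b - c a\<bar> \<le> \<bar>C\<bar> * (b - a)" if "0 \<le> a" "a \<le> b" "b \<le> T" for a b
    using integral_abs_le[of a b c' "\<bar>C\<bar>"] ftc[OF that] C that
    by (auto simp: integral_unique has_integral_integrable)
  have c'P: "(\<lambda>s. c' s * P s) integrable_on {a..b}" if "0 \<le> a" "b \<le> T" for a b
    using c' P_continuous[of T] that
    by (intro integrable_continuous_interval continuous_on_mult) (auto intro: continuous_on_subset)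
  have cF: "(\<lambda>s. c s * F s) integrable_on {a..b}" if "0 \<le> a" "b \<le> T" for a b
    using cc that by (intro int_mult_on) (auto intro: continuous_on_subset)
  have qi: "q integrable_on {a..b}" if "0 \<le> a" "b \<le> T" for a b
    unfolding q_def by (rule integrable_add[OF c'P[OF that] cF[OF that]])
  define H where "H s = c s * P s - integral {0..s} q" for s
  have "H t = H 0"
  proof (rule constant_if_quadratic_increments[OF _ t])
    fix s t assume st: "s \<in> {0..T}" "t \<in> {0..T}" "s \<le> t"
    have sub: "r \<in> {0..T}" if "r \<in> {s..t}" for r using st that by auto
    have q: "integral {0..t} q - integral {0..s} q = integral {s..t} q"
      using Henstock_Kurzweil_Integration.integral_combine[of 0 s t q] qi[of 0 t] st by auto
    \<comment> \<open>The increment of c P is (c t - c s) P t + c s (P t - P s), and each summand is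
      an integral with the other factor frozen at an endpoint.\<close>
    have i1: "((\<lambda>r. c' r * P t) has_integral (c t - c s) * P t) {s..t}"
      using st by (intro has_integral_mult_left ftc) auto
    have i2: "((\<lambda>r. c s * F r) has_integral c s * (P t - P s)) {s..t}"
      using P_diff[of s t] st int_on by (auto intro!: has_integral_mult_right simp: integrable_integral)
    have i3: "(q has_integral integral {s..t} q) {s..t}" using qi st by (auto simp: integrable_integral)
    have "((\<lambda>r. c' r * P t + c s * F r - q r) has_integral ((c t - c s) * P t + c s * (P t - P s) - integral {s..t} q)) {s..t}"
      by (intro has_integral_diff has_integral_add i1 i2 i3)
    also have "(c t - c s) * P t + c s * (P t - P s) - integral {s..t} q = H t - H s"
      unfolding H_def using q by (simp add: algebra_simps)
    finally have i: "((\<lambda>r. c' r * P t + c s * F r - q r) has_integral (H t - H s)) {s..t}" .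
    have "\<bar>c' r * P t + c s * F r - q r\<bar> \<le> 2 * \<bar>C\<bar> * K * (t - s)" if r: "r \<in> {s..t}" for r
    proof -
      \<comment> \<open>The error of freezing: each of its two terms contains an increment of size t
        - s, and integration over an interval of that length makes it quadratic.\<close>
      have "c' r * P t + c s * F r - q r = c' r * (P t - P r) - (c r - c s) * F r"
        unfolding q_def by (simp add: algebra_simps)
      moreover have "\<bar>c' r * (P t - P r)\<bar> \<le> \<bar>C\<bar> * (K * (t - s))"
      proof -
        have "\<bar>P t - P r\<bar> \<le> K * (t - r)" using P_Lipschitz[of r t] r st by auto
        also have "\<dots> \<le> K * (t - s)" using r K0 by (intro mult_left_mono) auto
        finally show ?thesis using C[OF sub[OF r]] by (auto simp: abs_mult intro!: mult_mono)
      qed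
      moreover have "\<bar>(c r - c s) * F r\<bar> \<le> (\<bar>C\<bar> * (t - s)) * K"
      proof -
        have "\<bar>c r - c s\<bar> \<le> \<bar>C\<bar> * (r - s)" using cl[of s r] r st by auto
        also have "\<dots> \<le> \<bar>C\<bar> * (t - s)" using r by (intro mult_left_mono) auto
        finally show ?thesis using FK[of r] r st by (auto simp: abs_mult intro!: mult_mono)
      qed
      ultimately show ?thesis by (simp add: algebra_simps)
    qed
    then have "\<bar>integral {s..t} (\<lambda>r. c' r * P t + c s * F r - q r)\<bar> \<le> 2 * \<bar>C\<bar> * K * (t - s) * (t - s)"
      using i st by (intro integral_abs_le) (auto simp: has_integral_integrable)
    then show "\<bar>H t - H s\<bar> \<le> 2 * \<bar>C\<bar> * K * (t - s)\<^sup>2"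
      using i by (simp add: integral_unique power2_eq_square mult.assoc)
  qed
  then show ?thesis unfolding H_def q_def[abs_def] by (simp add: P)
qed

end

section \<open>Weak time derivatives and initial values\<close>

text \<open>A plain antiderivative of \<eta> is a test function only if the integral of \<eta> is
  zero. A multiple of a bump b living in (-2,-1) is subtracted to enforce this; it lies before time
  0, where the values of the derivative do not matter.\<close>

lemma test_function_antiderivative:
  fixes \<eta> :: "real \<Rightarrow> real"
  assumes T: "0 < T" and \<eta>: "\<eta> \<in> test_functions {0<..<T}"
  obtains \<theta> where "\<theta> \<in> test_functions {..<T}" "\<And>t. 0 \<le> t \<Longrightarrow> partial 1 \<theta> t = \<eta> t"
proof -
  obtain K where K: "compact K" "K \<subseteq> {0<..<T}" "\<And>x. x \<notin> K \<Longrightarrow> \<eta> x = 0"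
    by (rule test_functionsE[OF \<eta>]) blast
  obtain S where S: "0 < S" "S < T" "K \<subseteq> {..<S}"
  proof (cases "K = {}")
    case True
    then show thesis using T that[of "T / 2"] by auto
  next
    case False
    from compact_attains_sup[OF K(1) False] obtain m where m: "m \<in> K" "\<forall>x\<in>K. x \<le> m" by blast
    have "0 < m" "m < T" using m K(2) by auto
    then show thesis using m by (intro that[of "(m + T) / 2"]) force+
  qed
  \<comment> \<open>A nonnegative bump that is positive at -3/2 is found among the approximations of
    the indicator of (-2,-1).\<close>
  obtain \<phi> where \<phi>: "\<And>n. \<phi> n \<in> test_functions {-2<..<-1::real}" "\<And>n x. 0 \<le> \<phi> n x \<and> \<phi> n x \<le> (1::real)"
    "\<And>x. (\<lambda>n. \<phi> n x) \<longlonglongrightarrow> indicator {-2<..<-1} x"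
    using open_indicator_approx[of "{-2<..<-1::real}"] by (metis open_greaterThanLessThan)
  have "(\<lambda>n. \<phi> n (- 3 / 2)) \<longlonglongrightarrow> 1" using \<phi>(3)[of "- 3 / 2"] by simp
  from order_tendstoD(1)[OF this, of 0] obtain n where n: "0 < \<phi> n (- 3 / 2)"
    by (auto simp: eventually_sequentially)
  define b where "b = \<phi> n"
  have b: "b \<in> test_functions {-2<..<-1}" "\<And>x. 0 \<le> b x" "0 < b (- 3 / 2)"
    using \<phi> n by (auto simp: b_def)
  have b0: "b x = 0" if "x \<notin> {-2<..<-1}" for x by (rule test_functions_outside[OF b(1) that])
  have \<eta>0: "\<eta> x = 0" if "x \<le> 0 \<or> S \<le> x" for x
    using K S that by (intro K(3)) auto
  have bc: "continuous_on A b" for A using test_functions_continuous[OF b(1)] .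
  have \<eta>c: "continuous_on A \<eta>" for A using test_functions_continuous[OF \<eta>] .
  have bi: "b integrable_on {x..y}" for x y by (intro integrable_continuous_interval bc)
  have \<eta>i: "\<eta> integrable_on {x..y}" for x y by (intro integrable_continuous_interval \<eta>c)
  define Ib where "Ib = integral {-3..S} b"
  have "Ib \<noteq> 0"
  proof
    assume "Ib = 0"
    then have h: "(b has_integral 0) (cbox (-3) S)" using bi[of "-3" S] unfolding Ib_def
      by (simp add: has_integral_iff)
    have "b (- 3 / 2) = 0"
      by (rule has_integral_0_cbox_imp_0[OF bc b(2) h]) (use S in auto)
    then show False using b(3) by simp
  qed
  define \<kappa> where "\<kappa> = integral {-3..S} \<eta> / Ib"
  define q where "q x = \<eta> x + (- \<kappa>) * b x" for x
  have qs: "smooth_on UNIV q"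
    unfolding q_def[abs_def]
    by (intro smooth_add smooth_mult smooth_const test_functions_smooth[OF \<eta>] test_functions_smooth[OF b(1)])
  have qc: "continuous_on A q" for A unfolding q_def by (intro continuous_intros bc \<eta>c)
  have qi: "q integrable_on {x..y}" for x y by (intro integrable_continuous_interval qc)
  have q0: "q x = 0" if "x \<le> -2 \<or> S \<le> x" for x
    using \<eta>0[of x] b0[of x] that S by (auto simp: q_def)
  \<comment> \<open>The lower limit -3 lies left of the support of b, so E vanishes before -2; after
    S it vanishes by the choice of \<kappa>.\<close>
  define E where "E t = integral {-3..t} q" for t
  have E0: "E t = 0" if "t \<notin> {-2..S}" for t
  proof (cases "t < -2")
    case True
    have "integral {-3..t} q = integral {-3..t} (\<lambda>x. 0)"
      by (rule Henstock_Kurzweil_Integration.integral_cong) (use True q0 in auto)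
    then show ?thesis by (simp add: E_def)
  next
    case False
    then have t: "S < t" using that by auto
    have "E t = integral {-3..S} q + integral {S..t} q"
      unfolding E_def by (rule Henstock_Kurzweil_Integration.integral_combine[symmetric]) (use t S qi in auto)
    moreover have "integral {S..t} q = integral {S..t} (\<lambda>x. 0)"
      by (rule Henstock_Kurzweil_Integration.integral_cong) (use q0 in auto)
    moreover have "integral {-3..S} q = integral {-3..S} \<eta> + (- \<kappa>) * Ib"
    proof -
      have "integral {-3..S} q = integral {-3..S} \<eta> + integral {-3..S} (\<lambda>x. (- \<kappa>) * b x)"
        unfolding q_def[abs_def] by (intro Henstock_Kurzweil_Integration.integral_add \<eta>i integrable_continuous_interval[OF continuous_on_mult[OF continuous_on_const bc]])
      then show ?thesis by (simp add: Ib_def)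
    qed
    ultimately show ?thesis using \<open>Ib \<noteq> 0\<close> by (simp add: \<kappa>_def)
  qed
  have Ed: "(E has_real_derivative q t) (at t)" for t
  proof (cases "t < -2")
    case True
    have "((\<lambda>t. 0) has_real_derivative q t) (at t)" using q0 True by simp
    then show ?thesis
      by (rule has_field_derivative_transform_within_open[where S="{..<-2}"]) (use True E0 in auto)
  next
    case False
    have "(E has_real_derivative q t) (at t within {-3..t+1})"
      unfolding E_def[abs_def] by (rule integral_has_real_derivative[OF qc]) (use False in auto)
    then show ?thesis using False by (subst (asm) at_within_interior) auto
  qed
  have pE: "partial 1 E = q"
  proof
    fix t
    show "partial 1 E t = q t"
      using partial_eq[of E "(*) (q t)" t 1] Ed[of t] by (simp add: has_field_derivative_def)
  qed
  show thesis
  proof (rule that)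
    have "E differentiable at t" for t
      using Ed real_differentiable_def by blast
    then have "smooth_on UNIV E" using qs pE by (subst smooth_on_step) simp
    then show "E \<in> test_functions {..<T}"
      by (rule test_functionsI[of _ "{-2..S}"]) (use E0 S in auto)
    show "partial 1 E t = \<eta> t" if "0 \<le> t" for t
      using b0[of t] that by (simp add: pE q_def)
  qed
qed

lemma test_function_derivative:
  fixes \<theta> :: "real \<Rightarrow> real"
  assumes "\<theta> \<in> test_functions S"
  shows "(\<theta> has_real_derivative partial 1 \<theta> t) (at t)"
proof -
  have d: "\<theta> differentiable at t" using test_functions_differentiable[OF assms] .
  have "frechet_derivative \<theta> (at t) = (*) (partial 1 \<theta> t)"
    using frechet_eq_sum_partial[OF d] by (intro ext) simp
  then show ?thesis using has_derivative_frechet[OF d] by (simp add: has_field_derivative_def)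
qed

lemma integral_Ioo_eq:
  fixes f :: "real \<Rightarrow> real"
  assumes "integrable (lebesgue_on {a<..<b}) f"
  shows "(LINT s|lebesgue_on {a<..<b}. f s) = integral {a..b} f"
  using lebesgue_integral_eq_integral[OF assms] by (simp add: integral_open_interval_real)

lemma integrable_Ioo:
  fixes f :: "real \<Rightarrow> real"
  assumes "integrable (lebesgue_on {a..b}) f"
  shows "integrable (lebesgue_on {a<..<b}) f"
  by (rule integrable_lebesgue_on_subset[OF assms]) auto

text \<open>The explicit solution P satisfies the same weak equation, with the same initial value,
  by the product rule. Subtracting, \<theta>' is orthogonal to G - P, and by
  \<open>test_function_antiderivative\<close> every test function on (0,T) is such a
  \<theta>'.\<close>

lemma weak_ODE_solution:
  fixes F G :: "real \<Rightarrow> real"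
  assumes T: "0 < T" and G: "integrable (lebesgue_on {0<..<T}) G"
    and F: "F \<in> borel_measurable (lebesgue_on {0<..<T})" "AE t in lebesgue_on {0<..<T}. \<bar>F t\<bar> \<le> K"
    and weak: "\<And>\<theta>. \<theta> \<in> test_functions {..<T} \<Longrightarrow>
      (LINT t|lebesgue_on {0<..<T}. partial 1 \<theta> t * G t + \<theta> t * F t) + \<theta> 0 * G0 = 0"
  obtains F' P where "bounded_density F' \<bar>K\<bar> G0 P" "AE t in lebesgue_on {0<..<T}. F t = F' t"
    "AE t in lebesgue_on {0<..<T}. G t = P t"
proof -
  \<comment> \<open>F is clipped to its almost everywhere bound and set to zero outside (0,T), which
    changes it on a null set of times in (0,T) and makes it bounded everywhere.\<close>
  define F' where "F' t = (if t \<in> {0<..<T} then max (- \<bar>K\<bar>) (min \<bar>K\<bar> (F t)) else 0)" for t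
  define P where "P t = G0 + integral {0..t} F'" for t
  let ?M = "lebesgue_on {0<..<T}"
  have F'F: "AE t in ?M. F t = F' t"
    using F(2) by (rule lebesgue_on_mono) (auto simp: F'_def)
  have bd: "bounded_density F' \<bar>K\<bar> G0 P"
  proof
    have "(\<lambda>t. max (- \<bar>K\<bar>) (min \<bar>K\<bar> (F t))) \<in> borel_measurable ?M" using F(1) by simp
    then show "F' \<in> borel_measurable lebesgue"
      unfolding F'_def[abs_def] by (rule borel_measurable_if_I) simp
    show "\<bar>F' s\<bar> \<le> \<bar>K\<bar>" for s by (auto simp: F'_def)
  qed (simp add: P_def)
  interpret bd: bounded_density F' "\<bar>K\<bar>" G0 P by fact
  have Pi: "integrable ?M (\<lambda>t. c t * P t)" if "continuous_on {0..T} c" for c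
  proof -
    have "(\<lambda>t. c t * P t) absolutely_integrable_on {0..T}"
      using absolutely_integrable_continuous_real[OF continuous_on_mult[OF that bd.P_continuous]] .
    then have "integrable (lebesgue_on {0..T}) (\<lambda>t. c t * P t)"
      by (simp add: absolutely_integrable_imp_integrable)
    then show ?thesis by (rule integrable_Ioo)
  qed
  have F'i: "integrable ?M (\<lambda>t. c t * F' t)" if "continuous_on {0..T} c" for c
    using bd.int_mult[OF that] by (rule integrable_Ioo)
  have "AE t in ?M. G t - P t = 0"
  proof (rule AE_zero_if_test_integrals_zero)
    show "locally_integrable {0<..<T} (\<lambda>t. G t - P t)"
      unfolding locally_integrable_def
    proof safe
      fix K assume K: "compact K" "K \<subseteq> {0<..<T}"
      have "integrable ?M (\<lambda>t. G t - P t)" using G Pi[of "\<lambda>_. 1"] by simp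
      then show "integrable (lebesgue_on K) (\<lambda>t. G t - P t)"
        by (rule integrable_lebesgue_on_subset) (use K in \<open>auto simp: compact_imp_closed\<close>)
    qed
    fix \<eta> :: "real \<Rightarrow> real" assume \<eta>: "\<eta> \<in> test_functions {0<..<T}"
    obtain \<theta> where \<theta>: "\<theta> \<in> test_functions {..<T}" "\<And>t. 0 \<le> t \<Longrightarrow> partial 1 \<theta> t = \<eta> t"
      by (rule test_function_antiderivative[OF T \<eta>]) blast
    have d: "(\<theta> has_real_derivative partial 1 \<theta> t) (at t within A)" for t A
      using test_function_derivative[OF \<theta>(1)] by (rule has_field_derivative_at_within)
    note p\<theta> = test_functions_partial[OF \<theta>(1), of 1, simplified]
    note cp = test_functions_continuous[OF p\<theta>] and ct = test_functions_continuous[OF \<theta>(1)]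
    have Gi: "integrable ?M (\<lambda>t. partial 1 \<theta> t * G t)"
    proof -
      obtain B where "B > 0" "\<And>x. norm (partial 1 \<theta> x) \<le> B" by (rule test_functions_bounded[OF p\<theta>]) blast
      then show ?thesis
        using integrable_bounded_mult[OF G lebesgue_on_borel_measurable[OF test_functions_measurable[OF p\<theta>]], of B] by auto
    qed
    \<comment> \<open>The product rule for \<theta> P up to T, where \<theta> vanishes.\<close>
    have "0 = \<theta> 0 * G0 + integral {0..T} (\<lambda>s. partial 1 \<theta> s * P s + \<theta> s * F' s)"
      using bd.product_rule[OF d cp, where t=T and T=T] T test_functions_outside[OF \<theta>(1), of T] by simp
    also have "integral {0..T} (\<lambda>s. partial 1 \<theta> s * P s + \<theta> s * F' s) = (LINT s|?M. partial 1 \<theta> s * P s + \<theta> s * F' s)"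
      by (rule integral_Ioo_eq[symmetric]) (intro Bochner_Integration.integrable_add Pi F'i cp ct)
    finally have 1: "0 = \<theta> 0 * G0 + (LINT s|?M. partial 1 \<theta> s * P s) + (LINT s|?M. \<theta> s * F' s)"
      using Pi[OF cp] F'i[OF ct] by simp
    have aeq: "AE t in ?M. partial 1 \<theta> t * G t + \<theta> t * F t = partial 1 \<theta> t * G t + \<theta> t * F' t"
      using F'F by eventually_elim simp
    have "(LINT t|?M. partial 1 \<theta> t * G t + \<theta> t * F t) = (LINT t|?M. partial 1 \<theta> t * G t + \<theta> t * F' t)"
    proof (rule integral_cong_AE[OF _ _ aeq])
      show "(\<lambda>t. partial 1 \<theta> t * G t + \<theta> t * F t) \<in> borel_measurable ?M"
        using Gi F(1) lebesgue_on_borel_measurable[OF test_functions_measurable[OF \<theta>(1)]]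
        by (intro borel_measurable_add[OF borel_measurable_integrable[OF Gi]] borel_measurable_times) auto
      show "(\<lambda>t. partial 1 \<theta> t * G t + \<theta> t * F' t) \<in> borel_measurable ?M"
        using Gi F'i[OF ct] by (intro borel_measurable_integrable Bochner_Integration.integrable_add)
    qed
    then have 2: "0 = \<theta> 0 * G0 + (LINT s|?M. partial 1 \<theta> s * G s) + (LINT s|?M. \<theta> s * F' s)"
      using weak[OF \<theta>(1)] Gi F'i[OF ct] by simp
    have "(LINT t|?M. \<eta> t * (G t - P t)) = (LINT t|?M. partial 1 \<theta> t * G t - partial 1 \<theta> t * P t)"
      by (rule Bochner_Integration.integral_cong) (use \<theta>(2) in \<open>auto simp: algebra_simps\<close>)
    also have "\<dots> = 0" using 1 2 Gi Pi[OF cp] by simp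
    finally show "(LINT t|?M. \<eta> t * (G t - P t)) = 0" .
  qed simp
  then have "AE t in ?M. G t = P t" by eventually_elim simp
  then show thesis using that bd F'F by blast
qed

text \<open>If P 0 exceeded C, so would P on an interval of positive length. Bounds known for almost
  every positive time are thus carried to the initial time.\<close>

lemma AE_le_at_left_endpoint:
  fixes P :: "real \<Rightarrow> real"
  assumes T: "0 < T" and c: "continuous_on {0..T} P" and ae: "AE t in lebesgue_on {0<..<T}. P t \<le> C"
  shows "P 0 \<le> C"
proof (rule ccontr)
  assume "\<not> P 0 \<le> C"
  then have "0 < P 0 - C" by simp
  then obtain d where d: "d > 0" "\<And>t. t \<in> {0..T} \<Longrightarrow> dist t 0 < d \<Longrightarrow> dist (P t) (P 0) < P 0 - C"
    using c T unfolding continuous_on_iff by (metis atLeastAtMost_iff less_imp_le order_refl)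
  define e where "e = min d T"
  have e: "0 < e" using d T by (simp add: e_def)
  have "AE t in lebesgue. t \<notin> {0<..<e}"
  proof -
    have "AE t in lebesgue. t \<in> {0<..<T} \<longrightarrow> P t \<le> C"
      using ae by (simp add: AE_restrict_space_iff)
    then show ?thesis
    proof eventually_elim
      case (elim t)
      show ?case
      proof
        assume t: "t \<in> {0<..<e}"
        then have "dist (P t) (P 0) < P 0 - C" by (intro d(2)) (auto simp: e_def dist_real_def)
        moreover have "P t \<le> C" using elim t by (auto simp: e_def)
        ultimately show False by (simp add: dist_real_def)
      qed
    qed
  qed
  then have "emeasure lebesgue {0<..<e} = 0"
    using AE_iff_measurable[of "{0<..<e}" lebesgue "\<lambda>t. t \<notin> {0<..<e}"] by (auto simp: set_eq_iff)
  then show False using e by simp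
qed

lemma integrable_product_bound:
  fixes f :: "'a::euclidean_space \<times> 'b::euclidean_space \<Rightarrow> real" and k :: "'b \<Rightarrow> 'c::euclidean_space"
  assumes I: "open I" "I \<in> lmeasurable" and \<Omega>: "open \<Omega>"
    and f: "f \<in> borel_measurable (lebesgue_on (I \<times> \<Omega>))"
    and b: "AE z in lebesgue_on (I \<times> \<Omega>). \<bar>f z\<bar> \<le> B * norm (k (snd z))"
    and k: "continuous_on \<Omega> k" "integrable (lebesgue_on \<Omega>) k"
  shows "integrable (lebesgue_on (I \<times> \<Omega>)) f"
proof (rule Bochner_Integration.integrable_bound[OF _ f])
  have m: "(\<lambda>z. norm (k (snd z))) \<in> borel_measurable (lebesgue_on (I \<times> \<Omega>))"
  proof (rule lebesgue_on_continuous_measurable)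
    show "continuous_on (I \<times> \<Omega>) (\<lambda>z. norm (k (snd z)))"
      by (intro continuous_on_norm continuous_on_compose2[OF k(1)] continuous_on_snd continuous_on_id) auto
    show "I \<times> \<Omega> \<in> sets borel" using I \<Omega> by (intro borel_open open_Times)
  qed
  have "(\<integral>\<^sup>+z. ennreal (norm (norm (k (snd z)))) \<partial>lebesgue_on (I \<times> \<Omega>)) =
      (\<integral>\<^sup>+t. \<integral>\<^sup>+x. ennreal (norm (k x)) \<partial>lebesgue_on \<Omega> \<partial>lebesgue_on I)"
    using I \<Omega> m by (subst nn_integral_lebesgue_on_slices) auto
  also have "\<dots> = (\<integral>\<^sup>+x. ennreal (norm (k x)) \<partial>lebesgue_on \<Omega>) * emeasure (lebesgue_on I) (space (lebesgue_on I))"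
    by simp
  also have "\<dots> < \<infinity>"
  proof (rule ennreal_mult_less_top[THEN iffD2, simplified, unfolded infinity_ennreal_def[symmetric]], intro disjI2 conjI)
    show "(\<integral>\<^sup>+x. ennreal (norm (k x)) \<partial>lebesgue_on \<Omega>) < \<infinity>"
      using k(2) by (simp add: integrable_iff_bounded)
    show "emeasure (lebesgue_on I) (space (lebesgue_on I)) < \<infinity>"
      using I by (simp add: emeasure_restrict_space fmeasurable_def)
  qed
  finally have "integrable (lebesgue_on (I \<times> \<Omega>)) (\<lambda>z. norm (k (snd z)))"
    using m by (simp add: integrable_iff_bounded)
  then show "integrable (lebesgue_on (I \<times> \<Omega>)) (\<lambda>z. B * norm (k (snd z)))" by simp
  show "AE z in lebesgue_on (I \<times> \<Omega>). norm (f z) \<le> norm (B * norm (k (snd z)))"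
    using b by eventually_elim auto
qed

text \<open>Writes f_n . g_n - F . G as (f_n - F) . (g_n - G) + (f_n - F) . G + F . (g_n - G) and
  applies the Cauchy-Schwarz inequality to each term.\<close>

lemma L2_limit_inner:
  fixes f g :: "nat \<Rightarrow> 'a::euclidean_space \<Rightarrow> 'b::euclidean_space"
  assumes L: "\<And>n. f n \<in> L2 \<Omega>" "\<And>n. g n \<in> L2 \<Omega>" "F \<in> L2 \<Omega>" "G \<in> L2 \<Omega>"
    and f: "(\<lambda>n. LINT x|lebesgue_on \<Omega>. (norm (f n x - F x))\<^sup>2) \<longlonglongrightarrow> 0"
    and g: "(\<lambda>n. LINT x|lebesgue_on \<Omega>. (norm (g n x - G x))\<^sup>2) \<longlonglongrightarrow> 0"
  shows "(\<lambda>n. LINT x|lebesgue_on \<Omega>. \<bar>f n x \<bullet> g n x - F x \<bullet> G x\<bar>) \<longlonglongrightarrow> 0"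
proof -
  let ?M = "lebesgue_on \<Omega>"
  note df = L2_diff[OF L(1) L(3)] and dg = L2_diff[OF L(2) L(4)]
  define e where "e n = sqrt (LINT x|?M. (norm (f n x - F x))\<^sup>2)" for n
  define d where "d n = sqrt (LINT x|?M. (norm (g n x - G x))\<^sup>2)" for n
  have e0: "e \<longlonglongrightarrow> 0" using tendsto_real_sqrt[OF f] by (simp add: e_def[abs_def])
  have d0: "d \<longlonglongrightarrow> 0" using tendsto_real_sqrt[OF g] by (simp add: d_def[abs_def])
  let ?R = "\<lambda>n. e n * d n + e n * sqrt (LINT x|?M. (norm (G x))\<^sup>2) + sqrt (LINT x|?M. (norm (F x))\<^sup>2) * d n"
  have le: "(LINT x|?M. \<bar>f n x \<bullet> g n x - F x \<bullet> G x\<bar>) \<le> ?R n" for n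
  proof -
    have "(LINT x|?M. \<bar>f n x \<bullet> g n x - F x \<bullet> G x\<bar>) \<le>
       (LINT x|?M. norm (f n x - F x) * norm (g n x - G x) + norm (f n x - F x) * norm (G x) + norm (F x) * norm (g n x - G x))"
    proof (rule integral_mono)
      show "integrable ?M (\<lambda>x. \<bar>f n x \<bullet> g n x - F x \<bullet> G x\<bar>)"
        using L2_inner_integrable[OF L(1,2)] L2_inner_integrable[OF L(3,4)] by auto
      fix x
      have "f n x \<bullet> g n x - F x \<bullet> G x = (f n x - F x) \<bullet> (g n x - G x) + (f n x - F x) \<bullet> G x + F x \<bullet> (g n x - G x)"
        by (simp add: inner_diff_left inner_diff_right)
      then show "\<bar>f n x \<bullet> g n x - F x \<bullet> G x\<bar> \<le> norm (f n x - F x) * norm (g n x - G x) + norm (f n x - F x) * norm (G x) + norm (F x) * norm (g n x - G x)"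
        using Cauchy_Schwarz_ineq2[of "f n x - F x" "g n x - G x"] Cauchy_Schwarz_ineq2[of "f n x - F x" "G x"]
          Cauchy_Schwarz_ineq2[of "F x" "g n x - G x"] by linarith
    qed (intro Bochner_Integration.integrable_add L2_mult_integrable df dg L)
    also have "\<dots> = (LINT x|?M. norm (f n x - F x) * norm (g n x - G x)) + (LINT x|?M. norm (f n x - F x) * norm (G x)) + (LINT x|?M. norm (F x) * norm (g n x - G x))"
      using L2_mult_integrable[OF df dg] L2_mult_integrable[OF df L(4)] L2_mult_integrable[OF L(3) dg] by simp
    also have "\<dots> \<le> ?R n"
      unfolding e_def d_def by (intro add_mono L2_Cauchy_Schwarz_norm df dg L)
    finally show ?thesis .
  qed
  have "?R \<longlonglongrightarrow> 0 * 0 + 0 * sqrt (LINT x|?M. (norm (G x))\<^sup>2) + sqrt (LINT x|?M. (norm (F x))\<^sup>2) * 0"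
    by (intro tendsto_intros e0 d0)
  then have lim: "?R \<longlonglongrightarrow> 0" by simp
  show ?thesis
    by (rule real_tendsto_sandwich[OF _ _ tendsto_const lim]) (use le in \<open>auto intro!: always_eventually\<close>)
qed

section \<open>The energy equality for the semi-Galerkin approximations\<close>

definition grad :: "('a::euclidean_space \<Rightarrow> real) \<Rightarrow> 'a \<Rightarrow> 'a" where
  "grad f x = (\<Sum>b\<in>Basis. partial b f x *\<^sub>R b)"

lemma inner_grad: "v \<bullet> grad f x = (\<Sum>b\<in>Basis. (v \<bullet> b) * partial b f x)"
  unfolding grad_def by (simp add: inner_sum_right mult.commute)

lemma frechet_eq_inner_grad:
  "f differentiable at x \<Longrightarrow> frechet_derivative f (at x) v = v \<bullet> grad f x"
  by (simp add: frechet_eq_sum_partial inner_grad)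

lemma continuous_on_grad:
  assumes "\<And>b. b \<in> Basis \<Longrightarrow> continuous_on S (partial b f)" shows "continuous_on S (grad f)"
  unfolding grad_def[abs_def] by (intro continuous_on_sum continuous_on_scaleR continuous_on_const assms)

lemma test_functions_integrable:
  fixes \<phi> :: "'a::euclidean_space \<Rightarrow> 'b::euclidean_space"
  assumes "\<phi> \<in> test_functions S" "\<Omega> \<in> lmeasurable"
  shows "integrable (lebesgue_on \<Omega>) \<phi>"
proof -
  obtain B where "\<And>x. norm (\<phi> x) \<le> B" by (rule test_functions_bounded[OF assms(1)]) blast
  then show ?thesis
    using lebesgue_on_borel_measurable[OF test_functions_measurable[OF assms(1)]] assms(2)
    by (intro integrable_bounded_lebesgue_on[of _ _ B]) auto
qed

lemma tensor_test_function:
  fixes \<theta> :: "real \<Rightarrow> real" and \<psi> :: "'a::euclidean_space \<Rightarrow> real"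
  assumes \<theta>: "\<theta> \<in> test_functions I" and \<psi>: "\<psi> \<in> test_functions \<Omega>"
  shows "(\<lambda>z. \<theta> (fst z) * \<psi> (snd z)) \<in> test_functions (I \<times> \<Omega>)"
proof -
  obtain K where K: "compact K" "K \<subseteq> I" "\<And>x. x \<notin> K \<Longrightarrow> \<theta> x = 0"
    by (rule test_functionsE[OF \<theta>]) blast
  obtain L where L: "compact L" "L \<subseteq> \<Omega>" "\<And>x. x \<notin> L \<Longrightarrow> \<psi> x = 0"
    by (rule test_functionsE[OF \<psi>]) blast
  have "smooth_on UNIV (\<lambda>z::real \<times> 'a. \<theta> (fst z + 0) * \<psi> (snd z + 0))"
    by (intro smooth_mult smooth_affine bounded_linear_fst bounded_linear_snd test_functions_smooth[OF \<theta>] test_functions_smooth[OF \<psi>])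
  then have "smooth_on UNIV (\<lambda>z::real \<times> 'a. \<theta> (fst z) * \<psi> (snd z))" by simp
  moreover have "\<theta> (fst z) * \<psi> (snd z) = 0" if "z \<notin> K \<times> L" for z
  proof -
    have "fst z \<notin> K \<or> snd z \<notin> L" using that by (auto simp: mem_Times_iff)
    then show ?thesis using K(3) L(3) by auto
  qed
  ultimately show ?thesis
    using compact_Times[OF K(1) L(1)] K(2) L(2) by (intro test_functionsI[of _ "K \<times> L"]) auto
qed


section \<open>Transport of a bounded density by a bounded field\<close>

text \<open>One approximation seen from the density alone; later \<open>lo\<close> is 1/N and
  \<open>hi\<close> is M + 1/N. The bound on u is pointwise, so a flux is controlled by the L^1 norm
  of the tested gradient. The bounds on \<rho> concern positive times; those on
  \<open>\<rho>0\<close> follow from them in \<open>\<rho>0_bounds\<close>.\<close>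

locale transport =
  fixes \<Omega> :: "'a::euclidean_space set" and T lo hi U :: real and \<rho>0 :: "'a \<Rightarrow> real"
    and u :: "real \<times> 'a \<Rightarrow> 'a" and \<rho> :: "real \<times> 'a \<Rightarrow> real"
  assumes open_\<Omega>: "open \<Omega>" and bounded_\<Omega>: "bounded \<Omega>" and T: "0 < T"
    and lo: "0 \<le> lo"
    and \<rho>0: "\<rho>0 \<in> L2 \<Omega>"
    and u_measurable: "u \<in> borel_measurable (lebesgue_on ({0<..<T} \<times> \<Omega>))"
    and u_bound: "\<And>t x. t \<in> {0<..<T} \<Longrightarrow> x \<in> \<Omega> \<Longrightarrow> norm (u (t, x)) \<le> U"
    and \<rho>_measurable: "\<rho> \<in> borel_measurable (lebesgue_on ({0<..<T} \<times> \<Omega>))"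
    and \<rho>_bounds: "AE z in lebesgue_on ({0<..<T} \<times> \<Omega>). lo \<le> \<rho> z \<and> \<rho> z \<le> hi"
    and continuity: "continuity_equation \<Omega> T \<rho>0 u \<rho>"
begin

abbreviation "Q \<equiv> {0<..<T} \<times> \<Omega>"

lemma \<Omega>_lmeasurable: "\<Omega> \<in> lmeasurable"
  using open_\<Omega> bounded_\<Omega> by (simp add: lmeasurable_open)

lemma \<rho>_le: "AE z in lebesgue_on Q. \<bar>\<rho> z\<bar> \<le> hi"
  using \<rho>_bounds by eventually_elim (use lo in auto)

lemma slice_bounds: "AE t in lebesgue_on {0<..<T}. AE x in lebesgue_on \<Omega>. lo \<le> \<rho> (t, x) \<and> \<rho> (t, x) \<le> hi"
  by (rule AE_lebesgue_on_slices[OF _ _ \<rho>_bounds]) (use open_\<Omega> in auto)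

lemma slice_measurable: "AE t in lebesgue_on {0<..<T}. (\<lambda>x. \<rho> (t, x)) \<in> borel_measurable (lebesgue_on \<Omega>)"
proof -
  have "integrable (lebesgue_on Q) \<rho>"
    by (rule integrable_product_bound[where B=hi and k="\<lambda>x. 1::real"])
      (use open_\<Omega> \<rho>_measurable \<rho>_le finite_measure.integrable_const[OF finite_measure_lebesgue_on[OF \<Omega>_lmeasurable]] in auto)
  from Fubini_lebesgue_on(1)[OF _ _ this] open_\<Omega> show ?thesis
    by (auto elim!: eventually_mono)
qed

lemma slice_integrable:
  fixes h :: "'a \<Rightarrow> real"
  assumes "integrable (lebesgue_on \<Omega>) h"
  shows "AE t in lebesgue_on {0<..<T}. integrable (lebesgue_on \<Omega>) (\<lambda>x. \<rho> (t, x) * h x)"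
  using slice_bounds slice_measurable
proof eventually_elim
  case (elim t)
  have "AE x in lebesgue_on \<Omega>. \<bar>\<rho> (t, x)\<bar> \<le> hi"
    using elim(1) by eventually_elim (use lo in auto)
  from integrable_bounded_mult[OF assms elim(2) this] show ?case by simp
qed

lemma slice_integral_le:
  fixes h :: "'a \<Rightarrow> real"
  assumes "integrable (lebesgue_on \<Omega>) h"
  shows "AE t in lebesgue_on {0<..<T}. \<bar>LINT x|lebesgue_on \<Omega>. \<rho> (t, x) * h x\<bar> \<le> hi * (LINT x|lebesgue_on \<Omega>. \<bar>h x\<bar>)"
  using slice_bounds slice_integrable[OF assms]
proof eventually_elim
  case (elim t)
  have "\<bar>LINT x|lebesgue_on \<Omega>. \<rho> (t, x) * h x\<bar> \<le> (LINT x|lebesgue_on \<Omega>. \<bar>\<rho> (t, x) * h x\<bar>)"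
    by (rule integral_abs_bound)
  also have "\<dots> \<le> (LINT x|lebesgue_on \<Omega>. hi * \<bar>h x\<bar>)"
  proof (rule integral_mono_AE)
    show "AE x in lebesgue_on \<Omega>. \<bar>\<rho> (t, x) * h x\<bar> \<le> hi * \<bar>h x\<bar>"
      using elim(1) by eventually_elim (use lo in \<open>auto simp: abs_mult intro!: mult_right_mono\<close>)
  qed (use elim(2) assms in auto)
  finally show ?case by simp
qed

lemma u_slice_measurable: "AE t in lebesgue_on {0<..<T}. (\<lambda>x. u (t, x)) \<in> borel_measurable (lebesgue_on \<Omega>)"
proof -
  have "AE t in lebesgue_on {0<..<T}. (\<lambda>x. u (t, x) \<bullet> b) \<in> borel_measurable (lebesgue_on \<Omega>)" if "b \<in> Basis" for b
  proof -
    have "integrable (lebesgue_on Q) (\<lambda>z. u z \<bullet> b)"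
    proof (rule integrable_product_bound[where B=U and k="\<lambda>x. 1::real"])
      show "AE z in lebesgue_on Q. \<bar>u z \<bullet> b\<bar> \<le> U * norm (1::real)"
      proof (rule AE_I2)
        fix z assume "z \<in> space (lebesgue_on Q)"
        then have "norm (u z) \<le> U" using u_bound[of "fst z" "snd z"] by (auto simp: mem_Times_iff)
        then show "\<bar>u z \<bullet> b\<bar> \<le> U * norm (1::real)" using Basis_le_norm[OF that, of "u z"] by simp
      qed
    qed (use open_\<Omega> u_measurable finite_measure.integrable_const[OF finite_measure_lebesgue_on[OF \<Omega>_lmeasurable]] in auto)
    from Fubini_lebesgue_on(1)[OF _ _ this] open_\<Omega> show ?thesis
      by (auto elim!: eventually_mono)
  qed
  then have "AE t in lebesgue_on {0<..<T}. \<forall>b\<in>Basis. (\<lambda>x. u (t, x) \<bullet> b) \<in> borel_measurable (lebesgue_on \<Omega>)"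
    by (intro AE_finite_allI) auto
  then show ?thesis
    by eventually_elim (rule borel_measurable_euclidean_space[THEN iffD2])
qed

lemma flux_integrable:
  fixes g :: "'a \<Rightarrow> 'a"
  assumes "integrable (lebesgue_on \<Omega>) g"
  shows "AE t in lebesgue_on {0<..<T}. integrable (lebesgue_on \<Omega>) (\<lambda>x. u (t, x) \<bullet> g x) \<and>
    (LINT x|lebesgue_on \<Omega>. \<bar>u (t, x) \<bullet> g x\<bar>) \<le> U * (LINT x|lebesgue_on \<Omega>. norm (g x))"
  using u_slice_measurable AE_space
proof eventually_elim
  case (elim t)
  have b: "\<bar>u (t, x) \<bullet> g x\<bar> \<le> U * norm (g x)" if "x \<in> \<Omega>" for x
  proof -
    have "\<bar>u (t, x) \<bullet> g x\<bar> \<le> norm (u (t, x)) * norm (g x)" by (rule Cauchy_Schwarz_ineq2)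
    also have "\<dots> \<le> U * norm (g x)" using u_bound[of t x] that elim by (intro mult_right_mono) auto
    finally show ?thesis .
  qed
  have i: "integrable (lebesgue_on \<Omega>) (\<lambda>x. u (t, x) \<bullet> g x)"
  proof (rule Bochner_Integration.integrable_bound)
    show "integrable (lebesgue_on \<Omega>) (\<lambda>x. U * norm (g x))" using assms by simp
    show "(\<lambda>x. u (t, x) \<bullet> g x) \<in> borel_measurable (lebesgue_on \<Omega>)" using elim assms by simp
    show "AE x in lebesgue_on \<Omega>. norm (u (t, x) \<bullet> g x) \<le> norm (U * norm (g x))"
    proof (rule AE_I2)
      fix x assume "x \<in> space (lebesgue_on \<Omega>)"
      then have "\<bar>u (t, x) \<bullet> g x\<bar> \<le> U * norm (g x)" by (intro b) simp
      then show "norm (u (t, x) \<bullet> g x) \<le> norm (U * norm (g x))"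
        using abs_ge_self[of "U * norm (g x)"] by (simp only: real_norm_def)
    qed
  qed
  have "(LINT x|lebesgue_on \<Omega>. \<bar>u (t, x) \<bullet> g x\<bar>) \<le> (LINT x|lebesgue_on \<Omega>. U * norm (g x))"
    using i assms b by (intro integral_mono) auto
  then show ?case using i by simp
qed

text \<open>\<open>h\<close> can be used as a spatial test function in the continuity equation, with \<open>g\<close> in the role of its gradient.\<close>

definition tests :: "('a \<Rightarrow> real) \<Rightarrow> ('a \<Rightarrow> 'a) \<Rightarrow> bool" where
  "tests h g \<longleftrightarrow> continuous_on \<Omega> h \<and> integrable (lebesgue_on \<Omega>) h \<and> continuous_on \<Omega> g \<and> integrable (lebesgue_on \<Omega>) g \<and>
    (\<forall>\<theta>\<in>test_functions {..<T}.
      (LINT t|lebesgue_on {0<..<T}. partial 1 \<theta> t * (LINT x|lebesgue_on \<Omega>. \<rho> (t, x) * h x)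
         + \<theta> t * (LINT x|lebesgue_on \<Omega>. \<rho> (t, x) * (u (t, x) \<bullet> g x)))
      + \<theta> 0 * (LINT x|lebesgue_on \<Omega>. \<rho>0 x * h x) = 0)"

lemma mass_integrable:
  fixes h :: "'a \<Rightarrow> real"
  assumes "continuous_on \<Omega> h" "integrable (lebesgue_on \<Omega>) h"
  shows "integrable (lebesgue_on {0<..<T}) (\<lambda>t. LINT x|lebesgue_on \<Omega>. \<rho> (t, x) * h x)"
proof -
  have hm: "(\<lambda>z. h (snd z)) \<in> borel_measurable (lebesgue_on Q)"
  proof (rule lebesgue_on_continuous_measurable)
    show "continuous_on Q (\<lambda>z. h (snd z))"
      by (intro continuous_on_compose2[OF assms(1)] continuous_on_snd continuous_on_id) auto
    show "Q \<in> sets borel" using open_\<Omega> by (intro borel_open open_Times) auto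
  qed
  have "integrable (lebesgue_on Q) (\<lambda>z. \<rho> z * h (snd z))"
  proof (rule integrable_product_bound[where B=hi and k=h])
    show "AE z in lebesgue_on Q. \<bar>\<rho> z * h (snd z)\<bar> \<le> hi * norm (h (snd z))"
      using \<rho>_le by eventually_elim (auto simp: abs_mult intro: mult_right_mono)
  qed (use open_\<Omega> \<rho>_measurable hm assms in auto)
  from Fubini_lebesgue_on(2)[OF _ _ this] open_\<Omega> show ?thesis by simp
qed

lemma flux_time_integrable:
  fixes g :: "'a \<Rightarrow> 'a"
  assumes "continuous_on \<Omega> g" "integrable (lebesgue_on \<Omega>) g"
  shows "integrable (lebesgue_on {0<..<T}) (\<lambda>t. LINT x|lebesgue_on \<Omega>. \<rho> (t, x) * (u (t, x) \<bullet> g x))"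
proof -
  have gm: "(\<lambda>z. g (snd z)) \<in> borel_measurable (lebesgue_on Q)"
  proof (rule lebesgue_on_continuous_measurable)
    show "continuous_on Q (\<lambda>z. g (snd z))"
      by (intro continuous_on_compose2[OF assms(1)] continuous_on_snd continuous_on_id) auto
    show "Q \<in> sets borel" using open_\<Omega> by (intro borel_open open_Times) auto
  qed
  have "integrable (lebesgue_on Q) (\<lambda>z. \<rho> z * (u z \<bullet> g (snd z)))"
  proof (rule integrable_product_bound[where B="hi * U" and k=g])
    show "AE z in lebesgue_on Q. \<bar>\<rho> z * (u z \<bullet> g (snd z))\<bar> \<le> hi * U * norm (g (snd z))"
      using \<rho>_le AE_space
    proof eventually_elim
      case (elim z)
      have "\<bar>u z \<bullet> g (snd z)\<bar> \<le> norm (u z) * norm (g (snd z))" by (rule Cauchy_Schwarz_ineq2)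
      also have "\<dots> \<le> U * norm (g (snd z))" using u_bound[of "fst z" "snd z"] elim by (intro mult_right_mono) auto
      finally have "\<bar>\<rho> z\<bar> * \<bar>u z \<bullet> g (snd z)\<bar> \<le> hi * (U * norm (g (snd z)))"
        using elim(1) by (intro mult_mono) auto
      then show ?case by (simp add: abs_mult mult.assoc)
    qed
  qed (use open_\<Omega> \<rho>_measurable u_measurable gm assms in auto)
  from Fubini_lebesgue_on(2)[OF _ _ this] open_\<Omega> show ?thesis by simp
qed

text \<open>Product test functions \<theta>(t) \<psi>(x) reduce the continuity equation to a scalar
  weak differential equation in time for the integral of \<rho> \<psi>.\<close>

lemma tests_test_function:
  fixes \<psi> :: "'a \<Rightarrow> real"
  assumes \<psi>: "\<psi> \<in> test_functions \<Omega>"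
  shows "tests \<psi> (grad \<psi>)"
proof -
  note p = test_functions_partial[OF \<psi>]
  have c\<psi>: "continuous_on \<Omega> \<psi>" by (rule test_functions_continuous[OF \<psi>])
  have i\<psi>: "integrable (lebesgue_on \<Omega>) \<psi>" by (rule test_functions_integrable[OF \<psi> \<Omega>_lmeasurable])
  have cg: "continuous_on \<Omega> (grad \<psi>)" by (intro continuous_on_grad test_functions_continuous[OF p])
  have ig: "integrable (lebesgue_on \<Omega>) (grad \<psi>)"
    unfolding grad_def[abs_def] using test_functions_integrable[OF p \<Omega>_lmeasurable] by auto
  have "(LINT t|lebesgue_on {0<..<T}. partial 1 \<theta> t * (LINT x|lebesgue_on \<Omega>. \<rho> (t, x) * \<psi> x)
         + \<theta> t * (LINT x|lebesgue_on \<Omega>. \<rho> (t, x) * (u (t, x) \<bullet> grad \<psi> x)))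
      + \<theta> 0 * (LINT x|lebesgue_on \<Omega>. \<rho>0 x * \<psi> x) = 0" if \<theta>: "\<theta> \<in> test_functions {..<T}" for \<theta>
  proof -
    let ?\<phi> = "\<lambda>z. \<theta> (fst z) * \<psi> (snd z)"
    have \<phi>: "?\<phi> \<in> test_functions ({..<T} \<times> \<Omega>)" by (rule tensor_test_function[OF \<theta> \<psi>])
    have d1: "partial (1, 0) ?\<phi> (t, x) = partial 1 \<theta> t * \<psi> x" for t x
    proof -
      have "((\<lambda>z. \<theta> (fst z)) has_derivative (\<lambda>v. partial 1 \<theta> t * fst v)) (at (t, x))"
      proof -
        have "(\<theta> has_derivative (\<lambda>v. partial 1 \<theta> t * v)) (at (fst (t, x)))"
          using test_function_derivative[OF \<theta>, of t] by (simp add: has_field_derivative_def)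
        from has_derivative_compose[OF has_derivative_fst[OF has_derivative_ident] this] show ?thesis .
      qed
      moreover have "((\<lambda>z. \<psi> (snd z)) has_derivative (\<lambda>v. frechet_derivative \<psi> (at x) (snd v))) (at (t, x))"
      proof -
        have "(\<psi> has_derivative frechet_derivative \<psi> (at x)) (at (snd (t, x)))"
          using has_derivative_frechet[OF test_functions_differentiable[OF \<psi>], of x] by simp
        from has_derivative_compose[OF has_derivative_snd[OF has_derivative_ident] this] show ?thesis .
      qed
      ultimately have "(?\<phi> has_derivative (\<lambda>v. \<theta> t * frechet_derivative \<psi> (at x) (snd v) + partial 1 \<theta> t * fst v * \<psi> x)) (at (t, x))"
        using has_derivative_mult[of "\<lambda>z. \<theta> (fst z)" _ "(t, x)" UNIV "\<lambda>z. \<psi> (snd z)"] by simp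
      from partial_eq[OF this, of "(1, 0)"] show ?thesis
        using linear_0[OF linear_frechet_derivative[OF test_functions_differentiable[OF \<psi>]]] by simp
    qed
    have d2: "frechet_derivative (curry ?\<phi> t) (at x) v = \<theta> t * (v \<bullet> grad \<psi> x)" for t x v
    proof -
      have "((\<lambda>x. \<theta> t * \<psi> x) has_derivative (\<lambda>v. \<theta> t * frechet_derivative \<psi> (at x) v)) (at x)"
        using has_derivative_frechet[OF test_functions_differentiable[OF \<psi>], of x] by (rule has_derivative_mult_right)
      then have "frechet_derivative (\<lambda>x. \<theta> t * \<psi> x) (at x) = (\<lambda>v. \<theta> t * frechet_derivative \<psi> (at x) v)"
        by (rule frechet_derivative_at[symmetric])
      then show ?thesis
        by (simp add: curry_def frechet_eq_inner_grad[OF test_functions_differentiable[OF \<psi>]])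
    qed
    have "(LINT t|lebesgue_on {0<..<T}. LINT x|lebesgue_on \<Omega>.
           \<rho> (t, x) * (partial (1, 0) ?\<phi> (t, x) + frechet_derivative (curry ?\<phi> t) (at x) (u (t, x))))
        + (LINT x|lebesgue_on \<Omega>. \<rho>0 x * ?\<phi> (0, x)) = 0"
      using continuity \<phi> unfolding continuity_equation_def by blast
    then have 0: "(LINT t|lebesgue_on {0<..<T}. LINT x|lebesgue_on \<Omega>.
           \<rho> (t, x) * (partial 1 \<theta> t * \<psi> x + \<theta> t * (u (t, x) \<bullet> grad \<psi> x)))
        + (LINT x|lebesgue_on \<Omega>. \<rho>0 x * (\<theta> 0 * \<psi> x)) = 0"
      by (simp only: d1 d2 fst_conv snd_conv)
    have m: "(\<lambda>t. partial 1 \<theta> t * (LINT x|lebesgue_on \<Omega>. \<rho> (t, x) * \<psi> x)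
         + \<theta> t * (LINT x|lebesgue_on \<Omega>. \<rho> (t, x) * (u (t, x) \<bullet> grad \<psi> x))) \<in> borel_measurable (lebesgue_on {0<..<T})"
      using lebesgue_on_borel_measurable[OF test_functions_measurable[OF \<theta>]]
        lebesgue_on_borel_measurable[OF test_functions_measurable[OF test_functions_partial[OF \<theta>, of 1, simplified]]]
      by (intro borel_measurable_add borel_measurable_times borel_measurable_integrable[OF mass_integrable[OF c\<psi> i\<psi>]]
        borel_measurable_integrable[OF flux_time_integrable[OF cg ig]])
    have ae: "AE t in lebesgue_on {0<..<T}. partial 1 \<theta> t * (LINT x|lebesgue_on \<Omega>. \<rho> (t, x) * \<psi> x)
         + \<theta> t * (LINT x|lebesgue_on \<Omega>. \<rho> (t, x) * (u (t, x) \<bullet> grad \<psi> x))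
       = (LINT x|lebesgue_on \<Omega>. \<rho> (t, x) * (partial 1 \<theta> t * \<psi> x + \<theta> t * (u (t, x) \<bullet> grad \<psi> x)))"
      using slice_integrable[OF i\<psi>] flux_integrable[OF ig] slice_bounds slice_measurable
    proof eventually_elim
      case (elim t)
      have "AE x in lebesgue_on \<Omega>. \<bar>\<rho> (t, x)\<bar> \<le> hi"
        using elim(3) by eventually_elim (use lo in auto)
      from integrable_bounded_mult[OF conjunct1[OF elim(2)] elim(4) this]
      have "integrable (lebesgue_on \<Omega>) (\<lambda>x. \<rho> (t, x) * (u (t, x) \<bullet> grad \<psi> x))" by simp
      then have "(LINT x|lebesgue_on \<Omega>. partial 1 \<theta> t * (\<rho> (t, x) * \<psi> x) + \<theta> t * (\<rho> (t, x) * (u (t, x) \<bullet> grad \<psi> x)))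
         = partial 1 \<theta> t * (LINT x|lebesgue_on \<Omega>. \<rho> (t, x) * \<psi> x) + \<theta> t * (LINT x|lebesgue_on \<Omega>. \<rho> (t, x) * (u (t, x) \<bullet> grad \<psi> x))"
        using elim(1) by simp
      then show ?case by (simp add: algebra_simps)
    qed
    have "(LINT t|lebesgue_on {0<..<T}. partial 1 \<theta> t * (LINT x|lebesgue_on \<Omega>. \<rho> (t, x) * \<psi> x)
         + \<theta> t * (LINT x|lebesgue_on \<Omega>. \<rho> (t, x) * (u (t, x) \<bullet> grad \<psi> x)))
       = (LINT t|lebesgue_on {0<..<T}. LINT x|lebesgue_on \<Omega>. \<rho> (t, x) * (partial 1 \<theta> t * \<psi> x + \<theta> t * (u (t, x) \<bullet> grad \<psi> x)))"
      by (rule integral_cong_AE[OF m lebesgue_on_AE_measurable[OF m ae] ae]) simp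
    moreover have "(LINT x|lebesgue_on \<Omega>. \<rho>0 x * (\<theta> 0 * \<psi> x)) = \<theta> 0 * (LINT x|lebesgue_on \<Omega>. \<rho>0 x * \<psi> x)"
    proof -
      have "(\<lambda>x. \<rho>0 x * (\<theta> 0 * \<psi> x)) = (\<lambda>x. \<theta> 0 * (\<rho>0 x * \<psi> x))" by (simp add: mult.left_commute)
      then show ?thesis by simp
    qed
    ultimately show ?thesis using 0 by simp
  qed
  then show ?thesis unfolding tests_def using c\<psi> i\<psi> cg ig by blast
qed

lemma slice_flux_le:
  fixes g :: "'a \<Rightarrow> 'a"
  assumes "integrable (lebesgue_on \<Omega>) g"
  shows "AE t in lebesgue_on {0<..<T}. integrable (lebesgue_on \<Omega>) (\<lambda>x. \<rho> (t, x) * (u (t, x) \<bullet> g x)) \<and>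
    \<bar>LINT x|lebesgue_on \<Omega>. \<rho> (t, x) * (u (t, x) \<bullet> g x)\<bar> \<le> hi * (U * (LINT x|lebesgue_on \<Omega>. norm (g x)))"
  using flux_integrable[OF assms] slice_bounds slice_measurable
proof eventually_elim
  case (elim t)
  have ae: "AE x in lebesgue_on \<Omega>. \<bar>\<rho> (t, x)\<bar> \<le> hi" using elim(2) by eventually_elim (use lo in auto)
  have i: "integrable (lebesgue_on \<Omega>) (\<lambda>x. \<rho> (t, x) * (u (t, x) \<bullet> g x))"
    using integrable_bounded_mult[OF conjunct1[OF elim(1)] elim(3) ae] by simp
  have "\<bar>LINT x|lebesgue_on \<Omega>. \<rho> (t, x) * (u (t, x) \<bullet> g x)\<bar> \<le> (LINT x|lebesgue_on \<Omega>. \<bar>\<rho> (t, x) * (u (t, x) \<bullet> g x)\<bar>)"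
    by (rule integral_abs_bound)
  also have "\<dots> \<le> (LINT x|lebesgue_on \<Omega>. \<bar>hi\<bar> * \<bar>u (t, x) \<bullet> g x\<bar>)"
  proof (rule integral_mono_AE)
    show "AE x in lebesgue_on \<Omega>. \<bar>\<rho> (t, x) * (u (t, x) \<bullet> g x)\<bar> \<le> \<bar>hi\<bar> * \<bar>u (t, x) \<bullet> g x\<bar>"
      using ae by eventually_elim (auto simp: abs_mult intro!: mult_right_mono)
  qed (use i elim(1) in auto)
  also have "\<dots> \<le> \<bar>hi\<bar> * (U * (LINT x|lebesgue_on \<Omega>. norm (g x)))"
    using elim(1) by (auto intro: mult_left_mono)
  finally have le: "\<bar>LINT x|lebesgue_on \<Omega>. \<rho> (t, x) * (u (t, x) \<bullet> g x)\<bar> \<le> \<bar>hi\<bar> * (U * (LINT x|lebesgue_on \<Omega>. norm (g x)))" .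
  show ?case
  proof (cases "0 \<le> hi")
    case True then show ?thesis using le i by simp
  next
    \<comment> \<open>A negative upper bound contradicts the lower bound 0, so the slice bounds can
      hold almost everywhere only if \<Omega> is null, and then all integrals vanish.\<close>
    case False
    have "AE x in lebesgue_on \<Omega>. False" by (rule eventually_mono[OF ae]) (use False in linarith)
    then have "(LINT x|lebesgue_on \<Omega>. f x) = 0" for f :: "'a \<Rightarrow> real"
      by (intro integral_eq_zero_AE) (auto elim: eventually_mono)
    then show ?thesis using i by simp
  qed
qed

text \<open>\<open>weak_ODE_solution\<close> with the mass as unknown and the flux as its
  derivative. The Lipschitz representative P is what gives the mass a value at time 0.\<close>

lemma tests_evolution:
  assumes "tests h g"
  obtains F P K where "bounded_density F K (LINT x|lebesgue_on \<Omega>. \<rho>0 x * h x) P"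
    "AE t in lebesgue_on {0<..<T}. (LINT x|lebesgue_on \<Omega>. \<rho> (t, x) * (u (t, x) \<bullet> g x)) = F t"
    "AE t in lebesgue_on {0<..<T}. (LINT x|lebesgue_on \<Omega>. \<rho> (t, x) * h x) = P t"
proof -
  have h: "continuous_on \<Omega> h" "integrable (lebesgue_on \<Omega>) h" and g: "continuous_on \<Omega> g" "integrable (lebesgue_on \<Omega>) g"
    using assms unfolding tests_def by blast+
  note b = eventually_mono[OF slice_flux_le[OF g(2)] conjunct2]
  show thesis
    by (rule weak_ODE_solution[OF T mass_integrable[OF h] borel_measurable_integrable[OF flux_time_integrable[OF g]] b])
      (use assms that in \<open>auto simp: tests_def\<close>)
qed

end

lemma L2_imp_integrable:
  fixes f :: "'a::euclidean_space \<Rightarrow> 'b::euclidean_space"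
  assumes "f \<in> L2 \<Omega>" "\<Omega> \<in> lmeasurable"
  shows "integrable (lebesgue_on \<Omega>) f"
proof (rule Bochner_Integration.integrable_bound)
  interpret finite_measure "lebesgue_on \<Omega>" by (rule finite_measure_lebesgue_on[OF assms(2)])
  show "integrable (lebesgue_on \<Omega>) (\<lambda>x. 1 + (norm (f x))\<^sup>2)" using L2_integrable[OF assms(1)] by simp
  have "norm y \<le> 1 + (norm y)\<^sup>2" for y :: 'b
  proof -
    have "2 * norm y \<le> (norm y)\<^sup>2 + 1" using sum_squares_bound[of "norm y" 1] by simp
    then show ?thesis using norm_ge_zero[of y] by linarith
  qed
  then show "AE x in lebesgue_on \<Omega>. norm (f x) \<le> norm (1 + (norm (f x))\<^sup>2)"
    by (intro AE_I2) (simp add: add_nonneg_nonneg)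
qed (use assms in \<open>simp add: L2_iff\<close>)

lemma weak_partial_square_le:
  assumes "open \<Omega>" "f \<in> Sobolev \<Omega> 1" "b \<in> Basis"
  shows "(LINT x|lebesgue_on \<Omega>. (norm (weak_partials \<Omega> [b] f x))\<^sup>2) \<le> H1_square \<Omega> f"
proof -
  have "(LINT x|lebesgue_on \<Omega>. (norm (weak_partials \<Omega> [b] f x))\<^sup>2) \<le> (\<Sum>b\<in>Basis. LINT x|lebesgue_on \<Omega>. (norm (weak_partials \<Omega> [b] f x))\<^sup>2)"
    by (rule member_le_sum) (use assms in auto)
  then show ?thesis
    using gradient_inner_le_H1_square[of \<Omega> f] by (simp add: gradient_inner_def power2_norm_eq_inner)
qed

lemma gradient_inner_sum_left:
  fixes f :: "'i \<Rightarrow> 'a::euclidean_space \<Rightarrow> 'b::euclidean_space"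
  assumes \<Omega>: "open \<Omega>" and h: "h \<in> Sobolev \<Omega> 1" and f: "\<And>k. k \<in> I \<Longrightarrow> f k \<in> Sobolev \<Omega> 1" and fin: "finite I"
    and z: "(\<lambda>x::'a. 0::'b) \<in> Sobolev \<Omega> 1"
  shows "(\<lambda>x. \<Sum>k\<in>I. r k *\<^sub>R f k x) \<in> Sobolev \<Omega> 1 \<and>
    gradient_inner \<Omega> (\<lambda>x. \<Sum>k\<in>I. r k *\<^sub>R f k x) h = (\<Sum>k\<in>I. r k * gradient_inner \<Omega> (f k) h)"
  using fin f
proof (induction I rule: finite_induct)
  case empty
  have "gradient_inner \<Omega> (\<lambda>x. 0 *\<^sub>R h x) h = 0" using gradient_inner_scaleR_left[OF \<Omega> h h, of 0] by simp
  then show ?case using z by simp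
next
  case (insert k I)
  have S: "(\<lambda>x. r k *\<^sub>R f k x) \<in> Sobolev \<Omega> 1" by (rule Sobolev_scaleR[OF \<Omega>]) (use insert in auto)
  have IH: "(\<lambda>x. \<Sum>k\<in>I. r k *\<^sub>R f k x) \<in> Sobolev \<Omega> 1"
    "gradient_inner \<Omega> (\<lambda>x. \<Sum>k\<in>I. r k *\<^sub>R f k x) h = (\<Sum>k\<in>I. r k * gradient_inner \<Omega> (f k) h)"
    using insert by auto
  show ?case
    using insert.hyps Sobolev_add[OF \<Omega> S IH(1)] gradient_inner_add_left[OF \<Omega> S IH(1) h] IH(2)
      gradient_inner_scaleR_left[OF \<Omega> _ h, of "f k" "r k"] insert.prems[of k] by simp
qed

lemma integral_cong_AE_Ioo:
  fixes f g :: "real \<Rightarrow> real"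
  assumes ae: "AE s in lebesgue_on {0<..<T}. f s = g s" and "t \<le> T"
  shows "integral {0..t} f = integral {0..t} g"
proof -
  have "AE s in lebesgue. \<not> (s \<in> {0<..<T} \<and> f s \<noteq> g s)"
    using ae by (simp add: AE_restrict_space_iff) (erule eventually_mono, auto)
  then have "{s. s \<in> {0<..<T} \<and> f s \<noteq> g s} \<in> null_sets lebesgue"
    by (rule back_subst[of "\<lambda>S. S \<in> null_sets lebesgue", OF completion.AE_iff_null_sets[THEN iffD1]]) auto
  then have n: "negligible {s. s \<in> {0<..<T} \<and> f s \<noteq> g s}" by (simp add: negligible_iff_null_sets)
  have "integral {0<..<t} f = integral {0<..<t} g"
    by (rule integral_spike[OF n]) (use assms(2) in auto)
  then show ?thesis by (simp add: integral_open_interval_real)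
qed

context transport
begin

text \<open>For \<psi> \<ge> 0 the mass lies between \<open>lo\<close> and \<open>hi\<close> times
  the integral of \<psi> at almost every time. Its continuous representative keeps these bounds at
  time 0, and there it is the initial mass; varying \<psi> gives the bounds pointwise.\<close>

lemma \<rho>0_bounds: "AE x in lebesgue_on \<Omega>. lo \<le> \<rho>0 x \<and> \<rho>0 x \<le> hi"
proof -
  have fin: "finite_measure (lebesgue_on \<Omega>)" by (rule finite_measure_lebesgue_on[OF \<Omega>_lmeasurable])
  have i0: "integrable (lebesgue_on \<Omega>) \<rho>0" by (rule L2_imp_integrable[OF \<rho>0 \<Omega>_lmeasurable])
  have key: "lo * (LINT x|lebesgue_on \<Omega>. \<psi> x) \<le> (LINT x|lebesgue_on \<Omega>. \<rho>0 x * \<psi> x) \<and>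
      (LINT x|lebesgue_on \<Omega>. \<rho>0 x * \<psi> x) \<le> hi * (LINT x|lebesgue_on \<Omega>. \<psi> x)"
    if \<psi>: "\<psi> \<in> test_functions \<Omega>" "\<forall>x. 0 \<le> \<psi> x" for \<psi>
  proof -
    obtain F P K where P: "bounded_density F K (LINT x|lebesgue_on \<Omega>. \<rho>0 x * \<psi> x) P"
      "AE t in lebesgue_on {0<..<T}. (LINT x|lebesgue_on \<Omega>. \<rho> (t, x) * \<psi> x) = P t"
      by (rule tests_evolution[OF tests_test_function[OF \<psi>(1)]]) blast
    interpret P: bounded_density F K "LINT x|lebesgue_on \<Omega>. \<rho>0 x * \<psi> x" P by fact
    \<comment> \<open>The mass itself is tied to the equation at almost every time only and says
      nothing at 0; its representative does.\<close>
    have P0: "P 0 = (LINT x|lebesgue_on \<Omega>. \<rho>0 x * \<psi> x)" by (simp add: P.P)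
    have i: "integrable (lebesgue_on \<Omega>) \<psi>" by (rule test_functions_integrable[OF \<psi>(1) \<Omega>_lmeasurable])
    have b: "AE t in lebesgue_on {0<..<T}. lo * (LINT x|lebesgue_on \<Omega>. \<psi> x) \<le> P t \<and> P t \<le> hi * (LINT x|lebesgue_on \<Omega>. \<psi> x)"
      using slice_bounds slice_integrable[OF i] P(2)
    proof eventually_elim
      case (elim t)
      have "(LINT x|lebesgue_on \<Omega>. lo * \<psi> x) \<le> (LINT x|lebesgue_on \<Omega>. \<rho> (t, x) * \<psi> x)"
      proof (rule integral_mono_AE)
        show "AE x in lebesgue_on \<Omega>. lo * \<psi> x \<le> \<rho> (t, x) * \<psi> x"
          using elim(1) by eventually_elim (use \<psi>(2) in \<open>auto intro: mult_right_mono\<close>)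
      qed (use i elim(2) in auto)
      moreover have "(LINT x|lebesgue_on \<Omega>. \<rho> (t, x) * \<psi> x) \<le> (LINT x|lebesgue_on \<Omega>. hi * \<psi> x)"
      proof (rule integral_mono_AE)
        show "AE x in lebesgue_on \<Omega>. \<rho> (t, x) * \<psi> x \<le> hi * \<psi> x"
          using elim(1) by eventually_elim (use \<psi>(2) in \<open>auto intro: mult_right_mono\<close>)
      qed (use i elim(2) in auto)
      ultimately show ?case using elim(3) by simp
    qed
    have "P 0 \<le> hi * (LINT x|lebesgue_on \<Omega>. \<psi> x)"
      by (rule AE_le_at_left_endpoint[OF T P.P_continuous]) (use b in eventually_elim, simp)
    moreover have "- P 0 \<le> - (lo * (LINT x|lebesgue_on \<Omega>. \<psi> x))"
      by (rule AE_le_at_left_endpoint[OF T continuous_on_minus[OF P.P_continuous]]) (use b in eventually_elim, simp)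
    ultimately show ?thesis using P0 by simp
  qed
  have i\<psi>: "integrable (lebesgue_on \<Omega>) \<psi>" "integrable (lebesgue_on \<Omega>) (\<lambda>x. \<psi> x * \<rho>0 x)"
    if \<psi>: "\<psi> \<in> test_functions \<Omega>" for \<psi> :: "'a \<Rightarrow> real"
  proof -
    show "integrable (lebesgue_on \<Omega>) \<psi>" by (rule test_functions_integrable[OF \<psi> \<Omega>_lmeasurable])
    obtain B where "\<And>x. norm (\<psi> x) \<le> B" by (rule test_functions_bounded[OF \<psi>]) blast
    then show "integrable (lebesgue_on \<Omega>) (\<lambda>x. \<psi> x * \<rho>0 x)"
      using integrable_bounded_mult[OF i0 lebesgue_on_borel_measurable[OF test_functions_measurable[OF \<psi>]], of B] by auto
  qed
  have "AE x in lebesgue_on \<Omega>. 0 \<le> \<rho>0 x - lo"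
  proof (rule AE_nonneg_if_test_integrals_nonneg[OF open_\<Omega>])
    show "integrable (lebesgue_on \<Omega>) (\<lambda>x. \<rho>0 x - lo)" by (intro Bochner_Integration.integrable_diff i0 finite_measure.integrable_const[OF fin])
    fix \<psi> :: "'a \<Rightarrow> real" assume \<psi>: "\<psi> \<in> test_functions \<Omega>" "\<forall>x. 0 \<le> \<psi> x"
    have "(LINT x|lebesgue_on \<Omega>. \<psi> x * (\<rho>0 x - lo)) = (LINT x|lebesgue_on \<Omega>. \<psi> x * \<rho>0 x - lo * \<psi> x)"
      by (simp add: algebra_simps)
    also have "\<dots> = (LINT x|lebesgue_on \<Omega>. \<psi> x * \<rho>0 x) - lo * (LINT x|lebesgue_on \<Omega>. \<psi> x)" using i\<psi>[OF \<psi>(1)] by simp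
    also have "\<dots> \<ge> 0" using key[OF \<psi>] by (simp add: mult.commute[of _ "\<rho>0 _"])
    finally show "0 \<le> (LINT x|lebesgue_on \<Omega>. \<psi> x * (\<rho>0 x - lo))" .
  qed
  moreover have "AE x in lebesgue_on \<Omega>. 0 \<le> hi - \<rho>0 x"
  proof (rule AE_nonneg_if_test_integrals_nonneg[OF open_\<Omega>])
    show "integrable (lebesgue_on \<Omega>) (\<lambda>x. hi - \<rho>0 x)" by (intro Bochner_Integration.integrable_diff i0 finite_measure.integrable_const[OF fin])
    fix \<psi> :: "'a \<Rightarrow> real" assume \<psi>: "\<psi> \<in> test_functions \<Omega>" "\<forall>x. 0 \<le> \<psi> x"
    have "(LINT x|lebesgue_on \<Omega>. \<psi> x * (hi - \<rho>0 x)) = (LINT x|lebesgue_on \<Omega>. hi * \<psi> x - \<psi> x * \<rho>0 x)"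
      by (simp add: algebra_simps)
    also have "\<dots> = hi * (LINT x|lebesgue_on \<Omega>. \<psi> x) - (LINT x|lebesgue_on \<Omega>. \<psi> x * \<rho>0 x)" using i\<psi>[OF \<psi>(1)] by simp
    also have "\<dots> \<ge> 0" using key[OF \<psi>] by (simp add: mult.commute[of _ "\<rho>0 _"])
    finally show "0 \<le> (LINT x|lebesgue_on \<Omega>. \<psi> x * (hi - \<rho>0 x))" .
  qed
  ultimately show ?thesis by eventually_elim auto
qed

lemma \<rho>0_mult_integrable:
  fixes h :: "'a \<Rightarrow> real"
  assumes "integrable (lebesgue_on \<Omega>) h"
  shows "integrable (lebesgue_on \<Omega>) (\<lambda>x. \<rho>0 x * h x)"
    and "\<bar>LINT x|lebesgue_on \<Omega>. \<rho>0 x * h x\<bar> \<le> \<bar>hi\<bar> * (LINT x|lebesgue_on \<Omega>. \<bar>h x\<bar>)"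
proof -
  have b: "AE x in lebesgue_on \<Omega>. \<bar>\<rho>0 x\<bar> \<le> \<bar>hi\<bar>" using \<rho>0_bounds by eventually_elim (use lo in auto)
  show i: "integrable (lebesgue_on \<Omega>) (\<lambda>x. \<rho>0 x * h x)"
    using integrable_bounded_mult[OF assms _ b] L2_measurable[OF \<rho>0] by simp
  have "\<bar>LINT x|lebesgue_on \<Omega>. \<rho>0 x * h x\<bar> \<le> (LINT x|lebesgue_on \<Omega>. \<bar>\<rho>0 x * h x\<bar>)" by (rule integral_abs_bound)
  also have "\<dots> \<le> (LINT x|lebesgue_on \<Omega>. \<bar>hi\<bar> * \<bar>h x\<bar>)"
  proof (rule integral_mono_AE)
    show "AE x in lebesgue_on \<Omega>. \<bar>\<rho>0 x * h x\<bar> \<le> \<bar>hi\<bar> * \<bar>h x\<bar>"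
      using b by eventually_elim (auto simp: abs_mult intro: mult_right_mono)
  qed (use i assms in auto)
  finally show "\<bar>LINT x|lebesgue_on \<Omega>. \<rho>0 x * h x\<bar> \<le> \<bar>hi\<bar> * (LINT x|lebesgue_on \<Omega>. \<bar>h x\<bar>)" by simp
qed

text \<open>As \<rho>, u and \<open>\<rho>0\<close> are bounded, each term of the tested equation is
  continuous in the L^1 norms of h and g. Admissible pairs are therefore closed under W^{1,1}
  convergence; the initial term is the reason for proving \<open>\<rho>0_bounds\<close>
  beforehand.\<close>

lemma tests_limit:
  assumes t: "\<And>n::nat. tests (\<psi> n) (\<gamma> n)"
    and h: "continuous_on \<Omega> h" "integrable (lebesgue_on \<Omega>) h" and g: "continuous_on \<Omega> g" "integrable (lebesgue_on \<Omega>) g"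
    and limh: "(\<lambda>n. LINT x|lebesgue_on \<Omega>. \<bar>\<psi> n x - h x\<bar>) \<longlonglongrightarrow> 0"
    and limg: "(\<lambda>n. LINT x|lebesgue_on \<Omega>. norm (\<gamma> n x - g x)) \<longlonglongrightarrow> 0"
  shows "tests h g"
  unfolding tests_def
proof (intro conjI h g ballI)
  fix \<theta> :: "real \<Rightarrow> real" assume \<theta>: "\<theta> \<in> test_functions {..<T}"
  note p\<theta> = test_functions_partial[OF \<theta>, of 1, simplified]
  note m\<theta> = lebesgue_on_borel_measurable[OF test_functions_measurable[OF \<theta>]] lebesgue_on_borel_measurable[OF test_functions_measurable[OF p\<theta>]]
  obtain B where B: "B > 0" "\<And>x. norm (\<theta> x) \<le> B" by (rule test_functions_bounded[OF \<theta>]) blast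
  obtain B' where B': "B' > 0" "\<And>x. norm (partial 1 \<theta> x) \<le> B'" by (rule test_functions_bounded[OF p\<theta>]) blast
  have n: "continuous_on \<Omega> (\<psi> n)" "integrable (lebesgue_on \<Omega>) (\<psi> n)" "continuous_on \<Omega> (\<gamma> n)" "integrable (lebesgue_on \<Omega>) (\<gamma> n)" for n
    using t[of n] unfolding tests_def by blast+
  let ?G = "\<lambda>h t. LINT x|lebesgue_on \<Omega>. \<rho> (t, x) * h x"
  let ?F = "\<lambda>g t. LINT x|lebesgue_on \<Omega>. \<rho> (t, x) * (u (t, x) \<bullet> g x)"
  let ?L = "\<lambda>h g. (LINT t|lebesgue_on {0<..<T}. partial 1 \<theta> t * ?G h t + \<theta> t * ?F g t) + \<theta> 0 * (LINT x|lebesgue_on \<Omega>. \<rho>0 x * h x)"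
  have int: "integrable (lebesgue_on {0<..<T}) (\<lambda>t. partial 1 \<theta> t * ?G h t + \<theta> t * ?F g t)"
    if "continuous_on \<Omega> h" "integrable (lebesgue_on \<Omega>) h" "continuous_on \<Omega> g" "integrable (lebesgue_on \<Omega>) g" for h g
  proof (rule Bochner_Integration.integrable_add)
    show "integrable (lebesgue_on {0<..<T}) (\<lambda>t. partial 1 \<theta> t * ?G h t)"
      using integrable_bounded_mult[OF mass_integrable[OF that(1,2)] m\<theta>(2), of B'] B' by auto
    show "integrable (lebesgue_on {0<..<T}) (\<lambda>t. \<theta> t * ?F g t)"
      using integrable_bounded_mult[OF flux_time_integrable[OF that(3,4)] m\<theta>(1), of B] B by auto
  qed
  define \<epsilon> where "\<epsilon> n = (LINT x|lebesgue_on \<Omega>. \<bar>\<psi> n x - h x\<bar>)" for n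
  define \<delta> where "\<delta> n = (LINT x|lebesgue_on \<Omega>. norm (\<gamma> n x - g x))" for n
  \<comment> \<open>The mass and flux errors, integrated over (0,T), plus the error of the initial
    term.\<close>
  let ?R = "\<lambda>n. (B' * (hi * \<epsilon> n) + B * (hi * (U * \<delta> n))) * T + B * (\<bar>hi\<bar> * \<epsilon> n)"
  have le: "\<bar>?L (\<psi> n) (\<gamma> n) - ?L h g\<bar> \<le> ?R n" for n
  proof -
    have i1: "integrable (lebesgue_on \<Omega>) (\<lambda>x. \<psi> n x - h x)" and i2: "integrable (lebesgue_on \<Omega>) (\<lambda>x. \<gamma> n x - g x)"
      using n h g by auto
    have ae: "AE t in lebesgue_on {0<..<T}. \<bar>(partial 1 \<theta> t * ?G (\<psi> n) t + \<theta> t * ?F (\<gamma> n) t) - (partial 1 \<theta> t * ?G h t + \<theta> t * ?F g t)\<bar>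
       \<le> B' * (hi * \<epsilon> n) + B * (hi * (U * \<delta> n))"
      using slice_integral_le[OF i1] slice_flux_le[OF i2] slice_integrable[OF n(2)[of n]] slice_integrable[OF h(2)]
        slice_flux_le[OF n(4)[of n]] slice_flux_le[OF g(2)]
    proof eventually_elim
      case (elim t)
      have G: "?G (\<lambda>x. \<psi> n x - h x) t = ?G (\<psi> n) t - ?G h t"
        using elim(3,4) by (simp add: right_diff_distrib)
      have F: "?F (\<lambda>x. \<gamma> n x - g x) t = ?F (\<gamma> n) t - ?F g t"
        using elim(5,6) by (simp add: right_diff_distrib inner_diff_right)
      have "(partial 1 \<theta> t * ?G (\<psi> n) t + \<theta> t * ?F (\<gamma> n) t) - (partial 1 \<theta> t * ?G h t + \<theta> t * ?F g t)
         = partial 1 \<theta> t * ?G (\<lambda>x. \<psi> n x - h x) t + \<theta> t * ?F (\<lambda>x. \<gamma> n x - g x) t"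
        unfolding G F by (simp add: algebra_simps)
      moreover have "\<bar>partial 1 \<theta> t * ?G (\<lambda>x. \<psi> n x - h x) t\<bar> \<le> B' * (hi * \<epsilon> n)"
        using elim(1) B'(2)[of t] B'(1) unfolding \<epsilon>_def abs_mult by (intro mult_mono) auto
      moreover have "\<bar>\<theta> t * ?F (\<lambda>x. \<gamma> n x - g x) t\<bar> \<le> B * (hi * (U * \<delta> n))"
        using elim(2) B(2)[of t] B(1) unfolding \<delta>_def abs_mult by (intro mult_mono) auto
      ultimately show ?case by linarith
    qed
    have fT: "finite_measure (lebesgue_on {0<..<T})" by (rule finite_measure_lebesgue_on) auto
    have mT: "measure (lebesgue_on {0<..<T}) {0<..<T} = T"
      using T by (simp add: measure_restrict_space)
    have "\<bar>(LINT t|lebesgue_on {0<..<T}. partial 1 \<theta> t * ?G (\<psi> n) t + \<theta> t * ?F (\<gamma> n) t)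
       - (LINT t|lebesgue_on {0<..<T}. partial 1 \<theta> t * ?G h t + \<theta> t * ?F g t)\<bar>
      = \<bar>LINT t|lebesgue_on {0<..<T}. (partial 1 \<theta> t * ?G (\<psi> n) t + \<theta> t * ?F (\<gamma> n) t) - (partial 1 \<theta> t * ?G h t + \<theta> t * ?F g t)\<bar>"
      by (subst Bochner_Integration.integral_diff[OF int[OF n] int[OF h g]]) (rule refl)
    also have "\<dots> \<le> (LINT t|lebesgue_on {0<..<T}. \<bar>(partial 1 \<theta> t * ?G (\<psi> n) t + \<theta> t * ?F (\<gamma> n) t) - (partial 1 \<theta> t * ?G h t + \<theta> t * ?F g t)\<bar>)"
      by (rule integral_abs_bound)
    also have "\<dots> \<le> (LINT t|lebesgue_on {0<..<T}. B' * (hi * \<epsilon> n) + B * (hi * (U * \<delta> n)))"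
      by (rule integral_mono_AE[OF _ _ ae])
        (use int[OF n] int[OF h g] finite_measure.integrable_const[OF fT] in \<open>auto intro!: Bochner_Integration.integrable_diff\<close>)
    also have "\<dots> = (B' * (hi * \<epsilon> n) + B * (hi * (U * \<delta> n))) * T"
      using mT by simp
    finally have 1: "\<bar>(LINT t|lebesgue_on {0<..<T}. partial 1 \<theta> t * ?G (\<psi> n) t + \<theta> t * ?F (\<gamma> n) t)
       - (LINT t|lebesgue_on {0<..<T}. partial 1 \<theta> t * ?G h t + \<theta> t * ?F g t)\<bar> \<le> (B' * (hi * \<epsilon> n) + B * (hi * (U * \<delta> n))) * T" .
    have "(LINT x|lebesgue_on \<Omega>. \<rho>0 x * (\<psi> n x - h x)) = (LINT x|lebesgue_on \<Omega>. \<rho>0 x * \<psi> n x) - (LINT x|lebesgue_on \<Omega>. \<rho>0 x * h x)"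
      using \<rho>0_mult_integrable(1)[OF n(2)[of n]] \<rho>0_mult_integrable(1)[OF h(2)] by (simp add: right_diff_distrib)
    then have "\<bar>(LINT x|lebesgue_on \<Omega>. \<rho>0 x * \<psi> n x) - (LINT x|lebesgue_on \<Omega>. \<rho>0 x * h x)\<bar> \<le> \<bar>hi\<bar> * \<epsilon> n"
      using \<rho>0_mult_integrable(2)[OF i1] by (simp add: \<epsilon>_def)
    then have "\<bar>\<theta> 0\<bar> * \<bar>(LINT x|lebesgue_on \<Omega>. \<rho>0 x * \<psi> n x) - (LINT x|lebesgue_on \<Omega>. \<rho>0 x * h x)\<bar> \<le> B * (\<bar>hi\<bar> * \<epsilon> n)"
      using B(2)[of 0] B(1) by (intro mult_mono) auto
    then have 2: "\<bar>\<theta> 0 * (LINT x|lebesgue_on \<Omega>. \<rho>0 x * \<psi> n x) - \<theta> 0 * (LINT x|lebesgue_on \<Omega>. \<rho>0 x * h x)\<bar> \<le> B * (\<bar>hi\<bar> * \<epsilon> n)"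
      by (simp add: abs_mult[symmetric] right_diff_distrib)
    show ?thesis using 1 2 by linarith
  qed
  have z: "?L (\<psi> n) (\<gamma> n) = 0" for n
    using t[of n] \<theta> unfolding tests_def by blast
  have "?R \<longlonglongrightarrow> (B' * (hi * 0) + B * (hi * (U * 0))) * T + B * (\<bar>hi\<bar> * 0)"
    unfolding \<epsilon>_def \<delta>_def by (intro tendsto_intros limh limg)
  then have R: "?R \<longlonglongrightarrow> 0" by simp
  have "\<bar>?L h g\<bar> \<le> ?R n" for n using le[of n] z[of n] by simp
  then have "\<bar>?L h g\<bar> \<le> 0" by (intro LIMSEQ_le_const[OF R]) auto
  then show "?L h g = 0" by simp
qed

end

text \<open>In the application m is the mass matrix and q i l j the integral of \<rho> ((a_l . grad)
  a_i) . a_j. Multiplying equation j by c_j and summing gives S1 + S2 + \<nu> S3 = 0. By the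
  symmetry of m and a relabelling of indices, the rates of all products c_j c_k m_jk add up to 2 (S1
  + S2).\<close>

lemma energy_algebra:
  fixes c c' :: "nat \<Rightarrow> real"
  assumes m: "\<And>j k. m j k = m k j"
    and eq: "\<And>j. j \<in> K \<Longrightarrow> (\<Sum>k\<in>K. c' k * m k j) + (\<Sum>i\<in>K. \<Sum>l\<in>K. c i * c l * q i l j) + \<nu> * (\<Sum>k\<in>K. c k * d k j) = 0"
  shows "(\<Sum>j\<in>K. \<Sum>k\<in>K. (c' j * c k + c j * c' k) * m j k + c j * c k * (\<Sum>l\<in>K. c l * (q j l k + q k l j)))
    = - 2 * \<nu> * (\<Sum>j\<in>K. \<Sum>k\<in>K. c j * c k * d k j)"
proof -
  define S1 where "S1 = (\<Sum>j\<in>K. \<Sum>k\<in>K. c' j * c k * m j k)"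
  define S2 where "S2 = (\<Sum>j\<in>K. \<Sum>k\<in>K. \<Sum>l\<in>K. c j * c k * c l * q j l k)"
  define S3 where "S3 = (\<Sum>j\<in>K. \<Sum>k\<in>K. c j * c k * d k j)"
  have a1: "(\<Sum>j\<in>K. \<Sum>k\<in>K. c j * c' k * m j k) = S1"
    unfolding S1_def by (subst sum.swap) (simp add: m mult.commute mult.left_commute)
  have b1: "(\<Sum>j\<in>K. \<Sum>k\<in>K. \<Sum>l\<in>K. c j * c k * c l * q k l j) = S2"
    unfolding S2_def by (subst sum.swap) (simp add: mult.commute mult.left_commute)
  have a2: "(\<Sum>j\<in>K. c j * (\<Sum>k\<in>K. c' k * m k j)) = S1"
    unfolding S1_def sum_distrib_left by (subst sum.swap) (simp add: mult.commute mult.left_commute)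
  have b2: "(\<Sum>j\<in>K. c j * (\<Sum>i\<in>K. \<Sum>l\<in>K. c i * c l * q i l j)) = S2"
    unfolding S2_def sum_distrib_left by (subst sum.swap) (simp add: mult.commute mult.left_commute)
  have c2: "(\<Sum>j\<in>K. c j * (\<nu> * (\<Sum>k\<in>K. c k * d k j))) = \<nu> * S3"
    unfolding S3_def sum_distrib_left by (simp add: mult.commute mult.left_commute)
  have "(\<Sum>j\<in>K. c j * ((\<Sum>k\<in>K. c' k * m k j) + (\<Sum>i\<in>K. \<Sum>l\<in>K. c i * c l * q i l j) + \<nu> * (\<Sum>k\<in>K. c k * d k j))) = 0"
    by (rule sum.neutral) (simp add: eq)
  then have 0: "S1 + S2 + \<nu> * S3 = 0"
    by (simp only: distrib_left sum.distrib a2 b2 c2)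
  have "(\<Sum>j\<in>K. \<Sum>k\<in>K. (c' j * c k + c j * c' k) * m j k + c j * c k * (\<Sum>l\<in>K. c l * (q j l k + q k l j)))
    = (\<Sum>j\<in>K. \<Sum>k\<in>K. c' j * c k * m j k) + (\<Sum>j\<in>K. \<Sum>k\<in>K. c j * c' k * m j k)
      + ((\<Sum>j\<in>K. \<Sum>k\<in>K. \<Sum>l\<in>K. c j * c k * c l * q j l k) + (\<Sum>j\<in>K. \<Sum>k\<in>K. \<Sum>l\<in>K. c j * c k * c l * q k l j))"
    by (simp add: sum.distrib[symmetric] sum_distrib_left distrib_left distrib_right mult.assoc)
  also have "\<dots> = 2 * (S1 + S2)" by (simp add: a1 b1 S1_def[symmetric] S2_def[symmetric])
  also have "\<dots> = - 2 * \<nu> * S3" using 0 by (simp add: algebra_simps)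
  finally show ?thesis by (simp add: S3_def)
qed

lemma integrable_on_cong_AE_Ioo:
  fixes f g :: "real \<Rightarrow> real"
  assumes ae: "AE s in lebesgue_on {0<..<T}. f s = g s" and "t \<le> T" and f: "f integrable_on {0..t}"
  shows "g integrable_on {0..t}"
proof -
  have "AE s in lebesgue. \<not> (s \<in> {0<..<T} \<and> f s \<noteq> g s)"
    using ae by (simp add: AE_restrict_space_iff) (erule eventually_mono, auto)
  then have "{s. s \<in> {0<..<T} \<and> f s \<noteq> g s} \<in> null_sets lebesgue"
    by (rule back_subst[of "\<lambda>S. S \<in> null_sets lebesgue", OF completion.AE_iff_null_sets[THEN iffD1]]) auto
  then have n: "negligible {s. s \<in> {0<..<T} \<and> f s \<noteq> g s}" by (simp add: negligible_iff_null_sets)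
  have f': "f integrable_on {0<..<t}" using f by (simp add: integrable_on_open_interval_real)
  have "g integrable_on {0<..<t}"
    by (rule integrable_spike[OF f' n]) (use assms(2) in auto)
  then show ?thesis by (simp add: integrable_on_open_interval_real)
qed

section \<open>Energy balance of a single semi-Galerkin approximation\<close>

text \<open>Smoothness inside \<Omega> supplies classical derivatives, continuity up to the boundary
  a sup bound, and membership in \<open>Hd\<close> the approximation by test functions.\<close>

locale galerkin = transport \<Omega> T lo hi U \<rho>0 "Galerkin_field a N c" \<rho>
  for \<Omega> :: "'a::euclidean_space set" and T lo hi U \<rho>0 a N c \<rho> +
  fixes \<nu> :: real and u0 :: "'a \<Rightarrow> 'a" and c' :: "nat \<Rightarrow> real \<Rightarrow> real"
  assumes a_smooth: "\<And>k. k \<in> {1..N} \<Longrightarrow> smooth_on \<Omega> (a k)"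
    and a_closure: "\<And>k. k \<in> {1..N} \<Longrightarrow> continuous_on (closure \<Omega>) (a k)"
    and a_Hd: "\<And>k. k \<in> {1..N} \<Longrightarrow> a k \<in> Hd \<Omega> 1"
    and sol: "semi_Galerkin_solution \<nu> \<Omega> T a N \<rho>0 u0 \<rho> c c'"
begin

abbreviation "u \<equiv> Galerkin_field a N c"
abbreviation "K \<equiv> {1..N}"
abbreviation "I \<equiv> lebesgue_on {0<..<T}"
abbreviation "X \<equiv> lebesgue_on \<Omega>"

lemma u_eq: "u (t, x) = (\<Sum>k\<in>K. c k t *\<^sub>R a k x)"
  by (simp add: Galerkin_field_def)

lemma a_differentiable: "k \<in> K \<Longrightarrow> x \<in> \<Omega> \<Longrightarrow> a k differentiable at x"
  using a_smooth smooth_on_differentiable by blast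

lemma a_continuous: "k \<in> K \<Longrightarrow> continuous_on \<Omega> (a k)"
  using a_smooth smooth_on_continuous_on by blast

lemma pa_continuous: "k \<in> K \<Longrightarrow> b \<in> Basis \<Longrightarrow> continuous_on \<Omega> (partial b (a k))"
  using smooth_on_partial[OF a_smooth] smooth_on_continuous_on by blast

lemma a_Sobolev: "k \<in> K \<Longrightarrow> a k \<in> Sobolev \<Omega> 1"
  using a_Hd Hd_Sobolev by blast

lemma a_L2: "k \<in> K \<Longrightarrow> a k \<in> L2 \<Omega>"
  using a_Sobolev Sobolev_L2 by blast

lemma wp_a: "k \<in> K \<Longrightarrow> b \<in> Basis \<Longrightarrow> AE x in X. weak_partials \<Omega> [b] (a k) x = partial b (a k) x"
  by (rule weak_partials_AE_eq[OF open_\<Omega> classical_partial_is_weak[OF open_\<Omega>]])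
    (use a_differentiable pa_continuous in auto)

text \<open>Smoothness inside \<Omega> does not control derivatives near the boundary. They are
  square integrable because they coincide almost everywhere with the weak ones.\<close>

lemma pa_L2: "k \<in> K \<Longrightarrow> b \<in> Basis \<Longrightarrow> partial b (a k) \<in> L2 \<Omega>"
  by (rule L2_AE_cong[OF Sobolev_weak_partial(2)[OF open_\<Omega> a_Sobolev] wp_a]) (use open_\<Omega> in auto)

lemma zero_Sobolev: "(\<lambda>x::'a. 0::'a) \<in> Sobolev \<Omega> 1"
  by (rule test_functions_Sobolev(1)[OF open_\<Omega> \<Omega>_lmeasurable test_functions_zero])

lemma a_bounded: obtains A where "0 \<le> A" "\<And>k x. k \<in> K \<Longrightarrow> x \<in> \<Omega> \<Longrightarrow> norm (a k x) \<le> A"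
proof -
  have "\<exists>A. \<forall>x\<in>\<Omega>. norm (a k x) \<le> A" if "k \<in> K" for k
  proof -
    have "compact (a k ` closure \<Omega>)"
      using a_closure[OF that] bounded_\<Omega> by (intro compact_continuous_image) (auto simp: compact_closure)
    then have "bounded (a k ` closure \<Omega>)" by (rule compact_imp_bounded)
    then obtain A where "\<forall>y\<in>a k ` closure \<Omega>. norm y \<le> A" unfolding bounded_iff by blast
    then show ?thesis using closure_subset[of \<Omega>] by blast
  qed
  then obtain A where A: "\<forall>k\<in>K. \<forall>x\<in>\<Omega>. norm (a k x) \<le> A k" by metis
  show thesis
  proof (rule that[of "\<Sum>k\<in>K. \<bar>A k\<bar>"])
    fix k x assume k: "k \<in> K" "x \<in> \<Omega>"
    have "norm (a k x) \<le> \<bar>A k\<bar>" using A k by (meson abs_ge_self order_trans)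
    also have "\<dots> \<le> (\<Sum>k\<in>K. \<bar>A k\<bar>)" using k by (intro member_le_sum) auto
    finally show "norm (a k x) \<le> (\<Sum>k\<in>K. \<bar>A k\<bar>)" .
  qed (simp add: sum_nonneg)
qed

lemma a_approx:
  assumes k: "k \<in> K"
  obtains \<phi> where "\<And>n::nat. \<phi> n \<in> test_functions \<Omega>"
    "(\<lambda>n. LINT x|X. (norm (\<phi> n x - a k x))\<^sup>2) \<longlonglongrightarrow> 0"
    "\<And>b. b \<in> Basis \<Longrightarrow> (\<lambda>n. LINT x|X. (norm (partial b (\<phi> n) x - partial b (a k) x))\<^sup>2) \<longlonglongrightarrow> 0"
proof -
  obtain \<phi> where \<phi>: "\<And>n. \<phi> n \<in> test_functions \<Omega>" "(\<lambda>n. H1_square \<Omega> (\<lambda>x. \<phi> n x - a k x)) \<longlonglongrightarrow> 0"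
    by (rule H10_approx[OF open_\<Omega> \<Omega>_lmeasurable Hd_H10[OF a_Hd[OF k]]]) blast
  note S = test_functions_Sobolev[OF open_\<Omega> \<Omega>_lmeasurable \<phi>(1)]
  show thesis
  proof (rule that[OF \<phi>(1)])
    show "(\<lambda>n. LINT x|X. (norm (\<phi> n x - a k x))\<^sup>2) \<longlonglongrightarrow> 0"
      by (rule tendsto_sandwich[OF _ _ tendsto_const \<phi>(2)]) (simp_all add: L2_square_le_H1_square)
    fix b :: 'a assume b: "b \<in> Basis"
    have le: "(LINT x|X. (norm (partial b (\<phi> n) x - partial b (a k) x))\<^sup>2) \<le> H1_square \<Omega> (\<lambda>x. \<phi> n x - a k x)" for n
    proof -
      note d = Sobolev_diff[OF open_\<Omega> S(1)[of n] a_Sobolev[OF k]]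
      have "has_weak_partials \<Omega> [b] (\<lambda>x. \<phi> n x + (-1) *\<^sub>R a k x) (\<lambda>x. weak_partials \<Omega> [b] (\<phi> n) x + (-1) *\<^sub>R weak_partials \<Omega> [b] (a k) x)"
        by (intro has_weak_partials_add open_\<Omega> has_weak_partials_scaleR Sobolev_weak_partial(1) S(1) a_Sobolev k b) (use b in auto)
      then have "AE x in X. weak_partials \<Omega> [b] (\<lambda>x. \<phi> n x - a k x) x = weak_partials \<Omega> [b] (\<phi> n) x - weak_partials \<Omega> [b] (a k) x"
        using weak_partials_AE_eq[OF open_\<Omega>, of "[b]" "\<lambda>x. \<phi> n x - a k x" "\<lambda>x. weak_partials \<Omega> [b] (\<phi> n) x - weak_partials \<Omega> [b] (a k) x"] by simp
      then have ae: "AE x in X. (norm (weak_partials \<Omega> [b] (\<lambda>x. \<phi> n x - a k x) x))\<^sup>2 = (norm (partial b (\<phi> n) x - partial b (a k) x))\<^sup>2"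
        using S(2)[OF b, of n] wp_a[OF k b] by eventually_elim simp
      have "(LINT x|X. (norm (weak_partials \<Omega> [b] (\<lambda>x. \<phi> n x - a k x) x))\<^sup>2) = (LINT x|X. (norm (partial b (\<phi> n) x - partial b (a k) x))\<^sup>2)"
      proof (rule integral_cong_AE[OF _ _ ae])
        show "(\<lambda>x. (norm (weak_partials \<Omega> [b] (\<lambda>x. \<phi> n x - a k x) x))\<^sup>2) \<in> borel_measurable X"
          using L2_measurable[OF Sobolev_weak_partial(2)[OF open_\<Omega> d b]] by simp
        then show "(\<lambda>x. (norm (partial b (\<phi> n) x - partial b (a k) x))\<^sup>2) \<in> borel_measurable X"
          by (rule lebesgue_on_AE_measurable[OF _ ae]) (use open_\<Omega> in auto)
      qed
      then show ?thesis using weak_partial_square_le[OF open_\<Omega> d b] by simp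
    qed
    show "(\<lambda>n. LINT x|X. (norm (partial b (\<phi> n) x - partial b (a k) x))\<^sup>2) \<longlonglongrightarrow> 0"
      by (rule tendsto_sandwich[OF _ _ tendsto_const \<phi>(2)]) (simp_all add: le)
  qed
qed

text \<open>The gradient of a_j . a_k, written out by the product rule.\<close>

definition ga :: "nat \<Rightarrow> nat \<Rightarrow> 'a \<Rightarrow> 'a" where
  "ga j k x = (\<Sum>b\<in>Basis. (partial b (a j) x \<bullet> a k x + a j x \<bullet> partial b (a k) x) *\<^sub>R b)"

lemma inner_integrable:
  "f \<in> L2 \<Omega> \<Longrightarrow> g \<in> L2 \<Omega> \<Longrightarrow> integrable X (\<lambda>x. f x \<bullet> g x)"
  by (rule L2_inner_integrable)

text \<open>Products of two H^1 limits converge only in W^{1,1}, through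
  \<open>L2_limit_inner\<close>; that is exactly the convergence \<open>tests_limit\<close> asks
  for.\<close>

lemma tests_products:
  assumes j: "j \<in> K" and k: "k \<in> K"
  shows "tests (\<lambda>x. a j x \<bullet> a k x) (ga j k)"
proof -
  obtain \<phi> where \<phi>: "\<And>n::nat. \<phi> n \<in> test_functions \<Omega>"
    "(\<lambda>n. LINT x|X. (norm (\<phi> n x - a j x))\<^sup>2) \<longlonglongrightarrow> 0"
    "\<And>b. b \<in> Basis \<Longrightarrow> (\<lambda>n. LINT x|X. (norm (partial b (\<phi> n) x - partial b (a j) x))\<^sup>2) \<longlonglongrightarrow> 0"
    by (rule a_approx[OF j]) blast
  obtain \<psi> where \<psi>: "\<And>n::nat. \<psi> n \<in> test_functions \<Omega>"
    "(\<lambda>n. LINT x|X. (norm (\<psi> n x - a k x))\<^sup>2) \<longlonglongrightarrow> 0"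
    "\<And>b. b \<in> Basis \<Longrightarrow> (\<lambda>n. LINT x|X. (norm (partial b (\<psi> n) x - partial b (a k) x))\<^sup>2) \<longlonglongrightarrow> 0"
    by (rule a_approx[OF k]) blast
  have tL: "\<chi>' \<in> L2 \<Omega>" if "\<chi>' \<in> test_functions \<Omega>" for \<chi>' :: "'a \<Rightarrow> 'a"
    using Sobolev_L2[OF test_functions_Sobolev(1)[OF open_\<Omega> \<Omega>_lmeasurable that]] .
  note L\<phi> = tL[OF \<phi>(1)] and L\<psi> = tL[OF \<psi>(1)]
  note Lp\<phi> = tL[OF test_functions_partial[OF \<phi>(1)]] and Lp\<psi> = tL[OF test_functions_partial[OF \<psi>(1)]]
  note La = a_L2[OF j] a_L2[OF k] and Lpa = pa_L2[OF j] pa_L2[OF k]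
  let ?h = "\<lambda>n x. \<phi> n x \<bullet> \<psi> n x"
  have th: "?h n \<in> test_functions \<Omega>" for n
    by (rule test_functions_inner[OF \<phi>(1) test_functions_smooth[OF \<psi>(1)]])
  have gh: "grad (?h n) x = (\<Sum>b\<in>Basis. (partial b (\<phi> n) x \<bullet> \<psi> n x + \<phi> n x \<bullet> partial b (\<psi> n) x) *\<^sub>R b)" for n x
    unfolding grad_def
    using partial_bilinear[OF bounded_bilinear_inner test_functions_differentiable[OF \<phi>(1)] test_functions_differentiable[OF \<psi>(1)]]
    by (simp add: add.commute)
  have ip: "integrable X (\<lambda>x. partial b (a j) x \<bullet> a k x)" "integrable X (\<lambda>x. a j x \<bullet> partial b (a k) x)" if "b \<in> Basis" for b
    using that by (intro inner_integrable La Lpa; simp)+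
  have ipn: "integrable X (\<lambda>x. partial b (\<phi> n) x \<bullet> \<psi> n x)" "integrable X (\<lambda>x. \<phi> n x \<bullet> partial b (\<psi> n) x)" if "b \<in> Basis" for b n
    using that by (intro inner_integrable L\<phi> L\<psi> Lp\<phi> Lp\<psi>; simp)+
  show ?thesis
  proof (rule tests_limit[OF tests_test_function[OF th]])
    show "continuous_on \<Omega> (\<lambda>x. a j x \<bullet> a k x)" by (intro continuous_intros a_continuous j k)
    show "integrable X (\<lambda>x. a j x \<bullet> a k x)" by (intro inner_integrable La)
    show "continuous_on \<Omega> (ga j k)"
      unfolding ga_def[abs_def] by (intro continuous_intros a_continuous pa_continuous j k)
    show "integrable X (ga j k)"
      unfolding ga_def[abs_def] using ip by (intro Bochner_Integration.integrable_sum integrable_scaleR_left Bochner_Integration.integrable_add) auto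
    show "(\<lambda>n. LINT x|X. \<bar>?h n x - a j x \<bullet> a k x\<bar>) \<longlonglongrightarrow> 0"
      by (rule L2_limit_inner[OF L\<phi> L\<psi> La \<phi>(2) \<psi>(2)])
    let ?A = "\<lambda>b n. LINT x|X. \<bar>partial b (\<phi> n) x \<bullet> \<psi> n x - partial b (a j) x \<bullet> a k x\<bar>"
    let ?B = "\<lambda>b n. LINT x|X. \<bar>\<phi> n x \<bullet> partial b (\<psi> n) x - a j x \<bullet> partial b (a k) x\<bar>"
    have A: "?A b \<longlonglongrightarrow> 0" if b: "b \<in> Basis" for b
      by (rule L2_limit_inner[OF Lp\<phi>[OF b] L\<psi> Lpa(1)[OF b] La(2) \<phi>(3)[OF b] \<psi>(2)])
    have B: "?B b \<longlonglongrightarrow> 0" if b: "b \<in> Basis" for b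
      by (rule L2_limit_inner[OF L\<phi> Lp\<psi>[OF b] La(1) Lpa(2)[OF b] \<phi>(2) \<psi>(3)[OF b]])
    have le: "(LINT x|X. norm (grad (?h n) x - ga j k x)) \<le> (\<Sum>b\<in>Basis. ?A b n + ?B b n)" for n
    proof -
      have "(LINT x|X. norm (grad (?h n) x - ga j k x)) \<le>
        (LINT x|X. (\<Sum>b\<in>Basis. \<bar>partial b (\<phi> n) x \<bullet> \<psi> n x - partial b (a j) x \<bullet> a k x\<bar> + \<bar>\<phi> n x \<bullet> partial b (\<psi> n) x - a j x \<bullet> partial b (a k) x\<bar>))"
      proof (rule integral_mono)
        show "integrable X (\<lambda>x. norm (grad (?h n) x - ga j k x))"
          unfolding gh ga_def using ip ipn
          by (intro Bochner_Integration.integrable_norm Bochner_Integration.integrable_diff Bochner_Integration.integrable_sum integrable_scaleR_left Bochner_Integration.integrable_add) auto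
        show "integrable X (\<lambda>x. \<Sum>b\<in>Basis. \<bar>partial b (\<phi> n) x \<bullet> \<psi> n x - partial b (a j) x \<bullet> a k x\<bar> + \<bar>\<phi> n x \<bullet> partial b (\<psi> n) x - a j x \<bullet> partial b (a k) x\<bar>)"
          using ip ipn by (intro Bochner_Integration.integrable_sum Bochner_Integration.integrable_add Bochner_Integration.integrable_abs Bochner_Integration.integrable_diff) auto
        fix x
        have e: "grad (?h n) x - ga j k x = (\<Sum>b\<in>Basis. ((partial b (\<phi> n) x \<bullet> \<psi> n x - partial b (a j) x \<bullet> a k x) + (\<phi> n x \<bullet> partial b (\<psi> n) x - a j x \<bullet> partial b (a k) x)) *\<^sub>R b)"
          unfolding gh ga_def sum_subtractf[symmetric] by (simp only: scaleR_diff_left[symmetric] add_diff_add)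
        have "norm (grad (?h n) x - ga j k x) \<le> (\<Sum>b\<in>Basis. norm (((partial b (\<phi> n) x \<bullet> \<psi> n x - partial b (a j) x \<bullet> a k x) + (\<phi> n x \<bullet> partial b (\<psi> n) x - a j x \<bullet> partial b (a k) x)) *\<^sub>R b))"
          unfolding e by (rule norm_sum)
        also have "\<dots> \<le> (\<Sum>b\<in>Basis. \<bar>partial b (\<phi> n) x \<bullet> \<psi> n x - partial b (a j) x \<bullet> a k x\<bar> + \<bar>\<phi> n x \<bullet> partial b (\<psi> n) x - a j x \<bullet> partial b (a k) x\<bar>)"
          by (intro sum_mono) (simp add: abs_triangle_ineq)
        finally show "norm (grad (?h n) x - ga j k x) \<le> (\<Sum>b\<in>Basis. \<bar>partial b (\<phi> n) x \<bullet> \<psi> n x - partial b (a j) x \<bullet> a k x\<bar> + \<bar>\<phi> n x \<bullet> partial b (\<psi> n) x - a j x \<bullet> partial b (a k) x\<bar>)" .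
      qed
      also have "\<dots> = (\<Sum>b\<in>Basis. ?A b n + ?B b n)"
        using ip ipn by (subst Bochner_Integration.integral_sum) (auto intro!: sum.cong)
      finally show ?thesis .
    qed
    have "(\<lambda>n. \<Sum>b\<in>Basis. ?A b n + ?B b n) \<longlonglongrightarrow> (\<Sum>b\<in>(Basis::'a set). 0 + 0)"
      by (intro tendsto_sum tendsto_add A B)
    then have lim: "(\<lambda>n. \<Sum>b\<in>Basis. ?A b n + ?B b n) \<longlonglongrightarrow> 0" by simp
    show "(\<lambda>n. LINT x|X. norm (grad (?h n) x - ga j k x)) \<longlonglongrightarrow> 0"
      by (rule tendsto_sandwich[OF _ _ tendsto_const lim]) (simp_all add: le)
  qed
qed

text \<open>The convective derivative (a_l . grad) a_i: the first index is differentiated, the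
  second transports.\<close>

definition Da :: "nat \<Rightarrow> nat \<Rightarrow> 'a \<Rightarrow> 'a" where
  "Da i l x = (\<Sum>b\<in>Basis. (a l x \<bullet> b) *\<^sub>R partial b (a i) x)"

text \<open>The mass matrix weighted by the density. With the convective coefficients
  \<open>q\<close> and the stiffness matrix \<open>d\<close> below, it turns the partial
  differential equations into relations between finitely many functions of time.\<close>

definition m :: "nat \<Rightarrow> nat \<Rightarrow> real \<Rightarrow> real" where
  "m j k t = (LINT x|X. \<rho> (t, x) * (a j x \<bullet> a k x))"

definition q :: "nat \<Rightarrow> nat \<Rightarrow> nat \<Rightarrow> real \<Rightarrow> real" where
  "q i l k t = (LINT x|X. \<rho> (t, x) * (Da i l x \<bullet> a k x))"

definition d :: "nat \<Rightarrow> nat \<Rightarrow> real" where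
  "d j k = gradient_inner \<Omega> (a j) (a k)"

text \<open>Three fields are multiplied: two are square integrable, so the third has to be bounded.
  Here the continuity of the basis fields up to the boundary enters.\<close>

lemma Da_integrable:
  assumes "i \<in> K" "l \<in> K" "k \<in> K"
  shows "integrable X (\<lambda>x. Da i l x \<bullet> a k x)"
proof -
  obtain A where A: "0 \<le> A" "\<And>k x. k \<in> K \<Longrightarrow> x \<in> \<Omega> \<Longrightarrow> norm (a k x) \<le> A" by (rule a_bounded) blast
  have "integrable X (\<lambda>x. (a l x \<bullet> b) * (partial b (a i) x \<bullet> a k x))" if b: "b \<in> Basis" for b
  proof -
    have 1: "integrable X (\<lambda>x. partial b (a i) x \<bullet> a k x)"
      using assms b by (intro inner_integrable pa_L2 a_L2)
    have 2: "(\<lambda>x. a l x \<bullet> b) \<in> borel_measurable X" using L2_measurable[OF a_L2[OF assms(2)]] by simp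
    have 3: "AE x in X. \<bar>a l x \<bullet> b\<bar> \<le> A"
      using A(2)[OF assms(2)] Basis_le_norm[OF b] by (intro AE_I2) (auto intro: order_trans)
    from integrable_bounded_mult[OF 1 2 3] show ?thesis by simp
  qed
  then show ?thesis unfolding Da_def by (simp add: inner_sum_left)
qed

text \<open>Finitely many index tuples occur, so one null set of times takes care of all of
  them.\<close>

lemma good_times:
  "AE t in I. (\<forall>j\<in>K. \<forall>k\<in>K. integrable X (\<lambda>x. \<rho> (t, x) * (a j x \<bullet> a k x))) \<and>
    (\<forall>i\<in>K. \<forall>l\<in>K. \<forall>k\<in>K. integrable X (\<lambda>x. \<rho> (t, x) * (Da i l x \<bullet> a k x)))"
  by (intro AE_conjI AE_finite_allI slice_integrable inner_integrable a_L2 Da_integrable) auto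

text \<open>The bridge between the two equations: the flux of the transport equation tested with a_j
  . a_k consists of the convective terms of the momentum equation.\<close>

lemma flux_eq:
  "u (t, x) \<bullet> ga j k x = (\<Sum>l\<in>K. c l t * (Da j l x \<bullet> a k x + Da k l x \<bullet> a j x))"
proof -
  let ?v = "\<lambda>b. partial b (a j) x \<bullet> a k x + a j x \<bullet> partial b (a k) x"
  have "u (t, x) \<bullet> ga j k x = (\<Sum>b\<in>Basis. ?v b * (\<Sum>l\<in>K. c l t * (a l x \<bullet> b)))"
    unfolding ga_def u_eq by (simp add: inner_sum_right inner_sum_left)
  also have "\<dots> = (\<Sum>b\<in>Basis. \<Sum>l\<in>K. c l t * (?v b * (a l x \<bullet> b)))"
    unfolding sum_distrib_left by (intro sum.cong refl) (rule mult.left_commute)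
  also have "\<dots> = (\<Sum>l\<in>K. c l t * (\<Sum>b\<in>Basis. ?v b * (a l x \<bullet> b)))"
    unfolding sum_distrib_left by (rule sum.swap)
  also have "\<dots> = (\<Sum>l\<in>K. c l t * (Da j l x \<bullet> a k x + Da k l x \<bullet> a j x))"
    unfolding Da_def inner_sum_left sum.distrib[symmetric]
    by (intro sum.cong refl arg_cong2[where f="(*)"]) (simp add: algebra_simps inner_commute)
  finally show ?thesis .
qed

lemma flux_integral:
  "AE t in I. \<forall>j\<in>K. \<forall>k\<in>K. (LINT x|X. \<rho> (t, x) * (u (t, x) \<bullet> ga j k x)) = (\<Sum>l\<in>K. c l t * (q j l k t + q k l j t))"
  using good_times
proof eventually_elim
  case (elim t)
  show ?case
  proof (intro ballI)
    fix j k assume jk: "j \<in> K" "k \<in> K"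
    have i: "integrable X (\<lambda>x. \<rho> (t, x) * (Da j l x \<bullet> a k x))" "integrable X (\<lambda>x. \<rho> (t, x) * (Da k l x \<bullet> a j x))" if "l \<in> K" for l
      using elim jk that by blast+
    have "(LINT x|X. \<rho> (t, x) * (u (t, x) \<bullet> ga j k x)) =
       (LINT x|X. (\<Sum>l\<in>K. c l t * (\<rho> (t, x) * (Da j l x \<bullet> a k x) + \<rho> (t, x) * (Da k l x \<bullet> a j x))))"
      unfolding flux_eq by (simp add: sum_distrib_left algebra_simps)
    also have "\<dots> = (\<Sum>l\<in>K. LINT x|X. c l t * (\<rho> (t, x) * (Da j l x \<bullet> a k x) + \<rho> (t, x) * (Da k l x \<bullet> a j x)))"
      using i by (intro Bochner_Integration.integral_sum) auto
    also have "\<dots> = (\<Sum>l\<in>K. c l t * (q j l k t + q k l j t))"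
      using i by (intro sum.cong refl) (simp add: q_def)
    finally show "(LINT x|X. \<rho> (t, x) * (u (t, x) \<bullet> ga j k x)) = (\<Sum>l\<in>K. c l t * (q j l k t + q k l j t))" .
  qed
qed

lemma partial_u:
  assumes x: "x \<in> \<Omega>"
  shows "partial b (curry (Galerkin_field a N r) t) x = (\<Sum>k\<in>K. r k t *\<^sub>R partial b (a k) x)"
proof -
  have d: "(\<lambda>x. r k t *\<^sub>R a k x) differentiable at x" if "k \<in> K" for k
    using a_differentiable[OF that x] by (intro differentiable_scaleR) auto
  have "partial b (curry (Galerkin_field a N r) t) x = partial b (\<lambda>x. \<Sum>k\<in>K. r k t *\<^sub>R a k x) x"
    by (simp add: curry_def Galerkin_field_def)
  also have "\<dots> = (\<Sum>k\<in>K. partial b (\<lambda>x. r k t *\<^sub>R a k x) x)" by (rule partial_sum) (rule d)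
  also have "\<dots> = (\<Sum>k\<in>K. r k t *\<^sub>R partial b (a k) x)"
    by (intro sum.cong refl partial_linear[OF bounded_linear_scaleR_right] a_differentiable x)
  finally show ?thesis .
qed

lemma convective_term:
  assumes x: "x \<in> \<Omega>"
  shows "frechet_derivative (curry u t) (at x) (u (t, x)) = (\<Sum>i\<in>K. \<Sum>l\<in>K. (c i t * c l t) *\<^sub>R Da i l x)"
proof -
  have "(\<lambda>x. c k t *\<^sub>R a k x) differentiable at x" if "k \<in> K" for k
    using a_differentiable[OF that x] by (intro differentiable_scaleR) auto
  then have "(\<lambda>x. \<Sum>k\<in>K. c k t *\<^sub>R a k x) differentiable at x"
    by (intro differentiable_sum) auto
  then have "curry u t differentiable at x" by (simp add: curry_def Galerkin_field_def)
  then have "frechet_derivative (curry u t) (at x) (u (t, x)) = (\<Sum>b\<in>Basis. (\<Sum>l\<in>K. c l t * (a l x \<bullet> b)) *\<^sub>R (\<Sum>i\<in>K. c i t *\<^sub>R partial b (a i) x))"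
    by (simp only: frechet_eq_sum_partial partial_u[OF x]) (simp add: u_eq inner_sum_left)
  also have "\<dots> = (\<Sum>b\<in>Basis. \<Sum>i\<in>K. \<Sum>l\<in>K. (c i t * c l t) *\<^sub>R (a l x \<bullet> b) *\<^sub>R partial b (a i) x)"
    by (simp add: scaleR_sum_left scaleR_sum_right sum_distrib_left mult.commute mult.left_commute)
  also have "\<dots> = (\<Sum>i\<in>K. \<Sum>b\<in>Basis. \<Sum>l\<in>K. (c i t * c l t) *\<^sub>R (a l x \<bullet> b) *\<^sub>R partial b (a i) x)"
    by (rule sum.swap)
  also have "\<dots> = (\<Sum>i\<in>K. \<Sum>l\<in>K. \<Sum>b\<in>Basis. (c i t * c l t) *\<^sub>R (a l x \<bullet> b) *\<^sub>R partial b (a i) x)"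
    by (intro sum.cong refl sum.swap)
  finally show ?thesis by (simp add: Da_def scaleR_sum_right)
qed

lemma d_eq:
  assumes ij: "i \<in> K" "j \<in> K"
  shows "d i j = (\<Sum>b\<in>Basis. LINT x|X. partial b (a i) x \<bullet> partial b (a j) x)"
  unfolding d_def gradient_inner_def
proof (intro sum.cong refl integral_cong_AE)
  fix b :: 'a assume b: "b \<in> Basis"
  show "AE x in X. weak_partials \<Omega> [b] (a i) x \<bullet> weak_partials \<Omega> [b] (a j) x = partial b (a i) x \<bullet> partial b (a j) x"
    using wp_a[OF ij(1) b] wp_a[OF ij(2) b] by eventually_elim simp
  show "(\<lambda>x. weak_partials \<Omega> [b] (a i) x \<bullet> weak_partials \<Omega> [b] (a j) x) \<in> borel_measurable X"
    using L2_measurable[OF Sobolev_weak_partial(2)[OF open_\<Omega> a_Sobolev[OF ij(1)] b]]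
      L2_measurable[OF Sobolev_weak_partial(2)[OF open_\<Omega> a_Sobolev[OF ij(2)] b]] by simp
  show "(\<lambda>x. partial b (a i) x \<bullet> partial b (a j) x) \<in> borel_measurable X"
    using L2_measurable[OF pa_L2[OF ij(1) b]] L2_measurable[OF pa_L2[OF ij(2) b]] by simp
qed

lemma Galerkin_equation:
  "AE t in I. \<forall>j\<in>K. (\<Sum>k\<in>K. c' k t * m k j t) + (\<Sum>i\<in>K. \<Sum>l\<in>K. c i t * c l t * q i l j t) + \<nu> * (\<Sum>k\<in>K. c k t * d k j) = 0"
proof -
  have G: "AE t in I. \<forall>j\<in>K.
        (LINT x|X. \<rho> (t, x) * ((curry (Galerkin_field a N c') t x + frechet_derivative (curry u t) (at x) (curry u t x)) \<bullet> a j x))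
        + \<nu> * (LINT x|X. (\<Sum>b\<in>Basis. partial b (curry u t) x \<bullet> partial b (a j) x)) = 0"
    using sol unfolding semi_Galerkin_solution_def Let_def by blast
  from G good_times show ?thesis
  proof eventually_elim
    case (elim t)
    show ?case
    proof
      fix j assume j: "j \<in> K"
      have im: "integrable X (\<lambda>x. \<rho> (t, x) * (a k x \<bullet> a j x))" if "k \<in> K" for k using elim(2) j that by blast
      have iq: "integrable X (\<lambda>x. \<rho> (t, x) * (Da i l x \<bullet> a j x))" if "i \<in> K" "l \<in> K" for i l using elim(2) j that by blast
      have "(LINT x|X. \<rho> (t, x) * ((curry (Galerkin_field a N c') t x + frechet_derivative (curry u t) (at x) (curry u t x)) \<bullet> a j x))
        = (LINT x|X. (\<Sum>k\<in>K. c' k t * (\<rho> (t, x) * (a k x \<bullet> a j x))) + (\<Sum>i\<in>K. \<Sum>l\<in>K. c i t * c l t * (\<rho> (t, x) * (Da i l x \<bullet> a j x))))"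
      proof (rule Bochner_Integration.integral_cong[OF refl])
        fix x assume "x \<in> space X"
        then have x: "x \<in> \<Omega>" by simp
        have "curry (Galerkin_field a N c') t x + frechet_derivative (curry u t) (at x) (curry u t x) =
          (\<Sum>k\<in>K. c' k t *\<^sub>R a k x) + (\<Sum>i\<in>K. \<Sum>l\<in>K. (c i t * c l t) *\<^sub>R Da i l x)"
          using convective_term[OF x, of t] by (simp add: curry_def Galerkin_field_def)
        then show "\<rho> (t, x) * ((curry (Galerkin_field a N c') t x + frechet_derivative (curry u t) (at x) (curry u t x)) \<bullet> a j x) =
          (\<Sum>k\<in>K. c' k t * (\<rho> (t, x) * (a k x \<bullet> a j x))) + (\<Sum>i\<in>K. \<Sum>l\<in>K. c i t * c l t * (\<rho> (t, x) * (Da i l x \<bullet> a j x)))"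
          by (simp add: inner_add_left inner_sum_left distrib_left sum_distrib_left mult.commute mult.left_commute)
      qed
      also have "\<dots> = (\<Sum>k\<in>K. c' k t * m k j t) + (\<Sum>i\<in>K. \<Sum>l\<in>K. c i t * c l t * q i l j t)"
      proof -
        have "(LINT x|X. (\<Sum>k\<in>K. c' k t * (\<rho> (t, x) * (a k x \<bullet> a j x))) + (\<Sum>i\<in>K. \<Sum>l\<in>K. c i t * c l t * (\<rho> (t, x) * (Da i l x \<bullet> a j x))))
          = (LINT x|X. (\<Sum>k\<in>K. c' k t * (\<rho> (t, x) * (a k x \<bullet> a j x)))) + (LINT x|X. (\<Sum>i\<in>K. \<Sum>l\<in>K. c i t * c l t * (\<rho> (t, x) * (Da i l x \<bullet> a j x))))"
          using im iq by (intro Bochner_Integration.integral_add Bochner_Integration.integrable_sum integrable_mult_right) auto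
        moreover have "(LINT x|X. (\<Sum>k\<in>K. c' k t * (\<rho> (t, x) * (a k x \<bullet> a j x)))) = (\<Sum>k\<in>K. c' k t * m k j t)"
          using im by (subst Bochner_Integration.integral_sum) (auto simp: m_def)
        moreover have "(LINT x|X. (\<Sum>i\<in>K. \<Sum>l\<in>K. c i t * c l t * (\<rho> (t, x) * (Da i l x \<bullet> a j x)))) = (\<Sum>i\<in>K. \<Sum>l\<in>K. c i t * c l t * q i l j t)"
          using iq by (subst Bochner_Integration.integral_sum) (auto simp: q_def intro!: sum.cong Bochner_Integration.integrable_sum)
        ultimately show ?thesis by simp
      qed
      finally have 1: "(LINT x|X. \<rho> (t, x) * ((curry (Galerkin_field a N c') t x + frechet_derivative (curry u t) (at x) (curry u t x)) \<bullet> a j x))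
        = (\<Sum>k\<in>K. c' k t * m k j t) + (\<Sum>i\<in>K. \<Sum>l\<in>K. c i t * c l t * q i l j t)" .
      have ip: "integrable X (\<lambda>x. partial b (a k) x \<bullet> partial b (a j) x)" if "k \<in> K" "b \<in> Basis" for k b
        using that j by (intro inner_integrable pa_L2)
      have "(LINT x|X. (\<Sum>b\<in>Basis. partial b (curry u t) x \<bullet> partial b (a j) x)) =
         (LINT x|X. (\<Sum>k\<in>K. c k t * (\<Sum>b\<in>Basis. partial b (a k) x \<bullet> partial b (a j) x)))"
      proof (rule Bochner_Integration.integral_cong[OF refl])
        fix x assume "x \<in> space X"
        then have x: "x \<in> \<Omega>" by simp
        show "(\<Sum>b\<in>Basis. partial b (curry u t) x \<bullet> partial b (a j) x) = (\<Sum>k\<in>K. c k t * (\<Sum>b\<in>Basis. partial b (a k) x \<bullet> partial b (a j) x))"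
          unfolding partial_u[OF x] inner_sum_left sum_distrib_left inner_scaleR_left by (rule sum.swap)
      qed
      also have "\<dots> = (\<Sum>k\<in>K. c k t * d k j)"
        using ip j by (subst Bochner_Integration.integral_sum) (auto simp: d_eq intro!: sum.cong Bochner_Integration.integral_sum)
      finally have 2: "(LINT x|X. (\<Sum>b\<in>Basis. partial b (curry u t) x \<bullet> partial b (a j) x)) = (\<Sum>k\<in>K. c k t * d k j)" .
      show "(\<Sum>k\<in>K. c' k t * m k j t) + (\<Sum>i\<in>K. \<Sum>l\<in>K. c i t * c l t * q i l j t) + \<nu> * (\<Sum>k\<in>K. c k t * d k j) = 0"
        using elim(1)[rule_format, OF j] unfolding 1 2 .
    qed
  qed
qed

end

context galerkin
begin

lemma c_derivative: "k \<in> K \<Longrightarrow> t \<in> {0..T} \<Longrightarrow> (c k has_real_derivative c' k t) (at t within {0..T})"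
  using sol unfolding semi_Galerkin_solution_def by blast

lemma c'_continuous: "k \<in> K \<Longrightarrow> continuous_on {0..T} (c' k)"
  using sol unfolding semi_Galerkin_solution_def by blast

lemma c_continuous: "k \<in> K \<Longrightarrow> continuous_on {0..T} (c k)"
  using c_derivative by (meson DERIV_continuous continuous_on_eq_continuous_within)

text \<open>The formal time derivative of c_j c_k m_jk: the coefficients by the product rule, m_jk
  by the transport equation.\<close>

definition power :: "nat \<Rightarrow> nat \<Rightarrow> real \<Rightarrow> real" where
  "power j k s = (c' j s * c k s + c j s * c' k s) * m j k s
    + c j s * c k s * (LINT x|X. \<rho> (s, x) * (u (s, x) \<bullet> ga j k x))"

text \<open>The product rule applied to c_j c_k and the Lipschitz representative of m_jk. The
  identity holds for almost every t only because m_jk agrees with that representative almost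
  everywhere.\<close>

lemma pair_evolution:
  assumes j: "j \<in> K" and k: "k \<in> K"
  shows "AE t in I. c j t * c k t * m j k t = c j 0 * c k 0 * (LINT x|X. \<rho>0 x * (a j x \<bullet> a k x)) + integral {0..t} (power j k)"
    and "t \<le> T \<Longrightarrow> power j k integrable_on {0..t}"
proof -
  obtain F P B where bd: "bounded_density F B (LINT x|X. \<rho>0 x * (a j x \<bullet> a k x)) P"
    and F: "AE t in I. (LINT x|X. \<rho> (t, x) * (u (t, x) \<bullet> ga j k x)) = F t"
    and P: "AE t in I. (LINT x|X. \<rho> (t, x) * (a j x \<bullet> a k x)) = P t"
    by (rule tests_evolution[OF tests_products[OF j k]]) blast
  interpret bd: bounded_density F B "LINT x|X. \<rho>0 x * (a j x \<bullet> a k x)" P by fact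
  let ?e = "\<lambda>s. c j s * c k s" and ?e' = "\<lambda>s. c' j s * c k s + c' k s * c j s"
  have e: "(?e has_real_derivative ?e' s) (at s within {0..T})" if "s \<in> {0..T}" for s
    by (rule DERIV_mult[OF c_derivative[OF j that] c_derivative[OF k that]])
  have e'c: "continuous_on {0..T} ?e'" and ec: "continuous_on {0..T} ?e"
    by (intro continuous_intros c_continuous c'_continuous j k)+
  have ae: "AE s in I. ?e' s * P s + ?e s * F s = power j k s"
    using F P unfolding power_def m_def by eventually_elim (simp add: algebra_simps)
  show "AE t in I. c j t * c k t * m j k t = c j 0 * c k 0 * (LINT x|X. \<rho>0 x * (a j x \<bullet> a k x)) + integral {0..t} (power j k)"
    using P AE_space
  proof eventually_elim
    case (elim t)
    then have t: "t \<in> {0..T}" by simp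
    have "integral {0..t} (\<lambda>s. ?e' s * P s + ?e s * F s) = integral {0..t} (power j k)"
      by (rule integral_cong_AE_Ioo[OF ae]) (use t in simp)
    then show ?case using bd.product_rule[OF e e'c t] elim(1) by (simp add: m_def)
  qed
  show "power j k integrable_on {0..t}" if t: "t \<le> T"
  proof (rule integrable_on_cong_AE_Ioo[OF ae t], rule integrable_add)
    have "continuous_on {0..t} ?e'" "continuous_on {0..t} ?e" "continuous_on {0..t} P"
      using t by (auto intro: continuous_on_subset[OF e'c] continuous_on_subset[OF ec] bd.P_continuous)
    then show "(\<lambda>s. ?e' s * P s) integrable_on {0..t}" "(\<lambda>s. ?e s * F s) integrable_on {0..t}"
      by (auto intro!: integrable_continuous_interval continuous_on_mult bd.int_mult_on)
  qed
qed

lemma u_Sobolev: "curry u t \<in> Sobolev \<Omega> 1"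
  and gradient_inner_u: "h \<in> Sobolev \<Omega> 1 \<Longrightarrow> gradient_inner \<Omega> (curry u t) h = (\<Sum>k\<in>K. c k t * gradient_inner \<Omega> (a k) h)"
  using gradient_inner_sum_left[OF open_\<Omega> _ a_Sobolev _ zero_Sobolev, where I=K and r="\<lambda>k. c k t"] zero_Sobolev
  by (auto simp: curry_def Galerkin_field_def simp del: One_nat_def)

lemma dissipation_eq: "gradient_inner \<Omega> (curry u t) (curry u t) = (\<Sum>j\<in>K. \<Sum>k\<in>K. c j t * c k t * d k j)"
proof -
  have "gradient_inner \<Omega> (a j) (curry u t) = (\<Sum>k\<in>K. c k t * d k j)" if "j \<in> K" for j
    using gradient_inner_u[OF a_Sobolev[OF that], of t] gradient_inner_commute[of \<Omega> "a j" "curry u t"] by (simp add: d_def)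
  then show ?thesis
    unfolding gradient_inner_u[OF u_Sobolev] by (simp add: sum_distrib_left mult.assoc)
qed

text \<open>Twice the kinetic energy is the quadratic form with coefficients m_jk in the c_j.
  Summing \<open>pair_evolution\<close> over all pairs leaves the total rate, which the momentum
  equation identifies with -2 \<nu> times the dissipation.\<close>

lemma energy_equality:
  "AE t in I. (LINT x|X. \<rho> (t, x) * (norm (u (t, x)))\<^sup>2) / 2
      + \<nu> * integral {0..t} (\<lambda>s. gradient_inner \<Omega> (curry u s) (curry u s))
    = (LINT x|X. \<rho>0 x * (norm (u0 x))\<^sup>2) / 2"
proof -
  have nu: "(norm (u (t, x)))\<^sup>2 = (\<Sum>j\<in>K. \<Sum>k\<in>K. c j t * c k t * (a j x \<bullet> a k x))" for t x
    unfolding u_eq power2_norm_eq_inner by (simp add: inner_sum_left inner_sum_right sum_distrib_left mult.assoc mult.left_commute inner_commute)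
  have E0: "(LINT x|X. \<rho>0 x * (norm (u0 x))\<^sup>2) = (\<Sum>j\<in>K. \<Sum>k\<in>K. c j 0 * c k 0 * (LINT x|X. \<rho>0 x * (a j x \<bullet> a k x)))"
  proof -
    have i: "integrable X (\<lambda>x. \<rho>0 x * (a j x \<bullet> a k x))" if "j \<in> K" "k \<in> K" for j k
      by (intro \<rho>0_mult_integrable inner_integrable a_L2 that)
    have u0: "AE x in X. u (0, x) = u0 x" using sol unfolding semi_Galerkin_solution_def by blast
    have s: "(\<lambda>x. \<rho>0 x * (norm (u (0, x)))\<^sup>2) = (\<lambda>x. \<Sum>j\<in>K. \<Sum>k\<in>K. c j 0 * c k 0 * (\<rho>0 x * (a j x \<bullet> a k x)))"
      unfolding nu by (simp add: sum_distrib_left mult.commute mult.left_commute)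
    have i': "integrable X (\<lambda>x. \<rho>0 x * (norm (u (0, x)))\<^sup>2)"
      unfolding s using i by (intro Bochner_Integration.integrable_sum integrable_mult_right) auto
    have ae: "AE x in X. \<rho>0 x * (norm (u (0, x)))\<^sup>2 = \<rho>0 x * (norm (u0 x))\<^sup>2"
      using u0 by eventually_elim simp
    have "(LINT x|X. \<rho>0 x * (norm (u0 x))\<^sup>2) = (LINT x|X. \<rho>0 x * (norm (u (0, x)))\<^sup>2)"
      using integral_cong_AE[OF borel_measurable_integrable[OF i'] lebesgue_on_AE_measurable[OF borel_measurable_integrable[OF i'] ae] ae] open_\<Omega>
      by simp
    also have "\<dots> = (\<Sum>j\<in>K. \<Sum>k\<in>K. c j 0 * c k 0 * (LINT x|X. \<rho>0 x * (a j x \<bullet> a k x)))"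
      unfolding s using i by (subst Bochner_Integration.integral_sum) (auto intro!: sum.cong Bochner_Integration.integrable_sum)
    finally show ?thesis .
  qed
  have pw: "AE s in I. (\<Sum>j\<in>K. \<Sum>k\<in>K. power j k s) = - 2 * \<nu> * gradient_inner \<Omega> (curry u s) (curry u s)"
    using flux_integral Galerkin_equation
  proof eventually_elim
    case (elim s)
    have "(\<Sum>j\<in>K. \<Sum>k\<in>K. power j k s) = (\<Sum>j\<in>K. \<Sum>k\<in>K. (c' j s * c k s + c j s * c' k s) * m j k s + c j s * c k s * (\<Sum>l\<in>K. c l s * (q j l k s + q k l j s)))"
      unfolding power_def using elim(1) by (intro sum.cong refl) simp
    also have "\<dots> = - 2 * \<nu> * (\<Sum>j\<in>K. \<Sum>k\<in>K. c j s * c k s * d k j)"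
      by (rule energy_algebra[where m="\<lambda>j k. m j k s" and q="\<lambda>i l k. q i l k s" and c="\<lambda>k. c k s" and c'="\<lambda>k. c' k s"])
        (use elim(2) in \<open>auto simp: m_def inner_commute\<close>)
    finally show ?case by (simp add: dissipation_eq)
  qed
  have all: "AE t in I. \<forall>j\<in>K. \<forall>k\<in>K. c j t * c k t * m j k t = c j 0 * c k 0 * (LINT x|X. \<rho>0 x * (a j x \<bullet> a k x)) + integral {0..t} (power j k)"
    by (intro AE_finite_allI pair_evolution) auto
  show ?thesis
    using all good_times AE_space
  proof eventually_elim
    case (elim t)
    then have t: "t \<in> {0<..<T}" by simp
    have "(LINT x|X. \<rho> (t, x) * (norm (u (t, x)))\<^sup>2) = (LINT x|X. (\<Sum>j\<in>K. \<Sum>k\<in>K. c j t * c k t * (\<rho> (t, x) * (a j x \<bullet> a k x))))"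
      unfolding nu by (simp add: sum_distrib_left mult.commute mult.left_commute)
    also have "\<dots> = (\<Sum>j\<in>K. \<Sum>k\<in>K. c j t * c k t * m j k t)"
      unfolding m_def using elim(2) by (subst Bochner_Integration.integral_sum) (auto intro!: sum.cong Bochner_Integration.integrable_sum)
    also have "\<dots> = (\<Sum>j\<in>K. \<Sum>k\<in>K. c j 0 * c k 0 * (LINT x|X. \<rho>0 x * (a j x \<bullet> a k x))) + (\<Sum>j\<in>K. \<Sum>k\<in>K. integral {0..t} (power j k))"
      using elim(1) by (simp add: sum.distrib)
    also have "(\<Sum>j\<in>K. \<Sum>k\<in>K. integral {0..t} (power j k)) = integral {0..t} (\<lambda>s. \<Sum>j\<in>K. \<Sum>k\<in>K. power j k s)"
      using pair_evolution(2)[of _ _ t] t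
      by (subst Henstock_Kurzweil_Integration.integral_sum)
        (auto intro!: sum.cong integrable_sum Henstock_Kurzweil_Integration.integral_sum[symmetric])
    also have "\<dots> = integral {0..t} (\<lambda>s. - 2 * \<nu> * gradient_inner \<Omega> (curry u s) (curry u s))"
      by (rule integral_cong_AE_Ioo[OF pw]) (use t in simp)
    also have "\<dots> = - 2 * \<nu> * integral {0..t} (\<lambda>s. gradient_inner \<Omega> (curry u s) (curry u s))"
      by (rule integral_mult_right)
    finally show ?case using E0 by (simp add: field_simps)
  qed
qed

end

text \<open>The bound U comes from compactness of [0,T] and of the closure of \<Omega>. It may grow
  with N, as it serves only the energy equality of a fixed approximation.\<close>

lemma galerkin_intro:
  fixes \<Omega> :: "'a::euclidean_space set"
  assumes \<Omega>: "open \<Omega>" "bounded \<Omega>" and T: "0 < T" and lo: "0 \<le> lo" and basis: "Galerkin_basis \<Omega> a"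
    and sol: "semi_Galerkin_solution \<nu> \<Omega> T a N \<rho>0 u0 \<rho> c c'" and \<rho>0: "\<rho>0 \<in> L2 \<Omega>"
    and b: "AE z in lebesgue_on ({0<..<T} \<times> \<Omega>). lo \<le> \<rho> z \<and> \<rho> z \<le> hi"
  shows "\<exists>U. galerkin \<Omega> T lo hi U \<rho>0 a N c \<rho> \<nu> u0 c'"
proof -
  have a: "smooth_on \<Omega> (a k)" "continuous_on (closure \<Omega>) (a k)" "a k \<in> Hd \<Omega> 1" if "k \<in> {1..N}" for k
    using basis that unfolding Galerkin_basis_def by auto
  have cc: "continuous_on {0..T} (c k)" if "k \<in> {1..N}" for k
  proof -
    have "(c k has_real_derivative c' k t) (at t within {0..T})" if "t \<in> {0..T}" for t
      using sol \<open>k \<in> {1..N}\<close> that unfolding semi_Galerkin_solution_def by blast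
    then show ?thesis by (meson DERIV_continuous continuous_on_eq_continuous_within)
  qed
  have "\<exists>A. \<forall>t\<in>{0..T}. \<forall>x\<in>\<Omega>. norm (c k t *\<^sub>R a k x) \<le> A" if k: "k \<in> {1..N}" for k
  proof -
    have "compact (a k ` closure \<Omega>)"
      using a(2)[OF k] \<Omega> by (intro compact_continuous_image) (auto simp: compact_closure)
    then have "bounded (a k ` closure \<Omega>)" by (rule compact_imp_bounded)
    then obtain A where A: "\<forall>y\<in>a k ` closure \<Omega>. norm y \<le> A" unfolding bounded_iff by blast
    have "bounded (c k ` {0..T})"
      using cc[OF k] by (intro compact_imp_bounded compact_continuous_image) auto
    then obtain C where C: "\<forall>y\<in>c k ` {0..T}. norm y \<le> C" unfolding bounded_iff by blast
    have "norm (c k t *\<^sub>R a k x) \<le> \<bar>C\<bar> * \<bar>A\<bar>" if "t \<in> {0..T}" "x \<in> \<Omega>" for t x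
    proof -
      have "c k t \<in> c k ` {0..T}" "a k x \<in> a k ` closure \<Omega>" using that closure_subset[of \<Omega>] by auto
      then have "norm (c k t) \<le> C" "norm (a k x) \<le> A" using A C by blast+
      then have "\<bar>c k t\<bar> \<le> \<bar>C\<bar>" "norm (a k x) \<le> \<bar>A\<bar>" by auto
      then show ?thesis by (simp add: mult_mono)
    qed
    then show ?thesis by blast
  qed
  then obtain A where A: "\<forall>k\<in>{1..N}. \<forall>t\<in>{0..T}. \<forall>x\<in>\<Omega>. norm (c k t *\<^sub>R a k x) \<le> A k" by metis
  define U where "U = (\<Sum>k\<in>{1..N}. A k)"
  have "galerkin \<Omega> T lo hi U \<rho>0 a N c \<rho> \<nu> u0 c'"
  proof
    show "open \<Omega>" "bounded \<Omega>" "0 < T" "0 \<le> lo" "\<rho>0 \<in> L2 \<Omega>" by fact+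
    show "AE z in lebesgue_on ({0<..<T} \<times> \<Omega>). lo \<le> \<rho> z \<and> \<rho> z \<le> hi" by fact
    show "Galerkin_field a N c \<in> borel_measurable (lebesgue_on ({0<..<T} \<times> \<Omega>))"
    proof (rule lebesgue_on_continuous_measurable)
      have "continuous_on ({0<..<T} \<times> \<Omega>) (\<lambda>z. \<Sum>k\<in>{1..N}. c k (fst z) *\<^sub>R a k (snd z))"
      proof (intro continuous_on_sum continuous_on_scaleR)
        fix k assume k: "k \<in> {1..N}"
        show "continuous_on ({0<..<T} \<times> \<Omega>) (\<lambda>z. c k (fst z))"
          by (rule continuous_on_compose2[OF cc[OF k]]) (auto intro: continuous_intros)
        show "continuous_on ({0<..<T} \<times> \<Omega>) (\<lambda>z. a k (snd z))"
          by (rule continuous_on_compose2[OF a(2)[OF k]]) (use closure_subset[of \<Omega>] in \<open>auto intro: continuous_intros\<close>)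
      qed
      then show "continuous_on ({0<..<T} \<times> \<Omega>) (Galerkin_field a N c)"
        by (simp add: Galerkin_field_def case_prod_unfold)
      show "{0<..<T} \<times> \<Omega> \<in> sets borel" using \<Omega> by (intro borel_open open_Times) auto
    qed
    show "norm (Galerkin_field a N c (t, x)) \<le> U" if "t \<in> {0<..<T}" "x \<in> \<Omega>" for t x
    proof -
      have "norm (Galerkin_field a N c (t, x)) \<le> (\<Sum>k\<in>{1..N}. norm (c k t *\<^sub>R a k x))"
        unfolding Galerkin_field_def prod.case by (rule norm_sum)
      also have "\<dots> \<le> U" unfolding U_def using A that by (intro sum_mono) auto
      finally show ?thesis .
    qed
    show "\<rho> \<in> borel_measurable (lebesgue_on ({0<..<T} \<times> \<Omega>))" "continuity_equation \<Omega> T \<rho>0 (Galerkin_field a N c) \<rho>"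
      using sol unfolding semi_Galerkin_solution_def Linfty_def by blast+
    show "semi_Galerkin_solution \<nu> \<Omega> T a N \<rho>0 u0 \<rho> c c'" by fact
  qed (use a in auto)
  then show ?thesis by blast
qed

section \<open>Passage to the limit\<close>

lemma H10_scaleR:
  assumes \<Omega>: "open \<Omega>" "\<Omega> \<in> lmeasurable" and f: "f \<in> H10 \<Omega>"
  shows "(\<lambda>x. c *\<^sub>R f x) \<in> H10 \<Omega>"
proof -
  obtain \<phi> where \<phi>: "\<And>n. \<phi> n \<in> test_functions \<Omega>" "(\<lambda>n. H1_square \<Omega> (\<lambda>x. \<phi> n x - f x)) \<longlonglongrightarrow> 0"
    by (rule H10_approx[OF \<Omega> f]) blast
  note S = H10_Sobolev[OF f]
  note d = Sobolev_diff[OF \<Omega>(1) test_functions_Sobolev(1)[OF \<Omega> \<phi>(1)] S]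
  have t: "(\<lambda>x. c *\<^sub>R \<phi> n x) \<in> test_functions \<Omega>" for n
    by (rule test_functions_linear[OF bounded_linear_scaleR_right \<phi>(1)])
  note cS = Sobolev_scaleR[OF \<Omega>(1) S, of c]
  have "(\<lambda>n. c\<^sup>2 * H1_square \<Omega> (\<lambda>x. \<phi> n x - f x)) \<longlonglongrightarrow> c\<^sup>2 * 0" by (intro tendsto_intros \<phi>)
  moreover have "H1_square \<Omega> (\<lambda>x. c *\<^sub>R \<phi> n x - c *\<^sub>R f x) = c\<^sup>2 * H1_square \<Omega> (\<lambda>x. \<phi> n x - f x)" for n
    using H1_square_scaleR[OF \<Omega>(1) d, of c n] by (simp add: scaleR_diff_right)
  ultimately have "(\<lambda>n. H1_square \<Omega> (\<lambda>x. c *\<^sub>R \<phi> n x - c *\<^sub>R f x)) \<longlonglongrightarrow> 0" by simp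
  then have "(\<lambda>n. H_norm \<Omega> 1 (\<lambda>x. c *\<^sub>R \<phi> n x - c *\<^sub>R f x)) \<longlonglongrightarrow> 0"
    using H_norm_tendsto_0_iff[OF \<Omega>(1) Sobolev_diff[OF \<Omega>(1) test_functions_Sobolev(1)[OF \<Omega> t] cS]] by simp
  then show ?thesis
    unfolding H10_def mem_Collect_eq using cS t by (intro conjI exI[of _ "\<lambda>n x. c *\<^sub>R \<phi> n x"]) auto
qed

text \<open>The dual norm is a supremum over the unit ball. Dividing \<psi> by its bound C rather
  than by its norm puts it there without a separate case for norm zero.\<close>

lemma L2_pairing_le:
  assumes \<Omega>: "open \<Omega>" "\<Omega> \<in> lmeasurable" and \<psi>: "\<psi> \<in> H10 \<Omega>" and C: "0 < C" "H_norm \<Omega> 1 \<psi> \<le> ennreal C"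
  shows "ennreal \<bar>L2_pairing \<Omega> g \<psi>\<bar> \<le> ennreal C * Hm1_norm \<Omega> (L2_pairing \<Omega> g)"
proof -
  let ?\<psi> = "\<lambda>x. (1 / C) *\<^sub>R \<psi> x"
  note S = H10_Sobolev[OF \<psi>]
  have "sqrt (H1_square \<Omega> \<psi>) \<le> C"
    using C unfolding H_norm_1[OF \<Omega>(1) S] by (simp add: H1_square_nonneg)
  then have "sqrt (H1_square \<Omega> ?\<psi>) \<le> 1"
    unfolding H1_square_scaleR[OF \<Omega>(1) S] real_sqrt_mult real_sqrt_abs using C(1) by (simp add: field_simps)
  then have "H_norm \<Omega> 1 ?\<psi> \<le> ennreal 1"
    unfolding H_norm_1[OF \<Omega>(1) Sobolev_scaleR[OF \<Omega>(1) S]] by (rule ennreal_leI)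
  then have "ennreal \<bar>L2_pairing \<Omega> g ?\<psi>\<bar> \<le> Hm1_norm \<Omega> (L2_pairing \<Omega> g)"
    unfolding dual_norm_def using H10_scaleR[OF \<Omega> \<psi>, of "1 / C"] by (intro SUP_upper) auto
  moreover have "L2_pairing \<Omega> g \<psi> = C * L2_pairing \<Omega> g ?\<psi>"
    unfolding L2_pairing_def using C(1) by simp
  ultimately show ?thesis
    using C(1) by (simp add: abs_mult ennreal_mult mult_left_mono)
qed

lemma ennsqrt_mono:
  assumes "x \<le> y" shows "ennsqrt x \<le> ennsqrt y"
proof (cases "y = \<infinity>")
  case False
  then have "y < \<infinity>" by (simp add: less_top)
  then have "x < \<infinity>" using assms by (rule le_less_trans[rotated])
  then show ?thesis
    using \<open>y < \<infinity>\<close> assms by (auto simp: ennsqrt_def intro!: ennreal_leI real_sqrt_le_mono enn2real_mono)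
qed (simp add: ennsqrt_def)

lemma L2t_norm_square: "(L2t_norm T nrm h)\<^sup>2 = (\<integral>\<^sup>+t. (nrm (h t))\<^sup>2 \<partial>lebesgue_on {0<..<T})"
  unfolding L2t_norm_def by simp

lemma L2t_norm_finite: "L2t_norm T nrm h < \<infinity> \<longleftrightarrow> (\<integral>\<^sup>+t. (nrm (h t))\<^sup>2 \<partial>lebesgue_on {0<..<T}) < \<infinity>"
  unfolding L2t_norm_def by (rule ennsqrt_less_top)

text \<open>The lower integral in \<open>L2t_norm\<close> dominates every measurable function below its integrand,
  so no measurability of the dual norm in time is needed.\<close>

lemma strong_pairing_limit:
  fixes g w :: "nat \<Rightarrow> real \<times> 'a::euclidean_space \<Rightarrow> 'b::euclidean_space"
  assumes \<Omega>: "open \<Omega>" "\<Omega> \<in> lmeasurable" and T: "0 < T"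
    and int: "\<And>n. integrable (lebesgue_on ({0<..<T} \<times> \<Omega>)) (\<lambda>z. g n z \<bullet> w n z)"
    and w: "\<And>n. AE t in lebesgue_on {0<..<T}. curry (w n) t \<in> H10 \<Omega> \<and> H_norm \<Omega> 1 (curry (w n) t) \<le> ennreal C" and C: "0 < C"
    and lim: "(\<lambda>n. L2t_norm T (\<lambda>f. Hm1_norm \<Omega> (L2_pairing \<Omega> f)) (\<lambda>t x. g n (t, x))) \<longlonglongrightarrow> 0"
  shows "(\<lambda>n. LINT t|lebesgue_on {0<..<T}. \<bar>LINT x|lebesgue_on \<Omega>. g n (t, x) \<bullet> w n (t, x)\<bar>) \<longlonglongrightarrow> 0"
proof -
  let ?I = "lebesgue_on {0<..<T}"
  define p where "p n t = (LINT x|lebesgue_on \<Omega>. g n (t, x) \<bullet> w n (t, x))" for n t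
  define e where "e n = L2t_norm T (\<lambda>f. Hm1_norm \<Omega> (L2_pairing \<Omega> f)) (\<lambda>t x. g n (t, x))" for n
  have pi: "integrable ?I (p n)" for n
    unfolding p_def[abs_def] using Fubini_lebesgue_on(2)[OF _ _ int[of n]] \<Omega> by auto
  have b: "AE t in ?I. (ennreal \<bar>p n t\<bar>)\<^sup>2 \<le> (ennreal C)\<^sup>2 * (Hm1_norm \<Omega> (L2_pairing \<Omega> (\<lambda>x. g n (t, x))))\<^sup>2" for n
    using w[of n]
  proof eventually_elim
    case (elim t)
    have "ennreal \<bar>L2_pairing \<Omega> (\<lambda>x. g n (t, x)) (curry (w n) t)\<bar> \<le> ennreal C * Hm1_norm \<Omega> (L2_pairing \<Omega> (\<lambda>x. g n (t, x)))"
      by (rule L2_pairing_le[OF \<Omega> _ C]) (use elim in auto)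
    then have "ennreal \<bar>p n t\<bar> \<le> ennreal C * Hm1_norm \<Omega> (L2_pairing \<Omega> (\<lambda>x. g n (t, x)))"
      by (simp add: p_def L2_pairing_def)
    from power_mono[OF this, of 2] show ?case by (simp add: power_mult_distrib)
  qed
  have le: "(\<integral>\<^sup>+t. ennreal ((p n t)\<^sup>2) \<partial>?I) \<le> (ennreal C)\<^sup>2 * (e n)\<^sup>2" for n
  proof -
    \<comment> \<open>The constant is taken out on the side of \<open>p n\<close>, which is
      measurable by Fubini; the dual norm in time may fail to be.\<close>
    have "(\<integral>\<^sup>+t. ennreal ((p n t)\<^sup>2) \<partial>?I) = (ennreal C)\<^sup>2 * (\<integral>\<^sup>+t. ennreal ((p n t)\<^sup>2 / C\<^sup>2) \<partial>?I)"
      using C pi[of n] by (subst nn_integral_cmult[symmetric]) (auto simp: ennreal_power ennreal_mult[symmetric])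
    also have "(\<integral>\<^sup>+t. ennreal ((p n t)\<^sup>2 / C\<^sup>2) \<partial>?I) \<le> (e n)\<^sup>2"
      unfolding e_def L2t_norm_square
    proof (rule nn_integral_mono_AE)
      show "AE t in ?I. ennreal ((p n t)\<^sup>2 / C\<^sup>2) \<le> (Hm1_norm \<Omega> (L2_pairing \<Omega> (\<lambda>x. g n (t, x))))\<^sup>2"
        using b[of n]
      proof eventually_elim
        case (elim t)
        have "ennreal ((p n t)\<^sup>2 / C\<^sup>2) = ennreal (1 / C\<^sup>2) * (ennreal \<bar>p n t\<bar>)\<^sup>2"
          by (simp add: ennreal_power ennreal_mult[symmetric])
        also have "\<dots> \<le> ennreal (1 / C\<^sup>2) * ((ennreal C)\<^sup>2 * (Hm1_norm \<Omega> (L2_pairing \<Omega> (\<lambda>x. g n (t, x))))\<^sup>2)"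
          by (rule mult_left_mono[OF elim]) simp
        also have "\<dots> = (Hm1_norm \<Omega> (L2_pairing \<Omega> (\<lambda>x. g n (t, x))))\<^sup>2"
          using C by (simp add: mult.assoc[symmetric] ennreal_power ennreal_mult[symmetric] del: mult.assoc)
        finally show ?case .
      qed
    qed
    finally show ?thesis by (simp add: mult_left_mono)
  qed
  have e0: "(\<lambda>n. (ennreal C)\<^sup>2 * (e n)\<^sup>2) \<longlonglongrightarrow> 0"
  proof -
    have "e \<longlonglongrightarrow> 0" using lim by (simp add: e_def[abs_def])
    then have "(\<lambda>n. (e n)\<^sup>2) \<longlonglongrightarrow> 0\<^sup>2" unfolding power2_eq_square by (intro tendsto_mult_ennreal) auto
    then have "(\<lambda>n. (ennreal C)\<^sup>2 * (e n)\<^sup>2) \<longlonglongrightarrow> (ennreal C)\<^sup>2 * 0"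
      using C by (intro ennreal_tendsto_cmult) (auto simp: ennreal_power)
    then show ?thesis by simp
  qed
  \<comment> \<open>The dual norms may be infinite for finitely many n, so \<open>p n\<close> is
    square integrable only eventually.\<close>
  have ev: "\<forall>\<^sub>F n in sequentially. (ennreal C)\<^sup>2 * (e n)\<^sup>2 < 1"
    using order_tendstoD(2)[OF e0, of 1] by simp
  define s where "s n = (LINT t|?I. (p n t)\<^sup>2)" for n
  have s: "\<forall>\<^sub>F n in sequentially. p n \<in> L2 {0<..<T} \<and> ennreal (s n) \<le> (ennreal C)\<^sup>2 * (e n)\<^sup>2"
    using ev
  proof eventually_elim
    case (elim n)
    have fin: "(\<integral>\<^sup>+t. ennreal ((p n t)\<^sup>2) \<partial>?I) < \<infinity>"
      using le[of n] elim by (metis ennreal_one_less_top infinity_ennreal_def le_less_trans order_less_imp_le order.strict_trans)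
    have "(\<lambda>t. (p n t)\<^sup>2) \<in> borel_measurable ?I"
      using borel_measurable_integrable[OF pi[of n]] by simp
    then have i: "integrable ?I (\<lambda>t. (p n t)\<^sup>2)"
      using fin by (simp add: integrable_iff_bounded)
    have "(\<integral>\<^sup>+t. ennreal ((p n t)\<^sup>2) \<partial>?I) = ennreal (s n)"
      unfolding s_def by (rule nn_integral_eq_integral[OF i]) simp
    then show ?case using i pi[of n] le[of n] by (simp add: L2_iff)
  qed
  have "(\<lambda>n. ennreal (s n)) \<longlonglongrightarrow> 0"
    by (rule tendsto_sandwich[OF _ _ tendsto_const e0]) (use s in \<open>auto elim: eventually_mono\<close>)
  then have "s \<longlonglongrightarrow> 0"
    using tendsto_ennreal_iff[of s sequentially 0] by (simp add: s_def)
  then have lim': "(\<lambda>n. sqrt (s n) * sqrt (LINT t|?I. (norm (1::real))\<^sup>2)) \<longlonglongrightarrow> 0"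
    using tendsto_mult_left_zero[OF tendsto_real_sqrt[of s 0 sequentially, simplified], of "sqrt (LINT t|?I. (norm (1::real))\<^sup>2)"]
    by simp
  have one: "(\<lambda>t. 1::real) \<in> L2 {0<..<T}" by (rule L2_bounded[where B=1]) auto
  show ?thesis
    unfolding p_def[symmetric]
  proof (rule tendsto_sandwich[OF _ _ tendsto_const lim'])
    show "\<forall>\<^sub>F n in sequentially. (LINT t|?I. \<bar>p n t\<bar>) \<le> sqrt (s n) * sqrt (LINT t|?I. (norm (1::real))\<^sup>2)"
      using s
    proof eventually_elim
      case (elim n)
      then show ?case using L2_Cauchy_Schwarz_norm[OF conjunct1[OF elim] one] by (simp add: s_def)
    qed
  qed simp
qed

section \<open>Space-time fields and functionals on them\<close>

lemma Hd_space_time_L2: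
  fixes w :: "real \<times> 'a::euclidean_space \<Rightarrow> 'a"
  assumes \<Omega>: "open \<Omega>" "\<Omega> \<in> lmeasurable" and w: "w \<in> L2t T \<Omega> (Hd \<Omega> 1) (H_norm \<Omega> 1)"
  shows "w \<in> L2 ({0<..<T} \<times> \<Omega>)" "(L2_norm ({0<..<T} \<times> \<Omega>) w)\<^sup>2 \<le> (L2t_norm T (H_norm \<Omega> 1) (curry w))\<^sup>2"
proof -
  have m: "w \<in> borel_measurable (lebesgue_on ({0<..<T} \<times> \<Omega>))" and ae: "AE t in lebesgue_on {0<..<T}. curry w t \<in> Hd \<Omega> 1"
    and fin: "L2t_norm T (H_norm \<Omega> 1) (curry w) < \<infinity>"
    using w unfolding L2t_def by auto
  have "(L2_norm ({0<..<T} \<times> \<Omega>) w)\<^sup>2 = (\<integral>\<^sup>+t. \<integral>\<^sup>+x. ennreal ((norm (w (t, x)))\<^sup>2) \<partial>lebesgue_on \<Omega> \<partial>lebesgue_on {0<..<T})"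
    unfolding L2_norm_square using m \<Omega> by (intro nn_integral_lebesgue_on_slices) auto
  also have "\<dots> \<le> (\<integral>\<^sup>+t. (H_norm \<Omega> 1 (curry w t))\<^sup>2 \<partial>lebesgue_on {0<..<T})"
  proof (rule nn_integral_mono_AE)
    show "AE t in lebesgue_on {0<..<T}. (\<integral>\<^sup>+x. ennreal ((norm (w (t, x)))\<^sup>2) \<partial>lebesgue_on \<Omega>) \<le> (H_norm \<Omega> 1 (curry w t))\<^sup>2"
      using ae
    proof eventually_elim
      case (elim t)
      note S = Hd_Sobolev[OF elim]
      have "(\<integral>\<^sup>+x. ennreal ((norm (w (t, x)))\<^sup>2) \<partial>lebesgue_on \<Omega>) = ennreal (LINT x|lebesgue_on \<Omega>. (norm (curry w t x))\<^sup>2)"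
        using L2_norm_square_eq[OF Sobolev_L2[OF S]] by (simp add: L2_norm_square)
      also have "\<dots> \<le> ennreal (H1_square \<Omega> (curry w t))" by (rule ennreal_leI[OF L2_square_le_H1_square])
      also have "\<dots> = (H_norm \<Omega> 1 (curry w t))\<^sup>2"
        unfolding H_norm_1[OF \<Omega>(1) S] by (simp add: ennreal_power H1_square_nonneg)
      finally show ?case .
    qed
  qed
  finally show 1: "(L2_norm ({0<..<T} \<times> \<Omega>) w)\<^sup>2 \<le> (L2t_norm T (H_norm \<Omega> 1) (curry w))\<^sup>2"
    by (simp add: L2t_norm_square)
  also have "\<dots> < \<infinity>" unfolding L2t_norm_square by (rule fin[unfolded L2t_norm_finite])
  finally show "w \<in> L2 ({0<..<T} \<times> \<Omega>)"
    using m unfolding L2_norm_square by (simp add: L2_iff integrable_iff_bounded)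
qed

text \<open>Through this functional, weak convergence in L^2(0,T;H^1_d) yields weak convergence in
  L^2 of space-time.\<close>

lemma L2_product_dual:
  fixes f :: "real \<times> 'a::euclidean_space \<Rightarrow> 'a"
  assumes \<Omega>: "open \<Omega>" "\<Omega> \<in> lmeasurable" and f: "f \<in> L2 ({0<..<T} \<times> \<Omega>)"
  shows "(\<lambda>w. LINT z|lebesgue_on ({0<..<T} \<times> \<Omega>). f z \<bullet> w z) \<in>
    dual (L2t T \<Omega> (Hd \<Omega> 1) (H_norm \<Omega> 1)) (\<lambda>w. L2t_norm T (H_norm \<Omega> 1) (curry w))"
proof -
  let ?Q = "lebesgue_on ({0<..<T} \<times> \<Omega>)" and ?V = "L2t T \<Omega> (Hd \<Omega> 1) (H_norm \<Omega> 1)"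
  note i = L2_inner_integrable[OF f Hd_space_time_L2(1)[OF \<Omega>]]
  define B where "B = sqrt (LINT z|?Q. (norm (f z))\<^sup>2)"
  have "ennreal \<bar>LINT z|?Q. f z \<bullet> w z\<bar> \<le> ennreal B * L2t_norm T (H_norm \<Omega> 1) (curry w)" if w: "w \<in> ?V" for w
  proof -
    note L = Hd_space_time_L2[OF \<Omega> w]
    have "ennreal \<bar>LINT z|?Q. f z \<bullet> w z\<bar> \<le> ennreal (B * sqrt (LINT z|?Q. (norm (w z))\<^sup>2))"
      unfolding B_def by (rule ennreal_leI[OF L2_Cauchy_Schwarz[OF f L(1)]])
    also have "\<dots> = ennreal B * ennreal (sqrt (LINT z|?Q. (norm (w z))\<^sup>2))"
      unfolding B_def by (intro ennreal_mult) auto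
    also have "ennreal (sqrt (LINT z|?Q. (norm (w z))\<^sup>2)) = L2_norm ({0<..<T} \<times> \<Omega>) w"
      using L2_norm_square_eq[OF L(1)] unfolding L2_norm_square
      by (simp add: L2_norm_def ennreal_power ennsqrt_ennreal)
    also have "\<dots> \<le> L2t_norm T (H_norm \<Omega> 1) (curry w)"
      using ennsqrt_mono[OF L(2)[unfolded L2_norm_def L2t_norm_def ennsqrt_square]]
      by (simp add: L2_norm_def L2t_norm_def)
    finally show ?thesis by (simp add: mult_left_mono)
  qed
  moreover have "(LINT z|?Q. f z \<bullet> (v z + w z)) = (LINT z|?Q. f z \<bullet> v z) + (LINT z|?Q. f z \<bullet> w z)" if "v \<in> ?V" "w \<in> ?V" for v w
    using i[OF that(1)] i[OF that(2)] by (simp add: inner_add_right)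
  ultimately show ?thesis unfolding dual_def by auto
qed

section \<open>Measurability in time of the Dirichlet form\<close>

text \<open>Weak derivatives are defined by scalar test functions; a vector-valued one is handled
  component by component.\<close>

lemma weak_partial_test_vector:
  fixes f \<psi> :: "'a::euclidean_space \<Rightarrow> 'b::euclidean_space"
  assumes \<Omega>: "open \<Omega>" "\<Omega> \<in> lmeasurable" and f: "f \<in> Sobolev \<Omega> 1" and \<psi>: "\<psi> \<in> test_functions \<Omega>" and b: "b \<in> Basis"
  shows "(LINT x|lebesgue_on \<Omega>. weak_partials \<Omega> [b] f x \<bullet> \<psi> x) = - (LINT x|lebesgue_on \<Omega>. f x \<bullet> partial b \<psi> x)"
proof -
  let ?X = "lebesgue_on \<Omega>" and ?g = "weak_partials \<Omega> [b] f"
  note w = Sobolev_weak_partial[OF \<Omega>(1) f b]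
  note li = has_weak_partials_locally_integrable[OF w(1)]
  have e: "(LINT x|?X. (f x \<bullet> e) * (partial b \<psi> x \<bullet> e)) = - (LINT x|?X. (?g x \<bullet> e) * (\<psi> x \<bullet> e))"
    and i1: "integrable ?X (\<lambda>x. (f x \<bullet> e) * (partial b \<psi> x \<bullet> e))"
    and i2: "integrable ?X (\<lambda>x. (?g x \<bullet> e) * (\<psi> x \<bullet> e))" for e
  proof -
    have t: "(\<lambda>x. \<psi> x \<bullet> e) \<in> test_functions \<Omega>" and t': "(\<lambda>x. partial b \<psi> x \<bullet> e) \<in> test_functions \<Omega>"
      using test_functions_linear[OF bounded_linear_inner_left] \<psi> test_functions_partial[OF \<psi> b] by auto
    have p: "partials [b] (\<lambda>x. \<psi> x \<bullet> e) = (\<lambda>x. partial b \<psi> x \<bullet> e)"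
      using partial_linear[OF bounded_linear_inner_left test_functions_differentiable[OF \<psi>]] by (simp add: partials_Cons fun_eq_iff)
    note j1 = integrable_test_times_locally_integrable[OF \<Omega>(1) conjunct1[OF li] t']
    note j2 = integrable_test_times_locally_integrable[OF \<Omega>(1) conjunct2[OF li] t]
    show "integrable ?X (\<lambda>x. (f x \<bullet> e) * (partial b \<psi> x \<bullet> e))"
      using integrable_inner_left[of e ?X, OF j1] by (simp add: mult.commute)
    show "integrable ?X (\<lambda>x. (?g x \<bullet> e) * (\<psi> x \<bullet> e))"
      using integrable_inner_left[of e ?X, OF j2] by (simp add: mult.commute)
    have "(LINT x|?X. (partial b \<psi> x \<bullet> e) *\<^sub>R f x) = - (LINT x|?X. (\<psi> x \<bullet> e) *\<^sub>R ?g x)"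
      using has_weak_partialsD[OF w(1) t] unfolding p by simp
    then have "(LINT x|?X. (partial b \<psi> x \<bullet> e) *\<^sub>R f x) \<bullet> e = - ((LINT x|?X. (\<psi> x \<bullet> e) *\<^sub>R ?g x) \<bullet> e)"
      by simp
    then show "(LINT x|?X. (f x \<bullet> e) * (partial b \<psi> x \<bullet> e)) = - (LINT x|?X. (?g x \<bullet> e) * (\<psi> x \<bullet> e))"
      using j1 j2 by (simp add: integral_inner_left[symmetric] mult.commute)
  qed
  have "(LINT x|?X. ?g x \<bullet> \<psi> x) = (\<Sum>e\<in>Basis. LINT x|?X. (?g x \<bullet> e) * (\<psi> x \<bullet> e))"
    using i2 by (subst euclidean_inner) simp
  moreover have "(LINT x|?X. f x \<bullet> partial b \<psi> x) = (\<Sum>e\<in>Basis. LINT x|?X. (f x \<bullet> e) * (partial b \<psi> x \<bullet> e))"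
    using i1 by (subst euclidean_inner) simp
  ultimately show ?thesis by (simp add: e sum_negf)
qed

definition laplacian :: "('a::euclidean_space \<Rightarrow> 'b::euclidean_space) \<Rightarrow> 'a \<Rightarrow> 'b" where
  "laplacian \<phi> x = (\<Sum>b\<in>Basis. partial b (partial b \<phi>) x)"

lemma laplacian_test_function: "\<phi> \<in> test_functions \<Omega> \<Longrightarrow> laplacian \<phi> \<in> test_functions \<Omega>"
  unfolding laplacian_def[abs_def] by (intro test_functions_sum test_functions_partial)

text \<open>Moves all derivatives to the test function, so that the weak derivatives of f, which are
  chosen for f alone, disappear. Time slices can then be treated by Fubini.\<close>

lemma gradient_inner_test:
  fixes f \<phi> :: "'a::euclidean_space \<Rightarrow> 'b::euclidean_space"
  assumes \<Omega>: "open \<Omega>" "\<Omega> \<in> lmeasurable" and f: "f \<in> Sobolev \<Omega> 1" and \<phi>: "\<phi> \<in> test_functions \<Omega>"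
  shows "gradient_inner \<Omega> f \<phi> = - (LINT x|lebesgue_on \<Omega>. f x \<bullet> laplacian \<phi> x)"
proof -
  let ?X = "lebesgue_on \<Omega>"
  have tL: "\<psi> \<in> L2 \<Omega>" if "\<psi> \<in> test_functions \<Omega>" for \<psi> :: "'a \<Rightarrow> 'b"
    using Sobolev_L2[OF test_functions_Sobolev(1)[OF \<Omega> that]] .
  have "(LINT x|?X. weak_partials \<Omega> [b] f x \<bullet> weak_partials \<Omega> [b] \<phi> x) = - (LINT x|?X. f x \<bullet> partial b (partial b \<phi>) x)"
    if b: "b \<in> Basis" for b
  proof -
    note S = test_functions_Sobolev[OF \<Omega> \<phi>]
    have "(LINT x|?X. weak_partials \<Omega> [b] f x \<bullet> weak_partials \<Omega> [b] \<phi> x) = (LINT x|?X. weak_partials \<Omega> [b] f x \<bullet> partial b \<phi> x)"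
    proof (rule integral_cong_AE)
      show "AE x in ?X. weak_partials \<Omega> [b] f x \<bullet> weak_partials \<Omega> [b] \<phi> x = weak_partials \<Omega> [b] f x \<bullet> partial b \<phi> x"
        using S(2)[OF b] by eventually_elim simp
    qed (use L2_measurable[OF Sobolev_weak_partial(2)[OF \<Omega>(1) f b]] L2_measurable[OF Sobolev_weak_partial(2)[OF \<Omega>(1) S(1) b]]
        L2_measurable[OF tL[OF test_functions_partial[OF \<phi> b]]] in auto)
    then show ?thesis using weak_partial_test_vector[OF \<Omega> f test_functions_partial[OF \<phi> b] b] by simp
  qed
  then have "gradient_inner \<Omega> f \<phi> = - (\<Sum>b\<in>Basis. LINT x|?X. f x \<bullet> partial b (partial b \<phi>) x)"
    unfolding gradient_inner_def by (simp add: sum_negf)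
  also have "(\<Sum>b\<in>Basis. LINT x|?X. f x \<bullet> partial b (partial b \<phi>) x) = (LINT x|?X. f x \<bullet> laplacian \<phi> x)"
    unfolding laplacian_def inner_sum_right
    using L2_inner_integrable[OF Sobolev_L2[OF f] tL[OF test_functions_partial[OF test_functions_partial[OF \<phi>]]]]
    by (subst Bochner_Integration.integral_sum) auto
  finally show ?thesis .
qed

lemma gradient_sqrt_triangle:
  assumes \<Omega>: "open \<Omega>" and f: "f \<in> Sobolev \<Omega> 1" and g: "g \<in> Sobolev \<Omega> 1"
  shows "sqrt (gradient_inner \<Omega> (\<lambda>x. f x + g x) (\<lambda>x. f x + g x)) \<le> sqrt (gradient_inner \<Omega> f f) + sqrt (gradient_inner \<Omega> g g)"
proof (rule real_le_lsqrt)
  let ?F = "sqrt (gradient_inner \<Omega> f f)" and ?G = "sqrt (gradient_inner \<Omega> g g)"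
  have "gradient_inner \<Omega> (\<lambda>x. f x + g x) (\<lambda>x. f x + g x) = gradient_inner \<Omega> f f + 2 * gradient_inner \<Omega> f g + gradient_inner \<Omega> g g"
    using gradient_inner_quadratic[OF assms, of 1] by simp
  also have "\<dots> \<le> ?F\<^sup>2 + 2 * (?F * ?G) + ?G\<^sup>2"
    using gradient_inner_Cauchy_Schwarz[OF assms] gradient_inner_nonneg[of \<Omega> f] gradient_inner_nonneg[of \<Omega> g] by simp
  finally show "gradient_inner \<Omega> (\<lambda>x. f x + g x) (\<lambda>x. f x + g x) \<le> (?F + ?G)\<^sup>2"
    by (simp add: power2_sum)
qed (auto simp: gradient_inner_nonneg)

lemma gradient_sqrt_scaleR:
  assumes \<Omega>: "open \<Omega>" and f: "f \<in> Sobolev \<Omega> 1"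
  shows "sqrt (gradient_inner \<Omega> (\<lambda>x. c *\<^sub>R f x) (\<lambda>x. c *\<^sub>R f x)) = \<bar>c\<bar> * sqrt (gradient_inner \<Omega> f f)"
proof -
  have "gradient_inner \<Omega> (\<lambda>x. c *\<^sub>R f x) (\<lambda>x. c *\<^sub>R f x) = c\<^sup>2 * gradient_inner \<Omega> f f"
    using gradient_inner_scaleR_left[OF assms Sobolev_scaleR[OF assms], of c c] gradient_inner_scaleR_right[OF assms f, of c]
    by (simp add: power2_eq_square)
  then show ?thesis by (simp add: real_sqrt_mult)
qed

text \<open>Separability of H^1_d in the Dirichlet seminorm: real coefficients in the dense span are
  replaced by rational ones, and finite lists of rationals are countable.\<close>

lemma Galerkin_dense_sequence:
  fixes \<Omega> :: "'a::euclidean_space set"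
  assumes \<Omega>: "open \<Omega>" "\<Omega> \<in> lmeasurable" and basis: "Galerkin_basis \<Omega> a"
  obtains y :: "nat \<Rightarrow> 'a \<Rightarrow> 'a" where "\<And>i. y i \<in> Hd \<Omega> 1"
    "\<And>f e. f \<in> Hd \<Omega> 1 \<Longrightarrow> 0 < e \<Longrightarrow> \<exists>i. sqrt (gradient_inner \<Omega> (\<lambda>x. f x - y i x) (\<lambda>x. f x - y i x)) < e"
proof -
  have a: "a k \<in> Hd \<Omega> 1" if "k \<in> {1..n}" for k n
    using basis that unfolding Galerkin_basis_def by auto
  have z: "(\<lambda>x. 0) \<in> Hd \<Omega> 1"
    using Hd_linear[OF \<Omega> a[of 1 1] a[of 1 1], of "-1"] by simp
  have comb: "(\<lambda>x. \<Sum>k\<in>J. r k *\<^sub>R a k x) \<in> Hd \<Omega> 1" if "J \<subseteq> {1..n}" for J and r :: "nat \<Rightarrow> real" and n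
  proof -
    have "finite J" using that finite_subset by blast
    then show ?thesis using that
    proof (induction J rule: finite_induct)
      case (insert k J)
      then have "(\<lambda>x. (\<Sum>k\<in>J. r k *\<^sub>R a k x) + r k *\<^sub>R a k x) \<in> Hd \<Omega> 1"
        by (intro Hd_linear \<Omega> a) auto
      then show ?case using insert.hyps by (simp add: add.commute)
    qed (simp add: z del: One_nat_def)
  qed
  \<comment> \<open>Positions in a list start at 0, basis indices at 1, hence the shift; the length
    of the list is the number of basis fields used.\<close>
  define L where "L qs x = (\<Sum>k\<in>{1..length qs}. of_rat (qs ! (k - 1)) *\<^sub>R a k x)" for qs x
  define y where "y i = L (from_nat i :: rat list)" for i
  show thesis
  proof (rule that[of y])
    show "y i \<in> Hd \<Omega> 1" for i
      unfolding y_def L_def[abs_def] by (rule comb[OF order_refl])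
    fix f :: "'a \<Rightarrow> 'a" and e :: real assume f: "f \<in> Hd \<Omega> 1" and e: "0 < e"
    have "0 < ennreal (e / 2)" using e by simp
    from basis[unfolded Galerkin_basis_def, THEN conjunct2, THEN conjunct2, rule_format, OF f this]
    obtain n \<gamma> where g: "H_norm \<Omega> 1 (\<lambda>x. f x - (\<Sum>k=1..n. \<gamma> k *\<^sub>R a k x)) < ennreal (e / 2)"
      by (elim exE)
    let ?g = "\<lambda>x. f x - (\<Sum>k=1..n. \<gamma> k *\<^sub>R a k x)"
    define S where "S = (\<Sum>k=1..n. sqrt (gradient_inner \<Omega> (a k) (a k)))"
    have S0: "0 \<le> S" unfolding S_def by (intro sum_nonneg) (simp add: gradient_inner_nonneg)
    \<comment> \<open>Perturbing each coefficient by less than \<delta> costs at most \<delta> S in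
      the seminorm, so half of e remains for the real combination. The summand 1 avoids division by
      zero.\<close>
    define \<delta> where "\<delta> = e / (2 * (S + 1))"
    have \<delta>: "0 < \<delta>" using e S0 by (simp add: \<delta>_def)
    have "\<exists>q::rat. \<bar>\<gamma> k - of_rat q\<bar> < \<delta>" for k
    proof -
      obtain q where "\<gamma> k - \<delta> < of_rat q" "of_rat q < \<gamma> k" using of_rat_dense[of "\<gamma> k - \<delta>" "\<gamma> k"] \<delta> by auto
      then show ?thesis by (intro exI[of _ q]) auto
    qed
    then obtain p where p: "\<And>k. \<bar>\<gamma> k - of_rat (p k)\<bar> < \<delta>" by metis
    define qs where "qs = map (\<lambda>k. p (Suc k)) [0..<n]"
    have qL: "L qs x = (\<Sum>k=1..n. of_rat (p k) *\<^sub>R a k x)" for x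
      unfolding L_def qs_def by (auto intro!: sum.cong)
    let ?h = "\<lambda>J x. \<Sum>k\<in>J. (\<gamma> k - of_rat (p k)) *\<^sub>R a k x"
    have hb: "sqrt (gradient_inner \<Omega> (?h J) (?h J)) \<le> (\<Sum>k\<in>J. \<delta> * sqrt (gradient_inner \<Omega> (a k) (a k)))" if "J \<subseteq> {1..n}" for J
    proof -
      have "finite J" using that finite_subset by blast
      then show ?thesis using that
      proof (induction J rule: finite_induct)
        case empty
        have "gradient_inner \<Omega> (\<lambda>x. 0 *\<^sub>R f x) f = 0"
          using gradient_inner_scaleR_left[OF \<Omega>(1) Hd_Sobolev[OF f] Hd_Sobolev[OF f], of 0] by simp
        moreover have "gradient_inner \<Omega> (\<lambda>x. 0 *\<^sub>R f x) (\<lambda>x. 0 *\<^sub>R f x) = 0"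
          using gradient_inner_scaleR_left[OF \<Omega>(1) Hd_Sobolev[OF f] Sobolev_scaleR[OF \<Omega>(1) Hd_Sobolev[OF f]], of 0 0] by simp
        ultimately show ?case by simp
      next
        case (insert k J)
        have ak: "a k \<in> Sobolev \<Omega> 1" using insert.prems a[of k n] Hd_Sobolev by auto
        have S1: "(\<lambda>x. (\<gamma> k - of_rat (p k)) *\<^sub>R a k x) \<in> Sobolev \<Omega> 1" by (rule Sobolev_scaleR[OF \<Omega>(1) ak])
        have S2: "?h J \<in> Sobolev \<Omega> 1" by (rule Hd_Sobolev, rule comb[of J n]) (use insert.prems in auto)
        have "sqrt (gradient_inner \<Omega> (?h (insert k J)) (?h (insert k J))) \<le>
           \<bar>\<gamma> k - of_rat (p k)\<bar> * sqrt (gradient_inner \<Omega> (a k) (a k)) + sqrt (gradient_inner \<Omega> (?h J) (?h J))"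
          using gradient_sqrt_triangle[OF \<Omega>(1) S1 S2] insert.hyps gradient_sqrt_scaleR[OF \<Omega>(1) ak] by simp
        also have "\<dots> \<le> \<delta> * sqrt (gradient_inner \<Omega> (a k) (a k)) + (\<Sum>k\<in>J. \<delta> * sqrt (gradient_inner \<Omega> (a k) (a k)))"
          using p[of k] insert by (intro add_mono mult_right_mono) (auto simp: gradient_inner_nonneg)
        finally show ?case using insert.hyps by simp
      qed
    qed
    have Sg: "?g \<in> Sobolev \<Omega> 1" by (intro Sobolev_diff \<Omega> Hd_Sobolev f comb[of "{1..n}" n]) simp
    have Sh: "?h {1..n} \<in> Sobolev \<Omega> 1" by (rule Hd_Sobolev, rule comb[of _ n]) simp
    have 1: "sqrt (gradient_inner \<Omega> ?g ?g) < e / 2"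
    proof -
      have "sqrt (gradient_inner \<Omega> ?g ?g) \<le> sqrt (H1_square \<Omega> ?g)" by (rule real_sqrt_le_mono[OF gradient_inner_le_H1_square])
      also have "\<dots> < e / 2"
        using g unfolding H_norm_1[OF \<Omega>(1) Sg] by (simp add: H1_square_nonneg ennreal_less_iff)
      finally show ?thesis .
    qed
    have 2: "sqrt (gradient_inner \<Omega> (?h {1..n}) (?h {1..n})) \<le> e / 2"
    proof -
      have "sqrt (gradient_inner \<Omega> (?h {1..n}) (?h {1..n})) \<le> \<delta> * S"
        using hb[of "{1..n}"] by (simp add: S_def sum_distrib_left)
      also have "\<dots> \<le> \<delta> * (S + 1)" using \<delta> by simp
      also have "\<dots> = e / 2"
      proof -
        have "S + 1 \<noteq> 0" using S0 by simp
        then have "\<delta> = e / 2 / (S + 1)" by (simp add: \<delta>_def field_simps)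
        then show ?thesis using \<open>S + 1 \<noteq> 0\<close> by (metis nonzero_eq_divide_eq)
      qed
      finally show ?thesis .
    qed
    have eq: "(\<lambda>x. f x - L qs x) = (\<lambda>x. ?g x + ?h {1..n} x)"
      by (simp add: qL scaleR_diff_left sum_subtractf)
    have "sqrt (gradient_inner \<Omega> (\<lambda>x. f x - L qs x) (\<lambda>x. f x - L qs x)) < e"
      unfolding eq using gradient_sqrt_triangle[OF \<Omega>(1) Sg Sh] 1 2 by linarith
    moreover have "y (to_nat qs) = L qs" by (simp add: y_def)
    ultimately show "\<exists>i. sqrt (gradient_inner \<Omega> (\<lambda>x. f x - y i x) (\<lambda>x. f x - y i x)) < e" by metis
  qed
qed

lemma product_lmeasurable:
  fixes \<Omega> :: "'a::euclidean_space set"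
  assumes "open \<Omega>" "bounded \<Omega>"
  shows "{0<..<T::real} \<times> \<Omega> \<in> lmeasurable" "\<Omega> \<in> lmeasurable"
  using assms by (auto intro!: lmeasurable_open bounded_Times open_Times)

text \<open>The weak derivatives of the slices are chosen anew for every t, so no joint
  measurability can be used. Measurability is therefore built up from a test function, through a
  fixed element of H^1_0 and the quadratic form, to two time-dependent fields.\<close>

lemma gradient_inner_time_measurable_test:
  fixes w :: "real \<times> 'a::euclidean_space \<Rightarrow> 'a"
  assumes \<Omega>: "open \<Omega>" "bounded \<Omega>" and w: "w \<in> L2 ({0<..<T} \<times> \<Omega>)"
    and ae: "AE t in lebesgue_on {0<..<T}. curry w t \<in> Sobolev \<Omega> 1" and \<phi>: "\<phi> \<in> test_functions \<Omega>"
  shows "(\<lambda>t. gradient_inner \<Omega> (curry w t) \<phi>) \<in> borel_measurable (lebesgue_on {0<..<T})"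
proof -
  note l = laplacian_test_function[OF \<phi>]
  obtain B where B: "\<And>x. norm (laplacian \<phi> x) \<le> B" by (rule test_functions_bounded[OF l]) blast
  have lm: "(\<lambda>z. laplacian \<phi> (snd z)) \<in> borel_measurable (lebesgue_on ({0<..<T} \<times> \<Omega>))"
  proof (rule lebesgue_on_continuous_measurable)
    show "continuous_on ({0<..<T} \<times> \<Omega>) (\<lambda>z. laplacian \<phi> (snd z))"
      by (rule continuous_on_compose2[OF test_functions_continuous[OF l, of UNIV]]) (auto intro: continuous_intros)
    show "{0<..<T} \<times> \<Omega> \<in> sets borel" using \<Omega> by (intro borel_open open_Times) auto
  qed
  have lL: "(\<lambda>z. laplacian \<phi> (snd z)) \<in> L2 ({0<..<T} \<times> \<Omega>)"
    by (rule L2_bounded[OF lm _ product_lmeasurable(1)[OF \<Omega>], of B]) (use B in auto)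
  have i: "integrable (lebesgue_on {0<..<T}) (\<lambda>t. LINT x|lebesgue_on \<Omega>. w (t, x) \<bullet> laplacian \<phi> x)"
    using Fubini_lebesgue_on(2)[OF _ _ L2_inner_integrable[OF w lL]] \<Omega> by simp
  show ?thesis
  proof (rule lebesgue_on_AE_measurable)
    show "(\<lambda>t. - (LINT x|lebesgue_on \<Omega>. w (t, x) \<bullet> laplacian \<phi> x)) \<in> borel_measurable (lebesgue_on {0<..<T})"
      using i by simp
    show "AE t in lebesgue_on {0<..<T}. - (LINT x|lebesgue_on \<Omega>. w (t, x) \<bullet> laplacian \<phi> x) = gradient_inner \<Omega> (curry w t) \<phi>"
      using ae by eventually_elim (simp add: gradient_inner_test[OF \<Omega>(1) product_lmeasurable(2)[OF \<Omega>] _ \<phi>])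
  qed simp
qed

lemma gradient_inner_time_measurable_fixed:
  fixes w :: "real \<times> 'a::euclidean_space \<Rightarrow> 'a"
  assumes \<Omega>: "open \<Omega>" "bounded \<Omega>" and w: "w \<in> L2 ({0<..<T} \<times> \<Omega>)"
    and ae: "AE t in lebesgue_on {0<..<T}. curry w t \<in> Sobolev \<Omega> 1" and h: "h \<in> H10 \<Omega>"
  shows "(\<lambda>t. gradient_inner \<Omega> (curry w t) h) \<in> borel_measurable (lebesgue_on {0<..<T})"
proof -
  note \<Omega>m = product_lmeasurable(2)[OF \<Omega>]
  obtain \<phi> where \<phi>: "\<And>n. \<phi> n \<in> test_functions \<Omega>" "(\<lambda>n. H1_square \<Omega> (\<lambda>x. \<phi> n x - h x)) \<longlonglongrightarrow> 0"
    by (rule H10_approx[OF \<Omega>(1) \<Omega>m h]) blast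
  note S\<phi> = test_functions_Sobolev(1)[OF \<Omega>(1) \<Omega>m \<phi>(1)] and Sh = H10_Sobolev[OF h]
  note Sd = Sobolev_diff[OF \<Omega>(1) S\<phi> Sh]
  \<comment> \<open>The default 0 at the exceptional times makes the convergence below hold at every
    t, as the measurability of a pointwise limit demands.\<close>
  define g where "g n t = (if curry w t \<in> Sobolev \<Omega> 1 then gradient_inner \<Omega> (curry w t) (\<phi> n) else 0)" for n t
  define g' where "g' t = (if curry w t \<in> Sobolev \<Omega> 1 then gradient_inner \<Omega> (curry w t) h else 0)" for t
  have lim: "(\<lambda>n. g n t) \<longlonglongrightarrow> g' t" for t
  proof (cases "curry w t \<in> Sobolev \<Omega> 1")
    case True
    let ?f = "curry w t"
    have le: "\<bar>g n t - g' t\<bar> \<le> sqrt (gradient_inner \<Omega> ?f ?f) * sqrt (H1_square \<Omega> (\<lambda>x. \<phi> n x - h x))" for n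
    proof -
      have "gradient_inner \<Omega> ?f (\<phi> n) = gradient_inner \<Omega> ?f (\<lambda>x. \<phi> n x - h x) + gradient_inner \<Omega> ?f h"
        using gradient_inner_add_right[OF \<Omega>(1) Sd Sh True] by simp
      then have "\<bar>g n t - g' t\<bar> = \<bar>gradient_inner \<Omega> ?f (\<lambda>x. \<phi> n x - h x)\<bar>" using True by (simp add: g_def g'_def)
      also have "\<dots> \<le> sqrt (gradient_inner \<Omega> ?f ?f) * sqrt (gradient_inner \<Omega> (\<lambda>x. \<phi> n x - h x) (\<lambda>x. \<phi> n x - h x))"
        by (rule gradient_inner_Cauchy_Schwarz[OF \<Omega>(1) True Sd])
      also have "\<dots> \<le> sqrt (gradient_inner \<Omega> ?f ?f) * sqrt (H1_square \<Omega> (\<lambda>x. \<phi> n x - h x))"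
        by (intro mult_left_mono real_sqrt_le_mono gradient_inner_le_H1_square) (simp add: gradient_inner_nonneg)
      finally show ?thesis .
    qed
    have "(\<lambda>n. sqrt (gradient_inner \<Omega> ?f ?f) * sqrt (H1_square \<Omega> (\<lambda>x. \<phi> n x - h x))) \<longlonglongrightarrow> sqrt (gradient_inner \<Omega> ?f ?f) * sqrt 0"
      by (intro tendsto_intros \<phi>)
    then have r: "(\<lambda>n. sqrt (gradient_inner \<Omega> ?f ?f) * sqrt (H1_square \<Omega> (\<lambda>x. \<phi> n x - h x))) \<longlonglongrightarrow> 0" by simp
    have "(\<lambda>n. \<bar>g n t - g' t\<bar>) \<longlonglongrightarrow> 0"
      by (rule tendsto_sandwich[OF _ _ tendsto_const r]) (use le in auto)
    then show ?thesis using LIM_zero_iff tendsto_rabs_zero_iff by blast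
  qed (simp add: g_def g'_def)
  have gm: "g n \<in> borel_measurable (lebesgue_on {0<..<T})" for n
    by (rule lebesgue_on_AE_measurable[OF gradient_inner_time_measurable_test[OF \<Omega> w ae \<phi>(1)[of n]]])
      (use ae in \<open>auto simp: g_def elim: eventually_mono\<close>)
  have g'm: "g' \<in> borel_measurable (lebesgue_on {0<..<T})"
    by (rule borel_measurable_LIMSEQ_real[OF lim gm])
  show ?thesis
    by (rule lebesgue_on_AE_measurable[OF g'm]) (use ae in \<open>auto simp: g'_def elim: eventually_mono\<close>)
qed

text \<open>The Dirichlet form is the supremum of its affine minorants over a countable dense set.\<close>

lemma gradient_inner_time_measurable_square:
  fixes w :: "real \<times> 'a::euclidean_space \<Rightarrow> 'a"
  assumes \<Omega>: "open \<Omega>" "bounded \<Omega>" and basis: "Galerkin_basis \<Omega> a" and w: "w \<in> L2 ({0<..<T} \<times> \<Omega>)"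
    and ae: "AE t in lebesgue_on {0<..<T}. curry w t \<in> Hd \<Omega> 1"
  shows "(\<lambda>t. gradient_inner \<Omega> (curry w t) (curry w t)) \<in> borel_measurable (lebesgue_on {0<..<T})"
proof -
  obtain y :: "nat \<Rightarrow> 'a \<Rightarrow> 'a" where y: "\<And>i. y i \<in> Hd \<Omega> 1"
    "\<And>f e. f \<in> Hd \<Omega> 1 \<Longrightarrow> 0 < e \<Longrightarrow> \<exists>i. sqrt (gradient_inner \<Omega> (\<lambda>x. f x - y i x) (\<lambda>x. f x - y i x)) < e"
    by (rule Galerkin_dense_sequence[OF \<Omega>(1) product_lmeasurable(2)[OF \<Omega>] basis]) blast
  have aeS: "AE t in lebesgue_on {0<..<T}. curry w t \<in> Sobolev \<Omega> 1"
    using ae by eventually_elim (rule Hd_Sobolev)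
  \<comment> \<open>The default 0 keeps the family bounded above at every t, as the measurability of
    its supremum demands.\<close>
  define F where "F i t = (if curry w t \<in> Hd \<Omega> 1 then 2 * gradient_inner \<Omega> (curry w t) (y i) - gradient_inner \<Omega> (y i) (y i) else 0)" for i t
  have Fm: "F i \<in> borel_measurable (lebesgue_on {0<..<T})" for i
  proof (rule lebesgue_on_AE_measurable)
    show "(\<lambda>t. 2 * gradient_inner \<Omega> (curry w t) (y i) - gradient_inner \<Omega> (y i) (y i)) \<in> borel_measurable (lebesgue_on {0<..<T})"
      using gradient_inner_time_measurable_fixed[OF \<Omega> w aeS Hd_H10[OF y(1)]] by simp
    show "AE t in lebesgue_on {0<..<T}. 2 * gradient_inner \<Omega> (curry w t) (y i) - gradient_inner \<Omega> (y i) (y i) = F i t"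
      using ae by eventually_elim (simp add: F_def)
  qed simp
  have upper: "F i t \<le> (if curry w t \<in> Hd \<Omega> 1 then gradient_inner \<Omega> (curry w t) (curry w t) else 0)" for i t
  proof (cases "curry w t \<in> Hd \<Omega> 1")
    case True
    then show ?thesis using two_gradient_inner_le[OF \<Omega>(1) Hd_Sobolev[OF True] Hd_Sobolev[OF y(1)[of i]]] by (simp add: F_def)
  qed (simp add: F_def)
  have bdd: "bdd_above ((\<lambda>i. F i t) ` UNIV)" for t
    using upper by (intro bdd_aboveI2)
  have sup: "(SUP i. F i t) = gradient_inner \<Omega> (curry w t) (curry w t)" if f: "curry w t \<in> Hd \<Omega> 1" for t
  proof (rule antisym)
    show "(SUP i. F i t) \<le> gradient_inner \<Omega> (curry w t) (curry w t)"
      using upper[of _ t] f by (intro cSUP_least) auto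
    show "gradient_inner \<Omega> (curry w t) (curry w t) \<le> (SUP i. F i t)"
    proof (rule field_le_epsilon)
      fix e :: real assume e: "0 < e"
      let ?f = "curry w t"
      \<comment> \<open>The gap between the form at f and its minorant at \<open>y i\<close> is the
        squared distance of the two, hence sqrt e.\<close>
      obtain i where i: "sqrt (gradient_inner \<Omega> (\<lambda>x. ?f x - y i x) (\<lambda>x. ?f x - y i x)) < sqrt e"
        using y(2)[OF f, of "sqrt e"] e by auto
      then have "gradient_inner \<Omega> (\<lambda>x. ?f x - y i x) (\<lambda>x. ?f x - y i x) < e" by simp
      then have "gradient_inner \<Omega> ?f ?f \<le> F i t + e"
        using gradient_inner_quadratic[OF \<Omega>(1) Hd_Sobolev[OF f] Hd_Sobolev[OF y(1)[of i]], of "-1"] f by (simp add: F_def)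
      also have "\<dots> \<le> (SUP i. F i t) + e" using cSUP_upper[OF _ bdd[of t], of i] by simp
      finally show "gradient_inner \<Omega> ?f ?f \<le> (SUP i. F i t) + e" .
    qed
  qed
  have "(\<lambda>t. SUP i\<in>(UNIV::nat set). F i t) \<in> borel_measurable (lebesgue_on {0<..<T})"
    by (rule borel_measurable_cSUP) (use Fm bdd in auto)
  then show ?thesis
    by (rule lebesgue_on_AE_measurable) (use ae sup in \<open>auto elim: eventually_mono\<close>)
qed

text \<open>Polarisation: the mixed form is a combination of the squares of w, h and w + h.\<close>

lemma gradient_inner_time_measurable:
  fixes w h :: "real \<times> 'a::euclidean_space \<Rightarrow> 'a"
  assumes \<Omega>: "open \<Omega>" "bounded \<Omega>" and basis: "Galerkin_basis \<Omega> a"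
    and w: "w \<in> L2 ({0<..<T} \<times> \<Omega>)" "AE t in lebesgue_on {0<..<T}. curry w t \<in> Hd \<Omega> 1"
    and h: "h \<in> L2 ({0<..<T} \<times> \<Omega>)" "AE t in lebesgue_on {0<..<T}. curry h t \<in> Hd \<Omega> 1"
  shows "(\<lambda>t. gradient_inner \<Omega> (curry w t) (curry h t)) \<in> borel_measurable (lebesgue_on {0<..<T})"
proof -
  note sq = gradient_inner_time_measurable_square[OF \<Omega> basis]
  have c: "curry (\<lambda>z. w z + h z) t = (\<lambda>x. curry w t x + curry h t x)" for t by (simp add: curry_def)
  have "AE t in lebesgue_on {0<..<T}. curry (\<lambda>z. w z + h z) t \<in> Hd \<Omega> 1"
    using w(2) h(2)
  proof eventually_elim
    case (elim t)
    show ?case unfolding c using Hd_linear[OF \<Omega>(1) product_lmeasurable(2)[OF \<Omega>] elim, of 1] by simp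
  qed
  note m = sq[OF w] sq[OF h] sq[OF L2_add[OF w(1) h(1)] this]
  show ?thesis
  proof (rule lebesgue_on_AE_measurable)
    let ?s = "\<lambda>t. gradient_inner \<Omega> (curry (\<lambda>z. w z + h z) t) (curry (\<lambda>z. w z + h z) t)"
    show "(\<lambda>t. (?s t - gradient_inner \<Omega> (curry w t) (curry w t) - gradient_inner \<Omega> (curry h t) (curry h t)) / 2) \<in> borel_measurable (lebesgue_on {0<..<T})"
      using m by simp
    show "AE t in lebesgue_on {0<..<T}. (?s t - gradient_inner \<Omega> (curry w t) (curry w t) - gradient_inner \<Omega> (curry h t) (curry h t)) / 2
       = gradient_inner \<Omega> (curry w t) (curry h t)"
      using w(2) h(2)
    proof eventually_elim
      case (elim t)
      show ?case unfolding c using gradient_inner_quadratic[OF \<Omega>(1) elim[THEN Hd_Sobolev], of 1] by simp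
    qed
  qed simp
qed

lemma Hd_field_gradient:
  fixes w :: "real \<times> 'a::euclidean_space \<Rightarrow> 'a"
  assumes \<Omega>: "open \<Omega>" "bounded \<Omega>" and basis: "Galerkin_basis \<Omega> a"
    and w: "w \<in> L2t T \<Omega> (Hd \<Omega> 1) (H_norm \<Omega> 1)"
  shows "(\<lambda>t. sqrt (gradient_inner \<Omega> (curry w t) (curry w t))) \<in> L2 {0<..<T}"
    and "ennreal (sqrt (LINT t|lebesgue_on {0<..<T}. gradient_inner \<Omega> (curry w t) (curry w t))) \<le> L2t_norm T (H_norm \<Omega> 1) (curry w)"
    and "integrable (lebesgue_on {0<..<T}) (\<lambda>t. gradient_inner \<Omega> (curry w t) (curry w t))"
proof -
  let ?I = "lebesgue_on {0<..<T}" and ?g = "\<lambda>t. gradient_inner \<Omega> (curry w t) (curry w t)"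
  have ae: "AE t in ?I. curry w t \<in> Hd \<Omega> 1" and fin: "L2t_norm T (H_norm \<Omega> 1) (curry w) < \<infinity>"
    using w unfolding L2t_def by auto
  have m: "?g \<in> borel_measurable ?I"
    by (rule gradient_inner_time_measurable_square[OF \<Omega> basis Hd_space_time_L2(1)[OF \<Omega>(1) product_lmeasurable(2)[OF \<Omega>] w] ae])
  have le: "(\<integral>\<^sup>+t. ennreal (?g t) \<partial>?I) \<le> (\<integral>\<^sup>+t. (H_norm \<Omega> 1 (curry w t))\<^sup>2 \<partial>?I)"
  proof (rule nn_integral_mono_AE)
    show "AE t in ?I. ennreal (?g t) \<le> (H_norm \<Omega> 1 (curry w t))\<^sup>2"
      using ae
    proof eventually_elim
      case (elim t)
      show ?case
        unfolding H_norm_1[OF \<Omega>(1) Hd_Sobolev[OF elim]]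
        by (simp add: ennreal_power H1_square_nonneg ennreal_leI gradient_inner_le_H1_square)
    qed
  qed
  also have "\<dots> < \<infinity>" by (rule fin[unfolded L2t_norm_finite])
  finally show i: "integrable ?I ?g"
    using m by (simp add: integrable_iff_bounded gradient_inner_nonneg)
  show "(\<lambda>t. sqrt (?g t)) \<in> L2 {0<..<T}"
    using m i by (simp add: L2_iff gradient_inner_nonneg)
  have "ennreal (sqrt (LINT t|?I. ?g t)) = ennsqrt (\<integral>\<^sup>+t. ennreal (?g t) \<partial>?I)"
    by (subst nn_integral_eq_integral[OF i])
      (auto simp: gradient_inner_nonneg ennsqrt_ennreal integral_nonneg_AE)
  also have "\<dots> \<le> L2t_norm T (H_norm \<Omega> 1) (curry w)"
    unfolding L2t_norm_def by (rule ennsqrt_mono[OF le])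
  finally show "ennreal (sqrt (LINT t|?I. ?g t)) \<le> L2t_norm T (H_norm \<Omega> 1) (curry w)" .
qed

text \<open>With u fixed, the Dirichlet form integrated up to t is linear in w and bounded, by the
  Cauchy-Schwarz inequality in space and then in time. Weak convergence can thus be tested with the
  limit itself.\<close>

lemma gradient_dual:
  fixes u :: "real \<times> 'a::euclidean_space \<Rightarrow> 'a"
  assumes \<Omega>: "open \<Omega>" "bounded \<Omega>" and basis: "Galerkin_basis \<Omega> a"
    and u: "u \<in> L2t T \<Omega> (Hd \<Omega> 1) (H_norm \<Omega> 1)"
  shows "(\<lambda>w. LINT s|lebesgue_on {0<..<T}. indicator {0<..<t} s * gradient_inner \<Omega> (curry w s) (curry u s)) \<in>
    dual (L2t T \<Omega> (Hd \<Omega> 1) (H_norm \<Omega> 1)) (\<lambda>w. L2t_norm T (H_norm \<Omega> 1) (curry w))"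
    and "w \<in> L2t T \<Omega> (Hd \<Omega> 1) (H_norm \<Omega> 1) \<Longrightarrow>
      integrable (lebesgue_on {0<..<T}) (\<lambda>s. gradient_inner \<Omega> (curry w s) (curry u s))"
proof -
  let ?I = "lebesgue_on {0<..<T}" and ?V = "L2t T \<Omega> (Hd \<Omega> 1) (H_norm \<Omega> 1)"
  let ?G = "\<lambda>w s. gradient_inner \<Omega> (curry w s) (curry u s)"
  let ?n = "\<lambda>w s. sqrt (gradient_inner \<Omega> (curry w s) (curry w s))"
  note \<Omega>m = product_lmeasurable(2)[OF \<Omega>]
  have V: "w \<in> L2 ({0<..<T} \<times> \<Omega>)" "AE s in ?I. curry w s \<in> Hd \<Omega> 1" if "w \<in> ?V" for w
    using Hd_space_time_L2(1)[OF \<Omega>(1) \<Omega>m that] that by (auto simp: L2t_def)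
  have m: "?G w \<in> borel_measurable ?I" if "w \<in> ?V" for w
    by (rule gradient_inner_time_measurable[OF \<Omega> basis V[OF that] V[OF u]])
  have b: "AE s in ?I. \<bar>?G w s\<bar> \<le> norm (?n w s) * norm (?n u s)" if "w \<in> ?V" for w
    using V(2)[OF that] V(2)[OF u]
  proof eventually_elim
    case (elim s)
    show ?case using gradient_inner_Cauchy_Schwarz[OF \<Omega>(1) elim[THEN Hd_Sobolev]] by (simp add: gradient_inner_nonneg)
  qed
  note LV = Hd_field_gradient(1)[OF \<Omega> basis]
  show i: "integrable ?I (?G w)" if "w \<in> ?V" for w
  proof (rule Bochner_Integration.integrable_bound[OF L2_mult_integrable[OF LV[OF that] LV[OF u]] m[OF that]])
    show "AE s in ?I. norm (?G w s) \<le> norm (norm (?n w s) * norm (?n u s))"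
      using b[OF that] by eventually_elim simp
  qed
  have it: "integrable ?I (\<lambda>s. indicator {0<..<t} s * ?G w s)" if "w \<in> ?V" for w
    using integrable_bounded_mult[OF i[OF that], of "indicator {0<..<t}" 1] lebesgue_on_borel_measurable[of "indicator {0<..<t}" "{0<..<T}"]
    by (simp add: indicator_def)
  define B where "B = sqrt (LINT s|?I. gradient_inner \<Omega> (curry u s) (curry u s))"
  have bound: "ennreal \<bar>LINT s|?I. indicator {0<..<t} s * ?G w s\<bar> \<le> ennreal B * L2t_norm T (H_norm \<Omega> 1) (curry w)" if w: "w \<in> ?V" for w
  proof -
    have "\<bar>LINT s|?I. indicator {0<..<t} s * ?G w s\<bar> \<le> (LINT s|?I. \<bar>indicator {0<..<t} s * ?G w s\<bar>)"
      by (rule integral_abs_bound)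
    also have "\<dots> \<le> (LINT s|?I. norm (?n w s) * norm (?n u s))"
    proof (rule integral_mono_AE)
      show "AE s in ?I. \<bar>indicator {0<..<t} s * ?G w s\<bar> \<le> norm (?n w s) * norm (?n u s)"
        using b[OF w] by eventually_elim (auto simp: indicator_def)
    qed (use it[OF w] L2_mult_integrable[OF LV[OF w] LV[OF u]] in auto)
    also have "\<dots> \<le> sqrt (LINT s|?I. (norm (?n w s))\<^sup>2) * sqrt (LINT s|?I. (norm (?n u s))\<^sup>2)"
      by (rule L2_Cauchy_Schwarz_norm[OF LV[OF w] LV[OF u]])
    also have "\<dots> = B * sqrt (LINT s|?I. gradient_inner \<Omega> (curry w s) (curry w s))"
      by (simp add: B_def gradient_inner_nonneg mult.commute)
    finally have "ennreal \<bar>LINT s|?I. indicator {0<..<t} s * ?G w s\<bar> \<le> ennreal (B * sqrt (LINT s|?I. gradient_inner \<Omega> (curry w s) (curry w s)))"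
      by (rule ennreal_leI)
    also have "\<dots> = ennreal B * ennreal (sqrt (LINT s|?I. gradient_inner \<Omega> (curry w s) (curry w s)))"
      by (rule ennreal_mult) (auto simp: B_def gradient_inner_nonneg integral_nonneg_AE)
    also have "\<dots> \<le> ennreal B * L2t_norm T (H_norm \<Omega> 1) (curry w)"
      by (intro mult_left_mono Hd_field_gradient(2)[OF \<Omega> basis w]) simp
    finally show ?thesis .
  qed
  have ae_eq: "(LINT s|?I. f s) = (LINT s|?I. g s)" if "integrable ?I g" "AE s in ?I. g s = f s" for f g :: "real \<Rightarrow> real"
    using integral_cong_AE[OF borel_measurable_integrable[OF that(1)] lebesgue_on_AE_measurable[OF borel_measurable_integrable[OF that(1)] that(2)] that(2)]
    by simp
  have add: "(LINT s|?I. indicator {0<..<t} s * ?G (\<lambda>z. v z + w z) s) = (LINT s|?I. indicator {0<..<t} s * ?G v s) + (LINT s|?I. indicator {0<..<t} s * ?G w s)"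
    if v: "v \<in> ?V" and w: "w \<in> ?V" for v w
  proof -
    have "AE s in ?I. indicator {0<..<t} s * ?G v s + indicator {0<..<t} s * ?G w s = indicator {0<..<t} s * ?G (\<lambda>z. v z + w z) s"
      using V(2)[OF v] V(2)[OF w] V(2)[OF u]
    proof eventually_elim
      case (elim s)
      show ?case
        using gradient_inner_add_left[OF \<Omega>(1) elim[THEN Hd_Sobolev]] by (simp add: curry_def distrib_left)
    qed
    from ae_eq[OF Bochner_Integration.integrable_add[OF it[OF v] it[OF w]] this]
    show ?thesis using it[OF v] it[OF w] by simp
  qed
  have scale: "(LINT s|?I. indicator {0<..<t} s * ?G (\<lambda>z. c *\<^sub>R w z) s) = c * (LINT s|?I. indicator {0<..<t} s * ?G w s)"
    if w: "w \<in> ?V" for c w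
  proof -
    have "AE s in ?I. c * (indicator {0<..<t} s * ?G w s) = indicator {0<..<t} s * ?G (\<lambda>z. c *\<^sub>R w z) s"
      using V(2)[OF w] V(2)[OF u]
    proof eventually_elim
      case (elim s)
      show ?case
        using gradient_inner_scaleR_left[OF \<Omega>(1) elim[THEN Hd_Sobolev], of c] by (simp add: curry_def)
    qed
    from ae_eq[OF integrable_mult_right[OF it[OF w], of c] this]
    show ?thesis by simp
  qed
  show "(\<lambda>w. LINT s|?I. indicator {0<..<t} s * ?G w s) \<in> dual ?V (\<lambda>w. L2t_norm T (H_norm \<Omega> 1) (curry w))"
    unfolding dual_def mem_Collect_eq using add scale bound by blast
qed

text \<open>Tests with the set where q is positive. That set is only Lebesgue measurable, so it is
  replaced by a Borel subset from which it differs by a null set.\<close>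

lemma AE_nonpos_if_integrals_nonpos:
  fixes q :: "real \<Rightarrow> real"
  assumes q: "integrable (lebesgue_on {0<..<T}) q"
    and le: "\<And>A. A \<in> sets borel \<Longrightarrow> (LINT t|lebesgue_on {0<..<T}. indicator A t * q t) \<le> 0"
  shows "AE t in lebesgue_on {0<..<T}. q t \<le> 0"
proof -
  let ?I = "lebesgue_on {0<..<T}"
  define P where "P = {t\<in>{0<..<T}. 0 < q t}"
  have "P \<in> sets ?I"
    using borel_measurable_less[OF borel_measurable_const[of 0] borel_measurable_integrable[OF q]] by (simp add: P_def)
  then have "P \<in> sets lebesgue" by (auto simp: sets_restrict_space)
  then obtain A N where A: "A \<in> sets borel" "negligible N" "A \<union> N = P"
    by (rule sets_lebesgue_almost_borel) blast
  have im: "integrable ?I (\<lambda>t. indicator S t * q t)" if "S \<in> sets borel" for S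
  proof -
    have "indicator S \<in> borel_measurable ?I"
      by (rule lebesgue_on_borel_measurable) (use that in simp)
    from integrable_bounded_mult[OF q this, of 1] show ?thesis by (simp add: indicator_def)
  qed
  have nn: "0 \<le> indicator A t * q t" for t
  proof (cases "t \<in> A")
    case True
    then have "t \<in> P" using A(3) by blast
    then show ?thesis using True by (simp add: P_def)
  qed simp
  have "(LINT t|?I. indicator A t * q t) = 0"
    by (rule antisym[OF le[OF A(1)] integral_nonneg_AE]) (rule AE_I2, rule nn)
  then have "AE t in ?I. indicator A t * q t = 0"
    using im[OF A(1)] nn by (subst (asm) integral_nonneg_eq_0_iff_AE) auto
  moreover have "AE t in ?I. t \<notin> N"
  proof -
    have "N \<in> null_sets lebesgue" using A(2) by (simp add: negligible_iff_null_sets)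
    from AE_not_in[OF this] have "AE t in lebesgue. t \<in> {0<..<T} \<longrightarrow> t \<notin> N" by eventually_elim simp
    then show ?thesis by (subst AE_restrict_space_iff) auto
  qed
  ultimately show ?thesis
    using AE_space
  proof eventually_elim
    case (elim t)
    show ?case
    proof (rule ccontr)
      assume "\<not> q t \<le> 0"
      then have "t \<in> P" using elim by (simp add: P_def)
      then have "t \<in> A" using A(3) elim(2) by blast
      then show False using elim \<open>\<not> q t \<le> 0\<close> by simp
    qed
  qed
qed

section \<open>Convergence of the initial energies\<close>

text \<open>Neither factor is good enough for Hoelder's inequality: f_n tends to zero in L^2 only
  and g is merely integrable. Truncating g at height m leaves a remainder that is small uniformly in
  n, because the f_n are bounded; the truncated part is at most m |f_n|.\<close>

lemma bounded_times_L1_limit: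
  fixes f :: "nat \<Rightarrow> 'a::euclidean_space \<Rightarrow> real" and g :: "'a \<Rightarrow> real"
  assumes \<Omega>: "\<Omega> \<in> lmeasurable" and f: "\<And>n. f n \<in> L2 \<Omega>" "\<And>n. AE x in lebesgue_on \<Omega>. \<bar>f n x\<bar> \<le> B"
    and lim: "(\<lambda>n. LINT x|lebesgue_on \<Omega>. (norm (f n x))\<^sup>2) \<longlonglongrightarrow> 0"
    and g: "integrable (lebesgue_on \<Omega>) g" "\<And>x. 0 \<le> g x"
  shows "(\<lambda>n. LINT x|lebesgue_on \<Omega>. \<bar>f n x\<bar> * g x) \<longlonglongrightarrow> 0"
proof -
  let ?X = "lebesgue_on \<Omega>"
  have one: "(\<lambda>x. 1::real) \<in> L2 \<Omega>" by (rule L2_bounded[where B=1]) (use \<Omega> in auto)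
  define r where "r m = (LINT x|?X. g x - min (g x) (real m))" for m
  have r0: "r \<longlonglongrightarrow> 0"
  proof -
    have "(\<lambda>m. LINT x|?X. g x - min (g x) (real m)) \<longlonglongrightarrow> (LINT x|?X. 0)"
    proof (rule integral_dominated_convergence[where w=g])
      show "AE x in ?X. (\<lambda>m. g x - min (g x) (real m)) \<longlonglongrightarrow> 0"
      proof (rule AE_I2)
        fix x
        obtain k where "g x \<le> real k" using real_arch_simple by blast
        then have "\<forall>m\<ge>k. g x - min (g x) (real m) = 0" by auto
        then show "(\<lambda>m. g x - min (g x) (real m)) \<longlonglongrightarrow> 0"
          by (intro tendsto_eventually) (auto simp: eventually_sequentially)
      qed
    qed (use g in auto)
    then show ?thesis by (simp add: r_def[abs_def])
  qed
  define s where "s n = sqrt (LINT x|?X. (norm (f n x))\<^sup>2) * sqrt (LINT x|?X. (norm (1::real))\<^sup>2)" for n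
  have s0: "s \<longlonglongrightarrow> 0"
    using tendsto_mult_left_zero[OF tendsto_real_sqrt[OF lim, simplified], of "sqrt (LINT x|?X. (norm (1::real))\<^sup>2)"]
    by (simp add: s_def[abs_def])
  have i1: "integrable ?X (f n)" for n by (rule L2_imp_integrable[OF f(1) \<Omega>])
  have ig: "integrable ?X (\<lambda>x. \<bar>f n x\<bar> * g x)" for n
    using integrable_bounded_mult[OF g(1) _ , of "\<lambda>x. \<bar>f n x\<bar>" B] f(2)[of n] L2_measurable[OF f(1)[of n]] by simp
  have im: "integrable ?X (\<lambda>x. g x - min (g x) (real m))" for m
    by (rule Bochner_Integration.integrable_bound[OF g(1)]) (use g in auto)
  have le: "(LINT x|?X. \<bar>f n x\<bar> * g x) \<le> \<bar>B\<bar> * r m + real m * s n" for n m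
  proof -
    have "(LINT x|?X. \<bar>f n x\<bar> * g x) \<le> (LINT x|?X. \<bar>B\<bar> * (g x - min (g x) (real m)) + real m * \<bar>f n x\<bar>)"
    proof (rule integral_mono_AE[OF ig])
      show "AE x in ?X. \<bar>f n x\<bar> * g x \<le> \<bar>B\<bar> * (g x - min (g x) (real m)) + real m * \<bar>f n x\<bar>"
        using f(2)[of n]
      proof eventually_elim
        case (elim x)
        have "\<bar>f n x\<bar> * g x = \<bar>f n x\<bar> * (g x - min (g x) (real m)) + \<bar>f n x\<bar> * min (g x) (real m)" by (simp add: algebra_simps)
        moreover have "\<bar>f n x\<bar> * (g x - min (g x) (real m)) \<le> \<bar>B\<bar> * (g x - min (g x) (real m))"
          using elim by (intro mult_right_mono) auto
        moreover have "\<bar>f n x\<bar> * min (g x) (real m) \<le> \<bar>f n x\<bar> * real m" by (intro mult_left_mono) auto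
        ultimately show ?case by (simp add: mult.commute)
      qed
    qed (use im i1 in auto)
    also have "\<dots> = \<bar>B\<bar> * r m + real m * (LINT x|?X. \<bar>f n x\<bar>)" using im i1 by (simp add: r_def)
    also have "\<dots> \<le> \<bar>B\<bar> * r m + real m * s n"
      using L2_Cauchy_Schwarz_norm[OF f(1)[of n] one] by (simp add: s_def mult_left_mono)
    finally show ?thesis .
  qed
  show ?thesis
  proof (rule LIMSEQ_I)
    fix e :: real assume e: "0 < e"
    \<comment> \<open>The height m is fixed before n, since the second term grows with m.\<close>
    have "(\<lambda>m. \<bar>B\<bar> * r m) \<longlonglongrightarrow> \<bar>B\<bar> * 0" by (intro tendsto_intros r0)
    then have "\<forall>\<^sub>F m in sequentially. \<bar>B\<bar> * r m < e / 2" using e by (intro order_tendstoD(2)[of _ 0]) auto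
    then obtain m where m: "\<bar>B\<bar> * r m < e / 2" by (auto simp: eventually_sequentially)
    have "(\<lambda>n. real m * s n) \<longlonglongrightarrow> real m * 0" by (intro tendsto_intros s0)
    then have "\<forall>\<^sub>F n in sequentially. real m * s n < e / 2" using e by (intro order_tendstoD(2)[of _ 0]) auto
    then obtain k where k: "\<And>n. n \<ge> k \<Longrightarrow> real m * s n < e / 2" by (auto simp: eventually_sequentially)
    show "\<exists>k. \<forall>n\<ge>k. norm ((LINT x|?X. \<bar>f n x\<bar> * g x) - 0) < e"
    proof (intro exI[of _ k] allI impI)
      fix n assume "k \<le> n"
      then have "(LINT x|?X. \<bar>f n x\<bar> * g x) < e" using le[of n m] m k[of n] by linarith
      moreover have "0 \<le> (LINT x|?X. \<bar>f n x\<bar> * g x)" using g(2) by (intro integral_nonneg_AE) auto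
      ultimately show "norm ((LINT x|?X. \<bar>f n x\<bar> * g x) - 0) < e" by simp
    qed
  qed
qed

lemma L2_norm_tendsto_0:
  fixes f :: "nat \<Rightarrow> 'a::euclidean_space \<Rightarrow> 'b::euclidean_space"
  assumes "\<And>n. f n \<in> L2 \<Omega>" "(\<lambda>n. L2_norm \<Omega> (f n)) \<longlonglongrightarrow> 0"
  shows "(\<lambda>n. LINT x|lebesgue_on \<Omega>. (norm (f n x))\<^sup>2) \<longlonglongrightarrow> 0"
proof -
  have "(\<lambda>n. (L2_norm \<Omega> (f n))\<^sup>2) \<longlonglongrightarrow> 0\<^sup>2"
    unfolding power2_eq_square by (intro tendsto_mult_ennreal assms) auto
  then show ?thesis
    using tendsto_ennreal_iff[of "\<lambda>n. LINT x|lebesgue_on \<Omega>. (norm (f n x))\<^sup>2" sequentially 0]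
    by (simp add: L2_norm_square_eq[OF assms(1)])
qed

text \<open>The difference is r_n (|v_n|^2 - |v0|^2) + (r_n - r0) |v0|^2. The first part uses the
  uniform bound on r_n and convergence of |v_n|^2 in L^1; the second is the case of
  \<open>bounded_times_L1_limit\<close>.\<close>

lemma initial_energy_limit:
  fixes r :: "nat \<Rightarrow> 'a::euclidean_space \<Rightarrow> real" and v :: "nat \<Rightarrow> 'a \<Rightarrow> 'b::euclidean_space"
  assumes \<Omega>: "\<Omega> \<in> lmeasurable"
    and r: "\<And>n. r n \<in> L2 \<Omega>" "\<And>n. AE x in lebesgue_on \<Omega>. \<bar>r n x\<bar> \<le> B" and r0: "r0 \<in> L2 \<Omega>" "AE x in lebesgue_on \<Omega>. \<bar>r0 x\<bar> \<le> B"
    and v: "\<And>n. v n \<in> L2 \<Omega>" and v0: "v0 \<in> L2 \<Omega>"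
    and rlim: "(\<lambda>n. L2_norm \<Omega> (\<lambda>x. r n x - r0 x)) \<longlonglongrightarrow> 0" and vlim: "(\<lambda>n. L2_norm \<Omega> (\<lambda>x. v n x - v0 x)) \<longlonglongrightarrow> 0"
  shows "(\<lambda>n. LINT x|lebesgue_on \<Omega>. r n x * (norm (v n x))\<^sup>2) \<longlonglongrightarrow> (LINT x|lebesgue_on \<Omega>. r0 x * (norm (v0 x))\<^sup>2)"
proof -
  let ?X = "lebesgue_on \<Omega>"
  have vl: "(\<lambda>n. LINT x|?X. (norm (v n x - v0 x))\<^sup>2) \<longlonglongrightarrow> 0"
    by (rule L2_norm_tendsto_0[OF L2_diff[OF v v0] vlim])
  have a: "(\<lambda>n. LINT x|?X. \<bar>v n x \<bullet> v n x - v0 x \<bullet> v0 x\<bar>) \<longlonglongrightarrow> 0"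
    by (rule L2_limit_inner[OF v v v0 v0 vl vl])
  have b: "(\<lambda>n. LINT x|?X. \<bar>r n x - r0 x\<bar> * (norm (v0 x))\<^sup>2) \<longlonglongrightarrow> 0"
  proof (rule bounded_times_L1_limit[OF \<Omega> L2_diff[OF r(1) r0(1)] _ L2_norm_tendsto_0[OF L2_diff[OF r(1) r0(1)] rlim] L2_integrable[OF v0]])
    show "AE x in ?X. \<bar>r n x - r0 x\<bar> \<le> 2 * B" for n
      using r(2)[of n] r0(2) by eventually_elim auto
  qed simp
  have iv: "integrable ?X (\<lambda>x. (norm (v n x))\<^sup>2)" "integrable ?X (\<lambda>x. (norm (v0 x))\<^sup>2)" for n
    by (rule L2_integrable, rule v) (rule L2_integrable, rule v0)
  have i1: "integrable ?X (\<lambda>x. r n x * (norm (v n x))\<^sup>2)" for n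
    using integrable_bounded_mult[OF iv(1)[of n] L2_measurable[OF r(1)[of n]] r(2)[of n]] by simp
  have i2: "integrable ?X (\<lambda>x. r0 x * (norm (v0 x))\<^sup>2)"
    using integrable_bounded_mult[OF iv(2) L2_measurable[OF r0(1)] r0(2)] by simp
  have i3: "integrable ?X (\<lambda>x. \<bar>r n x - r0 x\<bar> * (norm (v0 x))\<^sup>2)" for n
  proof -
    have "AE x in ?X. \<bar>\<bar>r n x - r0 x\<bar>\<bar> \<le> 2 * B" using r(2)[of n] r0(2) by eventually_elim auto
    then show ?thesis
      using integrable_bounded_mult[OF iv(2), of "\<lambda>x. \<bar>r n x - r0 x\<bar>"] L2_measurable[OF r(1)[of n]] L2_measurable[OF r0(1)] by simp
  qed
  have i4: "integrable ?X (\<lambda>x. \<bar>v n x \<bullet> v n x - v0 x \<bullet> v0 x\<bar>)" for n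
    using iv by (simp add: power2_norm_eq_inner)
  have le: "\<bar>(LINT x|?X. r n x * (norm (v n x))\<^sup>2) - (LINT x|?X. r0 x * (norm (v0 x))\<^sup>2)\<bar>
      \<le> \<bar>B\<bar> * (LINT x|?X. \<bar>v n x \<bullet> v n x - v0 x \<bullet> v0 x\<bar>) + (LINT x|?X. \<bar>r n x - r0 x\<bar> * (norm (v0 x))\<^sup>2)" for n
  proof -
    have "\<bar>(LINT x|?X. r n x * (norm (v n x))\<^sup>2) - (LINT x|?X. r0 x * (norm (v0 x))\<^sup>2)\<bar>
      = \<bar>LINT x|?X. r n x * (norm (v n x))\<^sup>2 - r0 x * (norm (v0 x))\<^sup>2\<bar>" using i1 i2 by simp
    also have "\<dots> \<le> (LINT x|?X. \<bar>r n x * (norm (v n x))\<^sup>2 - r0 x * (norm (v0 x))\<^sup>2\<bar>)" by (rule integral_abs_bound)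
    also have "\<dots> \<le> (LINT x|?X. \<bar>B\<bar> * \<bar>v n x \<bullet> v n x - v0 x \<bullet> v0 x\<bar> + \<bar>r n x - r0 x\<bar> * (norm (v0 x))\<^sup>2)"
    proof (rule integral_mono_AE)
      show "AE x in ?X. \<bar>r n x * (norm (v n x))\<^sup>2 - r0 x * (norm (v0 x))\<^sup>2\<bar> \<le> \<bar>B\<bar> * \<bar>v n x \<bullet> v n x - v0 x \<bullet> v0 x\<bar> + \<bar>r n x - r0 x\<bar> * (norm (v0 x))\<^sup>2"
        using r(2)[of n]
      proof eventually_elim
        case (elim x)
        have "r n x * (norm (v n x))\<^sup>2 - r0 x * (norm (v0 x))\<^sup>2 = r n x * (v n x \<bullet> v n x - v0 x \<bullet> v0 x) + (r n x - r0 x) * (norm (v0 x))\<^sup>2"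
          by (simp add: power2_norm_eq_inner algebra_simps)
        moreover have "\<bar>r n x * (v n x \<bullet> v n x - v0 x \<bullet> v0 x)\<bar> \<le> \<bar>B\<bar> * \<bar>v n x \<bullet> v n x - v0 x \<bullet> v0 x\<bar>"
          unfolding abs_mult using elim by (intro mult_right_mono) auto
        moreover have "\<bar>(r n x - r0 x) * (norm (v0 x))\<^sup>2\<bar> = \<bar>r n x - r0 x\<bar> * (norm (v0 x))\<^sup>2" by (simp add: abs_mult)
        ultimately show ?case by linarith
      qed
    qed (use i1 i2 i3 i4 in auto)
    also have "\<dots> = \<bar>B\<bar> * (LINT x|?X. \<bar>v n x \<bullet> v n x - v0 x \<bullet> v0 x\<bar>) + (LINT x|?X. \<bar>r n x - r0 x\<bar> * (norm (v0 x))\<^sup>2)"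
      using i3 i4 by simp
    finally show ?thesis .
  qed
  have "(\<lambda>n. \<bar>B\<bar> * (LINT x|?X. \<bar>v n x \<bullet> v n x - v0 x \<bullet> v0 x\<bar>) + (LINT x|?X. \<bar>r n x - r0 x\<bar> * (norm (v0 x))\<^sup>2)) \<longlonglongrightarrow> \<bar>B\<bar> * 0 + 0"
    by (intro tendsto_intros a b)
  then have lim: "(\<lambda>n. \<bar>B\<bar> * (LINT x|?X. \<bar>v n x \<bullet> v n x - v0 x \<bullet> v0 x\<bar>) + (LINT x|?X. \<bar>r n x - r0 x\<bar> * (norm (v0 x))\<^sup>2)) \<longlonglongrightarrow> 0" by simp
  have "(\<lambda>n. \<bar>(LINT x|?X. r n x * (norm (v n x))\<^sup>2) - (LINT x|?X. r0 x * (norm (v0 x))\<^sup>2)\<bar>) \<longlonglongrightarrow> 0"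
    by (rule tendsto_sandwich[OF _ _ tendsto_const lim]) (use le in auto)
  then show ?thesis using LIM_zero_iff tendsto_rabs_zero_iff by blast
qed

lemma L2_scaleR_bounded:
  fixes f :: "'a::euclidean_space \<Rightarrow> real" and v :: "'a \<Rightarrow> 'b::euclidean_space"
  assumes "f \<in> borel_measurable (lebesgue_on S)" "AE x in lebesgue_on S. \<bar>f x\<bar> \<le> B" "v \<in> L2 S"
  shows "(\<lambda>x. f x *\<^sub>R v x) \<in> L2 S"
proof -
  have "integrable (lebesgue_on S) (\<lambda>x. (f x)\<^sup>2 *\<^sub>R (norm (v x))\<^sup>2)"
  proof (rule integrable_bounded_mult[OF L2_integrable[OF assms(3)]])
    show "AE x in lebesgue_on S. \<bar>(f x)\<^sup>2\<bar> \<le> B\<^sup>2"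
      using assms(2) by eventually_elim (simp add: abs_le_square_iff[symmetric])
  qed (use assms(1) in simp)
  moreover have "(\<lambda>x. f x *\<^sub>R v x) \<in> borel_measurable (lebesgue_on S)"
    by (rule borel_measurable_scaleR[OF assms(1) L2_measurable[OF assms(3)]])
  ultimately show ?thesis by (simp add: L2_iff power_mult_distrib)
qed

section \<open>The sign of the limit density\<close>

text \<open>Derivatives of a slice are derivatives of \<Phi> in the directions (0, b), bounded on
  all of space-time. This gives the bound uniform in t that \<open>strong_pairing_limit\<close>
  requires.\<close>

lemma test_function_slice:
  fixes \<Phi> :: "real \<times> 'a::euclidean_space \<Rightarrow> real"
  assumes \<Omega>: "open \<Omega>" "\<Omega> \<in> lmeasurable" and \<Phi>: "\<Phi> \<in> test_functions (I \<times> \<Omega>)"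
  obtains C where "0 < C" "\<And>t. curry \<Phi> t \<in> H10 \<Omega> \<and> H_norm \<Omega> 1 (curry \<Phi> t) \<le> ennreal C"
proof -
  obtain K where K: "compact K" "K \<subseteq> I \<times> \<Omega>" "\<And>z. z \<notin> K \<Longrightarrow> \<Phi> z = 0"
    by (rule test_functionsE[OF \<Phi>]) blast
  have L: "bounded_linear (\<lambda>x::'a. (0::real, x))"
    by (intro bounded_linear_Pair bounded_linear_zero bounded_linear_ident)
  have t: "curry \<Phi> t \<in> test_functions \<Omega>" for t
  proof (rule test_functionsI[of _ "snd ` K"])
    show "smooth_on UNIV (curry \<Phi> t)"
      using smooth_affine[OF L test_functions_smooth[OF \<Phi>], where d="(t, 0)"] by (simp add: curry_def)
    show "compact (snd ` K)" by (intro compact_continuous_image continuous_intros K)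
    show "snd ` K \<subseteq> \<Omega>" using K(2) by auto
    show "curry \<Phi> t x = 0" if "x \<notin> snd ` K" for x
      using that K(3)[of "(t, x)"] by force
  qed
  have p: "partial b (curry \<Phi> t) x = partial (0, b) \<Phi> (t, x)" for b t x
    using partial_affine[OF L test_functions_differentiable[OF \<Phi>], where d="(t, 0)" and b=b and x=x] by (simp add: curry_def partial_def)
  obtain B where B: "\<And>z. norm (\<Phi> z) \<le> B" by (rule test_functions_bounded[OF \<Phi>]) blast
  have "\<exists>B. \<forall>z. norm (partial (0, b) \<Phi> z) \<le> B" if b: "b \<in> Basis" for b :: 'a
  proof -
    have "(0, b) \<in> (Basis :: (real \<times> 'a) set)" using b by (simp add: Basis_prod_def)
    from test_functions_partial[OF \<Phi> this] show ?thesis by (rule test_functions_bounded) blast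
  qed
  then obtain B' where B': "\<forall>b\<in>Basis. \<forall>z. norm (partial (0, b) \<Phi> z) \<le> B' b" by metis
  define D where "D = measure lebesgue \<Omega> * (B\<^sup>2 + (\<Sum>b\<in>Basis. (B' b)\<^sup>2))"
  have fin: "finite_measure (lebesgue_on \<Omega>)" by (rule finite_measure_lebesgue_on[OF \<Omega>(2)])
  have int_le: "(LINT x|lebesgue_on \<Omega>. (norm (f x))\<^sup>2) \<le> measure lebesgue \<Omega> * c\<^sup>2"
    if "f \<in> test_functions \<Omega>" "\<And>x. norm (f x) \<le> c" for f :: "'a \<Rightarrow> real" and c
  proof -
    have "(LINT x|lebesgue_on \<Omega>. (norm (f x))\<^sup>2) \<le> (LINT x|lebesgue_on \<Omega>. c\<^sup>2)"
      using that L2_integrable[OF Sobolev_L2[OF test_functions_Sobolev(1)[OF \<Omega> that(1)]]] finite_measure.integrable_const[OF fin]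
      by (intro integral_mono power_mono) auto
    then show ?thesis using \<Omega>(1) by (simp add: measure_restrict_space)
  qed
  have H: "H1_square \<Omega> (curry \<Phi> t) \<le> D" for t
  proof -
    note S = test_functions_Sobolev[OF \<Omega> t]
    have "(LINT x|lebesgue_on \<Omega>. weak_partials \<Omega> [b] (curry \<Phi> t) x \<bullet> weak_partials \<Omega> [b] (curry \<Phi> t) x) \<le> measure lebesgue \<Omega> * (B' b)\<^sup>2"
      if b: "b \<in> Basis" for b
    proof -
      note m = L2_measurable[OF Sobolev_weak_partial(2)[OF \<Omega>(1) S(1) b]]
      have ae: "AE x in lebesgue_on \<Omega>. weak_partials \<Omega> [b] (curry \<Phi> t) x \<bullet> weak_partials \<Omega> [b] (curry \<Phi> t) x = (norm (partial b (curry \<Phi> t) x))\<^sup>2"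
        using S(2)[OF b, of t] by eventually_elim (simp add: power2_eq_square)
      have "(LINT x|lebesgue_on \<Omega>. weak_partials \<Omega> [b] (curry \<Phi> t) x \<bullet> weak_partials \<Omega> [b] (curry \<Phi> t) x) = (LINT x|lebesgue_on \<Omega>. (norm (partial b (curry \<Phi> t) x))\<^sup>2)"
        by (rule integral_cong_AE[OF _ lebesgue_on_AE_measurable[OF _ ae] ae]) (use m \<Omega> in auto)
      also have "\<dots> \<le> measure lebesgue \<Omega> * (B' b)\<^sup>2"
        using B' b by (intro int_le test_functions_partial t) (auto simp: p)
      finally show ?thesis .
    qed
    then have "gradient_inner \<Omega> (curry \<Phi> t) (curry \<Phi> t) \<le> (\<Sum>b\<in>Basis. measure lebesgue \<Omega> * (B' b)\<^sup>2)"
      unfolding gradient_inner_def by (rule sum_mono)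
    moreover have "(LINT x|lebesgue_on \<Omega>. (norm (curry \<Phi> t x))\<^sup>2) \<le> measure lebesgue \<Omega> * B\<^sup>2"
      by (rule int_le[OF t]) (simp add: B del: real_norm_def)
    ultimately show ?thesis unfolding H1_square_def D_def by (simp add: distrib_left sum_distrib_left)
  qed
  show thesis
  proof (rule that)
    have "0 \<le> D" using H1_square_nonneg[of \<Omega> "curry \<Phi> 0"] H[of 0] by linarith
    then show "0 < sqrt D + 1" by (simp add: add_nonneg_pos)
    fix t
    have "sqrt (H1_square \<Omega> (curry \<Phi> t)) \<le> sqrt D + 1" using real_sqrt_le_mono[OF H[of t]] by linarith
    then have "H_norm \<Omega> 1 (curry \<Phi> t) \<le> ennreal (sqrt D + 1)"
      unfolding H_norm_1[OF \<Omega>(1) test_functions_Sobolev(1)[OF \<Omega> t]] by (rule ennreal_leI)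
    then show "curry \<Phi> t \<in> H10 \<Omega> \<and> H_norm \<Omega> 1 (curry \<Phi> t) \<le> ennreal (sqrt D + 1)"
      using test_functions_H10[OF \<Omega> t] by blast
  qed
qed

text \<open>Nonnegativity survives the limit, because nonnegative test functions are bounded in \<open>H\<^sup>1\<^sub>0\<close> uniformly in time.\<close>

lemma limit_density_nonneg:
  fixes r :: "nat \<Rightarrow> real \<times> 'a::euclidean_space \<Rightarrow> real"
  assumes \<Omega>: "open \<Omega>" "bounded \<Omega>" and T: "0 < T"
    and r: "\<And>n. r n \<in> borel_measurable (lebesgue_on ({0<..<T} \<times> \<Omega>))" "\<And>n. AE z in lebesgue_on ({0<..<T} \<times> \<Omega>). 0 \<le> r n z \<and> r n z \<le> B"
    and r0: "r0 \<in> borel_measurable (lebesgue_on ({0<..<T} \<times> \<Omega>))" "AE z in lebesgue_on ({0<..<T} \<times> \<Omega>). \<bar>r0 z\<bar> \<le> B'"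
    and lim: "(\<lambda>n. L2t_norm T (\<lambda>f. Hm1_norm \<Omega> (L2_pairing \<Omega> f)) (\<lambda>t x. r n (t, x) - r0 (t, x))) \<longlonglongrightarrow> 0"
  shows "AE z in lebesgue_on ({0<..<T} \<times> \<Omega>). 0 \<le> r0 z"
proof (rule AE_nonneg_if_test_integrals_nonneg)
  let ?Q = "lebesgue_on ({0<..<T} \<times> \<Omega>)"
  note Qm = product_lmeasurable(1)[OF \<Omega>] and \<Omega>m = product_lmeasurable(2)[OF \<Omega>]
  show "open ({0<..<T} \<times> \<Omega>)" using \<Omega> by (intro open_Times) auto
  show i0: "integrable ?Q r0" by (rule integrable_bounded_lebesgue_on[OF r0(1) _ Qm, where B=B']) (use r0(2) in simp)
  have ir: "integrable ?Q (r n)" for n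
    by (rule integrable_bounded_lebesgue_on[OF r(1) _ Qm, where B=B]) (use r(2)[of n] in eventually_elim, simp)
  fix \<Phi> :: "real \<times> 'a \<Rightarrow> real" assume \<Phi>: "\<Phi> \<in> test_functions ({0<..<T} \<times> \<Omega>)" "\<forall>x. 0 \<le> \<Phi> x"
  obtain C where C: "0 < C" "\<And>t. curry \<Phi> t \<in> H10 \<Omega> \<and> H_norm \<Omega> 1 (curry \<Phi> t) \<le> ennreal C"
    by (rule test_function_slice[OF \<Omega>(1) \<Omega>m \<Phi>(1)]) blast
  obtain P where P: "\<And>z. norm (\<Phi> z) \<le> P" by (rule test_functions_bounded[OF \<Phi>(1)]) blast
  note m\<Phi> = lebesgue_on_borel_measurable[OF test_functions_measurable[OF \<Phi>(1)], of "{0<..<T} \<times> \<Omega>"]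
  have i\<Phi>: "integrable ?Q (\<lambda>z. \<Phi> z * f z)" if "integrable ?Q f" for f
    using integrable_bounded_mult[OF that m\<Phi>, of P] P by simp
  have i: "integrable ?Q (\<lambda>z. (r n z - r0 z) \<bullet> \<Phi> z)" for n
    using i\<Phi>[OF Bochner_Integration.integrable_diff[OF ir[of n] i0]] by (simp add: mult.commute)
  have l: "(\<lambda>n. LINT t|lebesgue_on {0<..<T}. \<bar>LINT x|lebesgue_on \<Omega>. (r n (t, x) - r0 (t, x)) \<bullet> \<Phi> (t, x)\<bar>) \<longlonglongrightarrow> 0"
    using strong_pairing_limit[OF \<Omega>(1) \<Omega>m T, of "\<lambda>n z. r n z - r0 z" "\<lambda>n. \<Phi>" C] i C lim by auto
  \<comment> \<open>Adding the nonnegative integral of \<Phi> r_n bounds the negative part of the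
    limit by the pairing error.\<close>
  have le: "- (LINT z|?Q. \<Phi> z * r0 z) \<le> (LINT t|lebesgue_on {0<..<T}. \<bar>LINT x|lebesgue_on \<Omega>. (r n (t, x) - r0 (t, x)) \<bullet> \<Phi> (t, x)\<bar>)" for n
  proof -
    have "0 \<le> (LINT z|?Q. \<Phi> z * r n z)"
      using r(2)[of n] \<Phi>(2) by (intro integral_nonneg_AE) (auto elim!: eventually_mono)
    then have "- (LINT z|?Q. \<Phi> z * r0 z) \<le> (LINT z|?Q. \<Phi> z * r n z) - (LINT z|?Q. \<Phi> z * r0 z)" by simp
    also have "\<dots> = (LINT z|?Q. (r n z - r0 z) \<bullet> \<Phi> z)"
      using i\<Phi>[OF ir[of n]] i\<Phi>[OF i0] by (simp add: algebra_simps)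
    also have "\<dots> = (LINT t|lebesgue_on {0<..<T}. LINT x|lebesgue_on \<Omega>. (r n (t, x) - r0 (t, x)) \<bullet> \<Phi> (t, x))"
      using Fubini_lebesgue_on(3)[OF _ _ i[of n]] \<Omega> by simp
    also have "\<dots> \<le> (LINT t|lebesgue_on {0<..<T}. \<bar>LINT x|lebesgue_on \<Omega>. (r n (t, x) - r0 (t, x)) \<bullet> \<Phi> (t, x)\<bar>)"
      using Fubini_lebesgue_on(2)[OF _ _ i[of n]] \<Omega> by (intro integral_mono) auto
    finally show ?thesis .
  qed
  have "- (LINT z|?Q. \<Phi> z * r0 z) \<le> 0" by (rule LIMSEQ_le_const[OF l]) (use le in auto)
  then show "0 \<le> (LINT z|?Q. \<Phi> z * r0 z)" by simp
qed

section \<open>Limits of the kinetic energy and of the dissipation\<close>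

lemma indicator_fst_measurable:
  assumes "A \<in> sets borel"
  shows "(\<lambda>z. indicator A (fst z) :: real) \<in> borel_measurable (lebesgue_on (S :: (real \<times> 'b::euclidean_space) set))"
proof -
  have f: "(fst :: real \<times> 'b \<Rightarrow> real) \<in> borel_measurable borel" by (intro borel_measurable_continuous_onI continuous_intros)
  have i: "(indicator A :: real \<Rightarrow> real) \<in> borel_measurable borel" using assms by simp
  show ?thesis by (rule lebesgue_on_borel_measurable[OF measurable_compose[OF f i]])
qed

lemma integrable_indicator_mult:
  fixes f :: "'a::euclidean_space \<Rightarrow> real"
  assumes "integrable (lebesgue_on S) f" "A \<in> sets borel"
  shows "integrable (lebesgue_on S) (\<lambda>x. indicator A x * f x)"
proof -
  have m: "(indicator A :: 'a \<Rightarrow> real) \<in> borel_measurable (lebesgue_on S)"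
    by (rule lebesgue_on_borel_measurable) (use assms in simp)
  show ?thesis using integrable_bounded_mult[OF assms(1) m, of 1] by simp
qed

lemma Fubini_time_indicator:
  fixes \<phi> :: "real \<times> 'b::euclidean_space \<Rightarrow> real"
  assumes \<Omega>: "\<Omega> \<in> sets borel" and A: "A \<in> sets borel" and \<phi>: "integrable (lebesgue_on ({0<..<T} \<times> \<Omega>)) \<phi>"
  shows "integrable (lebesgue_on ({0<..<T} \<times> \<Omega>)) (\<lambda>z. indicator A (fst z) * \<phi> z)"
    and "(LINT z|lebesgue_on ({0<..<T} \<times> \<Omega>). indicator A (fst z) * \<phi> z) =
      (LINT t|lebesgue_on {0<..<T}. indicator A t * (LINT x|lebesgue_on \<Omega>. \<phi> (t, x)))"
proof -
  show i: "integrable (lebesgue_on ({0<..<T} \<times> \<Omega>)) (\<lambda>z. indicator A (fst z) * \<phi> z)"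
    using integrable_bounded_mult[OF \<phi> indicator_fst_measurable[OF A], of 1] by simp
  show "(LINT z|lebesgue_on ({0<..<T} \<times> \<Omega>). indicator A (fst z) * \<phi> z) =
      (LINT t|lebesgue_on {0<..<T}. indicator A t * (LINT x|lebesgue_on \<Omega>. \<phi> (t, x)))"
    using Fubini_lebesgue_on(3)[OF _ \<Omega> i] by simp
qed

text \<open>Splits r_n v_n . v_n into (r_n v_n - \<rho> u) . v_n and \<rho> u . v_n. The first part
  is a strong limit in H^-1 against a bound in H^1, the second a fixed functional of a weak limit.
  The hypotheses concern integrals over time, so the limit is taken over a set A of times.\<close>

lemma kinetic_energy_limit:
  fixes v :: "nat \<Rightarrow> real \<times> 'a::euclidean_space \<Rightarrow> 'a"
  assumes \<Omega>: "open \<Omega>" "bounded \<Omega>" and T: "0 < T" and A: "A \<in> sets borel"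
    and r: "\<And>n. r n \<in> borel_measurable (lebesgue_on ({0<..<T} \<times> \<Omega>))" "\<And>n. AE z in lebesgue_on ({0<..<T} \<times> \<Omega>). \<bar>r n z\<bar> \<le> B"
    and \<rho>: "\<rho> \<in> borel_measurable (lebesgue_on ({0<..<T} \<times> \<Omega>))" "AE z in lebesgue_on ({0<..<T} \<times> \<Omega>). \<bar>\<rho> z\<bar> \<le> B'"
    and C: "0 < C" "\<And>n. AE t in lebesgue_on {0<..<T}. H_norm \<Omega> 1 (curry (v n) t) \<le> ennreal C"
    and weak: "weakly_converges_L2t T \<Omega> (Hd \<Omega> 1) (H_norm \<Omega> 1) v u"
    and lim: "(\<lambda>n. L2t_norm T (\<lambda>f. Hm1_norm \<Omega> (L2_pairing \<Omega> f)) (\<lambda>t x. r n (t, x) *\<^sub>R v n (t, x) - \<rho> (t, x) *\<^sub>R u (t, x))) \<longlonglongrightarrow> 0"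
  shows "(\<lambda>n. LINT t|lebesgue_on {0<..<T}. indicator A t * (LINT x|lebesgue_on \<Omega>. r n (t, x) * (norm (v n (t, x)))\<^sup>2))
    \<longlonglongrightarrow> (LINT t|lebesgue_on {0<..<T}. indicator A t * (LINT x|lebesgue_on \<Omega>. \<rho> (t, x) * (norm (u (t, x)))\<^sup>2))"
proof -
  let ?Q = "lebesgue_on ({0<..<T} \<times> \<Omega>)" and ?I = "lebesgue_on {0<..<T}"
  note \<Omega>m = product_lmeasurable(2)[OF \<Omega>]
  have \<Omega>b: "\<Omega> \<in> sets borel" using \<Omega> by simp
  note F = Fubini_time_indicator[OF \<Omega>b A]
  have vV: "v n \<in> L2t T \<Omega> (Hd \<Omega> 1) (H_norm \<Omega> 1)" for n using weak unfolding weakly_converges_L2t_def by blast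
  have uV: "u \<in> L2t T \<Omega> (Hd \<Omega> 1) (H_norm \<Omega> 1)" using weak unfolding weakly_converges_L2t_def by blast
  note v2 = Hd_space_time_L2(1)[OF \<Omega>(1) \<Omega>m vV] and u2 = Hd_space_time_L2(1)[OF \<Omega>(1) \<Omega>m uV]
  define g where "g n z = r n z *\<^sub>R v n z" for n z
  define f where "f z = \<rho> z *\<^sub>R u z" for z
  have g2: "g n \<in> L2 ({0<..<T} \<times> \<Omega>)" for n unfolding g_def[abs_def] by (rule L2_scaleR_bounded[OF r v2])
  have f2: "f \<in> L2 ({0<..<T} \<times> \<Omega>)" unfolding f_def[abs_def] by (rule L2_scaleR_bounded[OF \<rho> u2])
  note id = L2_inner_integrable[OF L2_diff[OF g2 f2] v2]
  note iv = L2_inner_integrable[OF f2 v2] and iu = L2_inner_integrable[OF f2 u2]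
  define p where "p n t = (LINT x|lebesgue_on \<Omega>. (g n (t, x) - f (t, x)) \<bullet> v n (t, x))" for n t
  have pi: "integrable ?I (p n)" for n unfolding p_def[abs_def] using Fubini_lebesgue_on(2)[OF _ \<Omega>b id[of n n]] by simp
  have Ap: "integrable ?I (\<lambda>t. indicator A t * p n t)" for n
    by (rule integrable_indicator_mult[OF pi A])
  have l0: "(\<lambda>n. LINT t|?I. \<bar>p n t\<bar>) \<longlonglongrightarrow> 0"
    unfolding p_def
  proof (rule strong_pairing_limit[OF \<Omega>(1) \<Omega>m T id _ C(1)])
    show "AE t in ?I. curry (v n) t \<in> H10 \<Omega> \<and> H_norm \<Omega> 1 (curry (v n) t) \<le> ennreal C" for n
    proof -
      have "AE t in ?I. curry (v n) t \<in> Hd \<Omega> 1" using vV[of n] unfolding L2t_def by blast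
      then show ?thesis using C(2)[of n] by eventually_elim (use Hd_H10 in blast)
    qed
    show "(\<lambda>n. L2t_norm T (\<lambda>f. Hm1_norm \<Omega> (L2_pairing \<Omega> f)) (\<lambda>t x. g n (t, x) - f (t, x))) \<longlonglongrightarrow> 0"
      using lim unfolding g_def f_def .
  qed
  have l1: "(\<lambda>n. LINT t|?I. indicator A t * p n t) \<longlonglongrightarrow> 0"
  proof (rule Lim_null_comparison[OF _ l0], rule always_eventually, rule allI)
    fix n
    have "norm (LINT t|?I. indicator A t * p n t) \<le> (LINT t|?I. norm (indicator A t * p n t))"
      by (rule integral_norm_bound)
    moreover have "(LINT t|?I. norm (indicator A t * p n t)) \<le> (LINT t|?I. \<bar>p n t\<bar>)"
      using integrable_norm[OF Ap[of n]] pi[of n] by (intro integral_mono) (auto simp: indicator_def)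
    ultimately show "norm (LINT t|?I. indicator A t * p n t) \<le> (LINT t|?I. \<bar>p n t\<bar>)" by (rule order_trans)
  qed
  \<comment> \<open>The indicator of A is absorbed into the fixed factor \<rho> u, which remains
    square integrable however irregular A is.\<close>
  have Af: "(\<lambda>z. indicator A (fst z) *\<^sub>R f z) \<in> L2 ({0<..<T} \<times> \<Omega>)"
    by (rule L2_scaleR_bounded[OF indicator_fst_measurable[OF A] _ f2, where B=1]) simp
  have "\<forall>F \<in> dual (L2t T \<Omega> (Hd \<Omega> 1) (H_norm \<Omega> 1)) (\<lambda>w. L2t_norm T (H_norm \<Omega> 1) (curry w)). (\<lambda>n. F (v n)) \<longlonglongrightarrow> F u"
    using weak unfolding weakly_converges_L2t_def by blast
  from bspec[OF this L2_product_dual[OF \<Omega>(1) \<Omega>m Af]]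
  have l2: "(\<lambda>n. LINT z|?Q. indicator A (fst z) * (f z \<bullet> v n z)) \<longlonglongrightarrow> (LINT z|?Q. indicator A (fst z) * (f z \<bullet> u z))" by simp
  have e: "(LINT t|?I. indicator A t * (LINT x|lebesgue_on \<Omega>. r n (t, x) * (norm (v n (t, x)))\<^sup>2))
      = (LINT t|?I. indicator A t * p n t) + (LINT z|?Q. indicator A (fst z) * (f z \<bullet> v n z))" for n
  proof -
    note ig = L2_inner_integrable[OF g2[of n] v2[of n]]
    have "(LINT t|?I. indicator A t * (LINT x|lebesgue_on \<Omega>. r n (t, x) * (norm (v n (t, x)))\<^sup>2))
      = (LINT z|?Q. indicator A (fst z) * (g n z \<bullet> v n z))"
      unfolding F(2)[OF ig] by (simp add: g_def power2_norm_eq_inner)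
    also have "\<dots> = (LINT z|?Q. indicator A (fst z) * ((g n z - f z) \<bullet> v n z) + indicator A (fst z) * (f z \<bullet> v n z))"
      by (simp add: inner_diff_left right_diff_distrib)
    also have "\<dots> = (LINT z|?Q. indicator A (fst z) * ((g n z - f z) \<bullet> v n z)) + (LINT z|?Q. indicator A (fst z) * (f z \<bullet> v n z))"
      by (rule Bochner_Integration.integral_add[OF F(1)[OF id] F(1)[OF iv]])
    also have "(LINT z|?Q. indicator A (fst z) * ((g n z - f z) \<bullet> v n z)) = (LINT t|?I. indicator A t * p n t)"
      unfolding F(2)[OF id] p_def ..
    finally show ?thesis .
  qed
  have e0: "(LINT z|?Q. indicator A (fst z) * (f z \<bullet> u z)) = (LINT t|?I. indicator A t * (LINT x|lebesgue_on \<Omega>. \<rho> (t, x) * (norm (u (t, x)))\<^sup>2))"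
    unfolding F(2)[OF iu] by (simp add: f_def power2_norm_eq_inner)
  show ?thesis unfolding e e0[symmetric] using tendsto_add[OF l1 l2] by simp
qed

text \<open>Written over the fixed interval (0,T), the integral up to t depends on t only through an
  indicator, which suits functionals on (0,T). Its measurability in t comes from the continuity of
  the indefinite integral.\<close>

lemma time_integral:
  fixes q :: "real \<Rightarrow> real"
  assumes q: "integrable (lebesgue_on {0<..<T}) q"
  shows "t \<le> T \<Longrightarrow> (LINT s|lebesgue_on {0<..<T}. indicator {0<..<t} s * q s) = (LINT s|lebesgue_on {0<..<t}. q s)"
    and "\<bar>LINT s|lebesgue_on {0<..<T}. indicator {0<..<t} s * q s\<bar> \<le> (LINT s|lebesgue_on {0<..<T}. \<bar>q s\<bar>)"
    and "integrable (lebesgue_on {0<..<T}) (\<lambda>t. LINT s|lebesgue_on {0<..<T}. indicator {0<..<t} s * q s)"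
proof -
  let ?I = "lebesgue_on {0<..<T}"
  let ?J = "\<lambda>t. LINT s|?I. indicator {0<..<t} s * q s"
  show eq: "?J t = (LINT s|lebesgue_on {0<..<t}. q s)" if "t \<le> T" for t
  proof -
    have "?J t = (LINT s|lebesgue_on {0<..<t}. indicator {0<..<t} s * q s)"
      using that by (intro LINT_lebesgue_on_superset) auto
    also have "\<dots> = (LINT s|lebesgue_on {0<..<t}. q s)" by (rule Bochner_Integration.integral_cong) auto
    finally show ?thesis .
  qed
  have i: "integrable ?I (\<lambda>s. indicator {0<..<t} s * q s)" for t
    by (rule integrable_indicator_mult[OF q]) simp
  show bd: "\<bar>?J t\<bar> \<le> (LINT s|?I. \<bar>q s\<bar>)" for t
  proof -
    have "norm (?J t) \<le> (LINT s|?I. norm (indicator {0<..<t} s * q s))" by (rule integral_norm_bound)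
    moreover have "(LINT s|?I. norm (indicator {0<..<t} s * q s)) \<le> (LINT s|?I. \<bar>q s\<bar>)"
      using integrable_norm[OF i[of t]] q by (intro integral_mono) (auto simp: indicator_def)
    ultimately have "norm (?J t) \<le> (LINT s|?I. \<bar>q s\<bar>)" by (rule order_trans)
    then show ?thesis by (simp only: real_norm_def)
  qed
  have m: "?J \<in> borel_measurable ?I"
  proof -
    have c: "continuous_on {0<..<T} (\<lambda>t. integral {0..t} q)"
    proof (rule continuous_on_subset)
      have "q integrable_on {0..T}"
        using integrable_on_lebesgue_on[OF q] by (simp add: integrable_on_open_interval_real)
      then show "continuous_on {0..T} (\<lambda>t. integral {0..t} q)" by (rule indefinite_integral_continuous_1)
    qed auto
    have "(\<lambda>t. integral {0..t} q) \<in> borel_measurable ?I" by (rule lebesgue_on_continuous_measurable[OF c]) simp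
    moreover have "?J t = integral {0..t} q" if "t \<in> {0<..<T}" for t
    proof -
      have "integrable (lebesgue_on {0<..<t}) q" by (rule integrable_lebesgue_on_subset[OF q]) (use that in auto)
      then show ?thesis using eq[of t] integral_Ioo_eq that by auto
    qed
    ultimately show ?thesis by (subst measurable_cong[where g="\<lambda>t. integral {0..t} q"]) auto
  qed
  show "integrable ?I ?J"
    by (rule integrable_bounded_lebesgue_on[OF m _ _, of "LINT s|?I. \<bar>q s\<bar>"]) (use bd in auto)
qed

text \<open>Supplies a majorant that does not depend on f beyond its bound C, for the dominated
  convergence in \<open>limit_energy_inequality\<close>.\<close>

lemma gradient_inner_bound:
  assumes "open \<Omega>" "f \<in> Sobolev \<Omega> 1" "g \<in> Sobolev \<Omega> 1" "H_norm \<Omega> 1 f \<le> ennreal C" "0 < C"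
  shows "2 * \<bar>gradient_inner \<Omega> f g\<bar> \<le> C\<^sup>2 + gradient_inner \<Omega> g g"
proof -
  define a where "a = sqrt (gradient_inner \<Omega> f f)"
  define b where "b = sqrt (gradient_inner \<Omega> g g)"
  have "sqrt (H1_square \<Omega> f) \<le> C" using assms(4,5) unfolding H_norm_1[OF assms(1,2)] by simp
  moreover have "a \<le> sqrt (H1_square \<Omega> f)" unfolding a_def using gradient_inner_le_H1_square by simp
  moreover have "0 \<le> a" unfolding a_def by (simp add: gradient_inner_nonneg)
  ultimately have a: "a\<^sup>2 \<le> C\<^sup>2" by (intro power_mono) auto
  have "\<bar>gradient_inner \<Omega> f g\<bar> \<le> a * b" unfolding a_def b_def by (rule gradient_inner_Cauchy_Schwarz[OF assms(1-3)])
  moreover have "2 * (a * b) \<le> a\<^sup>2 + b\<^sup>2" using sum_squares_bound[of a b] by (simp add: mult.assoc)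
  moreover have "b\<^sup>2 = gradient_inner \<Omega> g g" unfolding b_def by (simp add: gradient_inner_nonneg)
  ultimately show ?thesis using a by linarith
qed

text \<open>The dissipation is only weakly lower semicontinuous: it is bounded below by its linearisation
  \<open>2 \<langle>\<nabla>v, \<nabla>u\<rangle> - \<langle>\<nabla>u, \<nabla>u\<rangle>\<close>, which passes to the weak limit.  Testing with all Borel sets of times
  recovers the inequality almost everywhere.\<close>

lemma limit_energy_inequality:
  fixes v :: "nat \<Rightarrow> real \<times> 'a::euclidean_space \<Rightarrow> 'a"
  assumes \<Omega>: "open \<Omega>" "bounded \<Omega>" and T: "0 < T" and \<nu>: "0 < \<nu>" and basis: "Galerkin_basis \<Omega> a"
    and r: "\<And>n. r n \<in> borel_measurable (lebesgue_on ({0<..<T} \<times> \<Omega>))" "\<And>n. AE z in lebesgue_on ({0<..<T} \<times> \<Omega>). \<bar>r n z\<bar> \<le> B"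
    and \<rho>: "\<rho> \<in> borel_measurable (lebesgue_on ({0<..<T} \<times> \<Omega>))" "AE z in lebesgue_on ({0<..<T} \<times> \<Omega>). \<bar>\<rho> z\<bar> \<le> B'"
    and C: "0 < C" "\<And>n. AE t in lebesgue_on {0<..<T}. H_norm \<Omega> 1 (curry (v n) t) \<le> ennreal C"
    and weak: "weakly_converges_L2t T \<Omega> (Hd \<Omega> 1) (H_norm \<Omega> 1) v u"
    and lim: "(\<lambda>n. L2t_norm T (\<lambda>f. Hm1_norm \<Omega> (L2_pairing \<Omega> f)) (\<lambda>t x. r n (t, x) *\<^sub>R v n (t, x) - \<rho> (t, x) *\<^sub>R u (t, x))) \<longlonglongrightarrow> 0"
    and energy: "\<And>n. AE t in lebesgue_on {0<..<T}. (LINT x|lebesgue_on \<Omega>. r n (t, x) * (norm (v n (t, x)))\<^sup>2) / 2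
      + \<nu> * (LINT s|lebesgue_on {0<..<t}. gradient_inner \<Omega> (curry (v n) s) (curry (v n) s)) = e n / 2"
    and e: "e \<longlonglongrightarrow> e0"
  shows "AE t in lebesgue_on {0<..<T}. (LINT x|lebesgue_on \<Omega>. \<rho> (t, x) * (norm (u (t, x)))\<^sup>2) / 2
      + \<nu> * (LINT s|lebesgue_on {0<..<t}. gradient_inner \<Omega> (curry u s) (curry u s)) \<le> e0 / 2"
proof -
  let ?Q = "lebesgue_on ({0<..<T} \<times> \<Omega>)" and ?I = "lebesgue_on {0<..<T}"
  note \<Omega>m = product_lmeasurable(2)[OF \<Omega>]
  have \<Omega>b: "\<Omega> \<in> sets borel" using \<Omega> by simp
  interpret I: finite_measure ?I by (rule finite_measure_lebesgue_on) simp
  have vV: "v n \<in> L2t T \<Omega> (Hd \<Omega> 1) (H_norm \<Omega> 1)" for n using weak unfolding weakly_converges_L2t_def by blast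
  have uV: "u \<in> L2t T \<Omega> (Hd \<Omega> 1) (H_norm \<Omega> 1)" using weak unfolding weakly_converges_L2t_def by blast
  note v2 = Hd_space_time_L2(1)[OF \<Omega>(1) \<Omega>m vV] and u2 = Hd_space_time_L2(1)[OF \<Omega>(1) \<Omega>m uV]
  have vS: "AE t in ?I. curry (v n) t \<in> Sobolev \<Omega> 1" for n
    using vV[of n] unfolding L2t_def by (auto elim!: eventually_mono intro: Hd_Sobolev)
  have uS: "AE t in ?I. curry u t \<in> Sobolev \<Omega> 1"
    using uV unfolding L2t_def by (auto elim!: eventually_mono intro: Hd_Sobolev)
  \<comment> \<open>For each t, integration against \<open>gm n\<close> up to t is a functional of
    \<open>v n\<close> to which weak convergence applies.\<close>
  define J where "J q t = (LINT s|?I. indicator {0<..<t} s * q s)" for q :: "real \<Rightarrow> real" and t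
  define gv where "gv n s = gradient_inner \<Omega> (curry (v n) s) (curry (v n) s)" for n s
  define gu where "gu s = gradient_inner \<Omega> (curry u s) (curry u s)" for s
  define gm where "gm n s = gradient_inner \<Omega> (curry (v n) s) (curry u s)" for n s
  have iv: "integrable ?I (gv n)" for n unfolding gv_def[abs_def] by (rule Hd_field_gradient(3)[OF \<Omega> basis vV])
  have iu: "integrable ?I gu" unfolding gu_def[abs_def] by (rule Hd_field_gradient(3)[OF \<Omega> basis uV])
  have im: "integrable ?I (gm n)" for n unfolding gm_def[abs_def] by (rule gradient_dual(2)[OF \<Omega> basis uV vV])
  have iJ: "integrable ?I (J q)" if "integrable ?I q" for q unfolding J_def[abs_def] by (rule time_integral(3)[OF that])
  define E where "E t = (LINT x|lebesgue_on \<Omega>. \<rho> (t, x) * (norm (u (t, x)))\<^sup>2)" for t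
  define Ev where "Ev n t = (LINT x|lebesgue_on \<Omega>. r n (t, x) * (norm (v n (t, x)))\<^sup>2)" for n t
  have iE: "integrable ?I E"
    using Fubini_lebesgue_on(2)[OF _ \<Omega>b L2_inner_integrable[OF L2_scaleR_bounded[OF \<rho> u2] u2]]
    unfolding E_def[abs_def] by (simp add: power2_norm_eq_inner)
  have iEv: "integrable ?I (Ev n)" for n
    using Fubini_lebesgue_on(2)[OF _ \<Omega>b L2_inner_integrable[OF L2_scaleR_bounded[OF r v2] v2], of n n]
    unfolding Ev_def[abs_def] by (simp add: power2_norm_eq_inner)
  have Jlim: "(\<lambda>n. J (gm n) t) \<longlonglongrightarrow> J gu t" for t
  proof -
    have "\<forall>F \<in> dual (L2t T \<Omega> (Hd \<Omega> 1) (H_norm \<Omega> 1)) (\<lambda>w. L2t_norm T (H_norm \<Omega> 1) (curry w)). (\<lambda>n. F (v n)) \<longlonglongrightarrow> F u"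
      using weak unfolding weakly_converges_L2t_def by blast
    from bspec[OF this gradient_dual(1)[OF \<Omega> basis uV]] show ?thesis unfolding J_def gm_def gu_def .
  qed
  \<comment> \<open>Independent of both n and t, as dominated convergence over t requires.\<close>
  define b where "b = (LINT s|?I. (C\<^sup>2 + gu s) / 2)"
  have ib: "integrable ?I (\<lambda>s. (C\<^sup>2 + gu s) / 2)" using iu by simp
  have Jb: "\<bar>J (gm n) t\<bar> \<le> b" for n t
  proof -
    have "\<bar>J (gm n) t\<bar> \<le> (LINT s|?I. \<bar>gm n s\<bar>)" unfolding J_def by (rule time_integral(2)[OF im])
    moreover have "(LINT s|?I. \<bar>gm n s\<bar>) \<le> b"
      unfolding b_def
    proof (rule integral_mono_AE)
      show "integrable ?I (\<lambda>s. \<bar>gm n s\<bar>)" using im by simp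
      show "integrable ?I (\<lambda>s. (C\<^sup>2 + gu s) / 2)" by (rule ib)
      show "AE s in ?I. \<bar>gm n s\<bar> \<le> (C\<^sup>2 + gu s) / 2"
        using vS[of n] uS C(2)[of n]
      proof eventually_elim
        case (elim s)
        show ?case using gradient_inner_bound[OF \<Omega>(1) elim(1,2,3) C(1)] unfolding gm_def gu_def by (simp only: le_divide_eq_numeral1 mult.commute)
      qed
    qed
    ultimately show ?thesis by linarith
  qed
  \<comment> \<open>The energy balance with the dissipation replaced by its linearisation; averaged
    over a set of times, every term now has a known limit.\<close>
  have le: "AE t in ?I. Ev n t / 2 + \<nu> * (2 * J (gm n) t - J gu t) - e n / 2 \<le> 0" for n
  proof -
    have J: "2 * J (gm n) t - J gu t \<le> J (gv n) t" for t
    proof -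
      have i: "integrable ?I (\<lambda>s. indicator {0<..<t} s * q s)" if "integrable ?I q" for q :: "real \<Rightarrow> real"
        by (rule integrable_indicator_mult[OF that]) simp
      have "2 * J (gm n) t - J gu t = (LINT s|?I. 2 * (indicator {0<..<t} s * gm n s) - indicator {0<..<t} s * gu s)"
        unfolding J_def using i[OF im[of n]] i[OF iu] by simp
      also have "\<dots> \<le> J (gv n) t"
        unfolding J_def
      proof (rule integral_mono_AE)
        show "integrable ?I (\<lambda>s. 2 * (indicator {0<..<t} s * gm n s) - indicator {0<..<t} s * gu s)"
          using i[OF im[of n]] i[OF iu] by simp
        show "integrable ?I (\<lambda>s. indicator {0<..<t} s * gv n s)" by (rule i[OF iv])
        show "AE s in ?I. 2 * (indicator {0<..<t} s * gm n s) - indicator {0<..<t} s * gu s \<le> indicator {0<..<t} s * gv n s"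
          using vS[of n] uS
        proof eventually_elim
          case (elim s)
          show ?case using two_gradient_inner_le[OF \<Omega>(1) elim] unfolding gm_def gu_def gv_def
            by (auto simp: indicator_def)
        qed
      qed
      finally show ?thesis .
    qed
    have "AE t in ?I. t \<in> {0<..<T}" by (rule AE_I2) simp
    with energy[of n] show ?thesis
    proof eventually_elim
      case (elim t)
      have "(LINT s|lebesgue_on {0<..<t}. gv n s) = J (gv n) t"
        unfolding J_def by (rule time_integral(1)[OF iv, symmetric]) (use elim in simp)
      then have "Ev n t / 2 + \<nu> * J (gv n) t = e n / 2" using elim(1) unfolding Ev_def gv_def by simp
      moreover have "\<nu> * (2 * J (gm n) t - J gu t) \<le> \<nu> * J (gv n) t" using J \<nu> by simp
      ultimately show ?case by linarith
    qed
  qed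
  define q where "q t = E t / 2 + \<nu> * J gu t - e0 / 2" for t
  have iq: "integrable ?I q" unfolding q_def[abs_def] using iE iJ[OF iu] by simp
  have "AE t in ?I. q t \<le> 0"
  proof (rule AE_nonpos_if_integrals_nonpos[OF iq])
    fix A :: "real set" assume A: "A \<in> sets borel"
    define L where "L f = (LINT t|?I. indicator A t * f t)" for f :: "real \<Rightarrow> real"
    have iA: "integrable ?I (\<lambda>t. indicator A t * f t)" if "integrable ?I f" for f :: "real \<Rightarrow> real"
      by (rule integrable_indicator_mult[OF that A])
    have L: "L (\<lambda>t. f t / 2 + \<nu> * g t - d) = L f / 2 + \<nu> * L g - d * L (\<lambda>t. 1)"
      if f: "integrable ?I f" and g: "integrable ?I g" for f g d
    proof -
      have "L (\<lambda>t. f t / 2 + \<nu> * g t - d)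
        = (LINT t|?I. (indicator A t * f t) / 2 + \<nu> * (indicator A t * g t) - d * (indicator A t * 1))"
        unfolding L_def by (rule Bochner_Integration.integral_cong) (auto simp: indicator_def)
      also have "\<dots> = L f / 2 + \<nu> * L g - d * L (\<lambda>t. 1)"
        unfolding L_def using iA[OF f] iA[OF g] iA[of "\<lambda>t. 1"] by simp
      finally show ?thesis .
    qed
    have LE: "(\<lambda>n. L (Ev n)) \<longlonglongrightarrow> L E"
      unfolding L_def Ev_def E_def by (rule kinetic_energy_limit[OF \<Omega> T A r \<rho> C weak lim])
    have LJ: "(\<lambda>n. L (J (gm n))) \<longlonglongrightarrow> L (J gu)"
      unfolding L_def
    proof (rule integral_dominated_convergence[where w="\<lambda>t. b"])
      show "(\<lambda>t. indicator A t * J gu t) \<in> borel_measurable ?I" using iA[OF iJ[OF iu]] by simp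
      show "(\<lambda>t. indicator A t * J (gm n) t) \<in> borel_measurable ?I" for n using iA[OF iJ[OF im]] by simp
      show "integrable ?I (\<lambda>t. b)" by simp
      show "AE t in ?I. (\<lambda>n. indicator A t * J (gm n) t) \<longlonglongrightarrow> indicator A t * J gu t"
        by (intro AE_I2 tendsto_intros Jlim)
      show "AE t in ?I. norm (indicator A t * J (gm n) t) \<le> b" for n
      proof (rule AE_I2)
        fix t show "norm (indicator A t * J (gm n) t) \<le> b"
          using Jb[of n t] by (cases "t \<in> A") auto
      qed
    qed
    have "L (Ev n) / 2 + \<nu> * (2 * L (J (gm n)) - L (J gu)) - e n / 2 * L (\<lambda>t. 1) \<le> 0" for n
    proof -
      have i2: "integrable ?I (\<lambda>t. 2 * J (gm n) t - J gu t)" using iJ[OF im[of n]] iJ[OF iu] by simp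
      have "L (\<lambda>t. 2 * J (gm n) t - J gu t) = (LINT t|?I. 2 * (indicator A t * J (gm n) t) - indicator A t * J gu t)"
        unfolding L_def by (rule Bochner_Integration.integral_cong) (auto simp: indicator_def)
      also have "\<dots> = 2 * L (J (gm n)) - L (J gu)"
        unfolding L_def using iA[OF iJ[OF im[of n]]] iA[OF iJ[OF iu]] by simp
      finally have l2: "L (\<lambda>t. 2 * J (gm n) t - J gu t) = 2 * L (J (gm n)) - L (J gu)" .
      have "L (\<lambda>t. Ev n t / 2 + \<nu> * (2 * J (gm n) t - J gu t) - e n / 2) \<le> 0"
      proof -
        have "0 \<le> (LINT t|?I. - (indicator A t * (Ev n t / 2 + \<nu> * (2 * J (gm n) t - J gu t) - e n / 2)))"
        proof (rule integral_nonneg_AE)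
          show "AE t in ?I. 0 \<le> - (indicator A t * (Ev n t / 2 + \<nu> * (2 * J (gm n) t - J gu t) - e n / 2))"
            using le[of n]
          proof eventually_elim
            case (elim t)
            then show ?case by (cases "t \<in> A") auto
          qed
        qed
        then show ?thesis unfolding L_def by simp
      qed
      then show ?thesis unfolding L[OF iEv i2] l2 .
    qed
    \<comment> \<open>In the limit the linearisation is taken at u itself and returns the
      dissipation: 2 J - J.\<close>
    moreover have "(\<lambda>n. L (Ev n) / 2 + \<nu> * (2 * L (J (gm n)) - L (J gu)) - e n / 2 * L (\<lambda>t. 1))
      \<longlonglongrightarrow> L E / 2 + \<nu> * (2 * L (J gu) - L (J gu)) - e0 / 2 * L (\<lambda>t. 1)"
      by (intro tendsto_intros LE LJ e) auto
    ultimately have "L E / 2 + \<nu> * (2 * L (J gu) - L (J gu)) - e0 / 2 * L (\<lambda>t. 1) \<le> 0"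
      by (intro LIMSEQ_le_const2) auto
    then show "(LINT t|?I. indicator A t * q t) \<le> 0"
      using L[OF iE iJ[OF iu], of "e0 / 2"] unfolding L_def q_def[symmetric] by simp
  qed
  moreover have "AE t in ?I. t \<in> {0<..<T}" by (rule AE_I2) simp
  ultimately show ?thesis
  proof eventually_elim
    case (elim t)
    have "(LINT s|lebesgue_on {0<..<t}. gu s) = J gu t"
      unfolding J_def by (rule time_integral(1)[OF iu, symmetric]) (use elim in simp)
    then show ?case using elim(1) unfolding q_def E_def gu_def by simp
  qed
qed

section \<open>From real integrals back to the norms of the statement\<close>

lemma Linfty_bound:
  assumes "f \<in> Linfty S"
  obtains B :: real where "f \<in> borel_measurable (lebesgue_on S)" "AE x in lebesgue_on S. norm (f x) \<le> B"
  using assms unfolding Linfty_def by blast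

text \<open>The sign of the density enters here: \<open>sqrt\<close> is odd, so without it the
  square of \<open>sqrt (r x)\<close> would be |r x|.\<close>

lemma weighted_L2_norm_square:
  fixes w :: "'a::euclidean_space \<Rightarrow> 'b::euclidean_space" and r :: "'a \<Rightarrow> real"
  assumes r: "r \<in> borel_measurable (lebesgue_on S)" "AE x in lebesgue_on S. 0 \<le> r x" "AE x in lebesgue_on S. \<bar>r x\<bar> \<le> B"
    and w: "w \<in> L2 S"
  shows "(L2_norm S (\<lambda>x. sqrt (r x) *\<^sub>R w x))\<^sup>2 = ennreal (LINT x|lebesgue_on S. r x * (norm (w x))\<^sup>2)"
proof -
  have "(L2_norm S (\<lambda>x. sqrt (r x) *\<^sub>R w x))\<^sup>2 = (\<integral>\<^sup>+x. ennreal (r x * (norm (w x))\<^sup>2) \<partial>lebesgue_on S)"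
    unfolding L2_norm_square
    by (rule nn_integral_cong_AE) (use r(2) in eventually_elim, simp add: power_mult_distrib)
  also have "\<dots> = ennreal (LINT x|lebesgue_on S. r x * (norm (w x))\<^sup>2)"
  proof (rule nn_integral_eq_integral)
    show "integrable (lebesgue_on S) (\<lambda>x. r x * (norm (w x))\<^sup>2)"
      using integrable_bounded_mult[OF L2_integrable[OF w] r(1,3)] by simp
    show "AE x in lebesgue_on S. 0 \<le> r x * (norm (w x))\<^sup>2" using r(2) by eventually_elim simp
  qed
  finally show ?thesis .
qed

lemma gradient_L2t_norm_square:
  fixes u :: "real \<times> 'a::euclidean_space \<Rightarrow> 'a"
  assumes \<Omega>: "open \<Omega>" "bounded \<Omega>" and basis: "Galerkin_basis \<Omega> a"
    and u: "u \<in> L2t T \<Omega> (Hd \<Omega> 1) (H_norm \<Omega> 1)" and t: "t \<le> T"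
  shows "(L2t_norm t (gradient_norm \<Omega>) (curry u))\<^sup>2 =
    ennreal (LINT s|lebesgue_on {0<..<t}. gradient_inner \<Omega> (curry u s) (curry u s))"
proof -
  have "AE s in lebesgue_on {0<..<T}. curry u s \<in> Hd \<Omega> 1" using u unfolding L2t_def by blast
  then have "AE s in lebesgue. s \<in> {0<..<T} \<longrightarrow> curry u s \<in> Hd \<Omega> 1" by (simp add: AE_restrict_space_iff)
  then have "AE s in lebesgue. s \<in> {0<..<t} \<longrightarrow> curry u s \<in> Hd \<Omega> 1"
    by (rule eventually_mono) (use t in auto)
  then have ae: "AE s in lebesgue_on {0<..<t}. curry u s \<in> Hd \<Omega> 1" by (simp add: AE_restrict_space_iff)
  have "(L2t_norm t (gradient_norm \<Omega>) (curry u))\<^sup>2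
    = (\<integral>\<^sup>+s. ennreal (gradient_inner \<Omega> (curry u s) (curry u s)) \<partial>lebesgue_on {0<..<t})"
    unfolding L2t_norm_square
    by (rule nn_integral_cong_AE) (use ae in eventually_elim, use gradient_norm_square[OF \<Omega>(1) Hd_Sobolev] in blast)
  also have "\<dots> = ennreal (LINT s|lebesgue_on {0<..<t}. gradient_inner \<Omega> (curry u s) (curry u s))"
  proof (rule nn_integral_eq_integral)
    show "integrable (lebesgue_on {0<..<t}) (\<lambda>s. gradient_inner \<Omega> (curry u s) (curry u s))"
      by (rule integrable_lebesgue_on_subset[OF Hd_field_gradient(3)[OF \<Omega> basis u]]) (use t in auto)
  qed (simp add: gradient_inner_nonneg)
  finally show ?thesis .
qed

lemma AE_closed_interval:
  assumes "AE t in lebesgue_on {0<..<T::real}. P t"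
  shows "AE t in lebesgue_on {0..T}. P t"
proof -
  have "AE t in lebesgue. t \<in> {0<..<T} \<longrightarrow> P t" using assms by (simp add: AE_restrict_space_iff)
  moreover have "AE t in lebesgue. t \<notin> {0, T}" by (rule AE_not_in) (simp add: negligible_iff_null_sets[symmetric])
  ultimately have "AE t in lebesgue. t \<in> {0..T} \<longrightarrow> P t" by eventually_elim auto
  then show ?thesis by (simp add: AE_restrict_space_iff)
qed

text \<open>The norm is an infimum; enlarging the constant avoids asking whether it is attained.
  \<open>\<bar>C\<bar> + 1\<close> is strictly larger than C and also positive when C is negative,
  where \<open>ennreal C\<close> is 0.\<close>

lemma Linftyt_norm_AE_le:
  assumes "Linftyt_norm T nrm h \<le> ennreal C"
  shows "AE t in lebesgue_on {0<..<T}. nrm (h t) \<le> ennreal (\<bar>C\<bar> + 1)"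
proof -
  have "ennreal C < ennreal (\<bar>C\<bar> + 1)" by (rule ennreal_lessI) auto
  with assms have "Linftyt_norm T nrm h < ennreal (\<bar>C\<bar> + 1)" by (rule le_less_trans)
  then obtain D where D: "AE t in lebesgue_on {0<..<T}. nrm (h t) \<le> D" "D < ennreal (\<bar>C\<bar> + 1)"
    unfolding Linftyt_norm_def Inf_less_iff by blast
  from D(1) show ?thesis by eventually_elim (use D(2) in simp)
qed

lemma Kim_limit_energy_inequality:
  fixes \<Omega> :: "'a::euclidean_space set"
  assumes \<Omega>: "open \<Omega>" "bounded \<Omega>" and \<nu>: "0 < \<nu>" and T: "0 < T"
    and u0: "u0 \<in> Hd \<Omega> 1" and \<rho>0: "\<rho>0 \<in> Linfty \<Omega>" and \<rho>0_nonneg: "AE x in lebesgue_on \<Omega>. 0 \<le> \<rho>0 x"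
    and \<rho>: "\<rho> \<in> Linfty ({0<..<T} \<times> \<Omega>)" and Kim: "Kim_limit \<nu> \<Omega> T M \<rho>0 u0 \<rho> u"
  shows "AE t in lebesgue_on {0..T}.
           ennreal (1/2) * (L2_norm \<Omega> (\<lambda>x. sqrt (\<rho> (t, x)) *\<^sub>R u (t, x)))\<^sup>2
           + ennreal \<nu> * (L2t_norm t (gradient_norm \<Omega>) (curry u))\<^sup>2
           \<le> ennreal (1/2) * (L2_norm \<Omega> (\<lambda>x. sqrt (\<rho>0 x) *\<^sub>R u0 x))\<^sup>2"
proof -
  let ?Q = "lebesgue_on ({0<..<T} \<times> \<Omega>)" and ?I = "lebesgue_on {0<..<T}" and ?X = "lebesgue_on \<Omega>"
  note \<Omega>m = product_lmeasurable(2)[OF \<Omega>]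
  have \<Omega>b: "\<Omega> \<in> sets borel" using \<Omega> by simp
  from Kim obtain a \<rho>0N u0N \<rho>N uN c c' \<sigma> C r where
    basis: "Galerkin_basis \<Omega> a" and uN: "uN = (\<lambda>N. Galerkin_field a N (c N))" and
    approx: "\<forall>N\<ge>1.
          \<rho>0N N \<in> L2 \<Omega> \<and> u0N N \<in> L2 \<Omega> \<and>
          semi_Galerkin_solution \<nu> \<Omega> T a N (\<rho>0N N) (u0N N) (\<rho>N N) (c N) (c' N) \<and>
          L2t_norm T (L2_norm \<Omega>)
            (\<lambda>t x. sqrt (\<rho>N N (t, x)) *\<^sub>R Galerkin_field a N (c' N) (t, x)) \<le> ennreal C \<and>
          Linftyt_norm T (H_norm \<Omega> 1) (curry (uN N)) \<le> ennreal C \<and>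
          L2t_norm T (H_norm \<Omega> 2) (curry (uN N)) \<le> ennreal C \<and>
          has_time_derivative_Hm1 T \<Omega> (\<rho>N N) (\<sigma> N) \<and>
          Linftyt_norm T (Hm1_norm \<Omega>) (\<sigma> N) \<le> ennreal C \<and>
          (AE z in lebesgue_on ({0<..<T} \<times> \<Omega>). 1 / real N \<le> \<rho>N N z \<and> \<rho>N N z \<le> M + 1 / real N)" and
    \<rho>0lim: "(\<lambda>N. L2_norm \<Omega> (\<lambda>x. \<rho>0N N x - \<rho>0 x)) \<longlonglongrightarrow> 0" and
    u0lim: "(\<lambda>N. L2_norm \<Omega> (\<lambda>x. u0N N x - u0 x)) \<longlonglongrightarrow> 0" and
    r: "strict_mono r" and
    \<rho>lim: "(\<lambda>n. L2t_norm T (\<lambda>f. Hm1_norm \<Omega> (L2_pairing \<Omega> f))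
          (\<lambda>t x. \<rho>N (r n) (t, x) - \<rho> (t, x))) \<longlonglongrightarrow> 0" and
    mlim: "(\<lambda>n. L2t_norm T (\<lambda>f. Hm1_norm \<Omega> (L2_pairing \<Omega> f))
          (\<lambda>t x. \<rho>N (r n) (t, x) *\<^sub>R uN (r n) (t, x) - \<rho> (t, x) *\<^sub>R u (t, x))) \<longlonglongrightarrow> 0" and
    weak: "weakly_converges_L2t T \<Omega> (Hd \<Omega> 1) (H_norm \<Omega> 1) (\<lambda>n. uN (r n)) u"
    unfolding Kim_limit_def by (elim exE conjE) (rule that)
  \<comment> \<open>The approximations are described for N \<ge> 1 while \<open>r 0\<close> may be
    0, so the subsequence is shifted by one.\<close>
  define k where "k n = r (Suc n)" for n
  have k1: "1 \<le> k n" for n using seq_suble[OF r, of "Suc n"] unfolding k_def by simp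
  have k: "strict_mono k" using r unfolding k_def strict_mono_def by simp
  note approx_k = approx[rule_format, OF k1]
  have b: "AE z in ?Q. 1 / real (k n) \<le> \<rho>N (k n) z \<and> \<rho>N (k n) z \<le> M + 1 / real (k n)" for n using approx_k[of n] by blast
  have sol: "semi_Galerkin_solution \<nu> \<Omega> T a (k n) (\<rho>0N (k n)) (u0N (k n)) (\<rho>N (k n)) (c (k n)) (c' (k n))" for n
    using approx_k[of n] by blast
  have \<rho>02: "\<rho>0N (k n) \<in> L2 \<Omega>" and u02: "u0N (k n) \<in> L2 \<Omega>" for n using approx_k[of n] by blast+
  have "\<exists>U. galerkin \<Omega> T (1 / real (k n)) (M + 1 / real (k n)) U (\<rho>0N (k n)) a (k n) (c (k n)) (\<rho>N (k n)) \<nu> (u0N (k n)) (c' (k n))" for n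
    by (rule galerkin_intro[OF \<Omega> T _ basis sol \<rho>02 b]) simp
  then obtain U where gal: "\<And>n. galerkin \<Omega> T (1 / real (k n)) (M + 1 / real (k n)) (U n) (\<rho>0N (k n)) a (k n) (c (k n)) (\<rho>N (k n)) \<nu> (u0N (k n)) (c' (k n))"
    by metis
  have k_le: "0 < 1 / real (k n) \<and> 1 / real (k n) \<le> 1" for n using k1[of n] by (auto simp: field_simps)
  have Rm: "\<rho>N (k n) \<in> borel_measurable ?Q" for n
    using sol[of n] unfolding semi_Galerkin_solution_def Linfty_def by blast
  \<comment> \<open>1/N is at most 1, so M + 1 bounds all approximating densities.\<close>
  have Rb: "AE z in ?Q. 0 \<le> \<rho>N (k n) z \<and> \<rho>N (k n) z \<le> M + 1" for n
    using b[of n] by eventually_elim (use k_le[of n] in linarith)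
  have Rb': "AE z in ?Q. \<bar>\<rho>N (k n) z\<bar> \<le> M + 1" for n using Rb[of n] by eventually_elim linarith
  \<comment> \<open>No bound on the initial densities is part of the approximation scheme; it comes
    from the positive times through \<open>\<rho>0_bounds\<close>.\<close>
  have R0b: "AE x in ?X. \<bar>\<rho>0N (k n) x\<bar> \<le> M + 1" for n
  proof -
    interpret galerkin \<Omega> T "1 / real (k n)" "M + 1 / real (k n)" "U n" "\<rho>0N (k n)" a "k n" "c (k n)" "\<rho>N (k n)" \<nu> "u0N (k n)" "c' (k n)"
      by (rule gal)
    show ?thesis using \<rho>0_bounds by eventually_elim (use k_le[of n] in linarith)
  qed
  obtain B where B: "\<rho> \<in> borel_measurable ?Q" "AE z in ?Q. norm (\<rho> z) \<le> B" by (rule Linfty_bound[OF \<rho>])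
  then have Bb: "AE z in ?Q. \<bar>\<rho> z\<bar> \<le> B" by simp
  obtain B0 where B0: "\<rho>0 \<in> borel_measurable ?X" "AE x in ?X. norm (\<rho>0 x) \<le> B0" by (rule Linfty_bound[OF \<rho>0])
  then have B0b: "AE x in ?X. \<bar>\<rho>0 x\<bar> \<le> B0" by simp
  have u02': "u0 \<in> L2 \<Omega>" by (rule Sobolev_L2[OF Hd_Sobolev[OF u0]])
  have weak_k: "weakly_converges_L2t T \<Omega> (Hd \<Omega> 1) (H_norm \<Omega> 1) (\<lambda>n. uN (k n)) u"
    using weak LIMSEQ_Suc unfolding weakly_converges_L2t_def k_def by blast
  then have uV: "u \<in> L2t T \<Omega> (Hd \<Omega> 1) (H_norm \<Omega> 1)" unfolding weakly_converges_L2t_def by blast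
  note u2 = Hd_space_time_L2(1)[OF \<Omega>(1) \<Omega>m uV]
  define e where "e n = (LINT x|?X. \<rho>0N (k n) x * (norm (u0N (k n) x))\<^sup>2)" for n
  define e0 where "e0 = (LINT x|?X. \<rho>0 x * (norm (u0 x))\<^sup>2)"
  have "e \<longlonglongrightarrow> e0"
    unfolding e_def[abs_def] e0_def
  \<comment> \<open>The maximum serves the approximating and the limit initial densities at
    once.\<close>
  proof (rule initial_energy_limit[OF \<Omega>m \<rho>02 _ _ _ u02 u02', where B="max (M + 1) B0"])
    show "AE x in ?X. \<bar>\<rho>0N (k n) x\<bar> \<le> max (M + 1) B0" for n using R0b[of n] by eventually_elim simp
    show "\<rho>0 \<in> L2 \<Omega>" by (rule L2_bounded[OF B0 \<Omega>m])
    show "AE x in ?X. \<bar>\<rho>0 x\<bar> \<le> max (M + 1) B0" using B0b by eventually_elim simp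
    show "(\<lambda>n. L2_norm \<Omega> (\<lambda>x. \<rho>0N (k n) x - \<rho>0 x)) \<longlonglongrightarrow> 0"
      using LIMSEQ_subseq_LIMSEQ[OF \<rho>0lim k] by (simp add: o_def)
    show "(\<lambda>n. L2_norm \<Omega> (\<lambda>x. u0N (k n) x - u0 x)) \<longlonglongrightarrow> 0"
      using LIMSEQ_subseq_LIMSEQ[OF u0lim k] by (simp add: o_def)
  qed
  moreover have "AE t in ?I. (LINT x|?X. \<rho>N (k n) (t, x) * (norm (uN (k n) (t, x)))\<^sup>2) / 2
      + \<nu> * (LINT s|lebesgue_on {0<..<t}. gradient_inner \<Omega> (curry (uN (k n)) s) (curry (uN (k n)) s)) = e n / 2" for n
  proof -
    interpret galerkin \<Omega> T "1 / real (k n)" "M + 1 / real (k n)" "U n" "\<rho>0N (k n)" a "k n" "c (k n)" "\<rho>N (k n)" \<nu> "u0N (k n)" "c' (k n)"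
      by (rule gal)
    let ?g = "\<lambda>s. gradient_inner \<Omega> (curry (uN (k n)) s) (curry (uN (k n)) s)"
    have V: "uN (k n) \<in> L2t T \<Omega> (Hd \<Omega> 1) (H_norm \<Omega> 1)" using weak_k unfolding weakly_converges_L2t_def by blast
    have "AE t in ?I. t \<in> {0<..<T}" by (rule AE_I2) simp
    with energy_equality show ?thesis
    proof eventually_elim
      case (elim t)
      \<comment> \<open>The energy equality speaks of the gauge integral on the closed interval, the
        limit argument of the Lebesgue integral on the open one.\<close>
      have "(LINT s|lebesgue_on {0<..<t}. ?g s) = integral {0..t} ?g"
        by (rule integral_Ioo_eq, rule integrable_lebesgue_on_subset[OF Hd_field_gradient(3)[OF \<Omega> basis V]]) (use elim(2) in auto)
      then show ?case using elim(1) unfolding uN e_def by simp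
    qed
  qed
  ultimately have main: "AE t in ?I. (LINT x|?X. \<rho> (t, x) * (norm (u (t, x)))\<^sup>2) / 2
      + \<nu> * (LINT s|lebesgue_on {0<..<t}. gradient_inner \<Omega> (curry u s) (curry u s)) \<le> e0 / 2"
  proof (intro limit_energy_inequality[OF \<Omega> T \<nu> basis Rm Rb' B(1) Bb _ _ weak_k])
    show "0 < \<bar>C\<bar> + 1" by simp
    show "AE t in ?I. H_norm \<Omega> 1 (curry (uN (k n)) t) \<le> ennreal (\<bar>C\<bar> + 1)" for n
      by (rule Linftyt_norm_AE_le[of T "H_norm \<Omega> 1"]) (use approx_k[of n] in blast)
    show "(\<lambda>n. L2t_norm T (\<lambda>f. Hm1_norm \<Omega> (L2_pairing \<Omega> f))
      (\<lambda>t x. \<rho>N (k n) (t, x) *\<^sub>R uN (k n) (t, x) - \<rho> (t, x) *\<^sub>R u (t, x))) \<longlonglongrightarrow> 0"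
      using LIMSEQ_Suc[OF mlim] unfolding k_def .
  qed
  have "AE z in ?Q. 0 \<le> \<rho> z"
    by (rule limit_density_nonneg[OF \<Omega> T Rm Rb B(1) Bb LIMSEQ_Suc[OF \<rho>lim, folded k_def]])
  with Bb have "AE z in ?Q. 0 \<le> \<rho> z \<and> \<bar>\<rho> z\<bar> \<le> B" by eventually_elim simp
  then have slices: "AE t in ?I. AE x in ?X. 0 \<le> \<rho> (t, x) \<and> \<bar>\<rho> (t, x)\<bar> \<le> B"
    by (intro AE_lebesgue_on_slices) (use \<Omega>b in auto)
  have "integrable ?Q \<rho>" by (rule integrable_bounded_lebesgue_on[OF B product_lmeasurable(1)[OF \<Omega>]])
  from Fubini_lebesgue_on(1)[OF _ \<Omega>b this]
  have \<rho>t: "AE t in ?I. integrable ?X (\<lambda>x. \<rho> (t, x))" by simp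
  have "AE t in ?I. curry u t \<in> Hd \<Omega> 1" using uV unfolding L2t_def by blast
  then have ut: "AE t in ?I. (\<lambda>x. u (t, x)) \<in> L2 \<Omega>"
    by eventually_elim (use Sobolev_L2[OF Hd_Sobolev] in \<open>simp add: curry_def\<close>)
  have rhs: "(L2_norm \<Omega> (\<lambda>x. sqrt (\<rho>0 x) *\<^sub>R u0 x))\<^sup>2 = ennreal e0"
    unfolding e0_def by (rule weighted_L2_norm_square[OF B0(1) \<rho>0_nonneg B0b u02'])
  show ?thesis
  proof (rule AE_closed_interval)
    have "AE t in ?I. t \<in> {0<..<T}" by (rule AE_I2) simp
    with main slices \<rho>t ut show "AE t in ?I.
           ennreal (1/2) * (L2_norm \<Omega> (\<lambda>x. sqrt (\<rho> (t, x)) *\<^sub>R u (t, x)))\<^sup>2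
           + ennreal \<nu> * (L2t_norm t (gradient_norm \<Omega>) (curry u))\<^sup>2
           \<le> ennreal (1/2) * (L2_norm \<Omega> (\<lambda>x. sqrt (\<rho>0 x) *\<^sub>R u0 x))\<^sup>2"
    proof eventually_elim
      case (elim t)
      define E where "E = (LINT x|?X. \<rho> (t, x) * (norm (u (t, x)))\<^sup>2)"
      define D where "D = (LINT s|lebesgue_on {0<..<t}. gradient_inner \<Omega> (curry u s) (curry u s))"
      have \<rho>m: "(\<lambda>x. \<rho> (t, x)) \<in> borel_measurable ?X" by (rule borel_measurable_integrable[OF elim(3)])
      have p: "AE x in ?X. 0 \<le> \<rho> (t, x)" and b: "AE x in ?X. \<bar>\<rho> (t, x)\<bar> \<le> B"
        using elim(2) by (auto elim!: eventually_mono)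
      have 1: "(L2_norm \<Omega> (\<lambda>x. sqrt (\<rho> (t, x)) *\<^sub>R u (t, x)))\<^sup>2 = ennreal E"
        unfolding E_def by (rule weighted_L2_norm_square[OF \<rho>m p b elim(4)])
      have 2: "(L2t_norm t (gradient_norm \<Omega>) (curry u))\<^sup>2 = ennreal D"
        unfolding D_def by (rule gradient_L2t_norm_square[OF \<Omega> basis uV]) (use elim(5) in simp)
      \<comment> \<open>\<open>ennreal\<close> cuts negative numbers off at 0, so signs are needed
        before the real inequality is transferred.\<close>
      have "0 \<le> E" unfolding E_def using p by (intro integral_nonneg_AE) (auto elim!: eventually_mono)
      moreover have "0 \<le> D" unfolding D_def by (intro integral_nonneg_AE) (simp add: gradient_inner_nonneg)
      ultimately have "ennreal (1/2) * ennreal E + ennreal \<nu> * ennreal D = ennreal (1/2 * E + \<nu> * D)"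
        using \<nu> by (simp only: ennreal_mult'[symmetric] ennreal_plus[symmetric] mult_nonneg_nonneg less_imp_le zero_le_divide_1_iff zero_le_numeral)
      moreover have "ennreal (1/2 * E + \<nu> * D) \<le> ennreal (1/2 * e0)"
        using elim(1) unfolding E_def[symmetric] D_def[symmetric] by (intro ennreal_leI) simp
      moreover have "ennreal (1/2 * e0) = ennreal (1/2) * ennreal e0" by (rule ennreal_mult') simp
      ultimately show ?case unfolding 1 2 rhs by simp
    qed
  qed
qed

theorem proposition2p6:
  fixes \<Omega> :: "(real^3) set" and \<nu> M T :: real
    and \<rho>0 :: "real^3 \<Rightarrow> real" and u0 :: "real^3 \<Rightarrow> real^3"
    and \<rho> :: "real \<times> (real^3) \<Rightarrow> real" and u :: "real \<times> (real^3) \<Rightarrow> real^3"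
  assumes "smooth_bounded_domain \<Omega>" and "\<nu> > 0" and "T > 0"
    and "u0 \<in> Hd \<Omega> 1"
    and "\<rho>0 \<in> Linfty \<Omega>"
    and "AE x in lebesgue_on \<Omega>. 0 \<le> \<rho>0 x \<and> \<rho>0 x \<le> M"
    and "weak_solution \<nu> \<Omega> T \<rho>0 u0 \<rho> u"
    and "Kim_limit \<nu> \<Omega> T M \<rho>0 u0 \<rho> u"
  shows "AE t in lebesgue_on {0..T}.
           ennreal (1/2) * (L2_norm \<Omega> (\<lambda>x. sqrt (\<rho> (t, x)) *\<^sub>R u (t, x)))\<^sup>2
           + ennreal \<nu> * (L2t_norm t (gradient_norm \<Omega>) (curry u))\<^sup>2
           \<le> ennreal (1/2) * (L2_norm \<Omega> (\<lambda>x. sqrt (\<rho>0 x) *\<^sub>R u0 x))\<^sup>2"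
proof (rule Kim_limit_energy_inequality)
  show "open \<Omega>" "bounded \<Omega>" using assms(1) unfolding smooth_bounded_domain_def by blast+
  show "AE x in lebesgue_on \<Omega>. 0 \<le> \<rho>0 x" using assms(6) by eventually_elim blast
  show "\<rho> \<in> Linfty ({0<..<T} \<times> \<Omega>)" using assms(7) unfolding weak_solution_def by blast
qed (use assms in blast)+

end
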